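(* Let $A=\varinjlim_n(A_n,\varphi_n)$ be a diagonal AH-algebra with canonical C$^*$-diagonal $C=\varinjlim_n C_n\subseteq A$, and let $\mathcal G=\mathcal G_{\mathcal B}$ be the groupoid model (tail-equivalence groupoid of the Bratteli diagram $\mathcal B$) arising from the AF-subsystem $(B_n,\varphi_n|_{B_n})_n$. There is an action of $\mathcal G$ on the Gelfand spectrum $\widehat C$ of $C$ such that $$A\cong C^*_{\mathrm r}(\mathcal G\ltimes\widehat C),$$ where $\mathcal G\ltimes\widehat C$ is the transformation groupoid with respect to the action $\mathcal G\curvearrowright\widehat C$.
   Context: Diagonal AH-systems. $\mathbb N=\{1,2,\dots\}$. For $n\in\mathbb N$ let $A_n=\bigoplus_{i=1}^{N_n}C(X_{n,i})\otimes M_{k_{n,i}}$ with $X_{n,i}$ compact Hausdorff. A diagonal AH-system is an inductive system of such algebras whose connecting maps $\varphi_n\colon A_n\to A_{n+1}$ are unital injective diagonal maps: for all $i\le N_n$, $j\le N_{n+1}$ there are a finite (possibly empty) set $E_n(i,j)$ and continuous maps (eigenfunctions) $\lambda_e\colon X_{n+1,j}\to X_{n,i}$, $e\in E_n(i,j)$, such that the $j$-th component of $\varphi_n(f_1,\dots,f_{N_n})$ is block diagonal with blocks $f_i\circ\lambda_e$ ($1\le i\le N_n$, $e\in E_n(i,j)$), in some fixed order. The limit $A=\varinjlim_n(A_n,\varphi_n)$ is a diagonal AH-algebra; $A_n$ is identified with its image in $A$. Subalgebras. $C_n=\bigoplus_i C(X_{n,i})\otimes D_{k_{n,i}}$ with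 $D_k\subseteq M_k$ the diagonal matrices, and $C=\varinjlim_n C_n\subseteq A$ (a C$^*$-diagonal of $A$). $B_n=\bigoplus_i 1\otimes M_{k_{n,i}}\subseteq A_n$ and $B=\varinjlim_n B_n\subseteq A$ (the AF-subalgebra). Bratteli diagram $\mathcal B$ of the AF-subsystem. $V_0=\{v_0\}$ (root), $V_n=\{(n,1),\dots,(n,N_n)\}$ for $n\ge1$; $E_0$ consists of $k_{1,j}$ edges from $v_0$ to $(1,j)$ for each $j$; for $n\ge 1$ the edges from $(n,i)$ to $(n+1,j)$ are the elements of $E_n(i,j)$, and $E_n=\bigsqcup_{i,j}E_n(i,j)$. $\mathcal P^\infty_{\mathcal B}$ is the set of infinite paths $x=x_1x_2\cdots$ starting at $v_0$ ($x_k\in E_{k-1}$), with base of open sets $Z_p=\{x: x_{[1,n]}=p\}$ for finite paths $p$ of length $n$ from $v_0$. $\mathcal G_{\mathcal B}$ is the groupoid of pairs $(x,y)$ of paths in $\mathcal P^\infty_{\mathcal B}$ with $x_{[m,\infty)}=y_{[m,\infty)}$ for some $m$, with $(x,y)(y,z)=(x,z)$, $r(x,y)=x$, $s(x,y)=y$, and base of open sets $Z_{p,q}=\{(x,y): x_{[1,n]}=p,\ y_{[1,n]}=q,\ x_{[n+1,\infty)}=y_{[n+1,\infty)}\}$ for paths $p,q$ from $v_0$ of equal length $n$ with the same terminal vertex. Actions. An action of an étale groupoid $\mathcal G$ on a space $X$ consists of a continuous anchor map $\rho\colon X\to\mathcal G^{(0)}$ and a continuous map $\{(\gamma,x):s(\gamma)=\rho(x)\}\to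 X$, $(\gamma,x)\mapsto\gamma\cdot x$, with $\rho(x)\cdot x=x$, $\rho(\gamma\cdot x)=r(\gamma)$, and $(\eta\gamma)\cdot x=\eta\cdot(\gamma\cdot x)$ whenever $s(\eta)=r(\gamma)$ and $s(\gamma)=\rho(x)$. The transformation groupoid $\mathcal G\ltimes X$ is the space $\{(\gamma,x):s(\gamma)=\rho(x)\}$ (subspace of $\mathcal G\times X$) with $r(\gamma,x)=(r(\gamma),\gamma\cdot x)$, $s(\gamma,x)=(s(\gamma),x)$ and $(\eta,\gamma\cdot x)(\gamma,x)=(\eta\gamma,x)$; its unit space is identified with $X$. *)

theory Defs
  imports
    "HOL-Analysis.Analysis"
    "HOL-Algebra.Ring"
    "HOL-Algebra.Module"
    "HOL-Algebra.QuotRing"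
    "Jordan_Normal_Form.Matrix"
    "Jordan_Normal_Form.VS_Connect"
    "Jordan_Normal_Form.Schur_Decomposition"
begin

section \<open>C*-algebras\<close>

text \<open>
  All C*-algebras below are unital (the zero algebra is allowed), so the carrier-based unital
  rings and modules of the library are reused, with an involution and a norm added.
\<close>

record 'a cstar = "(complex, 'a) module" +
  adj :: "'a \<Rightarrow> 'a"
  nrm :: "'a \<Rightarrow> real"

locale cstar_algebra = module "class_ring :: complex ring" A + ring A
  for A :: "'a cstar" (structure) +
  assumes smult_mult_left:
      "\<lbrakk>x \<in> carrier A; y \<in> carrier A\<rbrakk> \<Longrightarrow> (c \<odot>\<^bsub>A\<^esub> x) \<otimes>\<^bsub>A\<^esub> y = c \<odot>\<^bsub>A\<^esub> (x \<otimes>\<^bsub>A\<^esub> y)"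
    and smult_mult_right:
      "\<lbrakk>x \<in> carrier A; y \<in> carrier A\<rbrakk> \<Longrightarrow> x \<otimes>\<^bsub>A\<^esub> (c \<odot>\<^bsub>A\<^esub> y) = c \<odot>\<^bsub>A\<^esub> (x \<otimes>\<^bsub>A\<^esub> y)"
    and adj_closed: "x \<in> carrier A \<Longrightarrow> adj A x \<in> carrier A"
    and adj_adj: "x \<in> carrier A \<Longrightarrow> adj A (adj A x) = x"
    and adj_add:
      "\<lbrakk>x \<in> carrier A; y \<in> carrier A\<rbrakk> \<Longrightarrow> adj A (x \<oplus>\<^bsub>A\<^esub> y) = adj A x \<oplus>\<^bsub>A\<^esub> adj A y"
    and adj_smult: "x \<in> carrier A \<Longrightarrow> adj A (c \<odot>\<^bsub>A\<^esub> x) = cnj c \<odot>\<^bsub>A\<^esub> adj A x"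
    and adj_mult:
      "\<lbrakk>x \<in> carrier A; y \<in> carrier A\<rbrakk> \<Longrightarrow> adj A (x \<otimes>\<^bsub>A\<^esub> y) = adj A y \<otimes>\<^bsub>A\<^esub> adj A x"
    and nrm_nonneg: "x \<in> carrier A \<Longrightarrow> 0 \<le> nrm A x"
    and nrm_eq_0_iff: "x \<in> carrier A \<Longrightarrow> nrm A x = 0 \<longleftrightarrow> x = \<zero>\<^bsub>A\<^esub>"
    and nrm_triangle:
      "\<lbrakk>x \<in> carrier A; y \<in> carrier A\<rbrakk> \<Longrightarrow> nrm A (x \<oplus>\<^bsub>A\<^esub> y) \<le> nrm A x + nrm A y"
    and nrm_smult: "x \<in> carrier A \<Longrightarrow> nrm A (c \<odot>\<^bsub>A\<^esub> x) = cmod c * nrm A x"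
    and nrm_mult:
      "\<lbrakk>x \<in> carrier A; y \<in> carrier A\<rbrakk> \<Longrightarrow> nrm A (x \<otimes>\<^bsub>A\<^esub> y) \<le> nrm A x * nrm A y"
    and cstar_identity: "x \<in> carrier A \<Longrightarrow> nrm A (adj A x \<otimes>\<^bsub>A\<^esub> x) = (nrm A x)\<^sup>2"
    and nrm_complete:
      "\<lbrakk>\<And>n :: nat. u n \<in> carrier A;
        \<And>e. 0 < e \<Longrightarrow> \<exists>M. \<forall>m\<ge>M. \<forall>n\<ge>M. nrm A (u m \<ominus>\<^bsub>A\<^esub> u n) < e\<rbrakk>
       \<Longrightarrow> \<exists>x\<in>carrier A. (\<lambda>n. nrm A (u n \<ominus>\<^bsub>A\<^esub> x)) \<longlonglongrightarrow> 0"

definition star_hom :: "'a cstar \<Rightarrow> 'b cstar \<Rightarrow> ('a \<Rightarrow> 'b) set" where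
  "star_hom A B = {h \<in> Ring.ring_hom A B. \<forall>x\<in>carrier A.
     (\<forall>c. h (c \<odot>\<^bsub>A\<^esub> x) = c \<odot>\<^bsub>B\<^esub> h x) \<and> h (adj A x) = adj B (h x)}"

text \<open>A *-isomorphism of C*-algebras is automatically isometric.\<close>

definition star_isomorphic :: "'a cstar \<Rightarrow> 'b cstar \<Rightarrow> bool" where
  "star_isomorphic A B \<longleftrightarrow> star_hom A B \<inter> ring_iso A B \<noteq> {}"

definition norm_closure :: "'a cstar \<Rightarrow> 'a set \<Rightarrow> 'a set" where
  "norm_closure A S = {x \<in> carrier A. \<forall>e>0. \<exists>y\<in>S. nrm A (x \<ominus>\<^bsub>A\<^esub> y) < e}"

definition on_carrier :: "'a cstar \<Rightarrow> 'a set \<Rightarrow> 'a cstar" where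
  "on_carrier A S = A\<lparr>carrier := S\<rparr>"

subsection \<open>Inductive limits\<close>

text \<open>Sequences of algebras are indexed by the positive integers; the value at 0 is ignored.\<close>

primrec iterated :: "(nat \<Rightarrow> 'a \<Rightarrow> 'a) \<Rightarrow> nat \<Rightarrow> nat \<Rightarrow> 'a \<Rightarrow> 'a" where
  "iterated \<phi> n 0 a = a"
| "iterated \<phi> n (Suc m) a = \<phi> (n + m) (iterated \<phi> n m a)"

text \<open>
  \<open>L\<close> with the canonical maps \<open>\<iota> n\<close> is the C*-algebraic inductive limit: the completion of the
  algebraic direct limit for the seminorm sending the class of \<open>a\<close> at stage \<open>n\<close>
  to the limit over \<open>m\<close> of the norms of the images of \<open>a\<close> at stage \<open>n + m\<close>.
  This determines \<open>(L, \<iota>)\<close> up to a unique isomorphism.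
\<close>

definition inductive_limit ::
  "(nat \<Rightarrow> 'a cstar) \<Rightarrow> (nat \<Rightarrow> 'a \<Rightarrow> 'a) \<Rightarrow> 'b cstar \<Rightarrow> (nat \<Rightarrow> 'a \<Rightarrow> 'b) \<Rightarrow> bool" where
  "inductive_limit An \<phi> L \<iota> \<longleftrightarrow>
     cstar_algebra L \<and>
     (\<forall>n\<ge>1. \<iota> n \<in> star_hom (An n) L) \<and>
     (\<forall>n\<ge>1. \<forall>a\<in>carrier (An n). \<iota> (Suc n) (\<phi> n a) = \<iota> n a) \<and>
     (\<forall>n\<ge>1. \<forall>a\<in>carrier (An n).
        (\<lambda>m. nrm (An (n + m)) (iterated \<phi> n m a)) \<longlonglongrightarrow> nrm L (\<iota> n a)) \<and>
     norm_closure L (\<Union>n\<in>{1..}. \<iota> n ` carrier (An n)) = carrier L"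

subsection \<open>Gelfand spectrum\<close>

definition characters :: "'a cstar \<Rightarrow> ('a \<Rightarrow> complex) set" where
  "characters C = {h \<in> extensional (carrier C).
     (\<forall>x\<in>carrier C. \<forall>y\<in>carrier C.
        h (x \<oplus>\<^bsub>C\<^esub> y) = h x + h y \<and> h (x \<otimes>\<^bsub>C\<^esub> y) = h x * h y) \<and>
     (\<forall>c. \<forall>x\<in>carrier C. h (c \<odot>\<^bsub>C\<^esub> x) = c * h x) \<and>
     (\<exists>x\<in>carrier C. h x \<noteq> 0)}"

text \<open>The weak* topology is that of pointwise convergence on the algebra.\<close>

definition gelfand_spectrum :: "'a cstar \<Rightarrow> ('a \<Rightarrow> complex) topology" where
  "gelfand_spectrum C =
     subtopology (product_topology (\<lambda>_. euclidean) (carrier C)) (characters C)"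

subsection \<open>Bounded operators on the Hilbert space of square-summable functions on a set\<close>

definition ell2 :: "'g set \<Rightarrow> ('g \<Rightarrow> complex) set" where
  "ell2 S = {\<xi>. (\<forall>g. g \<notin> S \<longrightarrow> \<xi> g = 0) \<and> (\<lambda>g. (cmod (\<xi> g))\<^sup>2) summable_on S}"

definition ell2_inner :: "'g set \<Rightarrow> ('g \<Rightarrow> complex) \<Rightarrow> ('g \<Rightarrow> complex) \<Rightarrow> complex" where
  "ell2_inner S \<xi> \<eta> = (\<Sum>\<^sub>\<infinity>g\<in>S. \<xi> g * cnj (\<eta> g))"

definition ell2_norm :: "'g set \<Rightarrow> ('g \<Rightarrow> complex) \<Rightarrow> real" where
  "ell2_norm S \<xi> = sqrt (\<Sum>\<^sub>\<infinity>g\<in>S. (cmod (\<xi> g))\<^sup>2)"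

definition bounded_operators ::
  "'g set \<Rightarrow> (('g \<Rightarrow> complex) \<Rightarrow> ('g \<Rightarrow> complex)) set" where
  "bounded_operators S = {T \<in> ell2 S \<rightarrow>\<^sub>E ell2 S.
     (\<forall>\<xi>\<in>ell2 S. \<forall>\<eta>\<in>ell2 S. T (\<lambda>g. \<xi> g + \<eta> g) = (\<lambda>g. T \<xi> g + T \<eta> g)) \<and>
     (\<forall>c. \<forall>\<xi>\<in>ell2 S. T (\<lambda>g. c * \<xi> g) = (\<lambda>g. c * T \<xi> g)) \<and>
     (\<exists>K. \<forall>\<xi>\<in>ell2 S. ell2_norm S (T \<xi>) \<le> K * ell2_norm S \<xi>)}"

definition operator_algebra ::
  "'g set \<Rightarrow> (('g \<Rightarrow> complex) \<Rightarrow> ('g \<Rightarrow> complex)) cstar" where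
  "operator_algebra S =
    \<lparr>carrier = bounded_operators S,
     monoid.mult = (\<lambda>T U. compose (ell2 S) T U),
     one = (\<lambda>\<xi>\<in>ell2 S. \<xi>),
     zero = (\<lambda>\<xi>\<in>ell2 S. \<lambda>g. 0),
     add = (\<lambda>T U. \<lambda>\<xi>\<in>ell2 S. \<lambda>g. T \<xi> g + U \<xi> g),
     smult = (\<lambda>c T. \<lambda>\<xi>\<in>ell2 S. \<lambda>g. c * T \<xi> g),
     adj = (\<lambda>T. THE U. U \<in> bounded_operators S \<and>
              (\<forall>\<xi>\<in>ell2 S. \<forall>\<eta>\<in>ell2 S. ell2_inner S (T \<xi>) \<eta> = ell2_inner S \<xi> (U \<eta>))),
     nrm = (\<lambda>T. Sup {ell2_norm S (T \<xi>) | \<xi>. \<xi> \<in> ell2 S \<and> ell2_norm S \<xi> \<le> 1})\<rparr>"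

section \<open>Topological groupoids\<close>

text \<open>The set of arrows is the underlying set of the topology; units are arrows.\<close>

record 'g groupoid =
  arrows :: "'g topology"
  src :: "'g \<Rightarrow> 'g"
  rng :: "'g \<Rightarrow> 'g"
  gmul :: "'g \<Rightarrow> 'g \<Rightarrow> 'g"
  ginv :: "'g \<Rightarrow> 'g"

definition unit_space :: "'g groupoid \<Rightarrow> 'g topology" where
  "unit_space G = subtopology (arrows G) (src G ` topspace (arrows G))"

locale etale_groupoid =
  fixes G :: "'g groupoid"
  assumes src_closed: "g \<in> topspace (arrows G) \<Longrightarrow> src G g \<in> topspace (arrows G)"
    and rng_closed: "g \<in> topspace (arrows G) \<Longrightarrow> rng G g \<in> topspace (arrows G)"
    and unit_src:
      "g \<in> topspace (arrows G) \<Longrightarrow> src G (src G g) = src G g \<and> rng G (src G g) = src G g"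
    and unit_rng:
      "g \<in> topspace (arrows G) \<Longrightarrow> src G (rng G g) = rng G g \<and> rng G (rng G g) = rng G g"
    and mul_closed:
      "\<lbrakk>g \<in> topspace (arrows G); h \<in> topspace (arrows G); src G g = rng G h\<rbrakk>
       \<Longrightarrow> gmul G g h \<in> topspace (arrows G) \<and>
           rng G (gmul G g h) = rng G g \<and> src G (gmul G g h) = src G h"
    and mul_assoc:
      "\<lbrakk>g \<in> topspace (arrows G); h \<in> topspace (arrows G); k \<in> topspace (arrows G);
        src G g = rng G h; src G h = rng G k\<rbrakk>
       \<Longrightarrow> gmul G (gmul G g h) k = gmul G g (gmul G h k)"
    and mul_unit:
      "g \<in> topspace (arrows G) \<Longrightarrow> gmul G (rng G g) g = g \<and> gmul G g (src G g) = g"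
    and inv_closed:
      "g \<in> topspace (arrows G) \<Longrightarrow>
         ginv G g \<in> topspace (arrows G) \<and> src G (ginv G g) = rng G g \<and> rng G (ginv G g) = src G g"
    and mul_inv:
      "g \<in> topspace (arrows G) \<Longrightarrow>
         gmul G (ginv G g) g = src G g \<and> gmul G g (ginv G g) = rng G g"
    and continuous_mul:
      "continuous_map
         (subtopology (prod_topology (arrows G) (arrows G)) {(g, h). src G g = rng G h})
         (arrows G) (\<lambda>(g, h). gmul G g h)"
    and continuous_inv: "continuous_map (arrows G) (arrows G) (ginv G)"
    and rng_local_homeo:
      "g \<in> topspace (arrows G) \<Longrightarrow>
         \<exists>U. openin (arrows G) U \<and> g \<in> U \<and> openin (unit_space G) (rng G ` U) \<and>
             homeomorphic_map (subtopology (arrows G) U)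
               (subtopology (unit_space G) (rng G ` U)) (rng G)"

locale groupoid_action = etale_groupoid G
  for G :: "'g groupoid" and X :: "'x topology"
    and anchor :: "'x \<Rightarrow> 'g" and act :: "'g \<Rightarrow> 'x \<Rightarrow> 'x" +
  assumes continuous_anchor: "continuous_map X (unit_space G) anchor"
    and continuous_act:
      "continuous_map
         (subtopology (prod_topology (arrows G) X) {(g, x). src G g = anchor x})
         X (\<lambda>(g, x). act g x)"
    and act_unit: "x \<in> topspace X \<Longrightarrow> act (anchor x) x = x"
    and anchor_act:
      "\<lbrakk>g \<in> topspace (arrows G); x \<in> topspace X; src G g = anchor x\<rbrakk>
       \<Longrightarrow> anchor (act g x) = rng G g"
    and act_act:
      "\<lbrakk>h \<in> topspace (arrows G); g \<in> topspace (arrows G); x \<in> topspace X;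
        src G h = rng G g; src G g = anchor x\<rbrakk>
       \<Longrightarrow> act (gmul G h g) x = act h (act g x)"

text \<open>Under the unit space identification \<open>x\<close> corresponds to \<open>(anchor x, x)\<close>.\<close>

definition transformation_groupoid ::
  "'g groupoid \<Rightarrow> 'x topology \<Rightarrow> ('x \<Rightarrow> 'g) \<Rightarrow> ('g \<Rightarrow> 'x \<Rightarrow> 'x) \<Rightarrow> ('g \<times> 'x) groupoid" where
  "transformation_groupoid G X anchor act =
    \<lparr>arrows = subtopology (prod_topology (arrows G) X) {(g, x). src G g = anchor x},
     src = (\<lambda>(g, x). (src G g, x)),
     rng = (\<lambda>(g, x). (rng G g, act g x)),
     gmul = (\<lambda>(h, y) (g, x). (gmul G h g, x)),
     ginv = (\<lambda>(g, x). (ginv G g, act g x))\<rparr>"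

subsection \<open>Reduced groupoid C*-algebra\<close>

definition compactly_supported :: "'g groupoid \<Rightarrow> ('g \<Rightarrow> complex) set" where
  "compactly_supported G = {f. continuous_map (arrows G) euclidean f \<and>
     (\<forall>g. g \<notin> topspace (arrows G) \<longrightarrow> f g = 0) \<and>
     compactin (arrows G) (arrows G closure_of {g \<in> topspace (arrows G). f g \<noteq> 0})}"

text \<open>
  The direct sum over all units \<open>u\<close> of the left regular representations on the square-summable
  functions on the source fibres over \<open>u\<close>; since \<open>G\<close> is the disjoint union of these
  fibres, the representation space is the space of square-summable functions on \<open>G\<close>.
  For \<open>f\<close> of compact support and \<open>G\<close> etale the sum below has finitely many non-zero terms.
\<close>

definition regular_representation ::
  "'g groupoid \<Rightarrow> ('g \<Rightarrow> complex) \<Rightarrow> ('g \<Rightarrow> complex) \<Rightarrow> ('g \<Rightarrow> complex)" where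
  "regular_representation G f = (\<lambda>\<xi>\<in>ell2 (topspace (arrows G)). \<lambda>g.
     if g \<in> topspace (arrows G)
     then \<Sum>\<^sub>\<infinity>h\<in>{h \<in> topspace (arrows G). rng G h = rng G g}. f h * \<xi> (gmul G (ginv G h) g)
     else 0)"

definition reduced_cstar_algebra ::
  "'g groupoid \<Rightarrow> (('g \<Rightarrow> complex) \<Rightarrow> ('g \<Rightarrow> complex)) cstar" where
  "reduced_cstar_algebra G =
     on_carrier (operator_algebra (topspace (arrows G)))
       (norm_closure (operator_algebra (topspace (arrows G)))
          (regular_representation G ` compactly_supported G))"

section \<open>Diagonal AH-systems\<close>

text \<open>
  Stages \<open>n \<ge> 1\<close>, blocks \<open>i \<in> {1..nblocks S n}\<close>. The list \<open>block_order S n j\<close> fixes the order in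
  which the blocks \<open>f\<^sub>i \<circ> \<lambda>\<^sub>e\<close>, each recorded as the pair \<open>(i, e)\<close>, appear
  on the diagonal of the \<open>j\<close>-th component of the connecting map. Base spaces are allowed to be
  empty, and over an empty base space \<open>block_sizes\<close> is not a consequence of \<open>unital\<close>.
\<close>

record ('x, 'e) ah_system =
  nblocks :: "nat \<Rightarrow> nat"
  msize :: "nat \<Rightarrow> nat \<Rightarrow> nat"
  base :: "nat \<Rightarrow> nat \<Rightarrow> 'x topology"
  edges :: "nat \<Rightarrow> nat \<Rightarrow> nat \<Rightarrow> 'e set"
  eigenfun :: "nat \<Rightarrow> nat \<Rightarrow> nat \<Rightarrow> 'e \<Rightarrow> 'x \<Rightarrow> 'x"
  block_order :: "nat \<Rightarrow> nat \<Rightarrow> (nat \<times> 'e) list"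

definition matrix_norm :: "complex mat \<Rightarrow> real" where
  "matrix_norm M = Sup {sqrt (Re ((M *\<^sub>v v) \<bullet>c (M *\<^sub>v v))) | v.
     v \<in> carrier_vec (dim_col M) \<and> sqrt (Re (v \<bullet>c v)) \<le> 1}"

definition pointwise ::
  "('x, 'e) ah_system \<Rightarrow> nat \<Rightarrow> (nat \<Rightarrow> 'x \<Rightarrow> complex mat) \<Rightarrow> nat \<Rightarrow> 'x \<Rightarrow> complex mat" where
  "pointwise S n F = (\<lambda>i\<in>{1..nblocks S n}. \<lambda>x\<in>topspace (base S n i). F i x)"

text \<open>
  The direct sum of the algebras of continuous matrix-valued functions. The 0 inserted in the
  supremum only matters if all base spaces are empty.
\<close>

definition stage_algebra ::
  "('x, 'e) ah_system \<Rightarrow> nat \<Rightarrow> (nat \<Rightarrow> 'x \<Rightarrow> complex mat) cstar" where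
  "stage_algebra S n =
    \<lparr>carrier =
       {f \<in> (\<Pi>\<^sub>E i\<in>{1..nblocks S n}. \<Pi>\<^sub>E x\<in>topspace (base S n i).
                carrier_mat (msize S n i) (msize S n i)).
          \<forall>i\<in>{1..nblocks S n}. \<forall>a<msize S n i. \<forall>b<msize S n i.
            continuous_map (base S n i) euclidean (\<lambda>x. f i x $$ (a, b))},
     monoid.mult = (\<lambda>f g. pointwise S n (\<lambda>i x. f i x * g i x)),
     one = pointwise S n (\<lambda>i x. 1\<^sub>m (msize S n i)),
     zero = pointwise S n (\<lambda>i x. 0\<^sub>m (msize S n i) (msize S n i)),
     add = (\<lambda>f g. pointwise S n (\<lambda>i x. f i x + g i x)),
     smult = (\<lambda>c f. pointwise S n (\<lambda>i x. c \<cdot>\<^sub>m f i x)),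
     adj = (\<lambda>f. pointwise S n (\<lambda>i x. mat_adjoint (f i x))),
     nrm = (\<lambda>f. Sup (insert 0 {matrix_norm (f i x) | i x.
              i \<in> {1..nblocks S n} \<and> x \<in> topspace (base S n i)}))\<rparr>"

definition diagonal_part :: "('x, 'e) ah_system \<Rightarrow> nat \<Rightarrow> (nat \<Rightarrow> 'x \<Rightarrow> complex mat) set" where
  "diagonal_part S n = {f \<in> carrier (stage_algebra S n).
     \<forall>i\<in>{1..nblocks S n}. \<forall>x\<in>topspace (base S n i). diagonal_mat (f i x)}"

definition connecting_map ::
  "('x, 'e) ah_system \<Rightarrow> nat \<Rightarrow> (nat \<Rightarrow> 'x \<Rightarrow> complex mat) \<Rightarrow> (nat \<Rightarrow> 'x \<Rightarrow> complex mat)" where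
  "connecting_map S n f = pointwise S (Suc n) (\<lambda>j x.
     diag_block_mat (map (\<lambda>(i, e). f i (eigenfun S n i j e x)) (block_order S n j)))"

locale diagonal_AH_system =
  fixes S :: "('x, 'e) ah_system"
  assumes nblocks_pos: "n \<ge> 1 \<Longrightarrow> nblocks S n \<ge> 1"
    and msize_pos: "\<lbrakk>n \<ge> 1; i \<in> {1..nblocks S n}\<rbrakk> \<Longrightarrow> msize S n i \<ge> 1"
    and compact_base: "\<lbrakk>n \<ge> 1; i \<in> {1..nblocks S n}\<rbrakk> \<Longrightarrow> compact_space (base S n i)"
    and Hausdorff_base: "\<lbrakk>n \<ge> 1; i \<in> {1..nblocks S n}\<rbrakk> \<Longrightarrow> Hausdorff_space (base S n i)"
    and finite_edges:
      "\<lbrakk>n \<ge> 1; i \<in> {1..nblocks S n}; j \<in> {1..nblocks S (Suc n)}\<rbrakk> \<Longrightarrow> finite (edges S n i j)"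
    and continuous_eigenfun:
      "\<lbrakk>n \<ge> 1; i \<in> {1..nblocks S n}; j \<in> {1..nblocks S (Suc n)}; e \<in> edges S n i j\<rbrakk>
       \<Longrightarrow> continuous_map (base S (Suc n) j) (base S n i) (eigenfun S n i j e)"
    and block_order:
      "\<lbrakk>n \<ge> 1; j \<in> {1..nblocks S (Suc n)}\<rbrakk> \<Longrightarrow>
         distinct (block_order S n j) \<and>
         set (block_order S n j) = (SIGMA i:{1..nblocks S n}. edges S n i j)"
    and block_sizes:
      "\<lbrakk>n \<ge> 1; j \<in> {1..nblocks S (Suc n)}\<rbrakk> \<Longrightarrow>
         (\<Sum>(i, e)\<leftarrow>block_order S n j. msize S n i) = msize S (Suc n) j"
    and unital: "n \<ge> 1 \<Longrightarrow>
      connecting_map S n \<one>\<^bsub>stage_algebra S n\<^esub> = \<one>\<^bsub>stage_algebra S (Suc n)\<^esub>"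
    and injective: "n \<ge> 1 \<Longrightarrow> inj_on (connecting_map S n) (carrier (stage_algebra S n))"

definition limit_diagonal ::
  "('x, 'e) ah_system \<Rightarrow> 'a cstar \<Rightarrow> (nat \<Rightarrow> (nat \<Rightarrow> 'x \<Rightarrow> complex mat) \<Rightarrow> 'a) \<Rightarrow> 'a cstar" where
  "limit_diagonal S A \<iota> = on_carrier A (norm_closure A (\<Union>n\<in>{1..}. \<iota> n ` diagonal_part S n))"

subsection \<open>The Bratteli diagram of the AF-subsystem and its tail groupoid\<close>

text \<open>
  Vertices are pairs of a level and an index, the root being \<open>(0, 0)\<close>. \<open>Root_edge l j\<close> is the
  \<open>l\<close>-th edge from the root to \<open>(1, j)\<close>; \<open>Edge n i j e\<close> is the edge \<open>e\<close> from \<open>(n, i)\<close> to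
  \<open>(n + 1, j)\<close>, the tags making the union over \<open>i\<close> and \<open>j\<close> disjoint.
\<close>

datatype 'e bedge = Root_edge nat nat | Edge nat nat nat 'e

fun edge_start :: "'e bedge \<Rightarrow> nat \<times> nat" where
  "edge_start (Root_edge l j) = (0, 0)"
| "edge_start (Edge n i j e) = (n, i)"

fun edge_end :: "'e bedge \<Rightarrow> nat \<times> nat" where
  "edge_end (Root_edge l j) = (1, j)"
| "edge_end (Edge n i j e) = (Suc n, j)"

definition bratteli_edges :: "('x, 'e) ah_system \<Rightarrow> nat \<Rightarrow> 'e bedge set" where
  "bratteli_edges S n =
     (if n = 0 then {Root_edge l j | l j. j \<in> {1..nblocks S 1} \<and> l < msize S 1 j}
      else {Edge n i j e | i j e.
              i \<in> {1..nblocks S n} \<and> j \<in> {1..nblocks S (Suc n)} \<and> e \<in> edges S n i j})"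

text \<open>
  Positions in paths are counted from 0, so position \<open>k\<close> holds an edge from level \<open>k\<close> to
  level \<open>k + 1\<close>, i.e. the \<open>(k + 1)\<close>-st edge of the path.
\<close>

definition infinite_paths :: "('x, 'e) ah_system \<Rightarrow> (nat \<Rightarrow> 'e bedge) set" where
  "infinite_paths S = {x. \<forall>k. x k \<in> bratteli_edges S k \<and> edge_end (x k) = edge_start (x (Suc k))}"

definition finite_paths :: "('x, 'e) ah_system \<Rightarrow> 'e bedge list set" where
  "finite_paths S = {p. (\<forall>k<length p. p ! k \<in> bratteli_edges S k) \<and>
     (\<forall>k. Suc k < length p \<longrightarrow> edge_end (p ! k) = edge_start (p ! Suc k))}"

definition path_end :: "'e bedge list \<Rightarrow> nat \<times> nat" where
  "path_end p = (if p = [] then (0, 0) else edge_end (last p))"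

definition path_cylinder ::
  "('x, 'e) ah_system \<Rightarrow> 'e bedge list \<Rightarrow> 'e bedge list
     \<Rightarrow> ((nat \<Rightarrow> 'e bedge) \<times> (nat \<Rightarrow> 'e bedge)) set" where
  "path_cylinder S p q = {(x, y). x \<in> infinite_paths S \<and> y \<in> infinite_paths S \<and>
     map x [0..<length p] = p \<and> map y [0..<length q] = q \<and> (\<forall>k\<ge>length p. x k = y k)}"

text \<open>
  The arrows of this groupoid are all tail-equivalent pairs of infinite paths: the union of
  the cylinder sets. The unit \<open>(x, x)\<close> stands for the path \<open>x\<close>.
\<close>

definition tail_groupoid ::
  "('x, 'e) ah_system \<Rightarrow> ((nat \<Rightarrow> 'e bedge) \<times> (nat \<Rightarrow> 'e bedge)) groupoid" where
  "tail_groupoid S =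
    \<lparr>arrows = topology_generated_by {path_cylinder S p q | p q.
       p \<in> finite_paths S \<and> q \<in> finite_paths S \<and> length p = length q \<and> path_end p = path_end q},
     src = (\<lambda>(x, y). (y, y)),
     rng = (\<lambda>(x, y). (x, x)),
     gmul = (\<lambda>(x, y) (y', z). (x, z)),
     ginv = (\<lambda>(x, y). (y, x))\<rparr>"

lemma topspace_tail_groupoid:
  "topspace (arrows (tail_groupoid S)) =
     {(x, y). x \<in> infinite_paths S \<and> y \<in> infinite_paths S \<and> (\<exists>m. \<forall>k\<ge>m. x k = y k)}"
    (is "?L = ?R")
proof (intro Set.set_eqI iffI)
  fix g assume "g \<in> ?L"
  then show "g \<in> ?R"
    by (auto simp: tail_groupoid_def topology_generated_by_topspace path_cylinder_def)
next
  fix g assume "g \<in> ?R"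
  then obtain x y m where g: "g = (x, y)" and x: "x \<in> infinite_paths S"
    and y: "y \<in> infinite_paths S" and m: "\<forall>k\<ge>m. x k = y k"
    by auto
  have fin: "map z [0..<m] \<in> finite_paths S" if "z \<in> infinite_paths S" for z
    using that by (auto simp: infinite_paths_def finite_paths_def)
  have "path_end (map z [0..<m]) = (if m = 0 then (0, 0) else edge_start (z m))"
    if "z \<in> infinite_paths S" for z
    using that by (cases m) (auto simp: path_end_def infinite_paths_def)
  then have "path_end (map x [0..<m]) = path_end (map y [0..<m])"
    using x y m by simp
  moreover have "g \<in> path_cylinder S (map x [0..<m]) (map y [0..<m])"
    using g x y m by (simp add: path_cylinder_def)
  ultimately have "g \<in> \<Union> {path_cylinder S p q | p q.
       p \<in> finite_paths S \<and> q \<in> finite_paths S \<and> length p = length q \<and> path_end p = path_end q}"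
    using fin[OF x] fin[OF y] by fastforce
  then show "g \<in> ?L"
    by (simp add: tail_groupoid_def topology_generated_by_topspace)
qed

end

theory Submission
  imports Defs
begin

text \<open>
  A character of the limit diagonal restricts at every stage to the evaluation of one diagonal entry
  at one point, and these choices are compatible with the connecting maps; the chosen positions form
  an infinite path of the Bratteli diagram, which gives the anchor map. The groupoid acts by
  conjugation with the matrix units of the AF-subalgebra.

  An element of the \<open>n\<close>-th stage is turned into a kernel on the transformation groupoid,
  supported on the arrows whose two paths agree from level \<open>n\<close> on. These arrows decompose into
  finite blocks, on which the regular representation of the kernel is the given matrix evaluated at
  a point. Since every point of every base space is hit by a character, the representation is
  isometric on each stage. By Stone--Weierstrass on the spectrum the kernels are dense in the
  compactly supported functions, so the isometry extends to an isomorphism of the completions.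
\<close>

section \<open>Square-summable functions\<close>

text \<open>Neither the connecting maps nor the maps \<open>\<iota> n\<close> are assumed isometric;
  the hypothesis is injectivity of the connecting maps. It yields joint surjectivity of the
  eigenfunctions and, by dependent choice, a character above every point, hence isometry of the
  representation on each stage. As the kernel of an element is unchanged by the connecting map,
  isometry of the connecting maps and of \<open>\<iota> n\<close> follows. The partial isometry of
  an arrow is taken at the least level from which its paths agree, so it is locally constant in the
  arrow. At later stages it is no longer a matrix unit; what survives is that each row has at most
  one nonzero entry, and this makes conjugation preserve the diagonal. Points attached to a
  character are arbitrary choices, compared only through values of continuous functions. No
  C*-algebra axioms are established for the operators: differences, completeness and adjoints are
  computed by hand where the extension needs them.\<close>

lemma ell2I:
  assumes "\<And>g. g \<notin> S \<Longrightarrow> \<xi> g = 0"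
    and K: "\<And>F. finite F \<Longrightarrow> F \<subseteq> S \<Longrightarrow> L2_set (\<lambda>g. cmod (\<xi> g)) F \<le> K"
  shows "\<xi> \<in> ell2 S" "ell2_norm S \<xi> \<le> K"
proof -
  have K0: "0 \<le> K" using K[of "{}"] by simp
  have bd: "(\<Sum>g\<in>F. (cmod (\<xi> g))\<^sup>2) \<le> K\<^sup>2" if "finite F" "F \<subseteq> S" for F
    using K[OF that] K0 unfolding L2_set_def by (simp add: real_sqrt_le_iff' sqrt_le_D)
  have s: "(\<lambda>g. (cmod (\<xi> g))\<^sup>2) summable_on S"
    by (rule nonneg_bounded_partial_sums_imp_summable_on[where C = "K\<^sup>2"])
      (auto simp: bd intro!: eventually_finite_subsets_at_top_weakI)
  then show "\<xi> \<in> ell2 S" using assms(1) by (simp add: ell2_def)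
  have "(\<Sum>\<^sub>\<infinity>g\<in>S. (cmod (\<xi> g))\<^sup>2) \<le> K\<^sup>2"
    by (rule infsum_le_finite_sums[OF s]) (use bd in auto)
  then show "ell2_norm S \<xi> \<le> K" unfolding ell2_norm_def using K0 by (simp add: real_le_lsqrt)
qed

lemma ell2_outside: "\<xi> \<in> ell2 S \<Longrightarrow> g \<notin> S \<Longrightarrow> \<xi> g = 0"
  by (simp add: ell2_def)

lemma L2_set_le_ell2_norm:
  assumes "\<xi> \<in> ell2 S" "finite F" "F \<subseteq> S"
  shows "L2_set (\<lambda>g. cmod (\<xi> g)) F \<le> ell2_norm S \<xi>"
  unfolding L2_set_def ell2_norm_def
  using assms by (auto simp: ell2_def intro!: finite_sum_le_infsum)

lemma ell2_norm_nonneg: "0 \<le> ell2_norm S \<xi>"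
  unfolding ell2_norm_def by (simp add: infsum_nonneg)

lemma cmod_le_ell2_norm: "\<xi> \<in> ell2 S \<Longrightarrow> cmod (\<xi> g) \<le> ell2_norm S \<xi>"
  using L2_set_le_ell2_norm[of \<xi> S "{g}"] ell2_norm_nonneg[of S \<xi>] ell2_outside[of \<xi> S g]
  by (cases "g \<in> S") auto

lemma ell2_add:
  assumes "\<xi> \<in> ell2 S" "\<eta> \<in> ell2 S"
  shows "(\<lambda>g. \<xi> g + \<eta> g) \<in> ell2 S"
    "ell2_norm S (\<lambda>g. \<xi> g + \<eta> g) \<le> ell2_norm S \<xi> + ell2_norm S \<eta>"
proof -
  have "L2_set (\<lambda>g. cmod (\<xi> g + \<eta> g)) F \<le> ell2_norm S \<xi> + ell2_norm S \<eta>"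
    if "finite F" "F \<subseteq> S" for F
  proof -
    have "L2_set (\<lambda>g. cmod (\<xi> g + \<eta> g)) F \<le> L2_set (\<lambda>g. cmod (\<xi> g) + cmod (\<eta> g)) F"
      by (rule L2_set_mono) (auto simp: norm_triangle_ineq)
    also have "\<dots> \<le> L2_set (\<lambda>g. cmod (\<xi> g)) F + L2_set (\<lambda>g. cmod (\<eta> g)) F"
      by (rule L2_set_triangle_ineq)
    also have "\<dots> \<le> ell2_norm S \<xi> + ell2_norm S \<eta>"
      using assms that by (intro add_mono L2_set_le_ell2_norm)
    finally show ?thesis .
  qed
  note bd = this
  have z: "\<xi> g + \<eta> g = 0" if "g \<notin> S" for g
    by (simp add: ell2_outside[OF assms(1) that] ell2_outside[OF assms(2) that])
  show "(\<lambda>g. \<xi> g + \<eta> g) \<in> ell2 S" by (rule ell2I(1)[OF z bd])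
  show "ell2_norm S (\<lambda>g. \<xi> g + \<eta> g) \<le> ell2_norm S \<xi> + ell2_norm S \<eta>" by (rule ell2I(2)[OF z bd])
qed

lemma ell2_norm_cmult: "ell2_norm S (\<lambda>g. c * \<xi> g) = cmod c * ell2_norm S \<xi>"
proof -
  have "(\<Sum>\<^sub>\<infinity>g\<in>S. (cmod (c * \<xi> g))\<^sup>2) = (cmod c)\<^sup>2 * (\<Sum>\<^sub>\<infinity>g\<in>S. (cmod (\<xi> g))\<^sup>2)"
    by (subst infsum_cmult_right'[symmetric]) (simp add: norm_mult power_mult_distrib)
  then show ?thesis by (simp add: ell2_norm_def real_sqrt_mult)
qed

lemma ell2_cmult: "\<xi> \<in> ell2 S \<Longrightarrow> (\<lambda>g. c * \<xi> g) \<in> ell2 S"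
  by (auto simp: ell2_def norm_mult power_mult_distrib intro: summable_on_cmult_right)

lemma ell2_zero: "(\<lambda>g. 0) \<in> ell2 S"
  by (auto simp: ell2_def)

lemma ell2_norm_zero: "ell2_norm S (\<lambda>g. 0) = 0"
  by (simp add: ell2_norm_def)

lemma ell2_diff:
  assumes "\<xi> \<in> ell2 S" "\<eta> \<in> ell2 S"
  shows "(\<lambda>g. \<xi> g - \<eta> g) \<in> ell2 S"
    "ell2_norm S (\<lambda>g. \<xi> g - \<eta> g) \<le> ell2_norm S \<xi> + ell2_norm S \<eta>"
  using ell2_add[OF assms(1) ell2_cmult[OF assms(2), of "-1"]] ell2_norm_cmult[of S "-1" \<eta>]
  by simp_all

lemma ell2_finite_support:
  assumes "finite F" "F \<subseteq> S" "\<And>g. g \<notin> F \<Longrightarrow> \<xi> g = 0"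
  shows "\<xi> \<in> ell2 S" "ell2_norm S \<xi> = L2_set (\<lambda>g. cmod (\<xi> g)) F"
proof -
  have 1: "L2_set (\<lambda>g. cmod (\<xi> g)) F' \<le> L2_set (\<lambda>g. cmod (\<xi> g)) F" if "finite F'" for F'
  proof -
    have "(\<Sum>g\<in>F'. (cmod (\<xi> g))\<^sup>2) = (\<Sum>g\<in>F' \<inter> F. (cmod (\<xi> g))\<^sup>2)"
      using that assms(3) by (intro sum.mono_neutral_right) auto
    also have "\<dots> \<le> (\<Sum>g\<in>F. (cmod (\<xi> g))\<^sup>2)"
      using assms(1) by (intro sum_mono2) auto
    finally show ?thesis by (simp add: L2_set_def)
  qed
  show 2: "\<xi> \<in> ell2 S" by (rule ell2I) (use assms 1 in auto)
  have "ell2_norm S \<xi> \<le> L2_set (\<lambda>g. cmod (\<xi> g)) F" by (rule ell2I) (use assms 1 in auto)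
  moreover have "L2_set (\<lambda>g. cmod (\<xi> g)) F \<le> ell2_norm S \<xi>"
    by (rule L2_set_le_ell2_norm) (use assms 2 in auto)
  ultimately show "ell2_norm S \<xi> = L2_set (\<lambda>g. cmod (\<xi> g)) F" by simp
qed

lemma ell2_mult_abs_summable:
  assumes "\<xi> \<in> ell2 S" "\<eta> \<in> ell2 S"
  shows "(\<lambda>g. norm (\<xi> g * cnj (\<eta> g))) summable_on S"
proof -
  have "(\<lambda>g. (cmod (\<xi> g))\<^sup>2 + (cmod (\<eta> g))\<^sup>2) summable_on S"
    using assms by (auto simp: ell2_def intro: summable_on_add)
  then show ?thesis
  proof (rule summable_on_comparison_test)
    fix g
    have "2 * (cmod (\<xi> g) * cmod (\<eta> g)) \<le> (cmod (\<xi> g))\<^sup>2 + (cmod (\<eta> g))\<^sup>2"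
      using sum_squares_bound[of "cmod (\<xi> g)" "cmod (\<eta> g)"] by simp
    moreover have "0 \<le> cmod (\<xi> g) * cmod (\<eta> g)" by simp
    ultimately have "cmod (\<xi> g) * cmod (\<eta> g) \<le> (cmod (\<xi> g))\<^sup>2 + (cmod (\<eta> g))\<^sup>2"
      by linarith
    then show "norm (\<xi> g * cnj (\<eta> g)) \<le> (cmod (\<xi> g))\<^sup>2 + (cmod (\<eta> g))\<^sup>2"
      by (simp add: norm_mult)
  qed auto
qed

lemma ell2_inner_bound:
  assumes "\<xi> \<in> ell2 S" "\<eta> \<in> ell2 S"
  shows "cmod (ell2_inner S \<xi> \<eta>) \<le> ell2_norm S \<xi> * ell2_norm S \<eta>"
proof -
  have s: "(\<lambda>g. norm (\<xi> g * cnj (\<eta> g))) summable_on S"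
    by (rule ell2_mult_abs_summable[OF assms])
  have "cmod (ell2_inner S \<xi> \<eta>) \<le> (\<Sum>\<^sub>\<infinity>g\<in>S. cmod (\<xi> g * cnj (\<eta> g)))"
    unfolding ell2_inner_def by (rule norm_infsum_bound[OF s])
  also have "\<dots> \<le> ell2_norm S \<xi> * ell2_norm S \<eta>"
  proof (rule infsum_le_finite_sums[OF s])
    fix F assume F: "finite F" "F \<subseteq> S"
    have "(\<Sum>g\<in>F. cmod (\<xi> g * cnj (\<eta> g))) = (\<Sum>g\<in>F. \<bar>cmod (\<xi> g)\<bar> * \<bar>cmod (\<eta> g)\<bar>)"
      by (simp add: norm_mult)
    also have "\<dots> \<le> L2_set (\<lambda>g. cmod (\<xi> g)) F * L2_set (\<lambda>g. cmod (\<eta> g)) F"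
      by (rule L2_set_mult_ineq)
    also have "\<dots> \<le> ell2_norm S \<xi> * ell2_norm S \<eta>"
      using L2_set_le_ell2_norm[OF _ F] assms
      by (intro mult_mono) (auto simp: L2_set_nonneg ell2_norm_nonneg)
    finally show "(\<Sum>g\<in>F. cmod (\<xi> g * cnj (\<eta> g))) \<le> ell2_norm S \<xi> * ell2_norm S \<eta>" .
  qed
  finally show ?thesis .
qed

lemma ell2_inner_diff_left:
  assumes "\<xi> \<in> ell2 S" "\<xi>' \<in> ell2 S" "\<eta> \<in> ell2 S"
  shows "ell2_inner S (\<lambda>g. \<xi> g - \<xi>' g) \<eta> = ell2_inner S \<xi> \<eta> - ell2_inner S \<xi>' \<eta>"
proof -
  let ?a = "\<lambda>g. \<xi> g * cnj (\<eta> g)" and ?b = "\<lambda>g. \<xi>' g * cnj (\<eta> g)"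
  have a: "(?a has_sum ell2_inner S \<xi> \<eta>) S"
    unfolding ell2_inner_def
    by (rule has_sum_infsum[OF abs_summable_summable[OF ell2_mult_abs_summable[OF assms(1) assms(3)]]])
  have b: "(?b has_sum ell2_inner S \<xi>' \<eta>) S"
    unfolding ell2_inner_def
    by (rule has_sum_infsum[OF abs_summable_summable[OF ell2_mult_abs_summable[OF assms(2) assms(3)]]])
  have eq: "(\<lambda>g. ?a g + - ?b g) = (\<lambda>g. (\<xi> g - \<xi>' g) * cnj (\<eta> g))"
    by (rule ext) (simp add: algebra_simps)
  have "((\<lambda>g. ?a g + - ?b g) has_sum (ell2_inner S \<xi> \<eta> + - ell2_inner S \<xi>' \<eta>)) S"
    by (rule has_sum_add[OF a has_sum_uminus[THEN iffD2]]) (use b in simp)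
  from infsumI[OF this[unfolded eq]] show ?thesis
    by (simp only: ell2_inner_def diff_conv_add_uminus)
qed

lemma ell2_inner_diff_right:
  assumes "\<xi> \<in> ell2 S" "\<eta> \<in> ell2 S" "\<eta>' \<in> ell2 S"
  shows "ell2_inner S \<xi> (\<lambda>g. \<eta> g - \<eta>' g) = ell2_inner S \<xi> \<eta> - ell2_inner S \<xi> \<eta>'"
proof -
  let ?a = "\<lambda>g. \<xi> g * cnj (\<eta> g)" and ?b = "\<lambda>g. \<xi> g * cnj (\<eta>' g)"
  have a: "(?a has_sum ell2_inner S \<xi> \<eta>) S"
    unfolding ell2_inner_def
    by (rule has_sum_infsum[OF abs_summable_summable[OF ell2_mult_abs_summable[OF assms(1) assms(2)]]])
  have b: "(?b has_sum ell2_inner S \<xi> \<eta>') S"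
    unfolding ell2_inner_def
    by (rule has_sum_infsum[OF abs_summable_summable[OF ell2_mult_abs_summable[OF assms(1) assms(3)]]])
  have eq: "(\<lambda>g. ?a g + - ?b g) = (\<lambda>g. \<xi> g * cnj (\<eta> g - \<eta>' g))"
    by (rule ext) (simp add: algebra_simps)
  have "((\<lambda>g. ?a g + - ?b g) has_sum (ell2_inner S \<xi> \<eta> + - ell2_inner S \<xi> \<eta>')) S"
    by (rule has_sum_add[OF a has_sum_uminus[THEN iffD2]]) (use b in simp)
  from infsumI[OF this[unfolded eq]] show ?thesis
    by (simp only: ell2_inner_def diff_conv_add_uminus)
qed

text \<open>Testing against point masses recovers every coordinate. This is the uniqueness half of
  the adjoint in \<open>adj_operator\<close>.\<close>

lemma ell2_ext_inner:
  assumes "\<eta> \<in> ell2 S" "\<eta>' \<in> ell2 S"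
    and eq: "\<And>\<xi>. \<xi> \<in> ell2 S \<Longrightarrow> ell2_inner S \<xi> \<eta> = ell2_inner S \<xi> \<eta>'"
  shows "\<eta> = \<eta>'"
proof
  fix g
  show "\<eta> g = \<eta>' g"
  proof (cases "g \<in> S")
    case True
    let ?d = "\<lambda>h. if h = g then 1 else 0 :: complex"
    have d: "?d \<in> ell2 S" by (rule ell2_finite_support(1)[of "{g}"]) (use True in auto)
    have "ell2_inner S ?d \<zeta> = cnj (\<zeta> g)" for \<zeta>
    proof -
      have "ell2_inner S ?d \<zeta> = (\<Sum>\<^sub>\<infinity>h\<in>{g}. ?d h * cnj (\<zeta> h))"
        unfolding ell2_inner_def by (rule infsum_cong_neutral) (use True in auto)
      then show ?thesis by simp
    qed
    with eq[OF d] show ?thesis by simp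
  qed (simp add: ell2_outside[OF assms(1)] ell2_outside[OF assms(2)])
qed

section \<open>Bounded operators\<close>

lemma bounded_operatorsI:
  assumes "T \<in> extensional (ell2 S)" "\<And>\<xi>. \<xi> \<in> ell2 S \<Longrightarrow> T \<xi> \<in> ell2 S"
    "\<And>\<xi> \<eta>. \<xi> \<in> ell2 S \<Longrightarrow> \<eta> \<in> ell2 S \<Longrightarrow> T (\<lambda>g. \<xi> g + \<eta> g) = (\<lambda>g. T \<xi> g + T \<eta> g)"
    "\<And>c \<xi>. \<xi> \<in> ell2 S \<Longrightarrow> T (\<lambda>g. c * \<xi> g) = (\<lambda>g. c * T \<xi> g)"
    "\<And>\<xi>. \<xi> \<in> ell2 S \<Longrightarrow> ell2_norm S (T \<xi>) \<le> K * ell2_norm S \<xi>"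
  shows "T \<in> bounded_operators S"
proof -
  have "\<exists>K. \<forall>\<xi>\<in>ell2 S. ell2_norm S (T \<xi>) \<le> K * ell2_norm S \<xi>" using assms(5) by blast
  then show ?thesis using assms(1-4) by (simp add: bounded_operators_def PiE_def)
qed

lemma bounded_operatorsD:
  assumes "T \<in> bounded_operators S"
  shows "T \<in> extensional (ell2 S)" "\<And>\<xi>. \<xi> \<in> ell2 S \<Longrightarrow> T \<xi> \<in> ell2 S"
    "\<And>\<xi> \<eta>. \<xi> \<in> ell2 S \<Longrightarrow> \<eta> \<in> ell2 S \<Longrightarrow> T (\<lambda>g. \<xi> g + \<eta> g) = (\<lambda>g. T \<xi> g + T \<eta> g)"
    "\<And>c \<xi>. \<xi> \<in> ell2 S \<Longrightarrow> T (\<lambda>g. c * \<xi> g) = (\<lambda>g. c * T \<xi> g)"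
  using assms by (auto simp: bounded_operators_def PiE_def)

lemma bounded_operatorsE:
  assumes "T \<in> bounded_operators S"
  obtains K where "\<And>\<xi>. \<xi> \<in> ell2 S \<Longrightarrow> ell2_norm S (T \<xi>) \<le> K * ell2_norm S \<xi>"
  using assms unfolding bounded_operators_def by blast

lemma operator_eqI:
  assumes "T \<in> bounded_operators S" "U \<in> bounded_operators S"
    "\<And>\<xi> g. \<xi> \<in> ell2 S \<Longrightarrow> g \<in> S \<Longrightarrow> T \<xi> g = U \<xi> g"
  shows "T = U"
proof (rule extensionalityI[OF bounded_operatorsD(1)[OF assms(1)] bounded_operatorsD(1)[OF assms(2)]])
  fix \<xi> assume \<xi>: "\<xi> \<in> ell2 S"
  show "T \<xi> = U \<xi>"
  proof
    fix g show "T \<xi> g = U \<xi> g"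
      using assms(3)[OF \<xi>] ell2_outside[OF bounded_operatorsD(2)[OF assms(1) \<xi>]]
        ell2_outside[OF bounded_operatorsD(2)[OF assms(2) \<xi>]] by (cases "g \<in> S") simp_all
  qed
qed

abbreviation op_norm :: "'g set \<Rightarrow> (('g \<Rightarrow> complex) \<Rightarrow> ('g \<Rightarrow> complex)) \<Rightarrow> real" where
  "op_norm S \<equiv> nrm (operator_algebra S)"

lemma op_norm_def': "op_norm S T = Sup {ell2_norm S (T \<xi>) | \<xi>. \<xi> \<in> ell2 S \<and> ell2_norm S \<xi> \<le> 1}"
  by (simp add: operator_algebra_def)

lemma op_norm_leI:
  assumes "0 \<le> K" "\<And>\<xi>. \<xi> \<in> ell2 S \<Longrightarrow> ell2_norm S (T \<xi>) \<le> K * ell2_norm S \<xi>"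
  shows "op_norm S T \<le> K"
  unfolding op_norm_def'
proof (rule cSup_least)
  show "{ell2_norm S (T \<xi>) | \<xi>. \<xi> \<in> ell2 S \<and> ell2_norm S \<xi> \<le> 1} \<noteq> {}"
    using ell2_zero[of S] ell2_norm_zero[of S] by force
  fix y assume "y \<in> {ell2_norm S (T \<xi>) | \<xi>. \<xi> \<in> ell2 S \<and> ell2_norm S \<xi> \<le> 1}"
  then obtain \<xi> where "\<xi> \<in> ell2 S" "ell2_norm S \<xi> \<le> 1" "y = ell2_norm S (T \<xi>)" by auto
  moreover have "K * ell2_norm S \<xi> \<le> K * 1" using calculation assms(1) by (intro mult_left_mono)
  ultimately show "y \<le> K" using assms(2)[of \<xi>] by simp
qed

lemma op_norm_bdd:
  assumes "T \<in> bounded_operators S"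
  shows "bdd_above {ell2_norm S (T \<xi>) | \<xi>. \<xi> \<in> ell2 S \<and> ell2_norm S \<xi> \<le> 1}"
proof -
  obtain K where K: "\<And>\<xi>. \<xi> \<in> ell2 S \<Longrightarrow> ell2_norm S (T \<xi>) \<le> K * ell2_norm S \<xi>"
    using assms bounded_operatorsE by blast
  have "ell2_norm S (T \<xi>) \<le> \<bar>K\<bar>" if "\<xi> \<in> ell2 S" "ell2_norm S \<xi> \<le> 1" for \<xi>
  proof -
    have "K * ell2_norm S \<xi> \<le> \<bar>K\<bar> * 1"
      using that ell2_norm_nonneg by (intro mult_mono) auto
    then show ?thesis using K[OF that(1)] by simp
  qed
  then show ?thesis unfolding bdd_above_def by blast
qed

lemma op_norm_nonneg: "T \<in> bounded_operators S \<Longrightarrow> 0 \<le> op_norm S T"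
proof -
  assume T: "T \<in> bounded_operators S"
  have "ell2_norm S (T (\<lambda>g. 0)) \<le> op_norm S T"
    unfolding op_norm_def'
    by (rule cSup_upper[OF _ op_norm_bdd[OF T]]) (use ell2_zero[of S] ell2_norm_zero[of S] in force)
  then show ?thesis using ell2_norm_nonneg[of S "T (\<lambda>g. 0)"] by linarith
qed

lemma op_norm_bound:
  assumes T: "T \<in> bounded_operators S" and \<xi>: "\<xi> \<in> ell2 S"
  shows "ell2_norm S (T \<xi>) \<le> op_norm S T * ell2_norm S \<xi>"
proof (cases "ell2_norm S \<xi> = 0")
  \<comment> \<open>A vector of norm 0 cannot be rescaled, but any bound \<open>K\<close> already
    forces its image to have norm 0.\<close>
  case True
  obtain K where K: "\<And>\<xi>. \<xi> \<in> ell2 S \<Longrightarrow> ell2_norm S (T \<xi>) \<le> K * ell2_norm S \<xi>"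
    using T bounded_operatorsE by blast
  then show ?thesis using K[OF \<xi>] True by simp
next
  case False
  then have pos: "0 < ell2_norm S \<xi>" using ell2_norm_nonneg[of S \<xi>] by linarith
  let ?c = "complex_of_real (1 / ell2_norm S \<xi>)"
  have "ell2_norm S (T (\<lambda>g. ?c * \<xi> g)) \<le> op_norm S T"
    unfolding op_norm_def'
  proof (rule cSup_upper[OF _ op_norm_bdd[OF T]])
    have "ell2_norm S (\<lambda>g. ?c * \<xi> g) \<le> 1"
      using pos by (simp only: ell2_norm_cmult norm_of_real) simp
    then show "ell2_norm S (T (\<lambda>g. ?c * \<xi> g))
      \<in> {ell2_norm S (T \<xi>) | \<xi>. \<xi> \<in> ell2 S \<and> ell2_norm S \<xi> \<le> 1}"
      using ell2_cmult[OF \<xi>, of ?c] by blast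
  qed
  also have "ell2_norm S (T (\<lambda>g. ?c * \<xi> g)) = ell2_norm S (T \<xi>) / ell2_norm S \<xi>"
    using pos by (simp only: bounded_operatorsD(4)[OF T \<xi>] ell2_norm_cmult norm_of_real) simp
  finally show ?thesis using pos by (simp add: field_simps)
qed

lemma operator_diff_closed:
  assumes "T \<in> bounded_operators S" "U \<in> bounded_operators S"
  shows "(\<lambda>\<xi>\<in>ell2 S. \<lambda>g. T \<xi> g - U \<xi> g) \<in> bounded_operators S"
proof (rule bounded_operatorsI)
  fix \<xi> assume \<xi>: "\<xi> \<in> ell2 S"
  note TU = bounded_operatorsD(2)[OF assms(1) \<xi>] bounded_operatorsD(2)[OF assms(2) \<xi>]
  show "ell2_norm S ((\<lambda>\<xi>\<in>ell2 S. \<lambda>g. T \<xi> g - U \<xi> g) \<xi>) \<le> (op_norm S T + op_norm S U) * ell2_norm S \<xi>"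
    using ell2_diff(2)[OF TU] op_norm_bound[OF assms(1) \<xi>] op_norm_bound[OF assms(2) \<xi>] \<xi>
    by (simp add: distrib_right)
  show "(\<lambda>\<xi>\<in>ell2 S. \<lambda>g. T \<xi> g - U \<xi> g) \<xi> \<in> ell2 S" using \<xi> ell2_diff(1)[OF TU] by simp
qed (simp_all add: ell2_add(1) ell2_cmult bounded_operatorsD(3,4)[OF assms(1)]
  bounded_operatorsD(3,4)[OF assms(2)] fun_eq_iff algebra_simps)

lemma operator_add_closed:
  assumes "T \<in> bounded_operators S" "U \<in> bounded_operators S"
  shows "(\<lambda>\<xi>\<in>ell2 S. \<lambda>g. T \<xi> g + U \<xi> g) \<in> bounded_operators S"
proof (rule bounded_operatorsI)
  fix \<xi> assume \<xi>: "\<xi> \<in> ell2 S"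
  note TU = bounded_operatorsD(2)[OF assms(1) \<xi>] bounded_operatorsD(2)[OF assms(2) \<xi>]
  show "ell2_norm S ((\<lambda>\<xi>\<in>ell2 S. \<lambda>g. T \<xi> g + U \<xi> g) \<xi>) \<le> (op_norm S T + op_norm S U) * ell2_norm S \<xi>"
    using ell2_add(2)[OF TU] op_norm_bound[OF assms(1) \<xi>] op_norm_bound[OF assms(2) \<xi>] \<xi>
    by (simp add: distrib_right)
  show "(\<lambda>\<xi>\<in>ell2 S. \<lambda>g. T \<xi> g + U \<xi> g) \<xi> \<in> ell2 S" using \<xi> ell2_add(1)[OF TU] by simp
qed (simp_all add: ell2_add(1) ell2_cmult bounded_operatorsD(3,4)[OF assms(1)]
  bounded_operatorsD(3,4)[OF assms(2)] fun_eq_iff algebra_simps)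

text \<open>No ring axioms are available for \<open>operator_algebra\<close>, so the additive
  inverse inside the difference is computed from the description of \<open>m_inv\<close> in the
  additive monoid.\<close>

lemma operator_minus:
  assumes T: "T \<in> bounded_operators S" and U: "U \<in> bounded_operators S"
  shows "T \<ominus>\<^bsub>operator_algebra S\<^esub> U = (\<lambda>\<xi>\<in>ell2 S. \<lambda>g. T \<xi> g - U \<xi> g)"
proof -
  let ?Z = "(\<lambda>\<xi>\<in>ell2 S. \<lambda>g. 0) :: ('a \<Rightarrow> complex) \<Rightarrow> ('a \<Rightarrow> complex)"
  let ?N = "\<lambda>\<xi>\<in>ell2 S. \<lambda>g. - U \<xi> g"
  have Z: "?Z \<in> bounded_operators S"
    by (rule bounded_operatorsI[where K = 0]) (auto simp: ell2_zero ell2_norm_zero ell2_add ell2_cmult)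
  have "(\<lambda>\<xi>\<in>ell2 S. \<lambda>g. ?Z \<xi> g - U \<xi> g) \<in> bounded_operators S"
    by (rule operator_diff_closed[OF Z U])
  also have "(\<lambda>\<xi>\<in>ell2 S. \<lambda>g. ?Z \<xi> g - U \<xi> g) = ?N" by (auto simp: restrict_def)
  finally have N: "?N \<in> bounded_operators S" .
  have "\<ominus>\<^bsub>operator_algebra S\<^esub> U = ?N"
    unfolding a_inv_def m_inv_def
  proof (rule the_equality)
    fix V assume V: "V \<in> carrier (add_monoid (operator_algebra S)) \<and>
      U \<otimes>\<^bsub>add_monoid (operator_algebra S)\<^esub> V = \<one>\<^bsub>add_monoid (operator_algebra S)\<^esub> \<and>
      V \<otimes>\<^bsub>add_monoid (operator_algebra S)\<^esub> U = \<one>\<^bsub>add_monoid (operator_algebra S)\<^esub>"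
    then have *: "(\<lambda>\<xi>\<in>ell2 S. \<lambda>g. U \<xi> g + V \<xi> g) = ?Z" and V': "V \<in> bounded_operators S"
      by (simp_all add: operator_algebra_def)
    have "U \<xi> g + V \<xi> g = 0" if "\<xi> \<in> ell2 S" for \<xi> g
      using fun_cong[OF fun_cong[OF *, of \<xi>], of g] that by simp
    then show "V = ?N"
      by (intro operator_eqI[OF V' N]) (auto simp: eq_neg_iff_add_eq_0 add.commute)
  qed (use N in \<open>auto simp: operator_algebra_def restrict_def\<close>)
  then have "T \<ominus>\<^bsub>operator_algebra S\<^esub> U = T \<oplus>\<^bsub>operator_algebra S\<^esub> ?N" by (simp only: a_minus_def)
  then show ?thesis by (auto simp: operator_algebra_def fun_eq_iff)
qed

lemma op_norm_minus_bound:
  assumes "T \<in> bounded_operators S" "U \<in> bounded_operators S" "\<xi> \<in> ell2 S"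
  shows "ell2_norm S (\<lambda>g. T \<xi> g - U \<xi> g) \<le> op_norm S (T \<ominus>\<^bsub>operator_algebra S\<^esub> U) * ell2_norm S \<xi>"
  using op_norm_bound[OF operator_diff_closed[OF assms(1,2)] assms(3)] assms(3)
  by (simp add: operator_minus[OF assms(1,2)])

lemma op_norm_minus_leI:
  assumes "T \<in> bounded_operators S" "U \<in> bounded_operators S" "0 \<le> K"
    "\<And>\<xi>. \<xi> \<in> ell2 S \<Longrightarrow> ell2_norm S (\<lambda>g. T \<xi> g - U \<xi> g) \<le> K * ell2_norm S \<xi>"
  shows "op_norm S (T \<ominus>\<^bsub>operator_algebra S\<^esub> U) \<le> K"
  unfolding operator_minus[OF assms(1,2)] by (rule op_norm_leI) (use assms in auto)

lemma op_norm_minus_nonneg: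
  assumes "T \<in> bounded_operators S" "U \<in> bounded_operators S"
  shows "0 \<le> op_norm S (T \<ominus>\<^bsub>operator_algebra S\<^esub> U)"
  by (simp add: operator_minus[OF assms] op_norm_nonneg operator_diff_closed assms)

text \<open>Each coordinate of \<open>T n \<xi>\<close> is Cauchy, and the limit operator is defined
  coordinatewise. A Fatou argument, passing to the limit on finite sets of coordinates, turns the
  Cauchy condition into norm estimates for \<open>T n - U\<close>, from which both boundedness of
  \<open>U\<close> and convergence follow.\<close>

lemma bounded_operators_complete:
  fixes T :: "nat \<Rightarrow> ('g \<Rightarrow> complex) \<Rightarrow> ('g \<Rightarrow> complex)"
  assumes T: "\<And>n. T n \<in> bounded_operators S"
    and C: "\<And>e. 0 < e \<Longrightarrow> \<exists>N. \<forall>m\<ge>N. \<forall>n\<ge>N. op_norm S (T m \<ominus>\<^bsub>operator_algebra S\<^esub> T n) < e"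
  shows "\<exists>U\<in>bounded_operators S. (\<lambda>n. op_norm S (T n \<ominus>\<^bsub>operator_algebra S\<^esub> U)) \<longlonglongrightarrow> 0"
proof -
  have "Cauchy (\<lambda>n. T n \<xi> g)" if \<xi>: "\<xi> \<in> ell2 S" for \<xi> g
  proof (rule metric_CauchyI)
    fix e :: real assume "0 < e"
    \<comment> \<open>The summand 1 keeps the denominator positive for vectors of norm 0.\<close>
    then have "0 < e / (ell2_norm S \<xi> + 1)"
      by (intro divide_pos_pos add_nonneg_pos ell2_norm_nonneg) simp_all
    from C[OF this] obtain N where N: "\<And>m n. m \<ge> N \<Longrightarrow> n \<ge> N \<Longrightarrow>
      op_norm S (T m \<ominus>\<^bsub>operator_algebra S\<^esub> T n) < e / (ell2_norm S \<xi> + 1)" by blast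
    have "dist (T m \<xi> g) (T n \<xi> g) < e" if "m \<ge> N" "n \<ge> N" for m n
    proof -
      have "dist (T m \<xi> g) (T n \<xi> g) \<le> ell2_norm S (\<lambda>g. T m \<xi> g - T n \<xi> g)"
        unfolding dist_norm
        by (intro cmod_le_ell2_norm ell2_diff(1) bounded_operatorsD(2)[OF T \<xi>])
      also have "\<dots> \<le> op_norm S (T m \<ominus>\<^bsub>operator_algebra S\<^esub> T n) * ell2_norm S \<xi>"
        by (rule op_norm_minus_bound[OF T T \<xi>])
      also have "\<dots> \<le> op_norm S (T m \<ominus>\<^bsub>operator_algebra S\<^esub> T n) * (ell2_norm S \<xi> + 1)"
        by (intro mult_left_mono op_norm_minus_nonneg T) simp
      also have "\<dots> < e / (ell2_norm S \<xi> + 1) * (ell2_norm S \<xi> + 1)"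
        by (intro mult_strict_right_mono N that) (use ell2_norm_nonneg[of S \<xi>] in linarith)
      finally show ?thesis using ell2_norm_nonneg[of S \<xi>] by (simp split: if_splits)
    qed
    then show "\<exists>M. \<forall>m\<ge>M. \<forall>n\<ge>M. dist (T m \<xi> g) (T n \<xi> g) < e" by blast
  qed
  then have lim: "(\<lambda>n. T n \<xi> g) \<longlonglongrightarrow> lim (\<lambda>n. T n \<xi> g)" if "\<xi> \<in> ell2 S" for \<xi> g
    using that by (metis Cauchy_convergent convergent_LIMSEQ_iff)
  define U where "U = (\<lambda>\<xi>\<in>ell2 S. \<lambda>g. lim (\<lambda>n. T n \<xi> g))"
  have limU: "(\<lambda>n. T n \<xi> g) \<longlonglongrightarrow> U \<xi> g" if "\<xi> \<in> ell2 S" for \<xi> g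
    using lim[OF that] that by (simp add: U_def)
  have fatou: "\<exists>N. \<forall>n\<ge>N. \<forall>\<xi>\<in>ell2 S. (\<lambda>g. T n \<xi> g - U \<xi> g) \<in> ell2 S \<and>
      ell2_norm S (\<lambda>g. T n \<xi> g - U \<xi> g) \<le> e * ell2_norm S \<xi>" if e: "0 < e" for e
  proof -
    from C[OF e] obtain N where N: "\<And>m n. m \<ge> N \<Longrightarrow> n \<ge> N \<Longrightarrow>
      op_norm S (T m \<ominus>\<^bsub>operator_algebra S\<^esub> T n) < e" by blast
    have "(\<lambda>g. T n \<xi> g - U \<xi> g) \<in> ell2 S \<and>
      ell2_norm S (\<lambda>g. T n \<xi> g - U \<xi> g) \<le> e * ell2_norm S \<xi>" if n: "n \<ge> N" and \<xi>: "\<xi> \<in> ell2 S" for n \<xi>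
    proof -
      have "L2_set (\<lambda>g. cmod (T n \<xi> g - U \<xi> g)) F \<le> e * ell2_norm S \<xi>" if F: "finite F" "F \<subseteq> S" for F
      proof (rule LIMSEQ_le_const2)
        show "(\<lambda>m. L2_set (\<lambda>g. cmod (T n \<xi> g - T m \<xi> g)) F) \<longlonglongrightarrow> L2_set (\<lambda>g. cmod (T n \<xi> g - U \<xi> g)) F"
          unfolding L2_set_def by (intro tendsto_intros limU \<xi>)
        have "L2_set (\<lambda>g. cmod (T n \<xi> g - T m \<xi> g)) F \<le> e * ell2_norm S \<xi>" if m: "m \<ge> N" for m
        proof -
          have "L2_set (\<lambda>g. cmod (T n \<xi> g - T m \<xi> g)) F \<le> ell2_norm S (\<lambda>g. T n \<xi> g - T m \<xi> g)"
            by (intro L2_set_le_ell2_norm[OF _ F] ell2_diff(1) bounded_operatorsD(2)[OF T \<xi>])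
          also have "\<dots> \<le> op_norm S (T n \<ominus>\<^bsub>operator_algebra S\<^esub> T m) * ell2_norm S \<xi>"
            by (rule op_norm_minus_bound[OF T T \<xi>])
          also have "\<dots> \<le> e * ell2_norm S \<xi>"
            by (intro mult_right_mono ell2_norm_nonneg less_imp_le N n m)
          finally show ?thesis .
        qed
        then show "\<exists>M. \<forall>m\<ge>M. L2_set (\<lambda>g. cmod (T n \<xi> g - T m \<xi> g)) F \<le> e * ell2_norm S \<xi>" by blast
      qed
      moreover have "T n \<xi> g - U \<xi> g = 0" if "g \<notin> S" for g
        using limU[OF \<xi>, of g] that ell2_outside[OF bounded_operatorsD(2)[OF T \<xi>]]
        by (simp add: LIMSEQ_const_iff)
      ultimately show ?thesis by (intro conjI ell2I) auto
    qed
    then show ?thesis by blast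
  qed
  \<comment> \<open>The case of error 1 writes \<open>U \<xi>\<close> as \<open>T N \<xi>\<close>
    minus a vector of norm at most that of \<xi>, whence the bound
    \<open>op_norm S (T N) + 1\<close>.\<close>
  from fatou[of 1] obtain N where N: "\<And>\<xi>. \<xi> \<in> ell2 S \<Longrightarrow> (\<lambda>g. T N \<xi> g - U \<xi> g) \<in> ell2 S \<and>
      ell2_norm S (\<lambda>g. T N \<xi> g - U \<xi> g) \<le> ell2_norm S \<xi>" by auto
  have U: "U \<in> bounded_operators S"
  proof (rule bounded_operatorsI)
    show "U \<in> extensional (ell2 S)" by (simp add: U_def)
    fix \<xi> assume \<xi>: "\<xi> \<in> ell2 S"
    have TN: "T N \<xi> \<in> ell2 S" by (rule bounded_operatorsD(2)[OF T \<xi>])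
    from ell2_diff[OF TN N[OF \<xi>, THEN conjunct1]] N[OF \<xi>] op_norm_bound[OF T \<xi>, of N]
    show "U \<xi> \<in> ell2 S" "ell2_norm S (U \<xi>) \<le> (op_norm S (T N) + 1) * ell2_norm S \<xi>"
      by (auto simp: algebra_simps)
    show "U (\<lambda>g. c * \<xi> g) = (\<lambda>g. c * U \<xi> g)" for c
    proof
      fix g
      have "(\<lambda>n. T n (\<lambda>g. c * \<xi> g) g) \<longlonglongrightarrow> c * U \<xi> g"
        using tendsto_mult_left[OF limU[OF \<xi>]] by (simp add: bounded_operatorsD(4)[OF T \<xi>])
      with limU[OF ell2_cmult[OF \<xi>]] show "U (\<lambda>g. c * \<xi> g) g = c * U \<xi> g"
        by (rule LIMSEQ_unique)
    qed
    fix \<eta> assume \<eta>: "\<eta> \<in> ell2 S"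
    show "U (\<lambda>g. \<xi> g + \<eta> g) = (\<lambda>g. U \<xi> g + U \<eta> g)"
    proof
      fix g
      have "(\<lambda>n. T n (\<lambda>g. \<xi> g + \<eta> g) g) \<longlonglongrightarrow> U \<xi> g + U \<eta> g"
        using tendsto_add[OF limU[OF \<xi>] limU[OF \<eta>]] by (simp add: bounded_operatorsD(3)[OF T \<xi> \<eta>])
      with limU[OF ell2_add(1)[OF \<xi> \<eta>]] show "U (\<lambda>g. \<xi> g + \<eta> g) g = U \<xi> g + U \<eta> g"
        by (rule LIMSEQ_unique)
    qed
  qed
  moreover have "(\<lambda>n. op_norm S (T n \<ominus>\<^bsub>operator_algebra S\<^esub> U)) \<longlonglongrightarrow> 0"
  proof (rule metric_LIMSEQ_I)
    fix e :: real assume e: "0 < e"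
    from fatou[of "e/2"] e obtain N where "\<And>n \<xi>. n \<ge> N \<Longrightarrow> \<xi> \<in> ell2 S \<Longrightarrow>
      ell2_norm S (\<lambda>g. T n \<xi> g - U \<xi> g) \<le> e / 2 * ell2_norm S \<xi>" by auto
    then have "op_norm S (T n \<ominus>\<^bsub>operator_algebra S\<^esub> U) \<le> e / 2" if "n \<ge> N" for n
      using that e by (intro op_norm_minus_leI T U) auto
    then show "\<exists>N. \<forall>n\<ge>N. dist (op_norm S (T n \<ominus>\<^bsub>operator_algebra S\<^esub> U)) 0 < e"
      using e op_norm_minus_nonneg[OF T U] by (intro exI[of _ N]) (fastforce simp: dist_norm)
  qed
  ultimately show ?thesis by blast
qed

section \<open>Metric properties of C*-algebras\<close>

context cstar_algebra
begin

lemma carrier_closed [simp, intro]: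
  "\<zero>\<^bsub>A\<^esub> \<in> carrier A" "\<one>\<^bsub>A\<^esub> \<in> carrier A"
  "x \<in> carrier A \<Longrightarrow> y \<in> carrier A \<Longrightarrow> x \<oplus>\<^bsub>A\<^esub> y \<in> carrier A"
  "x \<in> carrier A \<Longrightarrow> y \<in> carrier A \<Longrightarrow> x \<otimes>\<^bsub>A\<^esub> y \<in> carrier A"
  "x \<in> carrier A \<Longrightarrow> y \<in> carrier A \<Longrightarrow> x \<ominus>\<^bsub>A\<^esub> y \<in> carrier A"
  "x \<in> carrier A \<Longrightarrow> c \<odot>\<^bsub>A\<^esub> x \<in> carrier A"
  "x \<in> carrier A \<Longrightarrow> adj A x \<in> carrier A"
proof -
  interpret A: ring A by (rule ring_axioms)
  show "\<zero>\<^bsub>A\<^esub> \<in> carrier A" "\<one>\<^bsub>A\<^esub> \<in> carrier A"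
    "x \<in> carrier A \<Longrightarrow> y \<in> carrier A \<Longrightarrow> x \<oplus>\<^bsub>A\<^esub> y \<in> carrier A"
    "x \<in> carrier A \<Longrightarrow> y \<in> carrier A \<Longrightarrow> x \<otimes>\<^bsub>A\<^esub> y \<in> carrier A"
    "x \<in> carrier A \<Longrightarrow> y \<in> carrier A \<Longrightarrow> x \<ominus>\<^bsub>A\<^esub> y \<in> carrier A"
    by (auto intro: abelian_group.minus_closed[OF ring.axioms(1)[OF ring_axioms]])
  show "x \<in> carrier A \<Longrightarrow> c \<odot>\<^bsub>A\<^esub> x \<in> carrier A"
    using smult_closed[of c x] by (simp add: class_ring_simps)
qed (rule adj_closed)

lemma smult_simps:
  assumes "x \<in> carrier A"
  shows "(a + b) \<odot>\<^bsub>A\<^esub> x = (a \<odot>\<^bsub>A\<^esub> x) \<oplus>\<^bsub>A\<^esub> (b \<odot>\<^bsub>A\<^esub> x)" "1 \<odot>\<^bsub>A\<^esub> x = x"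
    "(a * b) \<odot>\<^bsub>A\<^esub> x = a \<odot>\<^bsub>A\<^esub> (b \<odot>\<^bsub>A\<^esub> x)" "0 \<odot>\<^bsub>A\<^esub> x = \<zero>\<^bsub>A\<^esub>"
    "\<ominus>\<^bsub>A\<^esub> x = (-1) \<odot>\<^bsub>A\<^esub> x"
proof -
  show 1: "(a + b) \<odot>\<^bsub>A\<^esub> x = (a \<odot>\<^bsub>A\<^esub> x) \<oplus>\<^bsub>A\<^esub> (b \<odot>\<^bsub>A\<^esub> x)" for a b
    using smult_l_distr[of a b x] assms by (simp add: class_ring_simps)
  show 2: "1 \<odot>\<^bsub>A\<^esub> x = x" using smult_one[of x] assms by (simp add: class_ring_simps)
  show "(a * b) \<odot>\<^bsub>A\<^esub> x = a \<odot>\<^bsub>A\<^esub> (b \<odot>\<^bsub>A\<^esub> x)"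
    using smult_assoc1[of a b x] assms by (simp add: class_ring_simps)
  show 3: "0 \<odot>\<^bsub>A\<^esub> x = \<zero>\<^bsub>A\<^esub>" using smult_l_null[of x] assms by (simp add: class_ring_simps)
  interpret A: ring A by (rule ring_axioms)
  have "((-1) \<odot>\<^bsub>A\<^esub> x) \<oplus>\<^bsub>A\<^esub> x = \<zero>\<^bsub>A\<^esub>" using 1[of "-1" 1] 2 3 by simp
  then show "\<ominus>\<^bsub>A\<^esub> x = (-1) \<odot>\<^bsub>A\<^esub> x"
    by (rule abelian_group.minus_equality[OF ring.axioms(1)[OF ring_axioms]]) (use assms in auto)
qed

lemma minus_identities:
  assumes "x \<in> carrier A" "y \<in> carrier A" "x' \<in> carrier A" "y' \<in> carrier A"
  shows "(x \<ominus>\<^bsub>A\<^esub> y) \<oplus>\<^bsub>A\<^esub> (y \<ominus>\<^bsub>A\<^esub> y') = x \<ominus>\<^bsub>A\<^esub> y'"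
    "\<ominus>\<^bsub>A\<^esub> (x \<ominus>\<^bsub>A\<^esub> y) = y \<ominus>\<^bsub>A\<^esub> x"
    "(x \<oplus>\<^bsub>A\<^esub> y) \<ominus>\<^bsub>A\<^esub> (x' \<oplus>\<^bsub>A\<^esub> y') = (x \<ominus>\<^bsub>A\<^esub> x') \<oplus>\<^bsub>A\<^esub> (y \<ominus>\<^bsub>A\<^esub> y')"
    "(x \<otimes>\<^bsub>A\<^esub> y) \<ominus>\<^bsub>A\<^esub> (x' \<otimes>\<^bsub>A\<^esub> y') = (x \<otimes>\<^bsub>A\<^esub> (y \<ominus>\<^bsub>A\<^esub> y')) \<oplus>\<^bsub>A\<^esub> ((x \<ominus>\<^bsub>A\<^esub> x') \<otimes>\<^bsub>A\<^esub> y')"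
    "(x \<ominus>\<^bsub>A\<^esub> y) \<oplus>\<^bsub>A\<^esub> y = x"
    "(x \<oplus>\<^bsub>A\<^esub> y) \<ominus>\<^bsub>A\<^esub> (x \<oplus>\<^bsub>A\<^esub> y') = y \<ominus>\<^bsub>A\<^esub> y'"
    "(x \<otimes>\<^bsub>A\<^esub> y) \<ominus>\<^bsub>A\<^esub> (x \<otimes>\<^bsub>A\<^esub> y') = x \<otimes>\<^bsub>A\<^esub> (y \<ominus>\<^bsub>A\<^esub> y')"
    "x \<ominus>\<^bsub>A\<^esub> y = \<zero>\<^bsub>A\<^esub> \<longleftrightarrow> x = y" "x \<ominus>\<^bsub>A\<^esub> x = \<zero>\<^bsub>A\<^esub>"
    "c \<odot>\<^bsub>A\<^esub> x \<ominus>\<^bsub>A\<^esub> c \<odot>\<^bsub>A\<^esub> y = c \<odot>\<^bsub>A\<^esub> (x \<ominus>\<^bsub>A\<^esub> y)"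
    "adj A x \<ominus>\<^bsub>A\<^esub> adj A y = adj A (x \<ominus>\<^bsub>A\<^esub> y)"
proof -
  interpret A: ring A by (rule ring_axioms)
  show "(x \<ominus>\<^bsub>A\<^esub> y) \<oplus>\<^bsub>A\<^esub> (y \<ominus>\<^bsub>A\<^esub> y') = x \<ominus>\<^bsub>A\<^esub> y'"
    "\<ominus>\<^bsub>A\<^esub> (x \<ominus>\<^bsub>A\<^esub> y) = y \<ominus>\<^bsub>A\<^esub> x"
    "(x \<oplus>\<^bsub>A\<^esub> y) \<ominus>\<^bsub>A\<^esub> (x' \<oplus>\<^bsub>A\<^esub> y') = (x \<ominus>\<^bsub>A\<^esub> x') \<oplus>\<^bsub>A\<^esub> (y \<ominus>\<^bsub>A\<^esub> y')"
    "(x \<otimes>\<^bsub>A\<^esub> y) \<ominus>\<^bsub>A\<^esub> (x' \<otimes>\<^bsub>A\<^esub> y') = (x \<otimes>\<^bsub>A\<^esub> (y \<ominus>\<^bsub>A\<^esub> y')) \<oplus>\<^bsub>A\<^esub> ((x \<ominus>\<^bsub>A\<^esub> x') \<otimes>\<^bsub>A\<^esub> y')"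
    "(x \<ominus>\<^bsub>A\<^esub> y) \<oplus>\<^bsub>A\<^esub> y = x"
    "(x \<oplus>\<^bsub>A\<^esub> y) \<ominus>\<^bsub>A\<^esub> (x \<oplus>\<^bsub>A\<^esub> y') = y \<ominus>\<^bsub>A\<^esub> y'"
    "(x \<otimes>\<^bsub>A\<^esub> y) \<ominus>\<^bsub>A\<^esub> (x \<otimes>\<^bsub>A\<^esub> y') = x \<otimes>\<^bsub>A\<^esub> (y \<ominus>\<^bsub>A\<^esub> y')"
    "x \<ominus>\<^bsub>A\<^esub> x = \<zero>\<^bsub>A\<^esub>"
    using assms by algebra+
  show "x \<ominus>\<^bsub>A\<^esub> y = \<zero>\<^bsub>A\<^esub> \<longleftrightarrow> x = y" using assms by simp
  show "c \<odot>\<^bsub>A\<^esub> x \<ominus>\<^bsub>A\<^esub> c \<odot>\<^bsub>A\<^esub> y = c \<odot>\<^bsub>A\<^esub> (x \<ominus>\<^bsub>A\<^esub> y)"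
    using assms smult_r_distr[of c x "(-1) \<odot>\<^bsub>A\<^esub> y"] smult_simps(3)[of y c "-1"] smult_simps(3)[of y "-1" c]
    by (simp add: a_minus_def smult_simps(5) class_ring_simps)
  show "adj A x \<ominus>\<^bsub>A\<^esub> adj A y = adj A (x \<ominus>\<^bsub>A\<^esub> y)"
    using assms by (simp add: a_minus_def smult_simps(5) adj_add adj_smult)
qed

lemma nrm_zero: "nrm A \<zero>\<^bsub>A\<^esub> = 0"
  by (simp add: nrm_eq_0_iff)

lemma nrm_minus_commute:
  assumes "x \<in> carrier A" "y \<in> carrier A"
  shows "nrm A (x \<ominus>\<^bsub>A\<^esub> y) = nrm A (y \<ominus>\<^bsub>A\<^esub> x)"
  using nrm_smult[of "x \<ominus>\<^bsub>A\<^esub> y" "-1"] minus_identities(2)[OF assms assms] smult_simps(5)[of "x \<ominus>\<^bsub>A\<^esub> y"] assms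
  by simp

lemma nrm_minus_triangle:
  assumes "x \<in> carrier A" "y \<in> carrier A" "z \<in> carrier A"
  shows "nrm A (x \<ominus>\<^bsub>A\<^esub> z) \<le> nrm A (x \<ominus>\<^bsub>A\<^esub> y) + nrm A (y \<ominus>\<^bsub>A\<^esub> z)"
  using nrm_triangle[of "x \<ominus>\<^bsub>A\<^esub> y" "y \<ominus>\<^bsub>A\<^esub> z"] minus_identities(1)[of x y x z] assms by simp

lemma nrm_diff_le:
  assumes "x \<in> carrier A" "y \<in> carrier A"
  shows "\<bar>nrm A x - nrm A y\<bar> \<le> nrm A (x \<ominus>\<^bsub>A\<^esub> y)"
  using nrm_triangle[of "x \<ominus>\<^bsub>A\<^esub> y" y] nrm_triangle[of "y \<ominus>\<^bsub>A\<^esub> x" x]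
    minus_identities(5)[of x y x x] minus_identities(5)[of y x x x] nrm_minus_commute[of x y] assms
  by simp

text \<open>The C*-identity and submultiplicativity bound the square of \<open>nrm A y\<close> by
  \<open>nrm A (adj A y) * nrm A y\<close>; dividing, and applying this to \<open>adj A x\<close> as
  well, gives both inequalities.\<close>

lemma nrm_adj:
  assumes "x \<in> carrier A"
  shows "nrm A (adj A x) = nrm A x"
proof -
  have *: "nrm A y \<le> nrm A (adj A y)" if "y \<in> carrier A" for y
  proof (cases "nrm A y = 0")
    case False
    then have "0 < nrm A y" using nrm_nonneg[OF that] by simp
    moreover have "nrm A y * nrm A y \<le> nrm A (adj A y) * nrm A y"
      using cstar_identity[OF that] nrm_mult[of "adj A y" y] that by (simp add: power2_eq_square)
    ultimately show ?thesis by simp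
  qed (use nrm_nonneg[of "adj A y"] that in simp)
  show ?thesis using *[of x] *[of "adj A x"] assms by (simp add: adj_adj)
qed

lemma minus_tendsto_imp_nrm_tendsto:
  assumes "\<And>k. s k \<in> carrier A" "x \<in> carrier A" "((\<lambda>k. nrm A (s k \<ominus>\<^bsub>A\<^esub> x)) \<longlongrightarrow> 0) F"
  shows "((\<lambda>k. nrm A (s k)) \<longlongrightarrow> nrm A x) F"
proof (rule Lim_transform2[OF tendsto_const])
  show "((\<lambda>k. nrm A x - nrm A (s k)) \<longlongrightarrow> 0) F"
    by (rule Lim_null_comparison[OF _ assms(3)])
      (use nrm_diff_le[OF assms(2,1)] nrm_minus_commute[OF assms(2,1)] in auto)
qed

lemma limit_unique:
  assumes "\<And>k :: nat. s k \<in> carrier A" "x \<in> carrier A" "y \<in> carrier A"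
    "(\<lambda>k. nrm A (s k \<ominus>\<^bsub>A\<^esub> x)) \<longlonglongrightarrow> 0" "(\<lambda>k. nrm A (s k \<ominus>\<^bsub>A\<^esub> y)) \<longlonglongrightarrow> 0"
  shows "x = y"
proof -
  have "nrm A (x \<ominus>\<^bsub>A\<^esub> y) \<le> 0"
  proof (rule LIMSEQ_le_const)
    show "(\<lambda>k. nrm A (s k \<ominus>\<^bsub>A\<^esub> x) + nrm A (s k \<ominus>\<^bsub>A\<^esub> y)) \<longlonglongrightarrow> 0"
      using tendsto_add[OF assms(4,5)] by simp
    show "\<exists>N. \<forall>n\<ge>N. nrm A (x \<ominus>\<^bsub>A\<^esub> y) \<le> nrm A (s n \<ominus>\<^bsub>A\<^esub> x) + nrm A (s n \<ominus>\<^bsub>A\<^esub> y)"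
      using nrm_minus_triangle[OF assms(2,1,3)] nrm_minus_commute[OF assms(2,1)] by auto
  qed
  then have "nrm A (x \<ominus>\<^bsub>A\<^esub> y) = 0" using nrm_nonneg[of "x \<ominus>\<^bsub>A\<^esub> y"] assms(2,3) by simp
  then show ?thesis
    using nrm_eq_0_iff[of "x \<ominus>\<^bsub>A\<^esub> y"] minus_identities(8)[OF assms(2,3,2,3)] assms(2,3) by simp
qed

lemma limit_add:
  assumes "\<And>k :: nat. s k \<in> carrier A" "\<And>k. t k \<in> carrier A" "x \<in> carrier A" "y \<in> carrier A"
    "(\<lambda>k. nrm A (s k \<ominus>\<^bsub>A\<^esub> x)) \<longlonglongrightarrow> 0" "(\<lambda>k. nrm A (t k \<ominus>\<^bsub>A\<^esub> y)) \<longlonglongrightarrow> 0"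
  shows "(\<lambda>k. nrm A ((s k \<oplus>\<^bsub>A\<^esub> t k) \<ominus>\<^bsub>A\<^esub> (x \<oplus>\<^bsub>A\<^esub> y))) \<longlonglongrightarrow> 0"
proof (rule Lim_null_comparison)
  show "(\<lambda>k. nrm A (s k \<ominus>\<^bsub>A\<^esub> x) + nrm A (t k \<ominus>\<^bsub>A\<^esub> y)) \<longlonglongrightarrow> 0"
    using tendsto_add[OF assms(5,6)] by simp
  show "\<forall>\<^sub>F k in sequentially. norm (nrm A ((s k \<oplus>\<^bsub>A\<^esub> t k) \<ominus>\<^bsub>A\<^esub> (x \<oplus>\<^bsub>A\<^esub> y)))
      \<le> nrm A (s k \<ominus>\<^bsub>A\<^esub> x) + nrm A (t k \<ominus>\<^bsub>A\<^esub> y)"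
    using assms(1-4) by (simp add: minus_identities(3) nrm_nonneg nrm_triangle)
qed

lemma limit_mult:
  assumes s: "\<And>k :: nat. s k \<in> carrier A" "\<And>k. t k \<in> carrier A" "x \<in> carrier A" "y \<in> carrier A"
    and lim: "(\<lambda>k. nrm A (s k \<ominus>\<^bsub>A\<^esub> x)) \<longlonglongrightarrow> 0" "(\<lambda>k. nrm A (t k \<ominus>\<^bsub>A\<^esub> y)) \<longlonglongrightarrow> 0"
  shows "(\<lambda>k. nrm A ((s k \<otimes>\<^bsub>A\<^esub> t k) \<ominus>\<^bsub>A\<^esub> (x \<otimes>\<^bsub>A\<^esub> y))) \<longlonglongrightarrow> 0"
proof (rule Lim_null_comparison)
  show "(\<lambda>k. nrm A (s k) * nrm A (t k \<ominus>\<^bsub>A\<^esub> y) + nrm A (s k \<ominus>\<^bsub>A\<^esub> x) * nrm A y) \<longlonglongrightarrow> 0"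
    using tendsto_add[OF tendsto_mult[OF minus_tendsto_imp_nrm_tendsto[OF s(1,3) lim(1)] lim(2)]
      tendsto_mult[OF lim(1) tendsto_const[of "nrm A y"]]] by simp
  have "nrm A ((s k \<otimes>\<^bsub>A\<^esub> t k) \<ominus>\<^bsub>A\<^esub> (x \<otimes>\<^bsub>A\<^esub> y))
      \<le> nrm A (s k) * nrm A (t k \<ominus>\<^bsub>A\<^esub> y) + nrm A (s k \<ominus>\<^bsub>A\<^esub> x) * nrm A y" for k
    unfolding minus_identities(4)[OF s]
    by (rule order_trans[OF nrm_triangle add_mono[OF nrm_mult nrm_mult]]) (use s in auto)
  then show "\<forall>\<^sub>F k in sequentially. norm (nrm A ((s k \<otimes>\<^bsub>A\<^esub> t k) \<ominus>\<^bsub>A\<^esub> (x \<otimes>\<^bsub>A\<^esub> y)))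
      \<le> nrm A (s k) * nrm A (t k \<ominus>\<^bsub>A\<^esub> y) + nrm A (s k \<ominus>\<^bsub>A\<^esub> x) * nrm A y"
    using s by (simp add: nrm_nonneg)
qed

lemma limit_smult:
  assumes "\<And>k :: nat. s k \<in> carrier A" "x \<in> carrier A" "(\<lambda>k. nrm A (s k \<ominus>\<^bsub>A\<^esub> x)) \<longlonglongrightarrow> 0"
  shows "(\<lambda>k. nrm A ((c \<odot>\<^bsub>A\<^esub> s k) \<ominus>\<^bsub>A\<^esub> (c \<odot>\<^bsub>A\<^esub> x))) \<longlonglongrightarrow> 0"
  using tendsto_mult[OF tendsto_const[of "cmod c"] assms(3)] assms(1,2)
  by (simp add: minus_identities(10)[OF _ _ assms(2,2)] nrm_smult)

lemma limit_adj:
  assumes "\<And>k :: nat. s k \<in> carrier A" "x \<in> carrier A" "(\<lambda>k. nrm A (s k \<ominus>\<^bsub>A\<^esub> x)) \<longlonglongrightarrow> 0"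
  shows "(\<lambda>k. nrm A (adj A (s k) \<ominus>\<^bsub>A\<^esub> adj A x)) \<longlonglongrightarrow> 0"
  using assms by (simp add: minus_identities(11)[OF _ _ assms(2,2)] nrm_adj)

lemma limit_const: "x \<in> carrier A \<Longrightarrow> (\<lambda>k :: nat. nrm A (x \<ominus>\<^bsub>A\<^esub> x)) \<longlonglongrightarrow> 0"
  by (simp add: minus_identities(9)[of x x x x] nrm_zero)

lemma norm_closure_sequence:
  assumes "S \<subseteq> carrier A" "x \<in> norm_closure A S"
  obtains s where "\<And>k :: nat. s k \<in> S" "(\<lambda>k. nrm A (s k \<ominus>\<^bsub>A\<^esub> x)) \<longlonglongrightarrow> 0"
proof -
  have x: "x \<in> carrier A" using assms(2) by (simp add: norm_closure_def)
  have "\<exists>y\<in>S. nrm A (x \<ominus>\<^bsub>A\<^esub> y) < inverse (real (Suc k))" for k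
    using assms(2) by (simp add: norm_closure_def)
  then obtain s where s: "\<And>k. s k \<in> S" "\<And>k. nrm A (x \<ominus>\<^bsub>A\<^esub> s k) < inverse (real (Suc k))"
    by metis
  have "(\<lambda>k. nrm A (s k \<ominus>\<^bsub>A\<^esub> x)) \<longlonglongrightarrow> 0"
  proof (rule Lim_null_comparison[OF _ LIMSEQ_inverse_real_of_nat])
    have "nrm A (s k \<ominus>\<^bsub>A\<^esub> x) \<le> inverse (real (Suc k))" for k
      using s(2)[of k] nrm_minus_commute[OF x, of "s k"] s(1)[of k] assms(1) by force
    moreover have "0 \<le> nrm A (s k \<ominus>\<^bsub>A\<^esub> x)" for k using s(1)[of k] assms(1) x by (intro nrm_nonneg) auto
    ultimately show "\<forall>\<^sub>F k in sequentially. norm (nrm A (s k \<ominus>\<^bsub>A\<^esub> x)) \<le> inverse (real (Suc k))"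
      by simp
  qed
  with s(1) that show ?thesis by blast
qed

lemma norm_closureI:
  assumes "S \<subseteq> carrier A" "x \<in> carrier A" "\<And>k :: nat. s k \<in> S" "(\<lambda>k. nrm A (s k \<ominus>\<^bsub>A\<^esub> x)) \<longlonglongrightarrow> 0"
  shows "x \<in> norm_closure A S"
proof -
  have "\<exists>y\<in>S. nrm A (x \<ominus>\<^bsub>A\<^esub> y) < e" if "0 < e" for e
  proof -
    have "\<forall>\<^sub>F k in sequentially. nrm A (s k \<ominus>\<^bsub>A\<^esub> x) < e"
      using order_tendstoD(2)[OF assms(4) that] .
    then obtain k where "nrm A (s k \<ominus>\<^bsub>A\<^esub> x) < e" by (auto simp: eventually_sequentially)
    then have "nrm A (x \<ominus>\<^bsub>A\<^esub> s k) < e" using nrm_minus_commute[of x "s k"] assms(1,2) assms(3)[of k] by auto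
    then show ?thesis using assms(3) by blast
  qed
  then show ?thesis using assms(2) by (simp add: norm_closure_def)
qed

lemma norm_closure_mono:
  assumes "S \<subseteq> carrier A"
  shows "S \<subseteq> norm_closure A S"
proof
  fix x assume x: "x \<in> S"
  show "x \<in> norm_closure A S"
    by (rule norm_closureI[OF assms _ x limit_const]) (use x assms in auto)
qed

lemma norm_closure_idem:
  assumes S: "S \<subseteq> carrier A" and s: "\<And>k :: nat. s k \<in> norm_closure A S" and x: "x \<in> carrier A"
    and lim: "(\<lambda>k. nrm A (s k \<ominus>\<^bsub>A\<^esub> x)) \<longlonglongrightarrow> 0"
  shows "x \<in> norm_closure A S"
proof -
  have "\<exists>y\<in>S. nrm A (x \<ominus>\<^bsub>A\<^esub> y) < e" if e: "0 < e" for e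
  proof -
    have "\<forall>\<^sub>F k in sequentially. nrm A (s k \<ominus>\<^bsub>A\<^esub> x) < e / 2"
      using order_tendstoD(2)[OF lim, of "e/2"] e by simp
    then obtain k where k: "nrm A (s k \<ominus>\<^bsub>A\<^esub> x) < e / 2" by (auto simp: eventually_sequentially)
    obtain y where y: "y \<in> S" "nrm A (s k \<ominus>\<^bsub>A\<^esub> y) < e / 2"
      using s[of k] half_gt_zero[OF e] unfolding norm_closure_def by blast
    have c: "s k \<in> carrier A" "y \<in> carrier A" using s[of k] y S by (auto simp: norm_closure_def)
    have "nrm A (x \<ominus>\<^bsub>A\<^esub> y) < e"
      using nrm_minus_triangle[OF x c] nrm_minus_commute[OF x c(1)] k y(2) by simp
    with y show ?thesis by blast
  qed
  then show ?thesis using x by (simp add: norm_closure_def)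
qed

text \<open>If \<open>h x = 1\<close> with \<open>x\<close> of norm less than 1, then summing the geometric series gives
  \<open>z = x + x z\<close>, and applying \<open>h\<close> yields a contradiction.\<close>

lemma character_bounded:
  fixes h :: "'a \<Rightarrow> complex"
  assumes C: "C \<subseteq> carrier A"
    and C_add: "\<And>x y. x \<in> C \<Longrightarrow> y \<in> C \<Longrightarrow> x \<oplus>\<^bsub>A\<^esub> y \<in> C"
    and C_mult: "\<And>x y. x \<in> C \<Longrightarrow> y \<in> C \<Longrightarrow> x \<otimes>\<^bsub>A\<^esub> y \<in> C"
    and C_smult: "\<And>c x. x \<in> C \<Longrightarrow> c \<odot>\<^bsub>A\<^esub> x \<in> C"
    and C_closed: "\<And>s x. (\<And>k :: nat. s k \<in> C) \<Longrightarrow> x \<in> carrier A \<Longrightarrow>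
       (\<lambda>k. nrm A (s k \<ominus>\<^bsub>A\<^esub> x)) \<longlonglongrightarrow> 0 \<Longrightarrow> x \<in> C"
    and h_add: "\<And>x y. x \<in> C \<Longrightarrow> y \<in> C \<Longrightarrow> h (x \<oplus>\<^bsub>A\<^esub> y) = h x + h y"
    and h_mult: "\<And>x y. x \<in> C \<Longrightarrow> y \<in> C \<Longrightarrow> h (x \<otimes>\<^bsub>A\<^esub> y) = h x * h y"
    and h_smult: "\<And>c x. x \<in> C \<Longrightarrow> h (c \<odot>\<^bsub>A\<^esub> x) = c * h x"
    and x: "x \<in> C"
  shows "cmod (h x) \<le> nrm A x"
proof (rule ccontr)
  assume "\<not> cmod (h x) \<le> nrm A x"
  then have less: "nrm A x < cmod (h x)" by simp
  have xA: "x \<in> carrier A" using x C by auto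
  have hx: "h x \<noteq> 0" using less nrm_nonneg[OF xA] by auto
  define y where "y = (1 / h x) \<odot>\<^bsub>A\<^esub> x"
  define r where "r = nrm A y"
  have y: "y \<in> C" "h y = 1" using x hx by (auto simp: y_def C_smult h_smult)
  have yA: "y \<in> carrier A" using y C by auto
  have r1: "r < 1" using less hx xA by (simp add: r_def y_def nrm_smult norm_divide)
  have r0: "0 \<le> r" using yA by (simp add: r_def nrm_nonneg)
  define u where "u = rec_nat y (\<lambda>_ z. y \<oplus>\<^bsub>A\<^esub> (y \<otimes>\<^bsub>A\<^esub> z))"
  have u0: "u 0 = y" and uS: "u (Suc n) = y \<oplus>\<^bsub>A\<^esub> (y \<otimes>\<^bsub>A\<^esub> u n)" for n by (simp_all add: u_def)
  have uC: "u n \<in> C" for n by (induction n) (auto simp: u0 uS y C_add C_mult)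
  then have uA: "u n \<in> carrier A" for n using C by auto
  have bd: "nrm A (u n) \<le> r / (1 - r)" for n
  proof (induction n)
    case 0
    have "r * (1 - r) \<le> r" using r0 r1 by (simp add: mult_left_le)
    then show ?case using r1 by (simp add: u0 r_def[symmetric] pos_le_divide_eq)
  next
    case (Suc n)
    have "nrm A (u (Suc n)) \<le> r + r * nrm A (u n)"
      unfolding uS r_def
      by (rule order_trans[OF nrm_triangle add_left_mono[OF nrm_mult]]) (use yA uA in auto)
    also have "\<dots> \<le> r + r * (r / (1 - r))" using Suc r0 by (intro add_left_mono mult_left_mono)
    also have "\<dots> = r / (1 - r)" using r1 by (simp add: field_simps)
    finally show ?case .
  qed
  \<comment> \<open>The factor 2 comes from the start, where \<open>u k\<close> and
    \<open>u 0\<close> are each bounded by \<open>r / (1 - r)\<close>; every induction step pulls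
    out one factor \<open>y\<close> from the difference.\<close>
  have step: "nrm A (u (n + k) \<ominus>\<^bsub>A\<^esub> u n) \<le> r ^ n * (2 * (r / (1 - r)))" for n k
  proof (induction n)
    case 0
    have "nrm A (u k \<ominus>\<^bsub>A\<^esub> u 0) \<le> nrm A (u k) + nrm A (u 0)"
      using nrm_triangle[of "u k" "(-1) \<odot>\<^bsub>A\<^esub> u 0"] uA by (simp add: a_minus_def smult_simps(5) nrm_smult)
    then show ?case using bd[of k] bd[of 0] by simp
  next
    case (Suc n)
    have "u (Suc n + k) \<ominus>\<^bsub>A\<^esub> u (Suc n) = y \<otimes>\<^bsub>A\<^esub> (u (n + k) \<ominus>\<^bsub>A\<^esub> u n)"
      using yA uA by (simp add: uS minus_identities(6,7))
    then have "nrm A (u (Suc n + k) \<ominus>\<^bsub>A\<^esub> u (Suc n)) \<le> r * nrm A (u (n + k) \<ominus>\<^bsub>A\<^esub> u n)"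
      using nrm_mult[OF yA, of "u (n + k) \<ominus>\<^bsub>A\<^esub> u n"] uA by (simp add: r_def)
    also have "\<dots> \<le> r * (r ^ n * (2 * (r / (1 - r))))" using Suc r0 by (rule mult_left_mono)
    finally show ?case by (simp add: mult.assoc)
  qed
  have "\<exists>M. \<forall>m\<ge>M. \<forall>n\<ge>M. nrm A (u m \<ominus>\<^bsub>A\<^esub> u n) < e" if e: "0 < e" for e
  proof -
    have "(\<lambda>n. r ^ n * (2 * (r / (1 - r)))) \<longlonglongrightarrow> 0"
      using tendsto_mult[OF LIMSEQ_power_zero[of r] tendsto_const[of "2 * (r / (1 - r))"]] r0 r1 by simp
    from order_tendstoD(2)[OF this, of e] e
    obtain M where M: "\<And>n. n \<ge> M \<Longrightarrow> r ^ n * (2 * (r / (1 - r))) < e"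
      by (auto simp: eventually_sequentially)
    have le: "nrm A (u m \<ominus>\<^bsub>A\<^esub> u n) < e" if "n \<ge> M" "n \<le> m" for m n
      using step[of n "m - n"] M[OF that(1)] that(2) by simp
    have "nrm A (u m \<ominus>\<^bsub>A\<^esub> u n) < e" if "m \<ge> M" "n \<ge> M" for m n
      using le[of n m] le[of m n] that nrm_minus_commute[OF uA uA, of m n] by (cases "n \<le> m") auto
    then show ?thesis by blast
  qed
  then obtain z where zA: "z \<in> carrier A" and z: "(\<lambda>n. nrm A (u n \<ominus>\<^bsub>A\<^esub> z)) \<longlonglongrightarrow> 0"
    using nrm_complete[of u] uA by blast
  have zC: "z \<in> C" by (rule C_closed[OF uC zA z])
  have "(\<lambda>n. nrm A (u (Suc n) \<ominus>\<^bsub>A\<^esub> (y \<oplus>\<^bsub>A\<^esub> (y \<otimes>\<^bsub>A\<^esub> z)))) \<longlonglongrightarrow> 0"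
    unfolding uS
    by (intro limit_add limit_mult limit_const z yA zA uA carrier_closed)
  with LIMSEQ_Suc[OF z] have "z = y \<oplus>\<^bsub>A\<^esub> (y \<otimes>\<^bsub>A\<^esub> z)"
    by (intro limit_unique[of "\<lambda>n. u (Suc n)"]) (use uA yA zA in auto)
  then have "h z = h y + h y * h z"
    using h_add[OF y(1) C_mult[OF y(1) zC]] h_mult[OF y(1) zC] by metis
  then show False using y(2) by simp
qed

end

text \<open>A sequence in \<open>D\<close> witnesses each limit point; both structures are only required to be
  pseudometric on the given carriers, so that this applies to norms on algebra carriers.\<close>

lemma dense_extension:
  fixes d1 :: "'a \<Rightarrow> 'a \<Rightarrow> real" and d2 :: "'b \<Rightarrow> 'b \<Rightarrow> real" and u :: "'d \<Rightarrow> 'a" and v :: "'d \<Rightarrow> 'b"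
  assumes sym1: "\<And>x y. x \<in> M1 \<Longrightarrow> y \<in> M1 \<Longrightarrow> d1 x y = d1 y x"
    and nonneg2: "\<And>x y. x \<in> M2 \<Longrightarrow> y \<in> M2 \<Longrightarrow> 0 \<le> d2 x y"
    and tri1: "\<And>x y z. x \<in> M1 \<Longrightarrow> y \<in> M1 \<Longrightarrow> z \<in> M1 \<Longrightarrow> d1 x z \<le> d1 x y + d1 y z"
    and tri2: "\<And>x y z. x \<in> M2 \<Longrightarrow> y \<in> M2 \<Longrightarrow> z \<in> M2 \<Longrightarrow> d2 x z \<le> d2 x y + d2 y z"
    and complete: "\<And>s. (\<And>k :: nat. s k \<in> M2) \<Longrightarrow>
       (\<And>e. 0 < e \<Longrightarrow> \<exists>N. \<forall>m\<ge>N. \<forall>n\<ge>N. d2 (s m) (s n) < e) \<Longrightarrow> \<exists>y\<in>M2. (\<lambda>k. d2 (s k) y) \<longlonglongrightarrow> 0"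
    and u: "\<And>d. d \<in> D \<Longrightarrow> u d \<in> M1" and v: "\<And>d. d \<in> D \<Longrightarrow> v d \<in> M2"
    and contr: "\<And>d d'. d \<in> D \<Longrightarrow> d' \<in> D \<Longrightarrow> d2 (v d) (v d') \<le> d1 (u d) (u d')"
    and x: "x \<in> M1" and dense: "\<And>e. 0 < e \<Longrightarrow> \<exists>d\<in>D. d1 x (u d) < e"
  shows "\<exists>y\<in>M2. \<forall>s. (\<forall>k :: nat. s k \<in> D) \<longrightarrow> (\<lambda>k. d1 (u (s k)) x) \<longlonglongrightarrow> 0 \<longrightarrow> (\<lambda>k. d2 (v (s k)) y) \<longlonglongrightarrow> 0"
proof -
  have "\<exists>d\<in>D. d1 x (u d) < inverse (real (Suc k))" for k by (rule dense) simp
  then obtain s where s: "\<And>k. s k \<in> D" "\<And>k. d1 x (u (s k)) < inverse (real (Suc k))" by metis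
  have "\<exists>N. \<forall>m\<ge>N. \<forall>n\<ge>N. d2 (v (s m)) (v (s n)) < e" if e: "0 < e" for e
  proof -
    obtain N where N: "inverse (real (Suc N)) < e / 2" using reals_Archimedean[of "e/2"] e by auto
    have small: "d1 x (u (s n)) < e / 2" if "n \<ge> N" for n
    proof -
      have "inverse (real (Suc n)) \<le> inverse (real (Suc N))" using that by (intro le_imp_inverse_le) auto
      with s(2)[of n] N show ?thesis by linarith
    qed
    have "d2 (v (s m)) (v (s n)) < e" if "m \<ge> N" "n \<ge> N" for m n
      using contr[OF s(1) s(1), of m n] tri1[OF u[OF s(1)] x u[OF s(1)], of m n]
        sym1[OF x u[OF s(1)], of m] small[OF that(1)] small[OF that(2)] by linarith
    then show ?thesis by blast
  qed
  then obtain y where y: "y \<in> M2" and lim: "(\<lambda>k. d2 (v (s k)) y) \<longlonglongrightarrow> 0"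
    using complete[of "\<lambda>k. v (s k)"] v s(1) by blast
  have "(\<lambda>k. d2 (v (t k)) y) \<longlonglongrightarrow> 0" if t: "\<forall>k. t k \<in> D" and tl: "(\<lambda>k. d1 (u (t k)) x) \<longlonglongrightarrow> 0" for t
  proof (rule Lim_null_comparison)
    show "(\<lambda>k. (d1 (u (t k)) x + inverse (real (Suc k))) + d2 (v (s k)) y) \<longlonglongrightarrow> 0"
      using tendsto_add[OF tendsto_add[OF tl LIMSEQ_inverse_real_of_nat] lim] by simp
    have "d2 (v (t k)) y \<le> (d1 (u (t k)) x + inverse (real (Suc k))) + d2 (v (s k)) y" for k
      using tri2[OF v[OF t[rule_format]] v[OF s(1)] y, of k k] contr[OF t[rule_format] s(1), of k k]
        tri1[OF u[OF t[rule_format]] x u[OF s(1)], of k k] s(2)[of k] by linarith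
    then show "\<forall>\<^sub>F k in sequentially. norm (d2 (v (t k)) y)
        \<le> (d1 (u (t k)) x + inverse (real (Suc k))) + d2 (v (s k)) y"
      using nonneg2[OF v[OF t[rule_format]] y] by simp
  qed
  with y show ?thesis by blast
qed

section \<open>Block offsets\<close>

definition offset :: "('q \<Rightarrow> nat) \<Rightarrow> 'q list \<Rightarrow> 'q \<Rightarrow> nat" where
  "offset k xs q = sum_list (map k (takeWhile (\<lambda>p. p \<noteq> q) xs))"

lemma offset_Cons: "offset k (p # xs) q = (if p = q then 0 else k p + offset k xs q)"
  by (simp add: offset_def)

lemma offset_exists:
  "A < sum_list (map k xs) \<Longrightarrow> distinct xs \<Longrightarrow> \<exists>q\<in>set xs. \<exists>a<k q. A = offset k xs q + a"
proof (induction xs arbitrary: A)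
  case (Cons p xs)
  show ?case
  proof (cases "A < k p")
    case False
    then have "A - k p < sum_list (map k xs)" using Cons.prems(1) by simp
    from Cons.IH[OF this] Cons.prems(2) obtain q a where
      "q \<in> set xs" "a < k q" "A - k p = offset k xs q + a" by auto
    moreover from this Cons.prems(2) have "p \<noteq> q" by auto
    ultimately show ?thesis using False
      by (intro bexI[of _ q] exI[of _ a]) (auto simp: offset_Cons)
  qed (auto simp: offset_Cons)
qed simp

lemma offset_less: "q \<in> set xs \<Longrightarrow> a < k q \<Longrightarrow> offset k xs q + a < sum_list (map k xs)"
  by (induction xs) (auto simp: offset_Cons)

lemma offset_inj:
  "q \<in> set xs \<Longrightarrow> q' \<in> set xs \<Longrightarrow> a < k q \<Longrightarrow> b < k q' \<Longrightarrow> offset k xs q + a = offset k xs q' + b \<Longrightarrow>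
   q = q' \<and> a = b"
  by (induction xs) (auto simp: offset_Cons split: if_splits)

text \<open>Rows and columns are addressed by a block and a local index. The induction peels off the
  first block of \<open>four_block_mat\<close>: the address lies in that block exactly when the head
  of the list is the addressed one.\<close>

lemma diag_block_mat_index:
  assumes "distinct xs" "\<And>q. q \<in> set xs \<Longrightarrow> M q \<in> carrier_mat (k q) (k q)"
    "q \<in> set xs" "q' \<in> set xs" "a < k q" "b < k q'"
  shows "diag_block_mat (map M xs) $$ (offset k xs q + a, offset k xs q' + b) =
    (if q = q' then M q $$ (a, b) else (0 :: complex))"
  using assms
proof (induction xs)
  case (Cons p xs)
  have kq: "dim_row (M q) = k q" "dim_col (M q) = k q" if "q \<in> set xs" for q
    using Cons.prems(2)[of q] that by auto
  have dims: "dim_row (diag_block_mat (map M xs)) = sum_list (map k xs)"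
    "dim_col (diag_block_mat (map M xs)) = sum_list (map k xs)"
    using kq by (simp_all add: dim_diag_block_mat o_def cong: map_cong)
  have p: "dim_row (M p) = k p" "dim_col (M p) = k p" using Cons.prems(2)[of p] by auto
  have less: "offset k xs r + c < sum_list (map k xs)" if "r \<in> set xs" "c < k r" for r c
    by (rule offset_less[of r xs c k, OF that])
  have ind: "four_block_mat (M p) (0\<^sub>m (k p) (sum_list (map k xs))) (0\<^sub>m (sum_list (map k xs)) (k p))
      (diag_block_mat (map M xs)) $$ (i, j) =
    (if i < k p then if j < k p then M p $$ (i, j) else 0
     else if j < k p then 0 else diag_block_mat (map M xs) $$ (i - k p, j - k p))"
    if "i < k p + sum_list (map k xs)" "j < k p + sum_list (map k xs)" for i j
    using that p dims by (auto simp: index_mat_four_block)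
  have b: "offset k (p # xs) r + c < k p + sum_list (map k xs)" if "r \<in> set (p # xs)" "c < k r" for r c
    using offset_less[of r "p # xs" c k] that by simp
  have eq: "diag_block_mat (map M (p # xs)) = four_block_mat (M p) (0\<^sub>m (k p) (sum_list (map k xs)))
      (0\<^sub>m (sum_list (map k xs)) (k p)) (diag_block_mat (map M xs))"
    by (simp add: Let_def dims p)
  have IH: "diag_block_mat (map M xs) $$ (offset k xs q + a, offset k xs q' + b) =
      (if q = q' then M q $$ (a, b) else 0)" if "p \<noteq> q" "p \<noteq> q'"
    by (rule Cons.IH) (use Cons.prems that in auto)
  show ?case
    unfolding eq ind[OF b[OF Cons.prems(3,5)] b[OF Cons.prems(4,6)]]
    using IH Cons.prems(5,6) by (cases "p = q"; cases "p = q'") (simp_all add: offset_Cons)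
qed simp

section \<open>Matrix norms\<close>

lemma mat_mult_index:
  fixes M N :: "complex mat"
  assumes "M \<in> carrier_mat m m" "N \<in> carrier_mat m m" "a < m" "b < m"
  shows "(M * N) $$ (a, b) = (\<Sum>c<m. M $$ (a, c) * N $$ (c, b))"
  using assms by (auto simp: scalar_prod_def atLeast0LessThan intro!: sum.cong)

lemma mat_adjoint_index:
  fixes M :: "complex mat"
  assumes "M \<in> carrier_mat m m"
  shows "mat_adjoint M \<in> carrier_mat m m"
    "a < m \<Longrightarrow> b < m \<Longrightarrow> mat_adjoint M $$ (a, b) = cnj (M $$ (b, a))"
  using assms unfolding mat_adjoint_def by (auto simp: mat_of_rows_def)

lemma sqrt_cscalar_prod:
  "sqrt (Re (v \<bullet>c v)) = L2_set (\<lambda>i. cmod (vec_index v i)) {..<dim_vec v}" for v :: "complex vec"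
proof -
  have "v \<bullet>c v = (\<Sum>i<dim_vec v. complex_of_real ((cmod (vec_index v i))\<^sup>2))"
    by (auto simp: scalar_prod_def atLeast0LessThan complex_norm_square[unfolded of_real_power, symmetric] intro!: sum.cong)
  then have "Re (v \<bullet>c v) = (\<Sum>i<dim_vec v. (cmod (vec_index v i))\<^sup>2)" by simp
  then show ?thesis by (simp add: L2_set_def)
qed

text \<open>Replaces vectors with a dimension by functions measured with \<open>L2_set\<close>, so
  that matrix norms can be compared directly with \<open>ell2_norm\<close> on a finite block of
  arrows.\<close>

lemma matrix_norm_alt:
  assumes "M \<in> carrier_mat m m"
  shows "matrix_norm M = Sup {L2_set (\<lambda>a. cmod (\<Sum>b<m. M $$ (a, b) * v b)) {..<m} | v.
     L2_set (\<lambda>b. cmod (v b)) {..<m} \<le> 1}"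
proof -
  have 1: "sqrt (Re ((M *\<^sub>v v) \<bullet>c (M *\<^sub>v v))) =
      L2_set (\<lambda>a. cmod (\<Sum>b<m. M $$ (a, b) * vec_index v b)) {..<m}" if "v \<in> carrier_vec m" for v
    unfolding sqrt_cscalar_prod using assms that
    by (auto simp: scalar_prod_def atLeast0LessThan intro!: L2_set_cong arg_cong[where f = cmod] sum.cong)
  have "{sqrt (Re ((M *\<^sub>v v) \<bullet>c (M *\<^sub>v v))) | v. v \<in> carrier_vec (dim_col M) \<and> sqrt (Re (v \<bullet>c v)) \<le> 1}
    = {L2_set (\<lambda>a. cmod (\<Sum>b<m. M $$ (a, b) * v b)) {..<m} | v. L2_set (\<lambda>b. cmod (v b)) {..<m} \<le> 1}"
    (is "?L = ?R")
  proof (intro Set.set_eqI iffI)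
    fix y assume "y \<in> ?L"
    then obtain v where "y = sqrt (Re ((M *\<^sub>v v) \<bullet>c (M *\<^sub>v v)))" "v \<in> carrier_vec m"
      "sqrt (Re (v \<bullet>c v)) \<le> 1" using assms by auto
    then have "y = L2_set (\<lambda>a. cmod (\<Sum>b<m. M $$ (a, b) * vec_index v b)) {..<m} \<and>
        L2_set (\<lambda>b. cmod (vec_index v b)) {..<m} \<le> 1"
      using 1[of v] sqrt_cscalar_prod[of v] by simp
    then show "y \<in> ?R" by blast
  next
    fix y assume "y \<in> ?R"
    then obtain v where y: "y = L2_set (\<lambda>a. cmod (\<Sum>b<m. M $$ (a, b) * v b)) {..<m}"
      and v: "L2_set (\<lambda>b. cmod (v b)) {..<m} \<le> 1" by auto
    have "y = sqrt (Re ((M *\<^sub>v Matrix.vec m v) \<bullet>c (M *\<^sub>v Matrix.vec m v)))"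
      using 1[of "Matrix.vec m v"] y by simp
    moreover have "sqrt (Re (Matrix.vec m v \<bullet>c Matrix.vec m v)) \<le> 1"
      using v unfolding sqrt_cscalar_prod by (simp cong: L2_set_cong_simp)
    moreover have "Matrix.vec m v \<in> carrier_vec (dim_col M)" using assms by auto
    ultimately show "y \<in> ?L" by blast
  qed
  then show ?thesis by (simp add: matrix_norm_def)
qed

lemma matrix_norm_leI:
  assumes "M \<in> carrier_mat m m" "0 \<le> K"
    "\<And>v. L2_set (\<lambda>a. cmod (\<Sum>b<m. M $$ (a, b) * v b)) {..<m} \<le> K * L2_set (\<lambda>b. cmod (v b)) {..<m}"
  shows "matrix_norm M \<le> K"
  unfolding matrix_norm_alt[OF assms(1)]
proof (rule cSup_least)
  show "{L2_set (\<lambda>a. cmod (\<Sum>b<m. M $$ (a, b) * v b)) {..<m} | v. L2_set (\<lambda>b. cmod (v b)) {..<m} \<le> 1} \<noteq> {}"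
    by (rule ex_in_conv[THEN iffD1], rule exI, rule CollectI, rule exI[of _ "\<lambda>_. 0"], rule conjI, rule refl)
      (simp add: L2_set_def)
  fix y assume "y \<in> {L2_set (\<lambda>a. cmod (\<Sum>b<m. M $$ (a, b) * v b)) {..<m} | v. L2_set (\<lambda>b. cmod (v b)) {..<m} \<le> 1}"
  then obtain v where y: "y = L2_set (\<lambda>a. cmod (\<Sum>b<m. M $$ (a, b) * v b)) {..<m}"
    and v: "L2_set (\<lambda>b. cmod (v b)) {..<m} \<le> 1" by auto
  have "K * L2_set (\<lambda>b. cmod (v b)) {..<m} \<le> K * 1" using v assms(2) by (rule mult_left_mono)
  then show "y \<le> K" using assms(3)[of v] y by simp
qed

text \<open>The sum of all entry moduli dominates the operator norm. It makes the supremum in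
  \<open>matrix_norm\<close> finite, gives uniform bounds over compact base spaces, and later
  controls kernels with uniformly small entries.\<close>

lemma matrix_norm_crude:
  assumes "M \<in> carrier_mat m m"
  shows "L2_set (\<lambda>a. cmod (\<Sum>b<m. M $$ (a, b) * v b)) {..<m}
    \<le> (\<Sum>a<m. \<Sum>b<m. cmod (M $$ (a, b))) * L2_set (\<lambda>b. cmod (v b)) {..<m}"
proof -
  have "L2_set (\<lambda>a. cmod (\<Sum>b<m. M $$ (a, b) * v b)) {..<m} \<le> (\<Sum>a<m. cmod (\<Sum>b<m. M $$ (a, b) * v b))"
    by (rule L2_set_le_sum) simp
  also have "\<dots> \<le> (\<Sum>a<m. \<Sum>b<m. cmod (M $$ (a, b)) * L2_set (\<lambda>b. cmod (v b)) {..<m})"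
  proof (rule sum_mono)
    fix a
    have "cmod (\<Sum>b<m. M $$ (a, b) * v b) \<le> (\<Sum>b<m. cmod (M $$ (a, b)) * cmod (v b))"
      by (rule order_trans[OF norm_sum]) (simp add: norm_mult)
    also have "\<dots> \<le> (\<Sum>b<m. cmod (M $$ (a, b)) * L2_set (\<lambda>b. cmod (v b)) {..<m})"
      by (intro sum_mono mult_left_mono member_le_L2_set) auto
    finally show "cmod (\<Sum>b<m. M $$ (a, b) * v b) \<le> \<dots>" .
  qed
  also have "\<dots> = (\<Sum>a<m. \<Sum>b<m. cmod (M $$ (a, b))) * L2_set (\<lambda>b. cmod (v b)) {..<m}"
    by (simp add: sum_distrib_right)
  finally show ?thesis .
qed

lemma matrix_norm_bound:
  assumes M: "M \<in> carrier_mat m m"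
  shows "L2_set (\<lambda>a. cmod (\<Sum>b<m. M $$ (a, b) * v b)) {..<m} \<le> matrix_norm M * L2_set (\<lambda>b. cmod (v b)) {..<m}"
proof (cases "L2_set (\<lambda>b. cmod (v b)) {..<m} = 0")
  case True
  then show ?thesis using matrix_norm_crude[OF M, of v] by simp
next
  case False
  define r where "r = L2_set (\<lambda>b. cmod (v b)) {..<m}"
  have r: "0 < r" unfolding r_def using False L2_set_nonneg[of "\<lambda>b. cmod (v b)" "{..<m}"] by linarith
  let ?B = "{L2_set (\<lambda>a. cmod (\<Sum>b<m. M $$ (a, b) * v b)) {..<m} | v. L2_set (\<lambda>b. cmod (v b)) {..<m} \<le> 1}"
  let ?S = "\<Sum>a<m. \<Sum>b<m. cmod (M $$ (a, b))"
  have "y \<le> ?S" if y: "y \<in> ?B" for y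
  proof -
    obtain w where w: "y = L2_set (\<lambda>a. cmod (\<Sum>b<m. M $$ (a, b) * w b)) {..<m}"
      "L2_set (\<lambda>b. cmod (w b)) {..<m} \<le> 1" using y by blast
    have "?S * L2_set (\<lambda>b. cmod (w b)) {..<m} \<le> ?S * 1"
      using w(2) by (intro mult_left_mono sum_nonneg) auto
    then show ?thesis using matrix_norm_crude[OF M, of w] w(1) by simp
  qed
  then have bdd: "bdd_above ?B" unfolding bdd_above_def by blast
  have scale: "L2_set (\<lambda>a. cmod (complex_of_real (1 / r) * f a)) {..<m} = L2_set (\<lambda>a. cmod (f a)) {..<m} / r" for f
    using L2_set_right_distrib[of "1 / r" "\<lambda>a. cmod (f a)" "{..<m}"] r
    by (simp add: norm_mult norm_divide)
  have "L2_set (\<lambda>b. cmod (complex_of_real (1 / r) * v b)) {..<m} \<le> 1"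
    unfolding scale using r by (simp add: r_def[symmetric])
  then have "L2_set (\<lambda>a. cmod (\<Sum>b<m. M $$ (a, b) * (complex_of_real (1 / r) * v b))) {..<m} \<in> ?B"
    by (intro CollectI exI[of _ "\<lambda>b. complex_of_real (1 / r) * v b"] conjI refl)
  from cSup_upper[OF this bdd]
  have "L2_set (\<lambda>a. cmod (\<Sum>b<m. M $$ (a, b) * (complex_of_real (1 / r) * v b))) {..<m} \<le> matrix_norm M"
    unfolding matrix_norm_alt[OF M] .
  also have "(\<lambda>a. \<Sum>b<m. M $$ (a, b) * (complex_of_real (1 / r) * v b)) =
      (\<lambda>a. complex_of_real (1 / r) * (\<Sum>b<m. M $$ (a, b) * v b))"
    by (simp add: sum_distrib_left algebra_simps)
  finally have "L2_set (\<lambda>a. cmod (\<Sum>b<m. M $$ (a, b) * v b)) {..<m} / r \<le> matrix_norm M"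
    unfolding scale .
  then show ?thesis using r by (simp add: r_def[symmetric] pos_divide_le_eq)
qed

lemma index_le_matrix_norm:
  assumes M: "M \<in> carrier_mat m m" and ab: "a < m" "b < m"
  shows "cmod (M $$ (a, b)) \<le> matrix_norm M"
proof -
  let ?v = "\<lambda>c. if c = b then 1 else 0 :: complex"
  have "L2_set (\<lambda>c. cmod (?v c)) {..<m} = 1"
    using ab by (simp add: L2_set_def if_distrib[of cmod] if_distrib[of "\<lambda>x. x\<^sup>2"] cong: if_cong)
  moreover have "cmod (M $$ (a, b)) \<le> L2_set (\<lambda>a. cmod (\<Sum>c<m. M $$ (a, c) * ?v c)) {..<m}"
    using member_le_L2_set[of "{..<m}" a "\<lambda>a. cmod (\<Sum>c<m. M $$ (a, c) * ?v c)"] ab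
    by (simp add: if_distrib cong: if_cong)
  ultimately show ?thesis using matrix_norm_bound[OF M, of ?v] by simp
qed

section \<open>The stage algebras\<close>

text \<open>Reduces continuity on an abstract topology to limits at points, so that products,
  conjugates and inverses come from the \<open>tendsto\<close> rules.\<close>

lemma continuous_map_complex_iff:
  fixes f :: "'x \<Rightarrow> complex"
  shows "continuous_map X euclidean f \<longleftrightarrow> (\<forall>x\<in>topspace X. (f \<longlongrightarrow> f x) (atin X x))"
  by (simp add: continuous_map_atin limitin_canonical_iff)

lemma continuous_map_complex_mult:
  fixes f g :: "'x \<Rightarrow> complex"
  assumes "continuous_map X euclidean f" "continuous_map X euclidean g"
  shows "continuous_map X euclidean (\<lambda>x. f x * g x)"
  using assms unfolding continuous_map_complex_iff by (intro ballI tendsto_intros) auto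

lemma continuous_map_complex_cnj:
  fixes f :: "'x \<Rightarrow> complex"
  assumes "continuous_map X euclidean f"
  shows "continuous_map X euclidean (\<lambda>x. cnj (f x))"
  using assms unfolding continuous_map_complex_iff by (intro ballI tendsto_intros) auto

lemma continuous_map_complex_inverse:
  fixes f :: "'x \<Rightarrow> complex"
  assumes "continuous_map X euclidean f" "\<And>x. x \<in> topspace X \<Longrightarrow> f x \<noteq> 0"
  shows "continuous_map X euclidean (\<lambda>x. inverse (f x))"
  using assms unfolding continuous_map_complex_iff by (intro ballI tendsto_intros) auto

lemma continuous_map_complex_bounded:
  fixes f :: "'x \<Rightarrow> complex"
  assumes "continuous_map X euclidean f" "compact_space X"
  obtains K where "\<And>x. x \<in> topspace X \<Longrightarrow> cmod (f x) \<le> K"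
proof -
  have "compactin euclidean (f ` topspace X)"
    using image_compactin[OF _ assms(1)] assms(2) by (simp add: compact_space_def)
  then have "bounded (f ` topspace X)" by (simp add: compact_imp_bounded)
  then show ?thesis using that by (auto simp: bounded_iff)
qed

lemma pointwise_apply:
  "i \<in> {1..nblocks S n} \<Longrightarrow> x \<in> topspace (base S n i) \<Longrightarrow> pointwise S n F i x = F i x"
  by (simp add: pointwise_def)

lemma stage_carrierD:
  assumes "f \<in> carrier (stage_algebra S n)" "i \<in> {1..nblocks S n}"
  shows "x \<in> topspace (base S n i) \<Longrightarrow> f i x \<in> carrier_mat (msize S n i) (msize S n i)"
    "a < msize S n i \<Longrightarrow> b < msize S n i \<Longrightarrow> continuous_map (base S n i) euclidean (\<lambda>x. f i x $$ (a, b))"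
  using assms by (auto simp: stage_algebra_def PiE_iff)

lemma pointwise_closed:
  assumes "\<And>i x. i \<in> {1..nblocks S n} \<Longrightarrow> x \<in> topspace (base S n i) \<Longrightarrow>
      F i x \<in> carrier_mat (msize S n i) (msize S n i)"
    and "\<And>i a b. i \<in> {1..nblocks S n} \<Longrightarrow> a < msize S n i \<Longrightarrow> b < msize S n i \<Longrightarrow>
      continuous_map (base S n i) euclidean (\<lambda>x. F i x $$ (a, b))"
  shows "pointwise S n F \<in> carrier (stage_algebra S n)"
proof -
  have "continuous_map (base S n i) euclidean (\<lambda>x. pointwise S n F i x $$ (a, b))"
    if "i \<in> {1..nblocks S n}" "a < msize S n i" "b < msize S n i" for i a b
    by (rule continuous_map_eq[OF assms(2)[OF that]]) (simp add: pointwise_apply[OF that(1)])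
  then show ?thesis using assms(1) by (auto simp: stage_algebra_def pointwise_def)
qed

lemma stage_eqI:
  assumes "f \<in> carrier (stage_algebra S n)" "g \<in> carrier (stage_algebra S n)"
    and "\<And>i x a b. i \<in> {1..nblocks S n} \<Longrightarrow> x \<in> topspace (base S n i) \<Longrightarrow> a < msize S n i \<Longrightarrow>
      b < msize S n i \<Longrightarrow> f i x $$ (a, b) = g i x $$ (a, b)"
  shows "f = g"
proof -
  have fg: "f \<in> (\<Pi>\<^sub>E i\<in>{1..nblocks S n}. \<Pi>\<^sub>E x\<in>topspace (base S n i). carrier_mat (msize S n i) (msize S n i))"
    "g \<in> (\<Pi>\<^sub>E i\<in>{1..nblocks S n}. \<Pi>\<^sub>E x\<in>topspace (base S n i). carrier_mat (msize S n i) (msize S n i))"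
    using assms(1,2) by (auto simp: stage_algebra_def)
  show ?thesis
  proof (rule PiE_ext[OF fg])
    fix i assume i: "i \<in> {1..nblocks S n}"
    show "f i = g i"
    proof (rule PiE_ext)
      show "f i \<in> (\<Pi>\<^sub>E x\<in>topspace (base S n i). carrier_mat (msize S n i) (msize S n i))"
        "g i \<in> (\<Pi>\<^sub>E x\<in>topspace (base S n i). carrier_mat (msize S n i) (msize S n i))"
        by (rule PiE_mem[OF fg(1) i], rule PiE_mem[OF fg(2) i])
      fix x assume x: "x \<in> topspace (base S n i)"
      show "f i x = g i x"
      proof (rule eq_matI)
        note fc = carrier_matD[OF stage_carrierD(1)[OF assms(1) i x]]
        note gc = carrier_matD[OF stage_carrierD(1)[OF assms(2) i x]]
        show "dim_row (f i x) = dim_row (g i x)" "dim_col (f i x) = dim_col (g i x)"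
          by (simp_all only: fc gc)
        show "f i x $$ (a, b) = g i x $$ (a, b)" if "a < dim_row (g i x)" "b < dim_col (g i x)" for a b
          by (rule assms(3)[OF i x]) (use that gc in auto)
      qed
    qed
  qed
qed

definition stage_mat ::
  "('x, 'e) ah_system \<Rightarrow> nat \<Rightarrow> (nat \<Rightarrow> 'x \<Rightarrow> nat \<Rightarrow> nat \<Rightarrow> complex) \<Rightarrow> nat \<Rightarrow> 'x \<Rightarrow> complex mat" where
  "stage_mat S n F = pointwise S n (\<lambda>i x. Matrix.mat (msize S n i) (msize S n i) (\<lambda>(a, b). F i x a b))"

lemma stage_mat_closed:
  assumes "\<And>i a b. i \<in> {1..nblocks S n} \<Longrightarrow> a < msize S n i \<Longrightarrow> b < msize S n i \<Longrightarrow>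
      continuous_map (base S n i) euclidean (\<lambda>x. F i x a b)"
  shows "stage_mat S n F \<in> carrier (stage_algebra S n)"
  unfolding stage_mat_def by (rule pointwise_closed) (use assms in auto)

lemma stage_mat_index:
  assumes "i \<in> {1..nblocks S n}" "x \<in> topspace (base S n i)" "a < msize S n i" "b < msize S n i"
  shows "stage_mat S n F i x $$ (a, b) = F i x a b"
  using assms by (simp add: stage_mat_def pointwise_apply)

definition matrix_unit ::
  "('x, 'e) ah_system \<Rightarrow> nat \<Rightarrow> nat \<Rightarrow> nat \<Rightarrow> nat \<Rightarrow> ('x \<Rightarrow> complex) \<Rightarrow> nat \<Rightarrow> 'x \<Rightarrow> complex mat" where
  "matrix_unit S n i a b g = stage_mat S n (\<lambda>j x p q. if j = i \<and> p = a \<and> q = b then g x else 0)"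

text \<open>With indices out of range the element is 0, so continuity of \<open>g\<close> is asked
  for only when they are in range.\<close>

lemma matrix_unit_closed:
  assumes "i \<in> {1..nblocks S n} \<Longrightarrow> a < msize S n i \<Longrightarrow> b < msize S n i \<Longrightarrow> continuous_map (base S n i) euclidean g"
  shows "matrix_unit S n i a b g \<in> carrier (stage_algebra S n)"
  unfolding matrix_unit_def
proof (rule stage_mat_closed)
  fix j p q assume "j \<in> {1..nblocks S n}" "p < msize S n j" "q < msize S n j"
  then show "continuous_map (base S n j) euclidean (\<lambda>x. if j = i \<and> p = a \<and> q = b then g x else 0)"
    using assms by (cases "j = i \<and> p = a \<and> q = b") auto
qed

lemma matrix_unit_index:
  assumes "j \<in> {1..nblocks S n}" "x \<in> topspace (base S n j)" "p < msize S n j" "q < msize S n j"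
  shows "matrix_unit S n i a b g j x $$ (p, q) = (if j = i \<and> p = a \<and> q = b then g x else 0)"
  using assms by (simp add: matrix_unit_def stage_mat_index)

lemma matrix_unit_diagonal:
  assumes "i \<in> {1..nblocks S n} \<Longrightarrow> a < msize S n i \<Longrightarrow> continuous_map (base S n i) euclidean g"
  shows "matrix_unit S n i a a g \<in> diagonal_part S n"
proof -
  have c: "matrix_unit S n i a a g \<in> carrier (stage_algebra S n)" by (rule matrix_unit_closed[OF assms])
  show ?thesis unfolding diagonal_part_def diagonal_mat_def
    using c stage_carrierD(1)[OF c] by (fastforce simp: matrix_unit_index)
qed

lemma diagonal_partI:
  assumes "f \<in> carrier (stage_algebra S n)"
    "\<And>i x a b. i \<in> {1..nblocks S n} \<Longrightarrow> x \<in> topspace (base S n i) \<Longrightarrow> a < msize S n i \<Longrightarrow>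
      b < msize S n i \<Longrightarrow> a \<noteq> b \<Longrightarrow> f i x $$ (a, b) = 0"
  shows "f \<in> diagonal_part S n"
  unfolding diagonal_part_def diagonal_mat_def using assms stage_carrierD(1)[OF assms(1)] by fastforce

lemma diagonal_partD:
  assumes "f \<in> diagonal_part S n"
  shows "f \<in> carrier (stage_algebra S n)"
    "i \<in> {1..nblocks S n} \<Longrightarrow> x \<in> topspace (base S n i) \<Longrightarrow> a < msize S n i \<Longrightarrow>
      b < msize S n i \<Longrightarrow> a \<noteq> b \<Longrightarrow> f i x $$ (a, b) = 0"
proof -
  show c: "f \<in> carrier (stage_algebra S n)" using assms by (simp add: diagonal_part_def)
  show "f i x $$ (a, b) = 0" if "i \<in> {1..nblocks S n}" "x \<in> topspace (base S n i)" "a < msize S n i"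
      "b < msize S n i" "a \<noteq> b"
    using assms that stage_carrierD(1)[OF c that(1,2)] by (auto simp: diagonal_part_def diagonal_mat_def)
qed

lemma stage_ops_apply:
  assumes "i \<in> {1..nblocks S n}" "x \<in> topspace (base S n i)"
  shows "(f \<otimes>\<^bsub>stage_algebra S n\<^esub> g) i x = f i x * g i x"
    "(f \<oplus>\<^bsub>stage_algebra S n\<^esub> g) i x = f i x + g i x"
    "(c \<odot>\<^bsub>stage_algebra S n\<^esub> f) i x = c \<cdot>\<^sub>m f i x"
    "adj (stage_algebra S n) f i x = mat_adjoint (f i x)"
    "\<one>\<^bsub>stage_algebra S n\<^esub> i x = 1\<^sub>m (msize S n i)"
    "\<zero>\<^bsub>stage_algebra S n\<^esub> i x = 0\<^sub>m (msize S n i) (msize S n i)"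
  using assms by (simp_all add: stage_algebra_def pointwise_apply)

lemma stage_ops_index:
  assumes f: "f \<in> carrier (stage_algebra S n)" and g: "g \<in> carrier (stage_algebra S n)"
    and i: "i \<in> {1..nblocks S n}" and x: "x \<in> topspace (base S n i)" and ab: "a < msize S n i" "b < msize S n i"
  shows "(f \<otimes>\<^bsub>stage_algebra S n\<^esub> g) i x $$ (a, b) = (\<Sum>c<msize S n i. f i x $$ (a, c) * g i x $$ (c, b))"
    "(f \<oplus>\<^bsub>stage_algebra S n\<^esub> g) i x $$ (a, b) = f i x $$ (a, b) + g i x $$ (a, b)"
    "(c \<odot>\<^bsub>stage_algebra S n\<^esub> f) i x $$ (a, b) = c * f i x $$ (a, b)"
    "adj (stage_algebra S n) f i x $$ (a, b) = cnj (f i x $$ (b, a))"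
    "\<one>\<^bsub>stage_algebra S n\<^esub> i x $$ (a, b) = (if a = b then 1 else 0)"
    "\<zero>\<^bsub>stage_algebra S n\<^esub> i x $$ (a, b) = 0"
proof -
  note m = stage_carrierD(1)[OF f i x] stage_carrierD(1)[OF g i x]
  show "(f \<otimes>\<^bsub>stage_algebra S n\<^esub> g) i x $$ (a, b) = (\<Sum>c<msize S n i. f i x $$ (a, c) * g i x $$ (c, b))"
    unfolding stage_ops_apply[OF i x] by (rule mat_mult_index[OF m ab])
  show "adj (stage_algebra S n) f i x $$ (a, b) = cnj (f i x $$ (b, a))"
    unfolding stage_ops_apply[OF i x] by (rule mat_adjoint_index(2)[OF m(1) ab])
qed (use stage_carrierD(1)[OF f i x] stage_carrierD(1)[OF g i x] ab in \<open>auto simp: stage_ops_apply[OF i x]\<close>)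

lemma stage_closed:
  assumes f: "f \<in> carrier (stage_algebra S n)" and g: "g \<in> carrier (stage_algebra S n)"
  shows "f \<otimes>\<^bsub>stage_algebra S n\<^esub> g \<in> carrier (stage_algebra S n)"
    "f \<oplus>\<^bsub>stage_algebra S n\<^esub> g \<in> carrier (stage_algebra S n)"
    "c \<odot>\<^bsub>stage_algebra S n\<^esub> f \<in> carrier (stage_algebra S n)"
    "adj (stage_algebra S n) f \<in> carrier (stage_algebra S n)"
proof -
  have "pointwise S n (\<lambda>i x. f i x * g i x) \<in> carrier (stage_algebra S n)"
  proof (rule pointwise_closed)
    fix i a b assume i: "i \<in> {1..nblocks S n}" and ab: "a < msize S n i" "b < msize S n i"
    show "continuous_map (base S n i) euclidean (\<lambda>x. (f i x * g i x) $$ (a, b))"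
    proof (rule continuous_map_eq)
      show "continuous_map (base S n i) euclidean (\<lambda>x. \<Sum>c<msize S n i. f i x $$ (a, c) * g i x $$ (c, b))"
        by (intro continuous_map_sum continuous_map_complex_mult stage_carrierD(2)[OF f i] stage_carrierD(2)[OF g i])
          (use ab in auto)
    qed (use mat_mult_index[OF stage_carrierD(1)[OF f i] stage_carrierD(1)[OF g i] ab] in auto)
  qed (use stage_carrierD(1)[OF f] stage_carrierD(1)[OF g] in \<open>blast intro: mult_carrier_mat\<close>)
  then show "f \<otimes>\<^bsub>stage_algebra S n\<^esub> g \<in> carrier (stage_algebra S n)" by (simp add: stage_algebra_def)
  have "pointwise S n (\<lambda>i x. f i x + g i x) \<in> carrier (stage_algebra S n)"
  proof (rule pointwise_closed)
    fix i a b assume i: "i \<in> {1..nblocks S n}" and ab: "a < msize S n i" "b < msize S n i"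
    show "continuous_map (base S n i) euclidean (\<lambda>x. (f i x + g i x) $$ (a, b))"
      by (rule continuous_map_eq[OF continuous_map_add[OF stage_carrierD(2)[OF f i ab] stage_carrierD(2)[OF g i ab]]])
        (use stage_carrierD(1)[OF f i] stage_carrierD(1)[OF g i] ab in fastforce)
  qed (use stage_carrierD(1)[OF f] stage_carrierD(1)[OF g] in auto)
  then show "f \<oplus>\<^bsub>stage_algebra S n\<^esub> g \<in> carrier (stage_algebra S n)" by (simp add: stage_algebra_def)
  have "pointwise S n (\<lambda>i x. c \<cdot>\<^sub>m f i x) \<in> carrier (stage_algebra S n)"
  proof (rule pointwise_closed)
    fix i a b assume i: "i \<in> {1..nblocks S n}" and ab: "a < msize S n i" "b < msize S n i"
    have "continuous_map (base S n i) euclidean (\<lambda>x. c)" by simp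
    from continuous_map_complex_mult[OF this stage_carrierD(2)[OF f i ab]]
    show "continuous_map (base S n i) euclidean (\<lambda>x. (c \<cdot>\<^sub>m f i x) $$ (a, b))"
      by (rule continuous_map_eq) (use stage_carrierD(1)[OF f i] ab in fastforce)
  qed (use stage_carrierD(1)[OF f] in auto)
  then show "c \<odot>\<^bsub>stage_algebra S n\<^esub> f \<in> carrier (stage_algebra S n)" by (simp add: stage_algebra_def)
  have "pointwise S n (\<lambda>i x. mat_adjoint (f i x)) \<in> carrier (stage_algebra S n)"
  proof (rule pointwise_closed)
    fix i a b assume i: "i \<in> {1..nblocks S n}" and ab: "a < msize S n i" "b < msize S n i"
    from continuous_map_complex_cnj[OF stage_carrierD(2)[OF f i ab(2,1)]]
    show "continuous_map (base S n i) euclidean (\<lambda>x. mat_adjoint (f i x) $$ (a, b))"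
      by (rule continuous_map_eq) (use mat_adjoint_index(2)[OF stage_carrierD(1)[OF f i] ab] in auto)
  qed (use mat_adjoint_index(1)[OF stage_carrierD(1)[OF f]] in auto)
  then show "adj (stage_algebra S n) f \<in> carrier (stage_algebra S n)" by (simp add: stage_algebra_def)
qed

lemma stage_one_closed: "\<one>\<^bsub>stage_algebra S n\<^esub> \<in> carrier (stage_algebra S n)"
proof -
  have "pointwise S n (\<lambda>i x. 1\<^sub>m (msize S n i)) \<in> carrier (stage_algebra S n)"
    by (rule pointwise_closed) auto
  then show ?thesis by (simp add: stage_algebra_def)
qed

lemma diagonal_closed:
  assumes f: "f \<in> diagonal_part S n" and g: "g \<in> diagonal_part S n"
  shows "f \<otimes>\<^bsub>stage_algebra S n\<^esub> g \<in> diagonal_part S n"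
    "f \<oplus>\<^bsub>stage_algebra S n\<^esub> g \<in> diagonal_part S n"
    "c \<odot>\<^bsub>stage_algebra S n\<^esub> f \<in> diagonal_part S n"
    "adj (stage_algebra S n) f \<in> diagonal_part S n"
    "\<one>\<^bsub>stage_algebra S n\<^esub> \<in> diagonal_part S n"
proof -
  note fg = diagonal_partD(1)[OF f] diagonal_partD(1)[OF g]
  show "f \<otimes>\<^bsub>stage_algebra S n\<^esub> g \<in> diagonal_part S n"
  proof (rule diagonal_partI[OF stage_closed(1)[OF fg]])
    fix i x a b assume i: "i \<in> {1..nblocks S n}" "x \<in> topspace (base S n i)" "a < msize S n i" "b < msize S n i"
      and ne: "a \<noteq> b"
    have "f i x $$ (a, c) * g i x $$ (c, b) = 0" if "c < msize S n i" for c
      using diagonal_partD(2)[OF f i(1,2,3) that] diagonal_partD(2)[OF g i(1,2) that i(4)] ne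
      by (cases "a = c") auto
    then show "(f \<otimes>\<^bsub>stage_algebra S n\<^esub> g) i x $$ (a, b) = 0"
      unfolding stage_ops_index(1)[OF fg i] by (intro sum.neutral) auto
  qed
  show "f \<oplus>\<^bsub>stage_algebra S n\<^esub> g \<in> diagonal_part S n"
    by (rule diagonal_partI[OF stage_closed(2)[OF fg]])
      (use stage_ops_index(2)[OF fg] diagonal_partD(2)[OF f] diagonal_partD(2)[OF g] in auto)
  show "c \<odot>\<^bsub>stage_algebra S n\<^esub> f \<in> diagonal_part S n"
    by (rule diagonal_partI[OF stage_closed(3)[OF fg]])
      (use stage_ops_index(3)[OF fg] diagonal_partD(2)[OF f] in auto)
  show "adj (stage_algebra S n) f \<in> diagonal_part S n"
    by (rule diagonal_partI[OF stage_closed(4)[OF fg]])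
      (use stage_ops_index(4)[OF fg] diagonal_partD(2)[OF f] in auto)
  show "\<one>\<^bsub>stage_algebra S n\<^esub> \<in> diagonal_part S n"
    by (rule diagonal_partI[OF stage_one_closed]) (use stage_ops_index(5)[OF fg] in auto)
qed

lemma diagonal_mult_index:
  assumes f: "f \<in> diagonal_part S n" and g: "g \<in> diagonal_part S n"
    and i: "i \<in> {1..nblocks S n}" "x \<in> topspace (base S n i)" "a < msize S n i"
  shows "(f \<otimes>\<^bsub>stage_algebra S n\<^esub> g) i x $$ (a, a) = f i x $$ (a, a) * g i x $$ (a, a)"
proof -
  have "(\<Sum>c<msize S n i. f i x $$ (a, c) * g i x $$ (c, a)) = (\<Sum>c\<in>{a}. f i x $$ (a, c) * g i x $$ (c, a))"
    by (rule sum.mono_neutral_right) (use diagonal_partD(2)[OF f i(1,2,3)] i(3) in auto)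
  then show ?thesis
    using stage_ops_index(1)[OF diagonal_partD(1)[OF f] diagonal_partD(1)[OF g] i i(3)] by simp
qed

lemma stage_norm_leI:
  assumes "0 \<le> K"
    and "\<And>i x. i \<in> {1..nblocks S n} \<Longrightarrow> x \<in> topspace (base S n i) \<Longrightarrow> matrix_norm (f i x) \<le> K"
  shows "nrm (stage_algebra S n) f \<le> K"
proof -
  have "nrm (stage_algebra S n) f = Sup (insert 0 {matrix_norm (f i x) | i x.
      i \<in> {1..nblocks S n} \<and> x \<in> topspace (base S n i)})"
    by (simp add: stage_algebra_def)
  also have "\<dots> \<le> K" by (rule cSup_least) (use assms in blast)+
  finally show ?thesis .
qed

definition pos_offset :: "('x, 'e) ah_system \<Rightarrow> nat \<Rightarrow> nat \<Rightarrow> nat \<times> 'e \<Rightarrow> nat" where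
  "pos_offset S n j q = offset (\<lambda>(i, e). msize S n i) (block_order S n j) q"

context diagonal_AH_system
begin

text \<open>Each entry is bounded because the base space is compact; the crude entry sum then bounds
  the matrix norm over a block, and there are finitely many blocks.\<close>

lemma stage_norm_bdd:
  assumes "n \<ge> 1" "f \<in> carrier (stage_algebra S n)"
  shows "bdd_above (insert 0 {matrix_norm (f i x) | i x. i \<in> {1..nblocks S n} \<and> x \<in> topspace (base S n i)})"
proof -
  have "\<exists>K. \<forall>x\<in>topspace (base S n i). matrix_norm (f i x) \<le> K" if i: "i \<in> {1..nblocks S n}" for i
  proof -
    let ?m = "msize S n i"
    have "\<exists>K. \<forall>x\<in>topspace (base S n i). cmod (f i x $$ (a, b)) \<le> K" if "a < ?m" "b < ?m" for a b
      using continuous_map_complex_bounded[OF stage_carrierD(2)[OF assms(2) i that] compact_base[OF assms(1) i]]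
      by metis
    then obtain K where K: "\<And>a b x. a < ?m \<Longrightarrow> b < ?m \<Longrightarrow> x \<in> topspace (base S n i) \<Longrightarrow>
        cmod (f i x $$ (a, b)) \<le> K a b" by metis
    have "matrix_norm (f i x) \<le> (\<Sum>a<?m. \<Sum>b<?m. K a b)" if x: "x \<in> topspace (base S n i)" for x
    proof -
      note fm = stage_carrierD(1)[OF assms(2) i x]
      have "matrix_norm (f i x) \<le> (\<Sum>a<?m. \<Sum>b<?m. cmod (f i x $$ (a, b)))"
        by (rule matrix_norm_leI[OF fm _ matrix_norm_crude[OF fm]]) (intro sum_nonneg norm_ge_zero)
      also have "\<dots> \<le> (\<Sum>a<?m. \<Sum>b<?m. K a b)"
        by (intro sum_mono K x) auto
      finally show ?thesis .
    qed
    then show ?thesis by blast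
  qed
  then obtain K where K: "\<And>i x. i \<in> {1..nblocks S n} \<Longrightarrow> x \<in> topspace (base S n i) \<Longrightarrow> matrix_norm (f i x) \<le> K i"
    by metis
  show ?thesis
    unfolding bdd_above_def
  proof (intro exI ballI)
    fix y assume "y \<in> insert 0 {matrix_norm (f i x) | i x. i \<in> {1..nblocks S n} \<and> x \<in> topspace (base S n i)}"
    then consider "y = 0" | i x where "i \<in> {1..nblocks S n}" "x \<in> topspace (base S n i)" "y = matrix_norm (f i x)"
      by blast
    then show "y \<le> (\<Sum>i\<in>{1..nblocks S n}. \<bar>K i\<bar>)"
    proof cases
      case 2
      have "y \<le> \<bar>K i\<bar>" using K[OF 2(1,2)] 2(3) by simp
      also have "\<dots> \<le> (\<Sum>i\<in>{1..nblocks S n}. \<bar>K i\<bar>)"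
        by (rule member_le_sum[OF 2(1)]) auto
      finally show ?thesis .
    qed (simp add: sum_nonneg)
  qed
qed

lemma stage_norm_eq: "nrm (stage_algebra S n) f = Sup (insert 0 {matrix_norm (f i x) | i x.
      i \<in> {1..nblocks S n} \<and> x \<in> topspace (base S n i)})"
  by (simp add: stage_algebra_def)

lemma matrix_norm_le_stage_norm:
  assumes "n \<ge> 1" "f \<in> carrier (stage_algebra S n)" "i \<in> {1..nblocks S n}" "x \<in> topspace (base S n i)"
  shows "matrix_norm (f i x) \<le> nrm (stage_algebra S n) f"
  unfolding stage_norm_eq by (rule cSup_upper[OF _ stage_norm_bdd[OF assms(1,2)]]) (use assms(3,4) in blast)

lemma stage_norm_nonneg:
  assumes "n \<ge> 1" "f \<in> carrier (stage_algebra S n)"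
  shows "0 \<le> nrm (stage_algebra S n) f"
  unfolding stage_norm_eq by (rule cSup_upper[OF _ stage_norm_bdd[OF assms]]) blast

lemma position_exists:
  assumes "n \<ge> 1" "j \<in> {1..nblocks S (Suc n)}" "A < msize S (Suc n) j"
  obtains i e a where "i \<in> {1..nblocks S n}" "e \<in> edges S n i j" "a < msize S n i"
    "A = pos_offset S n j (i, e) + a"
proof -
  note bo = block_order[OF assms(1,2)]
  from offset_exists[of A "\<lambda>(i, e). msize S n i" "block_order S n j"] assms(3) block_sizes[OF assms(1,2)] bo
  obtain q a where q: "q \<in> set (block_order S n j)" "a < (\<lambda>(i, e). msize S n i) q"
    "A = offset (\<lambda>(i, e). msize S n i) (block_order S n j) q + a" by auto
  obtain i e where ie: "q = (i, e)" by (cases q)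
  from q bo ie have "i \<in> {1..nblocks S n}" "e \<in> edges S n i j" "a < msize S n i" by auto
  then show ?thesis using that q(3) ie by (simp add: pos_offset_def)
qed

lemma position_less:
  assumes "n \<ge> 1" "j \<in> {1..nblocks S (Suc n)}" "i \<in> {1..nblocks S n}" "e \<in> edges S n i j" "a < msize S n i"
  shows "pos_offset S n j (i, e) + a < msize S (Suc n) j"
  using offset_less[of "(i, e)" "block_order S n j" a "\<lambda>(i, e). msize S n i"] block_order[OF assms(1,2)] assms
    block_sizes[OF assms(1,2)] by (simp add: pos_offset_def)

lemma position_inj:
  assumes "n \<ge> 1" "j \<in> {1..nblocks S (Suc n)}"
    and "i \<in> {1..nblocks S n}" "e \<in> edges S n i j" "a < msize S n i"
    and "i' \<in> {1..nblocks S n}" "e' \<in> edges S n i' j" "a' < msize S n i'"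
    and "pos_offset S n j (i, e) + a = pos_offset S n j (i', e') + a'"
  shows "i = i'" "e = e'" "a = a'"
  using offset_inj[of "(i, e)" "block_order S n j" "(i', e')" a "\<lambda>(i, e). msize S n i" a']
    block_order[OF assms(1,2)] assms(3-9) by (simp_all add: pos_offset_def)

text \<open>In coordinates consisting of an edge and a local index, the connecting map composes
  entries with the eigenfunction of the edge and vanishes between different edges. Later
  computations with connecting maps rest on this formula, which also ties matrix indices to edges of
  the Bratteli diagram.\<close>

lemma connecting_map_index:
  assumes n: "n \<ge> 1" and f: "f \<in> carrier (stage_algebra S n)"
    and j: "j \<in> {1..nblocks S (Suc n)}" and x: "x \<in> topspace (base S (Suc n) j)"
    and ie: "i \<in> {1..nblocks S n}" "e \<in> edges S n i j" "a < msize S n i"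
    and ie': "i' \<in> {1..nblocks S n}" "e' \<in> edges S n i' j" "b < msize S n i'"
  shows "connecting_map S n f j x $$ (pos_offset S n j (i, e) + a, pos_offset S n j (i', e') + b) =
    (if i = i' \<and> e = e' then f i (eigenfun S n i j e x) $$ (a, b) else 0)"
proof -
  note bo = block_order[OF n j]
  have M: "(case q of (i, e) \<Rightarrow> f i (eigenfun S n i j e x)) \<in> carrier_mat ((\<lambda>(i, e). msize S n i) q) ((\<lambda>(i, e). msize S n i) q)"
    if "q \<in> set (block_order S n j)" for q
  proof -
    obtain i e where q: "q = (i, e)" by (cases q)
    with that bo have ie: "i \<in> {1..nblocks S n}" "e \<in> edges S n i j" by auto
    have "eigenfun S n i j e x \<in> topspace (base S n i)"
      using continuous_eigenfun[OF n ie(1) j ie(2)] x by (auto simp: continuous_map_def)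
    then show ?thesis using stage_carrierD(1)[OF f ie(1)] q by simp
  qed
  show ?thesis
    using diag_block_mat_index[of "block_order S n j" "\<lambda>(i, e). f i (eigenfun S n i j e x)" "\<lambda>(i, e). msize S n i"
        "(i, e)" "(i', e')" a b] M bo ie ie'
    by (simp add: connecting_map_def pointwise_apply[OF j x] pos_offset_def)
qed

lemma eigenfun_closed:
  assumes "n \<ge> 1" "i \<in> {1..nblocks S n}" "j \<in> {1..nblocks S (Suc n)}" "e \<in> edges S n i j"
    "x \<in> topspace (base S (Suc n) j)"
  shows "eigenfun S n i j e x \<in> topspace (base S n i)"
  using continuous_eigenfun[OF assms(1-4)] assms(5) by (auto simp: continuous_map_def)

lemma connecting_map_closed:
  assumes n: "n \<ge> 1" and f: "f \<in> carrier (stage_algebra S n)"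
  shows "connecting_map S n f \<in> carrier (stage_algebra S (Suc n))"
proof -
  let ?F = "\<lambda>j x. diag_block_mat (map (\<lambda>(i, e). f i (eigenfun S n i j e x)) (block_order S n j))"
  have "pointwise S (Suc n) ?F \<in> carrier (stage_algebra S (Suc n))"
  proof (rule pointwise_closed)
    fix j x assume j: "j \<in> {1..nblocks S (Suc n)}" and x: "x \<in> topspace (base S (Suc n) j)"
    have d: "dim_row (case q of (i, e) \<Rightarrow> f i (eigenfun S n i j e x)) = (case q of (i, e) \<Rightarrow> msize S n i)"
      "dim_col (case q of (i, e) \<Rightarrow> f i (eigenfun S n i j e x)) = (case q of (i, e) \<Rightarrow> msize S n i)"
      if "q \<in> set (block_order S n j)" for q
    proof -
      obtain i e where q: "q = (i, e)" by (cases q)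
      with that block_order[OF n j] have ie: "i \<in> {1..nblocks S n}" "e \<in> edges S n i j" by auto
      from carrier_matD[OF stage_carrierD(1)[OF f ie(1) eigenfun_closed[OF n ie(1) j ie(2) x]]]
      show "dim_row (case q of (i, e) \<Rightarrow> f i (eigenfun S n i j e x)) = (case q of (i, e) \<Rightarrow> msize S n i)"
        "dim_col (case q of (i, e) \<Rightarrow> f i (eigenfun S n i j e x)) = (case q of (i, e) \<Rightarrow> msize S n i)"
        by (simp_all add: q)
    qed
    show "?F j x \<in> carrier_mat (msize S (Suc n) j) (msize S (Suc n) j)"
      unfolding block_sizes[OF n j, symmetric]
      by (rule carrier_matI) (simp_all add: dim_diag_block_mat o_def d cong: map_cong)
  next
    fix j A B assume j: "j \<in> {1..nblocks S (Suc n)}" and AB: "A < msize S (Suc n) j" "B < msize S (Suc n) j"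
    obtain i e a where ie: "i \<in> {1..nblocks S n}" "e \<in> edges S n i j" "a < msize S n i"
      and A: "A = pos_offset S n j (i, e) + a" by (rule position_exists[OF n j AB(1)])
    obtain i' e' b where ie': "i' \<in> {1..nblocks S n}" "e' \<in> edges S n i' j" "b < msize S n i'"
      and B: "B = pos_offset S n j (i', e') + b" by (rule position_exists[OF n j AB(2)])
    have *: "?F j x $$ (A, B) = (if i = i' \<and> e = e' then f i (eigenfun S n i j e x) $$ (a, b) else 0)"
      if "x \<in> topspace (base S (Suc n) j)" for x
      using connecting_map_index[OF n f j that ie ie'] that A B
      by (simp add: connecting_map_def pointwise_apply[OF j that])
    show "continuous_map (base S (Suc n) j) euclidean (\<lambda>x. ?F j x $$ (A, B))"
    proof (cases "i = i' \<and> e = e'")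
      case True
      then have b: "b < msize S n i" using ie' by simp
      have "continuous_map (base S (Suc n) j) euclidean (\<lambda>x. f i (eigenfun S n i j e x) $$ (a, b))"
        using continuous_map_compose[OF continuous_eigenfun[OF n ie(1) j ie(2)] stage_carrierD(2)[OF f ie(1,3) b]]
        by (simp add: o_def)
      then show ?thesis by (rule continuous_map_eq) (use * True in simp)
    next
      case False
      have "continuous_map (base S (Suc n) j) euclidean (\<lambda>x. 0 :: complex)" by simp
      then show ?thesis by (rule continuous_map_eq) (use * False in auto)
    qed
  qed
  then show ?thesis by (simp add: connecting_map_def)
qed

lemma connecting_map_diagonal:
  assumes n: "n \<ge> 1" and f: "f \<in> diagonal_part S n"
  shows "connecting_map S n f \<in> diagonal_part S (Suc n)"
proof (rule diagonal_partI[OF connecting_map_closed[OF n diagonal_partD(1)[OF f]]])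
  fix j x A B assume j: "j \<in> {1..nblocks S (Suc n)}" and x: "x \<in> topspace (base S (Suc n) j)"
    and AB: "A < msize S (Suc n) j" "B < msize S (Suc n) j" and ne: "A \<noteq> B"
  obtain i e a where ie: "i \<in> {1..nblocks S n}" "e \<in> edges S n i j" "a < msize S n i"
    and A: "A = pos_offset S n j (i, e) + a" by (rule position_exists[OF n j AB(1)])
  obtain i' e' b where ie': "i' \<in> {1..nblocks S n}" "e' \<in> edges S n i' j" "b < msize S n i'"
    and B: "B = pos_offset S n j (i', e') + b" by (rule position_exists[OF n j AB(2)])
  show "connecting_map S n f j x $$ (A, B) = 0"
    unfolding A B connecting_map_index[OF n diagonal_partD(1)[OF f] j x ie ie']
    using diagonal_partD(2)[OF f ie(1) eigenfun_closed[OF n ie(1) j ie(2) x] ie(3), of b] ie' ne A B by auto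
qed

text \<open>A point missed by all eigenfunctions could be separated from their closed joint image by a
  continuous function, which the connecting map would send to 0.\<close>

lemma eigenfun_jointly_surj:
  assumes n: "n \<ge> 1" and i: "i \<in> {1..nblocks S n}" and x: "x \<in> topspace (base S n i)"
  obtains j e y where "j \<in> {1..nblocks S (Suc n)}" "e \<in> edges S n i j" "y \<in> topspace (base S (Suc n) j)"
    "eigenfun S n i j e y = x"
proof (rule ccontr)
  assume "\<not> thesis"
  note missed = this that
  let ?X = "base S n i"
  define K where "K = (\<Union>j\<in>{1..nblocks S (Suc n)}. \<Union>e\<in>edges S n i j. eigenfun S n i j e ` topspace (base S (Suc n) j))"
  have cl: "closedin ?X (eigenfun S n i j e ` topspace (base S (Suc n) j))"
    if j: "j \<in> {1..nblocks S (Suc n)}" and e: "e \<in> edges S n i j" for j e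
    using image_compactin[OF _ continuous_eigenfun[OF n i j e]] compact_base[of "Suc n" j] j
      compactin_imp_closedin[OF Hausdorff_base[OF n i]] by (simp add: compact_space_def)
  have "closedin ?X (\<Union>e\<in>edges S n i j. eigenfun S n i j e ` topspace (base S (Suc n) j))"
    if j: "j \<in> {1..nblocks S (Suc n)}" for j
    by (rule closedin_Union) (use finite_edges[OF n i j] cl[OF j] in auto)
  then have K: "closedin ?X K"
    unfolding K_def by (intro closedin_Union finite_imageI finite_atLeastAtMost) blast
  have xK: "x \<notin> K" using missed unfolding K_def by blast
  have "closedin ?X {x}" using closedin_Hausdorff_singleton[OF Hausdorff_base[OF n i] x] .
  moreover have "normal_space ?X"
    using compact_base[OF n i] Hausdorff_base[OF n i] compact_Hausdorff_or_regular_imp_normal_space by blast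
  moreover have "disjnt {x} K" using xK by simp
  ultimately obtain f where f: "continuous_map ?X euclideanreal f" "f ` {x} \<subseteq> {1}" "f ` K \<subseteq> {0}"
    using K Urysohn_lemma_alt by metis
  let ?g = "\<lambda>y. complex_of_real (f y)"
  have g: "continuous_map ?X euclidean ?g"
    using continuous_map_compose[OF f(1), of euclidean complex_of_real] by (simp add: o_def continuous_on_of_real)
  let ?F = "matrix_unit S n i 0 0 ?g" and ?Z = "matrix_unit S n i 0 0 (\<lambda>_. 0)"
  have F: "?F \<in> carrier (stage_algebra S n)" by (rule matrix_unit_closed[OF g])
  have Z: "?Z \<in> carrier (stage_algebra S n)" by (rule matrix_unit_closed) simp
  have "connecting_map S n ?F = connecting_map S n ?Z"
  proof (rule stage_eqI[OF connecting_map_closed[OF n F] connecting_map_closed[OF n Z]])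
    fix j y A B assume j: "j \<in> {1..nblocks S (Suc n)}" and y: "y \<in> topspace (base S (Suc n) j)"
      and AB: "A < msize S (Suc n) j" "B < msize S (Suc n) j"
    obtain i1 e1 a where ie: "i1 \<in> {1..nblocks S n}" "e1 \<in> edges S n i1 j" "a < msize S n i1"
      and A: "A = pos_offset S n j (i1, e1) + a" by (rule position_exists[OF n j AB(1)])
    obtain i2 e2 b where ie': "i2 \<in> {1..nblocks S n}" "e2 \<in> edges S n i2 j" "b < msize S n i2"
      and B: "B = pos_offset S n j (i2, e2) + b" by (rule position_exists[OF n j AB(2)])
    have eqv: "?F i1 (eigenfun S n i1 j e1 y) $$ (a, b) = ?Z i1 (eigenfun S n i1 j e1 y) $$ (a, b)" if "i1 = i2"
    proof -
      have "f (eigenfun S n i j e1 y) = 0" if "i1 = i" using that f(3) ie j y unfolding K_def by blast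
      then show ?thesis
        using matrix_unit_index[OF ie(1) eigenfun_closed[OF n ie(1) j ie(2) y] ie(3), of b] ie'(3) that by simp
    qed
    show "connecting_map S n ?F j y $$ (A, B) = connecting_map S n ?Z j y $$ (A, B)"
      unfolding A B connecting_map_index[OF n F j y ie ie'] connecting_map_index[OF n Z j y ie ie']
      by (rule if_cong[OF refl eqv refl]) simp
  qed
  then have eq: "?F = ?Z" using injective[OF n] F Z by (auto dest: inj_onD)
  have m: "0 < msize S n i" using msize_pos[OF n i] by simp
  have "?F i x $$ (0, 0) = 1" using f(2) by (simp add: matrix_unit_index[OF i x m m])
  moreover have "?Z i x $$ (0, 0) = 0" by (simp add: matrix_unit_index[OF i x m m])
  ultimately show False using eq by simp
qed

end

section \<open>Paths and matrix positions\<close>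

text \<open>Read off from the source of edge \<open>n\<close> rather than the target of the edge
  before it, so that it depends on the tail alone; \<open>vertex_prefix\<close> supplies the
  dependence on the prefix.\<close>

definition vertex :: "(nat \<Rightarrow> 'e bedge) \<Rightarrow> nat \<Rightarrow> nat" where
  "vertex x n = snd (edge_start (x n))"

text \<open>The first \<open>n\<close> edges of \<open>x\<close> correspond to the matrix index \<open>path_pos S x n\<close> of the block
  \<open>vertex x n\<close> at stage \<open>n\<close>; the value at \<open>n = 0\<close> is irrelevant.\<close>

primrec path_pos :: "('x, 'e) ah_system \<Rightarrow> (nat \<Rightarrow> 'e bedge) \<Rightarrow> nat \<Rightarrow> nat" where
  "path_pos S x 0 = 0"
| "path_pos S x (Suc n) = (case x n of Root_edge l j \<Rightarrow> l
     | Edge m i j e \<Rightarrow> pos_offset S n j (i, e) + path_pos S x n)"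

lemma infinite_pathsD:
  assumes "x \<in> infinite_paths S"
  shows "x k \<in> bratteli_edges S k" "edge_end (x k) = edge_start (x (Suc k))"
  using assms by (auto simp: infinite_paths_def)

lemma path_0:
  assumes "x \<in> infinite_paths S"
  shows "x 0 = Root_edge (path_pos S x 1) (vertex x 1)" "vertex x 1 \<in> {1..nblocks S 1}"
    "path_pos S x 1 < msize S 1 (vertex x 1)"
proof -
  obtain l j where "x 0 = Root_edge l j" "j \<in> {1..nblocks S 1}" "l < msize S 1 j"
    using infinite_pathsD(1)[OF assms, of 0] by (auto simp: bratteli_edges_def)
  moreover from this have "vertex x 1 = j"
    using infinite_pathsD(2)[OF assms, of 0] by (simp add: vertex_def) (metis snd_conv)
  ultimately show "x 0 = Root_edge (path_pos S x 1) (vertex x 1)" "vertex x 1 \<in> {1..nblocks S 1}"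
    "path_pos S x 1 < msize S 1 (vertex x 1)" by simp_all
qed

lemma path_Suc:
  assumes "x \<in> infinite_paths S" "n \<ge> 1"
  obtains e where "x n = Edge n (vertex x n) (vertex x (Suc n)) e"
    "e \<in> edges S n (vertex x n) (vertex x (Suc n))"
    "vertex x n \<in> {1..nblocks S n}" "vertex x (Suc n) \<in> {1..nblocks S (Suc n)}"
    "path_pos S x (Suc n) = pos_offset S n (vertex x (Suc n)) (vertex x n, e) + path_pos S x n"
proof -
  obtain i j e where e: "x n = Edge n i j e" "i \<in> {1..nblocks S n}" "j \<in> {1..nblocks S (Suc n)}" "e \<in> edges S n i j"
    using infinite_pathsD(1)[OF assms(1), of n] assms(2) by (auto simp: bratteli_edges_def)
  have "vertex x n = i" using e(1) by (simp add: vertex_def)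
  moreover have "vertex x (Suc n) = j"
    using infinite_pathsD(2)[OF assms(1), of n] e(1) by (simp add: vertex_def) (metis snd_conv)
  ultimately show ?thesis using that[of e] e by simp
qed

lemma vertex_in:
  assumes "x \<in> infinite_paths S" "n \<ge> 1"
  shows "vertex x n \<in> {1..nblocks S n}"
  using path_Suc[OF assms] by metis

lemma edge_start_path:
  assumes "x \<in> infinite_paths S" "n \<ge> 1"
  shows "edge_start (x n) = (n, vertex x n)"
  using path_Suc[OF assms] by (metis edge_start.simps(2))

lemma vertex_tail: "x n = y n \<Longrightarrow> vertex x n = vertex y n"
  by (simp add: vertex_def)

lemma vertex_prefix:
  assumes "x \<in> infinite_paths S" "y \<in> infinite_paths S" "x n = y n"
  shows "vertex x (Suc n) = vertex y (Suc n)"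
  using infinite_pathsD(2)[OF assms(1), of n] infinite_pathsD(2)[OF assms(2), of n] assms(3)
  by (simp add: vertex_def)

lemma path_pos_cong: "(\<And>k. k < n \<Longrightarrow> x k = y k) \<Longrightarrow> path_pos S x n = path_pos S y n"
  by (induction n) (auto split: bedge.split)

context diagonal_AH_system
begin

lemma path_pos_less:
  assumes x: "x \<in> infinite_paths S" and "n \<ge> 1"
  shows "path_pos S x n < msize S n (vertex x n)"
  using assms(2)
proof (induction n rule: dec_induct)
  case base
  show ?case by (rule path_0(3)[OF x])
next
  case (step n)
  obtain e where e: "x n = Edge n (vertex x n) (vertex x (Suc n)) e"
    "e \<in> edges S n (vertex x n) (vertex x (Suc n))"
    "vertex x n \<in> {1..nblocks S n}" "vertex x (Suc n) \<in> {1..nblocks S (Suc n)}"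
    "path_pos S x (Suc n) = pos_offset S n (vertex x (Suc n)) (vertex x n, e) + path_pos S x n"
    by (rule path_Suc[OF x step(1)])
  show ?case unfolding e(5) by (rule position_less[OF step(1) e(4,3,2) step.IH])
qed

text \<open>The last edge and the preceding index are decoded from the matrix index by
  \<open>position_inj\<close>, and induction does the rest. Equality of the vertices enters because
  an index is meaningful only inside its block.\<close>

lemma path_pos_inj:
  assumes x: "x \<in> infinite_paths S" and y: "y \<in> infinite_paths S" and "n \<ge> 1"
    and "vertex x n = vertex y n" "path_pos S x n = path_pos S y n" "k < n"
  shows "x k = y k"
  using assms(3-6)
proof (induction n rule: dec_induct)
  case base
  then have "k = 0" by simp
  show ?case unfolding \<open>k = 0\<close> path_0(1)[OF x] path_0(1)[OF y] base.prems(1,2) ..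
next
  case (step n)
  obtain e where e: "x n = Edge n (vertex x n) (vertex x (Suc n)) e"
    "e \<in> edges S n (vertex x n) (vertex x (Suc n))"
    "vertex x n \<in> {1..nblocks S n}" "vertex x (Suc n) \<in> {1..nblocks S (Suc n)}"
    "path_pos S x (Suc n) = pos_offset S n (vertex x (Suc n)) (vertex x n, e) + path_pos S x n"
    by (rule path_Suc[OF x step(1)])
  obtain d where d: "y n = Edge n (vertex y n) (vertex y (Suc n)) d"
    "d \<in> edges S n (vertex y n) (vertex y (Suc n))"
    "vertex y n \<in> {1..nblocks S n}" "vertex y (Suc n) \<in> {1..nblocks S (Suc n)}"
    "path_pos S y (Suc n) = pos_offset S n (vertex y (Suc n)) (vertex y n, d) + path_pos S y n"
    by (rule path_Suc[OF y step(1)])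
  note d' = d[folded step.prems(1)]
  have "pos_offset S n (vertex x (Suc n)) (vertex x n, e) + path_pos S x n =
      pos_offset S n (vertex x (Suc n)) (vertex y n, d) + path_pos S y n"
    using step.prems(2) unfolding e(5) d'(5) .
  note eq = position_inj[OF step(1) e(4) e(3,2) path_pos_less[OF x step(1)] d'(3,2) path_pos_less[OF y step(1)] this]
  show ?case
  proof (cases "k = n")
    case True
    then show ?thesis using e(1) d(1) eq step.prems(1) by simp
  next
    case False
    then show ?thesis using step.IH eq step.prems(3) by simp
  qed
qed

text \<open>Converse of \<open>path_pos_inj\<close>: a matrix index is decoded downwards, edge by
  edge, with \<open>position_exists\<close>. The finite path is given as a function whose values
  from \<open>n\<close> on are arbitrary.\<close>

lemma path_prefix_exists:
  assumes "n \<ge> 1" "j \<in> {1..nblocks S n}" "b < msize S n j"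
  shows "\<exists>p. (\<forall>k<n. p k \<in> bratteli_edges S k) \<and> (\<forall>k. Suc k < n \<longrightarrow> edge_end (p k) = edge_start (p (Suc k))) \<and>
    edge_end (p (n - 1)) = (n, j) \<and> path_pos S p n = b"
  using assms
proof (induction n arbitrary: j b rule: dec_induct)
  case base
  then show ?case by (intro exI[of _ "\<lambda>_. Root_edge b j"]) (auto simp: bratteli_edges_def)
next
  case (step n)
  obtain i e a where ie: "i \<in> {1..nblocks S n}" "e \<in> edges S n i j" "a < msize S n i"
    "b = pos_offset S n j (i, e) + a"
    using position_exists[OF step(1) step.prems] by metis
  from step.IH[OF ie(1,3)] obtain p where p: "\<And>k. k < n \<Longrightarrow> p k \<in> bratteli_edges S k"
    "\<And>k. Suc k < n \<Longrightarrow> edge_end (p k) = edge_start (p (Suc k))"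
    "edge_end (p (n - 1)) = (n, i)" "path_pos S p n = a" by blast
  let ?p = "p(n := Edge n i j e)"
  have "path_pos S ?p n = a" using path_pos_cong[of n ?p p S] p(4) by simp
  then have 1: "path_pos S ?p (Suc n) = b" using ie(4) by simp
  have 2: "?p k \<in> bratteli_edges S k" if "k < Suc n" for k
    using that p(1)[of k] ie step(1) step.prems by (auto simp: bratteli_edges_def less_Suc_eq)
  have 3: "edge_end (?p k) = edge_start (?p (Suc k))" if "Suc k < Suc n" for k
    using that p(2)[of k] p(3) by (cases "Suc k = n") auto
  have 4: "edge_end (?p (Suc n - 1)) = (Suc n, j)" by simp
  show ?case by (intro exI[of _ ?p] conjI allI impI 1 2 3 4)
qed

lemma path_splice:
  assumes x: "x \<in> infinite_paths S" and n: "n \<ge> 1" and b: "b < msize S n (vertex x n)"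
  shows "\<exists>y\<in>infinite_paths S. (\<forall>k\<ge>n. y k = x k) \<and> path_pos S y n = b"
proof -
  obtain p where p: "\<And>k. k < n \<Longrightarrow> p k \<in> bratteli_edges S k"
    "\<And>k. Suc k < n \<Longrightarrow> edge_end (p k) = edge_start (p (Suc k))"
    "edge_end (p (n - 1)) = (n, vertex x n)" "path_pos S p n = b"
    using path_prefix_exists[OF n vertex_in[OF x n] b] by blast
  define y where "y = (\<lambda>k. if k < n then p k else x k)"
  have "y k \<in> bratteli_edges S k" for k
    using p(1)[of k] infinite_pathsD(1)[OF x, of k] by (simp add: y_def)
  moreover have "edge_end (y k) = edge_start (y (Suc k))" for k
  proof -
    consider "Suc k < n" | "Suc k = n" | "k \<ge> n" by linarith
    then show ?thesis
    proof cases
      case 2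
      then have "y k = p (n - 1)" "y (Suc k) = x n" by (auto simp: y_def)
      then show ?thesis using p(3) edge_start_path[OF x n] by simp
    qed (use p(2)[of k] infinite_pathsD(2)[OF x, of k] in \<open>auto simp: y_def\<close>)
  qed
  ultimately have "y \<in> infinite_paths S" by (simp add: infinite_paths_def)
  moreover have "path_pos S y n = b" using path_pos_cong[of n y p S] p(4) by (simp add: y_def)
  ultimately show ?thesis by (intro bexI[of _ y]) (auto simp: y_def)
qed

text \<open>Meaningful only for \<open>b < msize S n (vertex x n)\<close>, when exactly one such path exists.\<close>

definition replace_prefix :: "nat \<Rightarrow> (nat \<Rightarrow> 'e bedge) \<Rightarrow> nat \<Rightarrow> (nat \<Rightarrow> 'e bedge)" where
  "replace_prefix n x b = (SOME y. y \<in> infinite_paths S \<and> (\<forall>k\<ge>n. y k = x k) \<and> path_pos S y n = b)"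

lemma replace_prefix:
  assumes "x \<in> infinite_paths S" "n \<ge> 1" "b < msize S n (vertex x n)"
  shows "replace_prefix n x b \<in> infinite_paths S" "k \<ge> n \<Longrightarrow> replace_prefix n x b k = x k"
    "path_pos S (replace_prefix n x b) n = b" "vertex (replace_prefix n x b) n = vertex x n"
proof -
  have *: "replace_prefix n x b \<in> infinite_paths S \<and> (\<forall>k\<ge>n. replace_prefix n x b k = x k) \<and>
      path_pos S (replace_prefix n x b) n = b"
  proof -
    have "\<exists>y. y \<in> infinite_paths S \<and> (\<forall>k\<ge>n. y k = x k) \<and> path_pos S y n = b"
      using path_splice[OF assms] by blast
    from someI_ex[OF this] show ?thesis unfolding replace_prefix_def .
  qed
  then show "replace_prefix n x b \<in> infinite_paths S" "k \<ge> n \<Longrightarrow> replace_prefix n x b k = x k"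
    "path_pos S (replace_prefix n x b) n = b" by blast+
  show "vertex (replace_prefix n x b) n = vertex x n" by (rule vertex_tail[of _ n]) (use * in simp)
qed

lemma path_eqI:
  assumes "x \<in> infinite_paths S" "y \<in> infinite_paths S" "n \<ge> 1" "\<And>k. k \<ge> n \<Longrightarrow> x k = y k"
    "path_pos S x n = path_pos S y n"
  shows "x = y"
proof
  fix k
  show "x k = y k"
  proof (cases "k < n")
    case True
    show ?thesis by (rule path_pos_inj[OF assms(1-3) vertex_tail[of x n y, OF assms(4)[OF order_refl]] assms(5) True])
  qed (use assms(4) in simp)
qed

lemma replace_prefix_unique:
  assumes x: "x \<in> infinite_paths S" and y: "y \<in> infinite_paths S" and n: "n \<ge> 1"
    and tail: "\<And>k. k \<ge> n \<Longrightarrow> y k = x k"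
  shows "replace_prefix n x (path_pos S y n) = y" "path_pos S y n < msize S n (vertex x n)"
proof -
  have v: "vertex y n = vertex x n" by (rule vertex_tail) (use tail in simp)
  show *: "path_pos S y n < msize S n (vertex x n)" using path_pos_less[OF y n] v by simp
  show "replace_prefix n x (path_pos S y n) = y"
    by (rule path_eqI[OF replace_prefix(1)[OF x n *] y n]) (use replace_prefix[OF x n *] tail in auto)
qed

end

section \<open>The tail groupoid\<close>

text \<open>Indexed by an arrow and a level instead of two finite paths, as a candidate
  neighbourhood of that arrow. It contains an arrow \<open>g\<close> exactly when the two paths of
  \<open>g\<close> agree from level \<open>n\<close> on.\<close>

definition cylinder ::
  "('x, 'e) ah_system \<Rightarrow> nat \<Rightarrow> (nat \<Rightarrow> 'e bedge) \<times> (nat \<Rightarrow> 'e bedge) \<Rightarrow> ((nat \<Rightarrow> 'e bedge) \<times> (nat \<Rightarrow> 'e bedge)) set" where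
  "cylinder S n g = {(x, y). x \<in> infinite_paths S \<and> y \<in> infinite_paths S \<and>
     (\<forall>k<n. x k = fst g k \<and> y k = snd g k) \<and> (\<forall>k\<ge>n. x k = y k)}"

definition tail_arrows :: "('x, 'e) ah_system \<Rightarrow> ((nat \<Rightarrow> 'e bedge) \<times> (nat \<Rightarrow> 'e bedge)) set" where
  "tail_arrows S = {(x, y). x \<in> infinite_paths S \<and> y \<in> infinite_paths S \<and> (\<exists>m. \<forall>k\<ge>m. x k = y k)}"

lemma topspace_tail: "topspace (arrows (tail_groupoid S)) = tail_arrows S"
  by (simp only: topspace_tail_groupoid tail_arrows_def)

lemma tail_arrowsI:
  assumes "x \<in> infinite_paths S" "y \<in> infinite_paths S" "\<forall>k\<ge>m. x k = y k"
  shows "(x, y) \<in> tail_arrows S"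
  using assms by (auto simp only: tail_arrows_def)

lemma tail_arrowsD:
  assumes "(x, y) \<in> tail_arrows S"
  shows "x \<in> infinite_paths S" "y \<in> infinite_paths S"
  using assms by (auto simp only: tail_arrows_def)

lemma agree_beyond:
  assumes "(x, y) \<in> tail_arrows S"
  obtains n where "n \<ge> N" "\<forall>k\<ge>n. x k = y k"
proof -
  from assms have "\<exists>m. \<forall>k\<ge>m. x k = y k" unfolding tail_arrows_def by blast
  then obtain m where m: "\<forall>k\<ge>m. x k = y k" by blast
  have "\<forall>k\<ge>max N m. x k = y k" using m by auto
  then show ?thesis by (rule that[OF max.cobounded1])
qed

lemma tail_trans:
  assumes "(x, y) \<in> tail_arrows S" "(y, z) \<in> tail_arrows S"
  shows "(x, z) \<in> tail_arrows S"
proof -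
  obtain m where m: "\<forall>k\<ge>m. x k = y k" by (rule agree_beyond[OF assms(1)])
  obtain n where n: "n \<ge> m" "\<forall>k\<ge>n. y k = z k" by (rule agree_beyond[OF assms(2)])
  have "\<forall>k\<ge>n. x k = z k" using m n by (metis le_trans)
  then show ?thesis using tail_arrowsD[OF assms(1)] tail_arrowsD[OF assms(2)] by (intro tail_arrowsI)
qed

lemma tail_sym: "(x, y) \<in> tail_arrows S \<Longrightarrow> (y, x) \<in> tail_arrows S"
  unfolding tail_arrows_def by (simp add: eq_commute)

lemma tail_refl: "x \<in> infinite_paths S \<Longrightarrow> (x, x) \<in> tail_arrows S"
  by (simp add: tail_arrows_def)

lemma cylinder_iff: "(x, y) \<in> cylinder S n (x', y') \<longleftrightarrow> x \<in> infinite_paths S \<and> y \<in> infinite_paths S \<and>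
     (\<forall>k<n. x k = x' k \<and> y k = y' k) \<and> (\<forall>k\<ge>n. x k = y k)"
  by (simp add: cylinder_def)

lemma cylinder_self: "(x, y) \<in> tail_arrows S \<Longrightarrow> \<forall>k\<ge>n. x k = y k \<Longrightarrow> (x, y) \<in> cylinder S n (x, y)"
  by (auto simp: cylinder_def tail_arrowsD)

lemma openin_cylinder:
  assumes g: "(x, y) \<in> tail_arrows S" and n: "\<forall>k\<ge>n. x k = y k"
  shows "openin (arrows (tail_groupoid S)) (cylinder S n (x, y))"
proof -
  note xy = tail_arrowsD[OF g]
  have fin: "map z [0..<n] \<in> finite_paths S" if "z \<in> infinite_paths S" for z
    using that by (auto simp: infinite_paths_def finite_paths_def)
  have "path_end (map z [0..<n]) = (if n = 0 then (0, 0) else edge_start (z n))"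
    if "z \<in> infinite_paths S" for z
    using that by (cases n) (auto simp: path_end_def infinite_paths_def)
  then have e: "path_end (map x [0..<n]) = path_end (map y [0..<n])" using xy n by simp
  have "cylinder S n (x, y) = path_cylinder S (map x [0..<n]) (map y [0..<n])"
    by (auto simp: cylinder_def path_cylinder_def)
  then have "cylinder S n (x, y) \<in> {path_cylinder S p q | p q.
       p \<in> finite_paths S \<and> q \<in> finite_paths S \<and> length p = length q \<and> path_end p = path_end q}"
    using fin[OF xy(1)] fin[OF xy(2)] e by fastforce
  then show ?thesis by (simp add: tail_groupoid_def topology_generated_by_Basis)
qed

lemma path_cylinder_superset:
  assumes "(x, y) \<in> path_cylinder S p q" "length p = length q" "n \<ge> length p"
  shows "cylinder S n (x, y) \<subseteq> path_cylinder S p q"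
proof
  fix g' assume "g' \<in> cylinder S n (x, y)"
  moreover obtain x' y' where g': "g' = (x', y')" by (cases g')
  ultimately have g2: "x' \<in> infinite_paths S" "y' \<in> infinite_paths S" "\<And>k. k < n \<Longrightarrow> x' k = x k"
    "\<And>k. k < n \<Longrightarrow> y' k = y k" "\<And>k. k \<ge> n \<Longrightarrow> x' k = y' k" by (auto simp: cylinder_iff)
  have g: "map x [0..<length p] = p" "map y [0..<length q] = q" "\<And>k. k \<ge> length p \<Longrightarrow> x k = y k"
    using assms(1) by (auto simp: path_cylinder_def)
  have "map x' [0..<length p] = map x [0..<length p]" "map y' [0..<length q] = map y [0..<length q]"
    using assms(2,3) g2(3,4) by auto
  then have m: "map x' [0..<length p] = p" "map y' [0..<length q] = q" by (simp_all only: g)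
  have "x' k = y' k" if "k \<ge> length p" for k
  proof (cases "k < n")
    case True
    show ?thesis unfolding g2(3)[OF True] g2(4)[OF True] by (rule g(3)[OF that])
  next
    case False
    then show ?thesis by (intro g2(5)) simp
  qed
  with m g2(1,2) show "g' \<in> path_cylinder S p q" by (simp only: g' path_cylinder_def mem_Collect_eq case_prod_conv) blast
qed

text \<open>The condition speaks of all sufficiently large levels, so that intersections only need
  the larger of two bounds. Conversely, at a level beyond which both paths of an arrow agree, its
  cylinder is open and contains it.\<close>

lemma openin_tail_iff:
  "openin (arrows (tail_groupoid S)) U \<longleftrightarrow>
     U \<subseteq> tail_arrows S \<and> (\<forall>g\<in>U. \<exists>N. \<forall>n\<ge>N. cylinder S n g \<subseteq> U)"
proof
  assume U: "openin (arrows (tail_groupoid S)) U"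
  then have "generate_topology_on {path_cylinder S p q | p q.
       p \<in> finite_paths S \<and> q \<in> finite_paths S \<and> length p = length q \<and> path_end p = path_end q} U"
    by (simp add: tail_groupoid_def openin_topology_generated_by_iff)
  then have "\<forall>g\<in>U. \<exists>N. \<forall>n\<ge>N. cylinder S n g \<subseteq> U"
  proof induction
    case (Int a b)
    show ?case
    proof
      fix g assume "g \<in> a \<inter> b"
      then have g: "g \<in> a" "g \<in> b" by simp_all
      obtain N where N: "\<forall>n\<ge>N. cylinder S n g \<subseteq> a" using bspec[OF Int.IH(1) g(1)] by blast
      obtain M where M: "\<forall>n\<ge>M. cylinder S n g \<subseteq> b" using bspec[OF Int.IH(2) g(2)] by blast
      have "\<forall>n\<ge>max N M. cylinder S n g \<subseteq> a \<inter> b" using N M by auto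
      then show "\<exists>N. \<forall>n\<ge>N. cylinder S n g \<subseteq> a \<inter> b" ..
    qed
  next
    case (UN K)
    show ?case
    proof
      fix g assume "g \<in> \<Union> K"
      then obtain k where k: "k \<in> K" "g \<in> k" by (rule UnionE)
      obtain N where "\<forall>n\<ge>N. cylinder S n g \<subseteq> k" using bspec[OF UN.IH[OF k(1)] k(2)] by blast
      then have "\<forall>n\<ge>N. cylinder S n g \<subseteq> \<Union> K" using k(1) by blast
      then show "\<exists>N. \<forall>n\<ge>N. cylinder S n g \<subseteq> \<Union> K" ..
    qed
  next
    case (Basis s)
    then obtain p q where s: "s = path_cylinder S p q" "length p = length q" by blast
    show ?case
    proof
      fix g assume g: "g \<in> s"
      obtain x y where xy: "g = (x, y)" by (cases g)
      have "\<forall>n\<ge>length p. cylinder S n g \<subseteq> s"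
        using path_cylinder_superset[OF _ s(2), of x y S] g unfolding xy s(1) by blast
      then show "\<exists>N. \<forall>n\<ge>N. cylinder S n g \<subseteq> s" ..
    qed
  qed simp
  then show "U \<subseteq> tail_arrows S \<and> (\<forall>g\<in>U. \<exists>N. \<forall>n\<ge>N. cylinder S n g \<subseteq> U)"
    using openin_subset[OF U] by (simp add: topspace_tail)
next
  assume U: "U \<subseteq> tail_arrows S \<and> (\<forall>g\<in>U. \<exists>N. \<forall>n\<ge>N. cylinder S n g \<subseteq> U)"
  show "openin (arrows (tail_groupoid S)) U"
    unfolding openin_subopen[of _ U]
  proof
    fix g assume g: "g \<in> U"
    obtain x y where xy: "g = (x, y)" by (cases g)
    have t: "(x, y) \<in> tail_arrows S" using U g xy by blast
    obtain N where N: "\<forall>n\<ge>N. cylinder S n g \<subseteq> U" using U g by blast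
    obtain n where n: "n \<ge> N" "\<forall>k\<ge>n. x k = y k" by (rule agree_beyond[OF t])
    have "cylinder S n (x, y) \<subseteq> U" using N n(1) xy by blast
    then show "\<exists>T. openin (arrows (tail_groupoid S)) T \<and> g \<in> T \<and> T \<subseteq> U"
      using openin_cylinder[OF t n(2)] cylinder_self[OF t n(2)] unfolding xy by blast
  qed
qed

text \<open>Open sets contain the cylinders of all large levels, so checking some level beyond each
  \<open>N\<close> is enough.\<close>

lemma continuous_into_tailI:
  assumes "\<And>g. g \<in> topspace X \<Longrightarrow> f g \<in> tail_arrows S"
    and "\<And>g N. g \<in> topspace X \<Longrightarrow> \<exists>n\<ge>N. \<exists>T. openin X T \<and> g \<in> T \<and> (\<forall>h\<in>T. f h \<in> cylinder S n (f g))"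
  shows "continuous_map X (arrows (tail_groupoid S)) f"
  unfolding continuous_map_def
proof (intro conjI allI impI)
  show "f \<in> topspace X \<rightarrow> topspace (arrows (tail_groupoid S))"
    by (rule funcsetI) (simp only: topspace_tail assms(1))
  fix U assume U: "openin (arrows (tail_groupoid S)) U"
  show "openin X {x \<in> topspace X. f x \<in> U}"
    unfolding openin_subopen[of X "{x \<in> topspace X. f x \<in> U}"]
  proof
    fix g assume g: "g \<in> {x \<in> topspace X. f x \<in> U}"
    then obtain N where N: "\<forall>n\<ge>N. cylinder S n (f g) \<subseteq> U"
      using bspec[OF conjunct2[OF iffD1[OF openin_tail_iff U]], of "f g"] by auto
    obtain n T where T: "n \<ge> N" "openin X T" "g \<in> T" "\<forall>h\<in>T. f h \<in> cylinder S n (f g)"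
      using assms(2)[of g N] g by blast
    have "T \<subseteq> {x \<in> topspace X. f x \<in> U}" using N T openin_subset[OF T(2)] by blast
    then show "\<exists>T. openin X T \<and> g \<in> T \<and> T \<subseteq> {x \<in> topspace X. f x \<in> U}" using T by blast
  qed
qed

lemma tail_groupoid_simps:
  "src (tail_groupoid S) (x, y) = (y, y)" "rng (tail_groupoid S) (x, y) = (x, x)"
  "gmul (tail_groupoid S) (x, y) (y', z) = (x, z)" "ginv (tail_groupoid S) (x, y) = (y, x)"
  by (simp_all add: tail_groupoid_def)

lemma tail_units: "src (tail_groupoid S) ` topspace (arrows (tail_groupoid S)) = {(x, x) | x. x \<in> infinite_paths S}"
  unfolding topspace_tail
proof (intro Set.set_eqI iffI)
  fix g assume "g \<in> {(x, x) | x. x \<in> infinite_paths S}"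
  then obtain x where "g = (x, x)" "x \<in> infinite_paths S" by blast
  then show "g \<in> src (tail_groupoid S) ` tail_arrows S"
    by (intro image_eqI[of _ _ "(x, x)"]) (simp_all add: tail_groupoid_simps tail_refl)
qed (auto simp: tail_groupoid_simps dest: tail_arrowsD)

lemma tail_continuous_mul:
  "continuous_map (subtopology (prod_topology (arrows (tail_groupoid S)) (arrows (tail_groupoid S)))
     {(g, h). src (tail_groupoid S) g = rng (tail_groupoid S) h})
   (arrows (tail_groupoid S)) (\<lambda>(g, h). gmul (tail_groupoid S) g h)" (is "continuous_map ?X _ _")
proof (rule continuous_into_tailI)
  fix gh assume "gh \<in> topspace ?X"
  moreover obtain x y y' z where gh': "gh = ((x, y), (y', z))" by (metis surj_pair)
  ultimately have gh: "gh = ((x, y), (y, z))"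
    and xy: "(x, y) \<in> tail_arrows S" and yz: "(y, z) \<in> tail_arrows S"
    by (auto simp: topspace_tail tail_groupoid_simps)
  show "(\<lambda>(g, h). gmul (tail_groupoid S) g h) gh \<in> tail_arrows S"
    using tail_trans[OF xy yz] gh by (simp add: tail_groupoid_simps)
  fix N
  obtain m where m: "m \<ge> N" "\<forall>k\<ge>m. x k = y k" by (rule agree_beyond[OF xy])
  obtain n where n: "n \<ge> m" "\<forall>k\<ge>n. y k = z k" by (rule agree_beyond[OF yz])
  have m': "\<forall>k\<ge>n. x k = y k" using m n(1) by auto
  let ?D = "{(g, h). src (tail_groupoid S) g = rng (tail_groupoid S) h}"
  let ?T = "(cylinder S n (x, y) \<times> cylinder S n (y, z)) \<inter> ?D"
  have "openin ?X ?T"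
    using openin_cylinder[OF xy m'] openin_cylinder[OF yz n(2)]
    by (intro openin_subtopology_Int) (simp add: openin_prod_Times_iff)
  moreover have "gh \<in> ?T"
    using cylinder_self[OF xy m'] cylinder_self[OF yz n(2)] gh by (auto simp: tail_groupoid_simps)
  moreover have "(\<lambda>(g, h). gmul (tail_groupoid S) g h) w \<in> cylinder S n ((\<lambda>(g, h). gmul (tail_groupoid S) g h) gh)"
    if "w \<in> ?T" for w
    using that gh by (auto simp: cylinder_iff tail_groupoid_simps)
  ultimately show "\<exists>n\<ge>N. \<exists>T. openin ?X T \<and> gh \<in> T \<and>
      (\<forall>h\<in>T. (\<lambda>(g, h). gmul (tail_groupoid S) g h) h \<in> cylinder S n ((\<lambda>(g, h). gmul (tail_groupoid S) g h) gh))"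
    using m(1) n(1) by (intro exI[of _ n] conjI exI[of _ ?T] ballI) auto
qed

lemma tail_continuous_inv:
  "continuous_map (arrows (tail_groupoid S)) (arrows (tail_groupoid S)) (ginv (tail_groupoid S))"
proof (rule continuous_into_tailI)
  fix g assume "g \<in> topspace (arrows (tail_groupoid S))"
  moreover obtain x y where g: "g = (x, y)" by (cases g)
  ultimately have xy: "(x, y) \<in> tail_arrows S" by (simp add: topspace_tail)
  show "ginv (tail_groupoid S) g \<in> tail_arrows S" using tail_sym[OF xy] g by (simp add: tail_groupoid_simps)
  fix N
  obtain n where n: "n \<ge> N" "\<forall>k\<ge>n. x k = y k" by (rule agree_beyond[OF xy])
  show "\<exists>n\<ge>N. \<exists>T. openin (arrows (tail_groupoid S)) T \<and> g \<in> T \<and>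
      (\<forall>h\<in>T. ginv (tail_groupoid S) h \<in> cylinder S n (ginv (tail_groupoid S) g))"
    using openin_cylinder[OF xy n(2)] cylinder_self[OF xy n(2)] n(1) g
    by (intro exI[of _ n] conjI exI[of _ "cylinder S n (x, y)"]) (auto simp: cylinder_def tail_groupoid_simps)
qed

lemma tail_continuous_rng:
  "continuous_map (arrows (tail_groupoid S)) (arrows (tail_groupoid S)) (rng (tail_groupoid S))"
proof (rule continuous_into_tailI)
  fix g assume "g \<in> topspace (arrows (tail_groupoid S))"
  moreover obtain x y where g: "g = (x, y)" by (cases g)
  ultimately have xy: "(x, y) \<in> tail_arrows S" by (simp add: topspace_tail)
  show "rng (tail_groupoid S) g \<in> tail_arrows S"
    using tail_refl[OF tail_arrowsD(1)[OF xy]] g by (simp add: tail_groupoid_simps)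
  fix N
  obtain n where n: "n \<ge> N" "\<forall>k\<ge>n. x k = y k" by (rule agree_beyond[OF xy])
  show "\<exists>n\<ge>N. \<exists>T. openin (arrows (tail_groupoid S)) T \<and> g \<in> T \<and>
      (\<forall>h\<in>T. rng (tail_groupoid S) h \<in> cylinder S n (rng (tail_groupoid S) g))"
    using openin_cylinder[OF xy n(2)] cylinder_self[OF xy n(2)] n(1) g
    by (intro exI[of _ n] conjI exI[of _ "cylinder S n (x, y)"]) (auto simp: cylinder_def tail_groupoid_simps)
qed

text \<open>On the cylinder of \<open>(x, y)\<close> at a level from which the paths agree, an arrow
  is recovered from its range path by exchanging the prefix of \<open>x\<close> for that of
  \<open>y\<close>. The inverse of the range map on this cylinder is therefore
  \<open>h\<close>.\<close>

lemma tail_rng_local_homeo: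
  fixes S :: "('x, 'e) ah_system"
  assumes "g \<in> topspace (arrows (tail_groupoid S))"
  shows "\<exists>U. openin (arrows (tail_groupoid S)) U \<and> g \<in> U \<and>
     openin (unit_space (tail_groupoid S)) (rng (tail_groupoid S) ` U) \<and>
     homeomorphic_map (subtopology (arrows (tail_groupoid S)) U)
       (subtopology (unit_space (tail_groupoid S)) (rng (tail_groupoid S) ` U)) (rng (tail_groupoid S))"
proof -
  let ?G = "tail_groupoid S" and ?A = "arrows (tail_groupoid S)"
  let ?E = "{(x, x) | x. x \<in> infinite_paths S}"
  have unit: "unit_space ?G = subtopology ?A ?E" by (simp add: unit_space_def tail_units)
  obtain x y where g: "g = (x, y)" by (cases g)
  with assms have xy: "(x, y) \<in> tail_arrows S" by (simp add: topspace_tail)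
  obtain n where n: "\<forall>k\<ge>n. x k = y k" by (rule agree_beyond[OF xy, of 0])
  note xyD = tail_arrowsD[OF xy]
  have xx: "(x, x) \<in> tail_arrows S" by (rule tail_refl[OF xyD(1)])
  define U where "U = cylinder S n (x, y)"
  define W where "W = cylinder S n (x, x) \<inter> ?E"
  have U: "openin ?A U" unfolding U_def by (rule openin_cylinder[OF xy n])
  have gU: "g \<in> U" unfolding U_def g by (rule cylinder_self[OF xy n])
  have W: "openin (unit_space ?G) W"
    unfolding W_def unit by (rule openin_subtopology_Int[OF openin_cylinder[OF xx]]) simp
  define h where "h = (\<lambda>w :: (nat \<Rightarrow> 'e bedge) \<times> (nat \<Rightarrow> 'e bedge). (fst w, \<lambda>k. if k < n then y k else fst w k))"
  have splice: "(\<lambda>k. if k < n then y k else z k) \<in> infinite_paths S"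
    if z: "z \<in> infinite_paths S" and zx: "\<forall>k<n. z k = x k" for z
  proof -
    have "edge_end (if k < n then y k else z k) = edge_start (if Suc k < n then y (Suc k) else z (Suc k))" for k
    proof -
      have 1: "edge_end (y k) = edge_start (y (Suc k))" by (rule infinite_pathsD(2)[OF xyD(2)])
      have 2: "edge_end (x k) = edge_start (x (Suc k))" by (rule infinite_pathsD(2)[OF xyD(1)])
      have 3: "edge_end (z k) = edge_start (z (Suc k))" using infinite_pathsD(2)[OF z] .
      consider "Suc k < n" | "Suc k = n" | "k \<ge> n" by linarith
      then show ?thesis
      proof cases
        \<comment> \<open>The only critical place is the junction: the prefixes of \<open>x\<close>
          and \<open>y\<close> end at the same vertex because their edges at level \<open>n\<close>
          coincide, and \<open>z\<close> passes through the same vertex since its prefix is that of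
          \<open>x\<close>.\<close>
        case 2
        then have "z k = x k" "x (Suc k) = y (Suc k)" using zx n by auto
        with 1 \<open>edge_end (x k) = edge_start (x (Suc k))\<close> 3 2 show ?thesis by simp
      qed (use 1 3 in auto)
    qed
    moreover have "y k \<in> bratteli_edges S k" "z k \<in> bratteli_edges S k" for k
      by (rule infinite_pathsD(1)[OF xyD(2)], rule infinite_pathsD(1)[OF z])
    ultimately show ?thesis by (simp add: infinite_paths_def)
  qed
  have hU: "h w \<in> U \<and> rng ?G (h w) = w" if "w \<in> W" for w
    using that splice by (auto simp: W_def U_def cylinder_def h_def tail_groupoid_simps)
  have rW: "rng ?G w \<in> W \<and> h (rng ?G w) = w" if "w \<in> U" for w
  proof -
    obtain a b where w: "w = (a, b)" by (cases w)
    have ab: "a \<in> infinite_paths S" "\<And>k. k < n \<Longrightarrow> a k = x k" "\<And>k. k < n \<Longrightarrow> b k = y k" "\<And>k. k \<ge> n \<Longrightarrow> a k = b k"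
      using that w by (auto simp: U_def cylinder_def)
    have "(\<lambda>k. if k < n then y k else a k) = b" using ab by (intro ext) auto
    then have "h (a, a) = (a, b)" unfolding h_def fst_conv by simp
    then show ?thesis using ab(1,2) by (simp add: w W_def cylinder_def tail_groupoid_simps)
  qed
  have img: "rng ?G ` U = W" using hU rW by (metis (no_types, lifting) image_iff subsetI subset_antisym)
  have subW: "subtopology (unit_space ?G) W = subtopology ?A W"
    unfolding unit subtopology_subtopology by (rule arg_cong[where f = "subtopology _"]) (auto simp: W_def)
  have "continuous_map (subtopology ?A U) (subtopology ?A W) (rng ?G)"
    using continuous_map_from_subtopology[OF tail_continuous_rng, of S U] rW
    by (auto simp: continuous_map_in_subtopology)
  moreover have "continuous_map (subtopology ?A W) (subtopology ?A U) h"
    unfolding continuous_map_in_subtopology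
  proof
    show "h \<in> topspace (subtopology ?A W) \<rightarrow> U" using hU by auto
    show "continuous_map (subtopology ?A W) ?A h"
    proof (rule continuous_into_tailI)
      fix w assume "w \<in> topspace (subtopology ?A W)"
      then have w: "w \<in> W" by simp
      then obtain z where z: "w = (z, z)" "z \<in> infinite_paths S" by (auto simp: W_def)
      show "h w \<in> tail_arrows S"
        using subsetD[OF openin_subset[OF U], of "h w"] hU[OF w] by (simp only: topspace_tail)
      fix N
      let ?m = "max N n"
      have zz: "(z, z) \<in> tail_arrows S" by (rule tail_refl[OF z(2)])
      have "openin (subtopology ?A W) (cylinder S ?m (z, z) \<inter> W)"
        by (rule openin_subtopology_Int[OF openin_cylinder[OF zz]]) simp
      moreover have "w \<in> cylinder S ?m (z, z) \<inter> W" using cylinder_self[OF zz, of ?m] z w by simp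
      moreover have "h v \<in> cylinder S ?m (h w)" if "v \<in> cylinder S ?m (z, z) \<inter> W" for v
        using that hU[of v] z by (auto simp: cylinder_def h_def W_def U_def)
      ultimately show "\<exists>n\<ge>N. \<exists>T. openin (subtopology ?A W) T \<and> w \<in> T \<and> (\<forall>v\<in>T. h v \<in> cylinder S n (h w))"
        by (intro exI[of _ ?m] conjI exI[of _ "cylinder S ?m (z, z) \<inter> W"]) auto
    qed
  qed
  ultimately have "homeomorphic_maps (subtopology ?A U) (subtopology ?A W) (rng ?G) h"
    unfolding homeomorphic_maps_def using hU rW by auto
  then have "homeomorphic_map (subtopology ?A U) (subtopology ?A W) (rng ?G)"
    using homeomorphic_map_maps by blast
  then show ?thesis using U gU W img subW by (intro exI[of _ U]) simp
qed

lemma etale_tail_groupoid: "etale_groupoid (tail_groupoid S)"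
proof
  let ?G = "tail_groupoid S"
  show "\<exists>U. openin (arrows ?G) U \<and> g \<in> U \<and> openin (unit_space ?G) (rng ?G ` U) \<and>
     homeomorphic_map (subtopology (arrows ?G) U) (subtopology (unit_space ?G) (rng ?G ` U)) (rng ?G)"
    if "g \<in> topspace (arrows ?G)" for g
    by (rule tail_rng_local_homeo[OF that])
  show "gmul ?G g h \<in> topspace (arrows ?G) \<and> rng ?G (gmul ?G g h) = rng ?G g \<and> src ?G (gmul ?G g h) = src ?G h"
    if gh: "g \<in> topspace (arrows ?G)" "h \<in> topspace (arrows ?G)" "src ?G g = rng ?G h" for g h
  proof -
    obtain x y y' z where "g = (x, y)" "h = (y', z)" by (cases g; cases h)
    moreover from this gh(3) have "y' = y" by (simp add: tail_groupoid_simps)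
    ultimately show ?thesis using gh(1,2) tail_trans[of x y S z] by (simp add: topspace_tail tail_groupoid_simps)
  qed
  fix g assume g: "g \<in> topspace (arrows ?G)"
  obtain x y where xy: "g = (x, y)" by (cases g)
  then have t: "(x, y) \<in> tail_arrows S" using g by (simp add: topspace_tail)
  note r = tail_refl[OF tail_arrowsD(1)[OF t]] tail_refl[OF tail_arrowsD(2)[OF t]] tail_sym[OF t]
  show "src ?G g \<in> topspace (arrows ?G)" "rng ?G g \<in> topspace (arrows ?G)"
    "src ?G (src ?G g) = src ?G g \<and> rng ?G (src ?G g) = src ?G g"
    "src ?G (rng ?G g) = rng ?G g \<and> rng ?G (rng ?G g) = rng ?G g"
    "gmul ?G (rng ?G g) g = g \<and> gmul ?G g (src ?G g) = g"
    "ginv ?G g \<in> topspace (arrows ?G) \<and> src ?G (ginv ?G g) = rng ?G g \<and> rng ?G (ginv ?G g) = src ?G g"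
    "gmul ?G (ginv ?G g) g = src ?G g \<and> gmul ?G g (ginv ?G g) = rng ?G g"
    by (simp_all add: xy r tail_groupoid_simps topspace_tail)
  show "gmul ?G (gmul ?G g h) k = gmul ?G g (gmul ?G h k)" for h k
    by (cases h; cases k) (simp add: xy tail_groupoid_simps)
qed (rule tail_continuous_mul tail_continuous_inv)+

section \<open>Characters of the limit diagonal\<close>

locale ah_limit = diagonal_AH_system S for S :: "('x, 'e) ah_system" +
  fixes A :: "'a cstar" and \<iota> :: "nat \<Rightarrow> (nat \<Rightarrow> 'x \<Rightarrow> complex mat) \<Rightarrow> 'a"
  assumes limit: "inductive_limit (stage_algebra S) (connecting_map S) A \<iota>"
begin

sublocale A: cstar_algebra A
  using limit by (simp add: inductive_limit_def)

lemma iota_hom: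
  assumes "n \<ge> 1"
  shows "a \<in> carrier (stage_algebra S n) \<Longrightarrow> \<iota> n a \<in> carrier A"
    "a \<in> carrier (stage_algebra S n) \<Longrightarrow> b \<in> carrier (stage_algebra S n) \<Longrightarrow>
       \<iota> n (a \<otimes>\<^bsub>stage_algebra S n\<^esub> b) = \<iota> n a \<otimes>\<^bsub>A\<^esub> \<iota> n b"
    "a \<in> carrier (stage_algebra S n) \<Longrightarrow> b \<in> carrier (stage_algebra S n) \<Longrightarrow>
       \<iota> n (a \<oplus>\<^bsub>stage_algebra S n\<^esub> b) = \<iota> n a \<oplus>\<^bsub>A\<^esub> \<iota> n b"
    "\<iota> n \<one>\<^bsub>stage_algebra S n\<^esub> = \<one>\<^bsub>A\<^esub>"
    "a \<in> carrier (stage_algebra S n) \<Longrightarrow> \<iota> n (c \<odot>\<^bsub>stage_algebra S n\<^esub> a) = c \<odot>\<^bsub>A\<^esub> \<iota> n a"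
    "a \<in> carrier (stage_algebra S n) \<Longrightarrow> \<iota> n (adj (stage_algebra S n) a) = adj A (\<iota> n a)"
proof -
  have "\<iota> n \<in> star_hom (stage_algebra S n) A" using limit assms by (simp add: inductive_limit_def)
  then have r: "\<iota> n \<in> Ring.ring_hom (stage_algebra S n) A" and
    s: "\<forall>x\<in>carrier (stage_algebra S n). (\<forall>c. \<iota> n (c \<odot>\<^bsub>stage_algebra S n\<^esub> x) = c \<odot>\<^bsub>A\<^esub> \<iota> n x) \<and>
        \<iota> n (adj (stage_algebra S n) x) = adj A (\<iota> n x)"
    by (simp_all add: star_hom_def)
  show "a \<in> carrier (stage_algebra S n) \<Longrightarrow> \<iota> n a \<in> carrier A" by (rule ring_hom_closed[OF r])
  show "a \<in> carrier (stage_algebra S n) \<Longrightarrow> b \<in> carrier (stage_algebra S n) \<Longrightarrow>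
       \<iota> n (a \<otimes>\<^bsub>stage_algebra S n\<^esub> b) = \<iota> n a \<otimes>\<^bsub>A\<^esub> \<iota> n b" by (rule ring_hom_mult[OF r])
  show "a \<in> carrier (stage_algebra S n) \<Longrightarrow> b \<in> carrier (stage_algebra S n) \<Longrightarrow>
       \<iota> n (a \<oplus>\<^bsub>stage_algebra S n\<^esub> b) = \<iota> n a \<oplus>\<^bsub>A\<^esub> \<iota> n b" by (rule ring_hom_add[OF r])
  show "\<iota> n \<one>\<^bsub>stage_algebra S n\<^esub> = \<one>\<^bsub>A\<^esub>" by (rule ring_hom_one[OF r])
  show "a \<in> carrier (stage_algebra S n) \<Longrightarrow> \<iota> n (c \<odot>\<^bsub>stage_algebra S n\<^esub> a) = c \<odot>\<^bsub>A\<^esub> \<iota> n a"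
    "a \<in> carrier (stage_algebra S n) \<Longrightarrow> \<iota> n (adj (stage_algebra S n) a) = adj A (\<iota> n a)"
    using s by blast+
qed

lemma iota_Suc: "n \<ge> 1 \<Longrightarrow> a \<in> carrier (stage_algebra S n) \<Longrightarrow> \<iota> (Suc n) (connecting_map S n a) = \<iota> n a"
  using limit by (simp add: inductive_limit_def)

lemma iota_lift_diagonal:
  assumes "n \<ge> 1" "n \<le> m" "a \<in> diagonal_part S n"
  shows "\<exists>b\<in>diagonal_part S m. \<iota> m b = \<iota> n a"
  using assms(2)
proof (induction m rule: dec_induct)
  case base
  then show ?case using assms(3) by blast
next
  case (step m)
  then obtain b where b: "b \<in> diagonal_part S m" "\<iota> m b = \<iota> n a" by blast
  have m: "m \<ge> 1" using assms(1) step(1) by simp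
  show ?case
    using connecting_map_diagonal[OF m b(1)] iota_Suc[OF m diagonal_partD(1)[OF b(1)]] b(2)
    by (intro bexI[of _ "connecting_map S m b"]) auto
qed

lemma dense_union: "norm_closure A (\<Union>n\<in>{1..}. \<iota> n ` carrier (stage_algebra S n)) = carrier A"
  using limit by (simp add: inductive_limit_def)

section \<open>The union of the stage diagonals and its closure\<close>

definition Dpre :: "'a set" where "Dpre = (\<Union>n\<in>{1..}. \<iota> n ` diagonal_part S n)"
definition Dlim :: "'a set" where "Dlim = norm_closure A Dpre"

lemma limit_diagonal_carrier: "carrier (limit_diagonal S A \<iota>) = Dlim"
  by (simp add: limit_diagonal_def on_carrier_def Dlim_def Dpre_def)

lemma Dpre_sub: "Dpre \<subseteq> carrier A"
  using iota_hom(1) diagonal_partD(1) unfolding Dpre_def by fastforce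

lemma DpreI: "n \<ge> 1 \<Longrightarrow> c \<in> diagonal_part S n \<Longrightarrow> \<iota> n c \<in> Dpre"
  unfolding Dpre_def by auto

text \<open>The lower bound \<open>N\<close> is essential in use: the formulas for an arrow hold
  only at stages beyond the level from which its paths agree.\<close>

lemma DpreE:
  assumes "d \<in> Dpre"
  obtains n c where "n \<ge> N" "n \<ge> 1" "c \<in> diagonal_part S n" "d = \<iota> n c"
proof -
  obtain n c where n: "n \<ge> 1" "c \<in> diagonal_part S n" "d = \<iota> n c" using assms unfolding Dpre_def by auto
  obtain b where b: "b \<in> diagonal_part S (max N n)" "\<iota> (max N n) b = \<iota> n c"
    using iota_lift_diagonal[OF n(1) max.cobounded2 n(2), of N] by blast
  have "d = \<iota> (max N n) b" unfolding b(2) by (rule n(3))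
  then show ?thesis by (rule that[OF max.cobounded1 order_trans[OF n(1) max.cobounded2] b(1)])
qed

lemma DpreE2:
  assumes "d \<in> Dpre" "d' \<in> Dpre"
  obtains n c c' where "n \<ge> N" "n \<ge> 1" "c \<in> diagonal_part S n" "d = \<iota> n c" "c' \<in> diagonal_part S n" "d' = \<iota> n c'"
proof -
  obtain n c where n: "n \<ge> N" "n \<ge> 1" "c \<in> diagonal_part S n" "d = \<iota> n c" by (rule DpreE[OF assms(1)])
  obtain m c' where m: "m \<ge> n" "m \<ge> 1" "c' \<in> diagonal_part S m" "d' = \<iota> m c'" by (rule DpreE[OF assms(2)])
  obtain b where b: "b \<in> diagonal_part S m" "\<iota> m b = \<iota> n c" using iota_lift_diagonal[OF n(2) m(1) n(3)] by blast
  have "d = \<iota> m b" unfolding b(2) by (rule n(4))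
  then show ?thesis by (rule that[OF le_trans[OF n(1) m(1)] m(2) b(1) _ m(3,4)])
qed

lemma iota_diagonal:
  assumes "n \<ge> 1" "c \<in> diagonal_part S n" "c' \<in> diagonal_part S n"
  shows "\<iota> n (c \<otimes>\<^bsub>stage_algebra S n\<^esub> c') = \<iota> n c \<otimes>\<^bsub>A\<^esub> \<iota> n c'"
    "\<iota> n (c \<oplus>\<^bsub>stage_algebra S n\<^esub> c') = \<iota> n c \<oplus>\<^bsub>A\<^esub> \<iota> n c'"
    "\<iota> n (z \<odot>\<^bsub>stage_algebra S n\<^esub> c) = z \<odot>\<^bsub>A\<^esub> \<iota> n c"
  using iota_hom[OF assms(1)] diagonal_partD(1)[OF assms(2)] diagonal_partD(1)[OF assms(3)] by blast+

lemma Dpre_closed: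
  assumes "d \<in> Dpre" "d' \<in> Dpre"
  shows "d \<otimes>\<^bsub>A\<^esub> d' \<in> Dpre" "d \<oplus>\<^bsub>A\<^esub> d' \<in> Dpre" "z \<odot>\<^bsub>A\<^esub> d \<in> Dpre" "\<one>\<^bsub>A\<^esub> \<in> Dpre"
proof -
  obtain n c c' where n: "n \<ge> 1" "n \<ge> 1" "c \<in> diagonal_part S n" "d = \<iota> n c" "c' \<in> diagonal_part S n" "d' = \<iota> n c'"
    by (rule DpreE2[OF assms])
  show "d \<otimes>\<^bsub>A\<^esub> d' \<in> Dpre" "d \<oplus>\<^bsub>A\<^esub> d' \<in> Dpre" "z \<odot>\<^bsub>A\<^esub> d \<in> Dpre"
    unfolding n(4,6) iota_diagonal[OF n(1,3,5), symmetric]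
    by (intro DpreI n(1) diagonal_closed[OF n(3,5)])+
  show "\<one>\<^bsub>A\<^esub> \<in> Dpre" unfolding iota_hom(4)[OF n(1), symmetric] by (intro DpreI n(1) diagonal_closed[OF n(3,5)])
qed

lemma Dlim_sub: "Dlim \<subseteq> carrier A"
  by (auto simp: Dlim_def norm_closure_def)

lemma Dpre_Dlim: "Dpre \<subseteq> Dlim"
  unfolding Dlim_def by (rule A.norm_closure_mono[OF Dpre_sub])

lemma Dlim_sequence:
  assumes "x \<in> Dlim"
  obtains s where "\<And>k :: nat. s k \<in> Dpre" "(\<lambda>k. nrm A (s k \<ominus>\<^bsub>A\<^esub> x)) \<longlonglongrightarrow> 0"
  using A.norm_closure_sequence[OF Dpre_sub assms[unfolded Dlim_def]] that by blast

lemma Dlim_limit: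
  assumes "\<And>k :: nat. s k \<in> Dlim" "x \<in> carrier A" "(\<lambda>k. nrm A (s k \<ominus>\<^bsub>A\<^esub> x)) \<longlonglongrightarrow> 0"
  shows "x \<in> Dlim"
  using A.norm_closure_idem[OF Dpre_sub assms[unfolded Dlim_def]] by (simp add: Dlim_def)

lemma Dlim_closed:
  assumes x: "x \<in> Dlim" and y: "y \<in> Dlim"
  shows "x \<otimes>\<^bsub>A\<^esub> y \<in> Dlim" "x \<oplus>\<^bsub>A\<^esub> y \<in> Dlim" "z \<odot>\<^bsub>A\<^esub> x \<in> Dlim"
proof -
  obtain s where s: "\<And>k :: nat. s k \<in> Dpre" "(\<lambda>k. nrm A (s k \<ominus>\<^bsub>A\<^esub> x)) \<longlonglongrightarrow> 0" using Dlim_sequence[OF x] by blast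
  obtain t where t: "\<And>k :: nat. t k \<in> Dpre" "(\<lambda>k. nrm A (t k \<ominus>\<^bsub>A\<^esub> y)) \<longlonglongrightarrow> 0" using Dlim_sequence[OF y] by blast
  have sc: "s k \<in> carrier A" "t k \<in> carrier A" for k using s(1) t(1) Dpre_sub by auto
  have xy: "x \<in> carrier A" "y \<in> carrier A" using x y Dlim_sub by auto
  have in_lim: "d \<in> Dlim" if "d \<in> Dpre" for d using that Dpre_Dlim by blast
  show "x \<otimes>\<^bsub>A\<^esub> y \<in> Dlim"
    by (rule Dlim_limit[OF in_lim[OF Dpre_closed(1)[OF s(1) t(1)]] _ A.limit_mult[OF sc xy s(2) t(2)]]) (use xy in auto)
  show "x \<oplus>\<^bsub>A\<^esub> y \<in> Dlim"
    by (rule Dlim_limit[OF in_lim[OF Dpre_closed(2)[OF s(1) t(1)]] _ A.limit_add[OF sc xy s(2) t(2)]]) (use xy in auto)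
  show "z \<odot>\<^bsub>A\<^esub> x \<in> Dlim"
    by (rule Dlim_limit[OF in_lim[OF Dpre_closed(3)[OF s(1) t(1)]] _ A.limit_smult[OF sc(1) xy(1) s(2)]]) (use xy in auto)
qed

section \<open>Characters and their automatic continuity\<close>

definition chars :: "('a \<Rightarrow> complex) set" where
  "chars = characters (limit_diagonal S A \<iota>)"

lemma topspace_spectrum: "topspace (gelfand_spectrum (limit_diagonal S A \<iota>)) = chars"
proof -
  have "chars \<subseteq> extensional Dlim" by (auto simp: chars_def characters_def limit_diagonal_carrier)
  then show ?thesis
    by (auto simp: gelfand_spectrum_def limit_diagonal_carrier PiE_def chars_def[symmetric])
qed

lemma chars_iff:
  "h \<in> chars \<longleftrightarrow> h \<in> extensional Dlim \<and>
     (\<forall>x\<in>Dlim. \<forall>y\<in>Dlim. h (x \<oplus>\<^bsub>A\<^esub> y) = h x + h y \<and> h (x \<otimes>\<^bsub>A\<^esub> y) = h x * h y) \<and>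
     (\<forall>c. \<forall>x\<in>Dlim. h (c \<odot>\<^bsub>A\<^esub> x) = c * h x) \<and> (\<exists>x\<in>Dlim. h x \<noteq> 0)"
proof -
  have "limit_diagonal S A \<iota> = A\<lparr>carrier := Dlim\<rparr>"
    by (simp add: limit_diagonal_def on_carrier_def Dlim_def Dpre_def)
  then show ?thesis by (simp add: chars_def characters_def)
qed

lemma char_hom:
  assumes "h \<in> chars"
  shows "x \<in> Dlim \<Longrightarrow> y \<in> Dlim \<Longrightarrow> h (x \<oplus>\<^bsub>A\<^esub> y) = h x + h y"
    "x \<in> Dlim \<Longrightarrow> y \<in> Dlim \<Longrightarrow> h (x \<otimes>\<^bsub>A\<^esub> y) = h x * h y"
    "x \<in> Dlim \<Longrightarrow> h (c \<odot>\<^bsub>A\<^esub> x) = c * h x"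
  using assms unfolding chars_iff by blast+

lemma one_diagonal: "\<one>\<^bsub>stage_algebra S n\<^esub> \<in> diagonal_part S n"
proof (rule diagonal_partI[OF stage_one_closed])
  fix i x a b assume ix: "i \<in> {1..nblocks S n}" "x \<in> topspace (base S n i)" "a < msize S n i" "b < msize S n i"
    and ne: "a \<noteq> b"
  show "\<one>\<^bsub>stage_algebra S n\<^esub> i x $$ (a, b) = 0"
    unfolding stage_ops_index(5)[OF stage_one_closed stage_one_closed ix] using ne by simp
qed

lemma one_Dlim: "\<one>\<^bsub>A\<^esub> \<in> Dlim"
proof -
  from DpreI[OF _ one_diagonal] have "\<one>\<^bsub>A\<^esub> \<in> Dpre" using iota_hom(4)[of 1] by (metis order_refl)
  then show ?thesis using Dpre_Dlim by blast
qed

lemma char_one: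
  assumes h: "h \<in> chars"
  shows "h \<one>\<^bsub>A\<^esub> = 1"
proof -
  obtain x where x: "x \<in> Dlim" "h x \<noteq> 0" using h unfolding chars_iff by blast
  have "\<one>\<^bsub>A\<^esub> \<otimes>\<^bsub>A\<^esub> x = x" using x Dlim_sub by (intro monoid.l_one[OF ring.is_monoid[OF A.ring_axioms]]) auto
  then have "h \<one>\<^bsub>A\<^esub> * h x = h x" using char_hom(2)[OF h one_Dlim x(1)] by simp
  then show ?thesis using x(2) by simp
qed

lemma char_bound:
  assumes h: "h \<in> chars" and x: "x \<in> Dlim"
  shows "cmod (h x) \<le> nrm A x"
proof (rule A.character_bounded[of Dlim h x])
  fix c y z assume y: "y \<in> Dlim" and z: "z \<in> Dlim"
  show "y \<oplus>\<^bsub>A\<^esub> z \<in> Dlim" "y \<otimes>\<^bsub>A\<^esub> z \<in> Dlim" by (rule Dlim_closed[OF y z])+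
  show "h (y \<oplus>\<^bsub>A\<^esub> z) = h y + h z" "h (y \<otimes>\<^bsub>A\<^esub> z) = h y * h z" by (rule char_hom(1,2)[OF h y z])+
next
  fix c y assume y: "y \<in> Dlim"
  show "c \<odot>\<^bsub>A\<^esub> y \<in> Dlim" by (rule Dlim_closed(3)[OF y y])
  show "h (c \<odot>\<^bsub>A\<^esub> y) = c * h y" by (rule char_hom(3)[OF h y])
next
  fix s :: "nat \<Rightarrow> 'a" and y assume "\<And>k. s k \<in> Dlim" "y \<in> carrier A" "(\<lambda>k. nrm A (s k \<ominus>\<^bsub>A\<^esub> y)) \<longlonglongrightarrow> 0"
  then show "y \<in> Dlim" by (rule Dlim_limit)
qed (rule Dlim_sub, rule x)

lemma char_minus:
  assumes h: "h \<in> chars" and x: "x \<in> Dlim" and y: "y \<in> Dlim"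
  shows "x \<ominus>\<^bsub>A\<^esub> y \<in> Dlim" "h (x \<ominus>\<^bsub>A\<^esub> y) = h x - h y"
proof -
  have "x \<ominus>\<^bsub>A\<^esub> y = x \<oplus>\<^bsub>A\<^esub> ((-1) \<odot>\<^bsub>A\<^esub> y)"
    using y Dlim_sub by (simp add: a_minus_def A.smult_simps(5) subset_iff)
  then show "x \<ominus>\<^bsub>A\<^esub> y \<in> Dlim" "h (x \<ominus>\<^bsub>A\<^esub> y) = h x - h y"
    using Dlim_closed[OF x Dlim_closed(3)[OF y y]] char_hom(1)[OF h x Dlim_closed(3)[OF y y]] char_hom(3)[OF h y]
    by simp_all
qed

lemma char_tendsto:
  assumes h: "h \<in> chars" and s: "\<And>k :: nat. s k \<in> Dlim" and x: "x \<in> Dlim"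
    and lim: "(\<lambda>k. nrm A (s k \<ominus>\<^bsub>A\<^esub> x)) \<longlonglongrightarrow> 0"
  shows "(\<lambda>k. h (s k)) \<longlonglongrightarrow> h x"
proof (rule LIM_zero_cancel, rule Lim_null_comparison[OF _ lim])
  show "\<forall>\<^sub>F k in sequentially. norm (h (s k) - h x) \<le> nrm A (s k \<ominus>\<^bsub>A\<^esub> x)"
    using char_bound[OF h char_minus(1)[OF h s x]] char_minus(2)[OF h s x] by simp
qed

text \<open>Characters are continuous and \<open>Dpre\<close> is dense. Elements of
  \<open>Dpre\<close> have representatives at arbitrarily high stages, so the comparison may start
  at any \<open>N\<close>.\<close>

lemma char_eqI:
  assumes h: "h \<in> chars" and g: "g \<in> chars"
    and eq: "\<And>n c. n \<ge> N \<Longrightarrow> n \<ge> 1 \<Longrightarrow> c \<in> diagonal_part S n \<Longrightarrow> h (\<iota> n c) = g (\<iota> n c)"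
  shows "h = g"
proof (rule extensionalityI[of _ Dlim])
  show "h \<in> extensional Dlim" "g \<in> extensional Dlim" using h g by (auto simp: chars_iff)
  have *: "h d = g d" if "d \<in> Dpre" for d using DpreE[OF that] eq by metis
  fix x assume x: "x \<in> Dlim"
  obtain s where s: "\<And>k :: nat. s k \<in> Dpre" "(\<lambda>k. nrm A (s k \<ominus>\<^bsub>A\<^esub> x)) \<longlonglongrightarrow> 0" using Dlim_sequence[OF x] by blast
  have sl: "s k \<in> Dlim" for k using s(1) Dpre_Dlim by blast
  show "h x = g x"
    using LIMSEQ_unique[OF char_tendsto[OF h sl x s(2)]] char_tendsto[OF g sl x s(2)] *[OF s(1)] by simp
qed

lemma stage_Dlim: "n \<ge> 1 \<Longrightarrow> c \<in> diagonal_part S n \<Longrightarrow> \<iota> n c \<in> Dlim"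
  using DpreI Dpre_Dlim by blast

lemma char_stage:
  assumes h: "h \<in> chars" and n: "n \<ge> 1" and c: "c \<in> diagonal_part S n" and c': "c' \<in> diagonal_part S n"
  shows "h (\<iota> n (c \<otimes>\<^bsub>stage_algebra S n\<^esub> c')) = h (\<iota> n c) * h (\<iota> n c')"
    "h (\<iota> n (c \<oplus>\<^bsub>stage_algebra S n\<^esub> c')) = h (\<iota> n c) + h (\<iota> n c')"
    "h (\<iota> n (z \<odot>\<^bsub>stage_algebra S n\<^esub> c)) = z * h (\<iota> n c)"
    "h (\<iota> n \<one>\<^bsub>stage_algebra S n\<^esub>) = 1"
  using iota_diagonal[OF n c c'] char_hom(1,2)[OF h stage_Dlim[OF n c] stage_Dlim[OF n c']] char_hom(3)[OF h stage_Dlim[OF n c]]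
    iota_hom(4)[OF n] char_one[OF h] by simp_all

text \<open>If a character were not a point evaluation on the diagonal of stage \<open>n\<close>, then by compactness
  finitely many elements of its kernel would have no common zero, and a sum of elements
  \<open>d\<^sup>* d\<close> of the kernel would be invertible.\<close>

lemma character_at_stage:
  assumes h: "h \<in> chars" and n: "n \<ge> 1"
  shows "\<exists>i b x. i \<in> {1..nblocks S n} \<and> b < msize S n i \<and> x \<in> topspace (base S n i) \<and>
    (\<forall>c\<in>diagonal_part S n. h (\<iota> n c) = c i x $$ (b, b))"
proof (rule ccontr)
  assume neg: "\<not> ?thesis"
  let ?A = "stage_algebra S n" and ?I = "{1..nblocks S n}"
  define Z where "Z = {s \<in> diagonal_part S n. h (\<iota> n s) = 0 \<and>
     (\<forall>i\<in>?I. \<forall>x\<in>topspace (base S n i). \<forall>b<msize S n i. s i x $$ (b, b) \<in> \<real> \<and> 0 \<le> Re (s i x $$ (b, b)))}"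
  have Zd: "s \<in> diagonal_part S n" "h (\<iota> n s) = 0" if "s \<in> Z" for s using that by (auto simp: Z_def)
  have Znn: "s i x $$ (b, b) \<in> \<real>" "0 \<le> Re (s i x $$ (b, b))"
    if "s \<in> Z" "i \<in> ?I" "x \<in> topspace (base S n i)" "b < msize S n i" for s i x b
    using that unfolding Z_def by blast+
  note one = one_diagonal[of n]
  have pos: "\<exists>s\<in>Z. 0 < Re (s i x $$ (b, b))"
    if i: "i \<in> ?I" and b: "b < msize S n i" and x: "x \<in> topspace (base S n i)" for i b x
  proof -
    obtain c where c: "c \<in> diagonal_part S n" "h (\<iota> n c) \<noteq> c i x $$ (b, b)" using neg i b x by blast
    \<comment> \<open>Subtracting the value of \<open>h\<close> times the unit puts \<open>c\<close>
      into the kernel, while the entry on which \<open>c\<close> and \<open>h\<close> disagree stays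
      nonzero.\<close>
    define d where "d = c \<oplus>\<^bsub>?A\<^esub> ((- h (\<iota> n c)) \<odot>\<^bsub>?A\<^esub> \<one>\<^bsub>?A\<^esub>)"
    have m1: "(- h (\<iota> n c)) \<odot>\<^bsub>?A\<^esub> \<one>\<^bsub>?A\<^esub> \<in> diagonal_part S n" by (rule diagonal_closed(3)[OF one one])
    have d: "d \<in> diagonal_part S n" unfolding d_def by (rule diagonal_closed(2)[OF c(1) m1])
    have hd: "h (\<iota> n d) = 0"
      unfolding d_def char_stage(2)[OF h n c(1) m1] char_stage(3)[OF h n one one] char_stage(4)[OF h n one one] by simp
    have dv: "d i x $$ (b, b) = c i x $$ (b, b) - h (\<iota> n c)"
      unfolding d_def using stage_ops_index(2)[OF diagonal_partD(1)[OF c(1)] diagonal_partD(1)[OF m1] i x b b]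
        stage_ops_index(3)[OF stage_one_closed stage_one_closed i x b b, of "- h (\<iota> n c)"]
        stage_ops_index(5)[OF stage_one_closed stage_one_closed i x b b] by simp
    define s where "s = adj ?A d \<otimes>\<^bsub>?A\<^esub> d"
    have ad: "adj ?A d \<in> diagonal_part S n" by (rule diagonal_closed(4)[OF d d])
    have s: "s \<in> diagonal_part S n" unfolding s_def by (rule diagonal_closed(1)[OF ad d])
    have sv: "s i x $$ (b, b) = complex_of_real ((cmod (d i x $$ (b, b)))\<^sup>2)"
      if "i \<in> ?I" "b < msize S n i" "x \<in> topspace (base S n i)" for i b x
      unfolding s_def diagonal_mult_index[OF ad d that(1,3,2)]
        stage_ops_index(4)[OF diagonal_partD(1)[OF d] diagonal_partD(1)[OF d] that(1,3,2,2)]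
      by (subst complex_norm_square) (simp add: mult.commute)
    have "h (\<iota> n s) = 0" unfolding s_def char_stage(1)[OF h n ad d] hd by simp
    moreover have "s i x $$ (b, b) \<in> \<real> \<and> 0 \<le> Re (s i x $$ (b, b))"
      if "i \<in> ?I" "x \<in> topspace (base S n i)" "b < msize S n i" for i x b
      unfolding sv[OF that(1,3,2)] by simp
    ultimately have "s \<in> Z" unfolding Z_def using s by blast
    moreover have "0 < Re (s i x $$ (b, b))" unfolding sv[OF i b x] using dv c(2) by simp
    ultimately show ?thesis by blast
  qed
  \<comment> \<open>Members of \<open>Z\<close> have nonnegative diagonal entries, so a sum
    dominates each summand and finitely many of them can be replaced by one.\<close>
  have sup: "\<exists>s\<in>Z. \<forall>f\<in>F. \<forall>i\<in>?I. \<forall>x\<in>topspace (base S n i). \<forall>b<msize S n i. Re (f i x $$ (b, b)) \<le> Re (s i x $$ (b, b))"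
    if "finite F" "F \<subseteq> Z" for F
    using that
  proof (induction F)
    case empty
    let ?z = "0 \<odot>\<^bsub>?A\<^esub> \<one>\<^bsub>?A\<^esub>"
    have "?z \<in> diagonal_part S n" by (rule diagonal_closed(3)[OF one one])
    moreover have "h (\<iota> n ?z) = 0" unfolding char_stage(3)[OF h n one one] by simp
    moreover have "?z i x $$ (b, b) \<in> \<real> \<and> 0 \<le> Re (?z i x $$ (b, b))"
      if "i \<in> ?I" "x \<in> topspace (base S n i)" "b < msize S n i" for i x b
      unfolding stage_ops_index(3)[OF stage_one_closed stage_one_closed that that(3)] by simp
    ultimately have "?z \<in> Z" unfolding Z_def by blast
    then show ?case by blast
  next
    case (insert f F)
    then obtain s where s: "s \<in> Z" "\<And>g i x b. g \<in> F \<Longrightarrow> i \<in> ?I \<Longrightarrow> x \<in> topspace (base S n i) \<Longrightarrow> b < msize S n i \<Longrightarrow>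
      Re (g i x $$ (b, b)) \<le> Re (s i x $$ (b, b))" by blast
    have f: "f \<in> Z" using insert by blast
    let ?s = "f \<oplus>\<^bsub>?A\<^esub> s"
    have ev: "?s i x $$ (b, b) = f i x $$ (b, b) + s i x $$ (b, b)"
      if "i \<in> ?I" "x \<in> topspace (base S n i)" "b < msize S n i" for i x b
      by (rule stage_ops_index(2)[OF diagonal_partD(1)[OF Zd(1)[OF f]] diagonal_partD(1)[OF Zd(1)[OF s(1)]] that that(3)])
    have "?s \<in> diagonal_part S n" by (rule diagonal_closed(2)[OF Zd(1)[OF f] Zd(1)[OF s(1)]])
    moreover have "h (\<iota> n ?s) = 0"
      unfolding char_stage(2)[OF h n Zd(1)[OF f] Zd(1)[OF s(1)]] Zd(2)[OF f] Zd(2)[OF s(1)] by simp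
    moreover have "?s i x $$ (b, b) \<in> \<real> \<and> 0 \<le> Re (?s i x $$ (b, b))"
      if "i \<in> ?I" "x \<in> topspace (base S n i)" "b < msize S n i" for i x b
      unfolding ev[OF that] using Znn[OF f that] Znn[OF s(1) that] by simp
    ultimately have "?s \<in> Z" unfolding Z_def by blast
    moreover have "Re (g i x $$ (b, b)) \<le> Re (?s i x $$ (b, b))"
      if g: "g \<in> insert f F" and ix: "i \<in> ?I" "x \<in> topspace (base S n i)" "b < msize S n i" for g i x b
      unfolding ev[OF ix] using g s(2)[OF _ ix, of g] Znn(2)[OF f ix] Znn(2)[OF s(1) ix] by auto
    ultimately show ?case by blast
  qed
  have "\<exists>F. finite F \<and> F \<subseteq> Z \<and> (\<forall>x\<in>topspace (base S n i). \<exists>s\<in>F. 0 < Re (s i x $$ (b, b)))"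
    if i: "i \<in> ?I" and b: "b < msize S n i" for i b
  proof -
    define U where "U = (\<lambda>s. {x \<in> topspace (base S n i). s i x $$ (b, b) \<in> {z. 0 < Re z}})"
    have "openin (base S n i) (U s)" if "s \<in> Z" for s
      unfolding U_def
      by (rule openin_continuous_map_preimage[OF stage_carrierD(2)[OF diagonal_partD(1)[OF Zd(1)[OF that]] i b b]])
        (use open_halfspace_Re_gt[of 0] in simp)
    moreover have "topspace (base S n i) \<subseteq> \<Union> (U ` Z)" using pos[OF i b] by (fastforce simp: U_def)
    ultimately obtain \<F> where "finite \<F>" "\<F> \<subseteq> U ` Z" "topspace (base S n i) \<subseteq> \<Union> \<F>"
      using compact_base[OF n i] unfolding compact_space_alt by (metis (no_types, lifting) image_iff)
    then obtain F where "finite F" "F \<subseteq> Z" "topspace (base S n i) \<subseteq> \<Union> (U ` F)"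
      using finite_subset_image by metis
    then show ?thesis by (intro exI[of _ F]) (auto simp: U_def)
  qed
  then obtain F where F: "\<And>i b. i \<in> ?I \<Longrightarrow> b < msize S n i \<Longrightarrow> finite (F i b) \<and> F i b \<subseteq> Z \<and>
      (\<forall>x\<in>topspace (base S n i). \<exists>s\<in>F i b. 0 < Re (s i x $$ (b, b)))" by metis
  have "finite (\<Union>i\<in>?I. \<Union>b<msize S n i. F i b)" "(\<Union>i\<in>?I. \<Union>b<msize S n i. F i b) \<subseteq> Z"
    using F by (blast intro!: finite_UN_I)+
  from sup[OF this] obtain s where s: "s \<in> Z" and sup: "\<And>f i x b. f \<in> (\<Union>i\<in>?I. \<Union>b<msize S n i. F i b) \<Longrightarrow>
      i \<in> ?I \<Longrightarrow> x \<in> topspace (base S n i) \<Longrightarrow> b < msize S n i \<Longrightarrow> Re (f i x $$ (b, b)) \<le> Re (s i x $$ (b, b))"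
    by blast
  have spos: "s i x $$ (b, b) \<noteq> 0" if ix: "i \<in> ?I" "x \<in> topspace (base S n i)" "b < msize S n i" for i x b
  proof -
    obtain f where "f \<in> F i b" "0 < Re (f i x $$ (b, b))" using F[OF ix(1,3)] ix(2) by blast
    then have "0 < Re (s i x $$ (b, b))" using sup[OF _ ix, of f] ix by fastforce
    then show ?thesis by auto
  qed
  define t where "t = stage_mat S n (\<lambda>i x a b. if a = b then inverse (s i x $$ (b, b)) else 0)"
  have tc: "t \<in> carrier ?A"
    unfolding t_def
  proof (rule stage_mat_closed)
    fix i a b assume i: "i \<in> ?I" and ab: "a < msize S n i" "b < msize S n i"
    have "continuous_map (base S n i) euclidean (\<lambda>x. inverse (s i x $$ (b, b)))"
      by (rule continuous_map_complex_inverse[OF stage_carrierD(2)[OF diagonal_partD(1)[OF Zd(1)[OF s]] i ab(2,2)]])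
        (rule spos[OF i _ ab(2)])
    then show "continuous_map (base S n i) euclidean (\<lambda>x. if a = b then inverse (s i x $$ (b, b)) else 0)"
      by (cases "a = b") auto
  qed
  have t: "t \<in> diagonal_part S n"
    by (rule diagonal_partI[OF tc]) (simp add: t_def stage_mat_index)
  have "t \<otimes>\<^bsub>?A\<^esub> s = \<one>\<^bsub>?A\<^esub>"
  proof (rule stage_eqI[OF stage_closed(1)[OF tc diagonal_partD(1)[OF Zd(1)[OF s]]] stage_one_closed])
    fix i x a b assume ix: "i \<in> ?I" "x \<in> topspace (base S n i)" "a < msize S n i" "b < msize S n i"
    show "(t \<otimes>\<^bsub>?A\<^esub> s) i x $$ (a, b) = \<one>\<^bsub>?A\<^esub> i x $$ (a, b)"
    proof (cases "a = b")
      case True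
      have "(t \<otimes>\<^bsub>?A\<^esub> s) i x $$ (b, b) = inverse (s i x $$ (b, b)) * s i x $$ (b, b)"
        unfolding diagonal_mult_index[OF t Zd(1)[OF s] ix(1,2,4)]
        unfolding t_def stage_mat_index[OF ix(1,2,4,4)] by simp
      then show ?thesis
        using spos[OF ix(1,2,4)] True stage_ops_index(5)[OF stage_one_closed stage_one_closed ix] by simp
    next
      case False
      then show ?thesis
        using diagonal_partD(2)[OF diagonal_closed(1)[OF t Zd(1)[OF s]] ix]
          stage_ops_index(5)[OF stage_one_closed stage_one_closed ix] by simp
    qed
  qed
  then have "h (\<iota> n t) * h (\<iota> n s) = 1"
    using char_stage(1)[OF h n t Zd(1)[OF s]] char_stage(4)[OF h n one one] by simp
  then show False using Zd(2)[OF s] by simp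
qed

section \<open>Block, index, point and path attached to a character\<close>

text \<open>Block and index are forced by the values on diagonal units. The point enters later only
  through values of continuous functions, so an arbitrary choice does no harm.\<close>

definition stage_data :: "('a \<Rightarrow> complex) \<Rightarrow> nat \<Rightarrow> nat \<times> nat \<times> 'x" where
  "stage_data h n = (SOME (i, b, x). i \<in> {1..nblocks S n} \<and> b < msize S n i \<and> x \<in> topspace (base S n i) \<and>
    (\<forall>c\<in>diagonal_part S n. h (\<iota> n c) = c i x $$ (b, b)))"

definition char_block :: "('a \<Rightarrow> complex) \<Rightarrow> nat \<Rightarrow> nat" where "char_block h n = fst (stage_data h n)"
definition char_index :: "('a \<Rightarrow> complex) \<Rightarrow> nat \<Rightarrow> nat" where "char_index h n = fst (snd (stage_data h n))"
definition char_point :: "('a \<Rightarrow> complex) \<Rightarrow> nat \<Rightarrow> 'x" where "char_point h n = snd (snd (stage_data h n))"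

lemma char_data:
  assumes h: "h \<in> chars" and n: "n \<ge> 1"
  shows "char_block h n \<in> {1..nblocks S n}" "char_index h n < msize S n (char_block h n)"
    "char_point h n \<in> topspace (base S n (char_block h n))"
    "c \<in> diagonal_part S n \<Longrightarrow> h (\<iota> n c) = c (char_block h n) (char_point h n) $$ (char_index h n, char_index h n)"
proof -
  have "\<exists>p. (\<lambda>(i, b, x). i \<in> {1..nblocks S n} \<and> b < msize S n i \<and> x \<in> topspace (base S n i) \<and>
    (\<forall>c\<in>diagonal_part S n. h (\<iota> n c) = c i x $$ (b, b))) p"
    using character_at_stage[OF h n] by auto
  from someI_ex[OF this] have *: "(\<lambda>(i, b, x). i \<in> {1..nblocks S n} \<and> b < msize S n i \<and> x \<in> topspace (base S n i) \<and>
    (\<forall>c\<in>diagonal_part S n. h (\<iota> n c) = c i x $$ (b, b))) (stage_data h n)"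
    unfolding stage_data_def .
  then show "char_block h n \<in> {1..nblocks S n}" "char_index h n < msize S n (char_block h n)"
    "char_point h n \<in> topspace (base S n (char_block h n))"
    "c \<in> diagonal_part S n \<Longrightarrow> h (\<iota> n c) = c (char_block h n) (char_point h n) $$ (char_index h n, char_index h n)"
    by (auto simp: char_block_def char_index_def char_point_def split: prod.splits)
qed

abbreviation diag_unit :: "nat \<Rightarrow> nat \<Rightarrow> nat \<Rightarrow> nat \<Rightarrow> 'x \<Rightarrow> complex mat" where
  "diag_unit n i b \<equiv> matrix_unit S n i b b (\<lambda>_. 1)"

lemma diag_unit: "diag_unit n i b \<in> diagonal_part S n"
  by (rule matrix_unit_diagonal) simp

lemma char_diag_unit:
  assumes h: "h \<in> chars" and n: "n \<ge> 1"
  shows "h (\<iota> n (diag_unit n i b)) = (if char_block h n = i \<and> char_index h n = b then 1 else 0)"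
  unfolding char_data(4)[OF h n diag_unit]
  by (simp add: matrix_unit_index[OF char_data(1)[OF h n] char_data(3)[OF h n] char_data(2)[OF h n] char_data(2)[OF h n]])

text \<open>The index at stage \<open>Suc n\<close> is decoded as an edge \<open>e\<close> from
  block \<open>i\<close> and a local index \<open>a\<close>. The connecting map sends the diagonal
  unit of \<open>(i, a)\<close> to an element with entry 1 at the decoded position, so
  \<open>h\<close> takes the value 1 on that unit, which identifies \<open>i\<close> and
  \<open>a\<close> as the data of \<open>h\<close> at stage \<open>n\<close>.\<close>

lemma char_Suc:
  assumes h: "h \<in> chars" and n: "n \<ge> 1"
  shows "\<exists>e\<in>edges S n (char_block h n) (char_block h (Suc n)).
    char_index h (Suc n) = pos_offset S n (char_block h (Suc n)) (char_block h n, e) + char_index h n"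
proof -
  have n': "Suc n \<ge> 1" by simp
  note d = char_data[OF h n']
  obtain i e a where ie: "i \<in> {1..nblocks S n}" "e \<in> edges S n i (char_block h (Suc n))" "a < msize S n i"
    and B: "char_index h (Suc n) = pos_offset S n (char_block h (Suc n)) (i, e) + a"
    by (rule position_exists[OF n d(1,2)])
  have u: "diag_unit n i a \<in> diagonal_part S n" by (rule diag_unit)
  have "h (\<iota> n (diag_unit n i a)) = h (\<iota> (Suc n) (connecting_map S n (diag_unit n i a)))"
    using iota_Suc[OF n diagonal_partD(1)[OF u]] by simp
  also have "\<dots> = diag_unit n i a i (eigenfun S n i (char_block h (Suc n)) e (char_point h (Suc n))) $$ (a, a)"
    unfolding d(4)[OF connecting_map_diagonal[OF n u]] B
      connecting_map_index[OF n diagonal_partD(1)[OF u] d(1,3) ie ie] by simp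
  also have "\<dots> = 1"
    by (simp add: matrix_unit_index[OF ie(1) eigenfun_closed[OF n ie(1) d(1) ie(2) d(3)] ie(3,3)])
  finally have "char_block h n = i" "char_index h n = a"
    unfolding char_diag_unit[OF h n] by (simp_all split: if_splits)
  then show ?thesis using ie(2) B by blast
qed

definition char_path :: "('a \<Rightarrow> complex) \<Rightarrow> nat \<Rightarrow> 'e bedge" where
  "char_path h k = (if k = 0 then Root_edge (char_index h 1) (char_block h 1)
     else Edge k (char_block h k) (char_block h (Suc k))
       (SOME e. e \<in> edges S k (char_block h k) (char_block h (Suc k)) \<and>
          char_index h (Suc k) = pos_offset S k (char_block h (Suc k)) (char_block h k, e) + char_index h k))"

lemma char_path_Suc:
  assumes h: "h \<in> chars" and n: "n \<ge> 1"
  obtains e where "char_path h n = Edge n (char_block h n) (char_block h (Suc n)) e"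
    "e \<in> edges S n (char_block h n) (char_block h (Suc n))"
    "char_index h (Suc n) = pos_offset S n (char_block h (Suc n)) (char_block h n, e) + char_index h n"
proof -
  let ?P = "\<lambda>e. e \<in> edges S n (char_block h n) (char_block h (Suc n)) \<and>
          char_index h (Suc n) = pos_offset S n (char_block h (Suc n)) (char_block h n, e) + char_index h n"
  have "\<exists>e. ?P e" using char_Suc[OF h n] by blast
  from someI_ex[OF this] have "?P (SOME e. ?P e)" .
  moreover have "char_path h n = Edge n (char_block h n) (char_block h (Suc n)) (SOME e. ?P e)"
    using n by (simp add: char_path_def)
  ultimately show ?thesis using that by blast
qed

lemma char_path:
  assumes h: "h \<in> chars"
  shows "char_path h \<in> infinite_paths S" "n \<ge> 1 \<Longrightarrow> vertex (char_path h) n = char_block h n"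
    "n \<ge> 1 \<Longrightarrow> path_pos S (char_path h) n = char_index h n"
proof -
  have 0: "char_path h 0 = Root_edge (char_index h 1) (char_block h 1)" by (simp add: char_path_def)
  have e: "char_path h k \<in> bratteli_edges S k" for k
  proof (cases "k = 0")
    case True
    then show ?thesis using 0 char_data[OF h, of 1] by (auto simp: bratteli_edges_def)
  next
    case False
    then have k: "k \<ge> 1" by simp
    obtain e where "char_path h k = Edge k (char_block h k) (char_block h (Suc k)) e"
      "e \<in> edges S k (char_block h k) (char_block h (Suc k))" by (rule char_path_Suc[OF h k])
    then show ?thesis using False char_data(1)[OF h k] char_data(1)[OF h, of "Suc k"]
      by (simp add: bratteli_edges_def)
  qed
  have st: "edge_start (char_path h (Suc k)) = (Suc k, char_block h (Suc k))" for k by (simp add: char_path_def)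
  have en: "edge_end (char_path h k) = (Suc k, char_block h (Suc k))" for k by (simp add: char_path_def)
  show "char_path h \<in> infinite_paths S" using e st en by (simp add: infinite_paths_def)
  show "vertex (char_path h) n = char_block h n" if "n \<ge> 1"
    using st[of "n - 1"] that by (simp add: vertex_def)
  show "path_pos S (char_path h) n = char_index h n" if "n \<ge> 1"
    using that
  proof (induction n rule: dec_induct)
    case base
    then show ?case using 0 by simp
  next
    case (step n)
    obtain e where "char_path h n = Edge n (char_block h n) (char_block h (Suc n)) e"
      "char_index h (Suc n) = pos_offset S n (char_block h (Suc n)) (char_block h n, e) + char_index h n"
      by (rule char_path_Suc[OF h step(1)])
    then show ?case using step.IH by simp
  qed
qed

lemma char_eval:
  assumes h: "h \<in> chars" and n: "n \<ge> 1"
  shows "char_point h n \<in> topspace (base S n (vertex (char_path h) n))"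
    "c \<in> diagonal_part S n \<Longrightarrow> h (\<iota> n c) =
       c (vertex (char_path h) n) (char_point h n) $$ (path_pos S (char_path h) n, path_pos S (char_path h) n)"
  using char_data(3,4)[OF h n] char_path(2,3)[OF h n] by simp_all

text \<open>A nonzero value on the diagonal unit at level \<open>n\<close> determines vertex and
  position there, hence the first \<open>n\<close> edges by \<open>path_pos_inj\<close>; every edge
  is covered by some such \<open>n\<close>.\<close>

lemma char_path_eqI:
  assumes h: "h \<in> chars" and y: "y \<in> infinite_paths S"
    and ev: "\<And>n. n \<ge> N \<Longrightarrow> n \<ge> 1 \<Longrightarrow> h (\<iota> n (diag_unit n (vertex y n) (path_pos S y n))) \<noteq> 0"
  shows "char_path h = y"
proof
  fix k
  define n where "n = max N (Suc k)"
  have n: "n \<ge> N" "n \<ge> 1" "k < n" by (auto simp: n_def)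
  have "char_block h n = vertex y n" "char_index h n = path_pos S y n"
    using ev[OF n(1,2)] unfolding char_diag_unit[OF h n(2)] by (simp_all split: if_splits)
  then show "char_path h k = y k"
    using path_pos_inj[OF char_path(1)[OF h] y n(2) _ _ n(3)] char_path(2,3)[OF h n(2)] by simp
qed

lemma char_diag_unit_path:
  assumes h: "h \<in> chars" and n: "n \<ge> 1"
  shows "h (\<iota> n (diag_unit n i b)) = (if vertex (char_path h) n = i \<and> path_pos S (char_path h) n = b then 1 else 0)"
  unfolding char_diag_unit[OF h n] char_path(2,3)[OF h n] ..

end

section \<open>The action on the spectrum\<close>

lemma continuous_map_locallyI:
  assumes "\<And>x. x \<in> topspace X \<Longrightarrow> \<exists>T g. openin X T \<and> x \<in> T \<and> continuous_map X Y g \<and> (\<forall>y\<in>T. f y = g y)"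
  shows "continuous_map X Y f"
  unfolding continuous_map_def
proof (intro conjI allI impI)
  show "f \<in> topspace X \<rightarrow> topspace Y"
  proof
    fix x assume x: "x \<in> topspace X"
    then obtain T g where "openin X T" "x \<in> T" "continuous_map X Y g" "\<forall>y\<in>T. f y = g y" using assms by blast
    then show "f x \<in> topspace Y" using x by (simp add: continuous_map_def Pi_iff)
  qed
  fix U assume U: "openin Y U"
  show "openin X {x \<in> topspace X. f x \<in> U}"
    unfolding openin_subopen[of X "{x \<in> topspace X. f x \<in> U}"]
  proof
    fix x assume x: "x \<in> {x \<in> topspace X. f x \<in> U}"
    then obtain T g where T: "openin X T" "x \<in> T" "continuous_map X Y g" "\<forall>y\<in>T. f y = g y" using assms by blast
    have "openin X (T \<inter> {x \<in> topspace X. g x \<in> U})"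
      by (rule openin_Int[OF T(1) openin_continuous_map_preimage[OF T(3) U]])
    moreover have "T \<inter> {x \<in> topspace X. g x \<in> U} \<subseteq> {x \<in> topspace X. f x \<in> U}" "x \<in> T \<inter> {x \<in> topspace X. g x \<in> U}"
      using T x by auto
    ultimately show "\<exists>T. openin X T \<and> x \<in> T \<and> T \<subseteq> {x \<in> topspace X. f x \<in> U}" by blast
  qed
qed

text \<open>The bound 1 is there because stages start at 1. Minimality makes this number constant
  near an arrow, and with it the partial isometry chosen below.\<close>

definition level :: "(nat \<Rightarrow> 'c) \<times> (nat \<Rightarrow> 'c) \<Rightarrow> nat" where
  "level g = (LEAST n. n \<ge> 1 \<and> (\<forall>k\<ge>n. fst g k = snd g k))"

lemma level:
  assumes "(x, y) \<in> tail_arrows S"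
  shows "level (x, y) \<ge> 1" "k \<ge> level (x, y) \<Longrightarrow> x k = y k"
proof -
  obtain n where "n \<ge> 1" "\<forall>k\<ge>n. x k = y k" by (rule agree_beyond[OF assms])
  then have "n \<ge> 1 \<and> (\<forall>k\<ge>n. fst (x, y) k = snd (x, y) k)" by simp
  from LeastI[of "\<lambda>n. n \<ge> 1 \<and> (\<forall>k\<ge>n. fst (x, y) k = snd (x, y) k)", OF this]
  have "level (x, y) \<ge> 1 \<and> (\<forall>k\<ge>level (x, y). fst (x, y) k = snd (x, y) k)" unfolding level_def .
  then show "level (x, y) \<ge> 1" "k \<ge> level (x, y) \<Longrightarrow> x k = y k" by auto
qed

lemma level_le: "n \<ge> 1 \<Longrightarrow> (\<And>k. k \<ge> n \<Longrightarrow> x k = y k) \<Longrightarrow> level (x, y) \<le> n"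
  unfolding level_def by (rule Least_le) simp

text \<open>Members of the cylinder share both prefixes with \<open>(x, y)\<close>, so an earlier
  agreement level for one would be an agreement level for the other.\<close>

lemma level_cylinder:
  assumes xy: "(x, y) \<in> tail_arrows S" and c: "(x', y') \<in> cylinder S (level (x, y)) (x, y)"
  shows "level (x', y') = level (x, y)"
proof -
  let ?n = "level (x, y)"
  have c': "x' \<in> infinite_paths S" "y' \<in> infinite_paths S" "\<And>k. k < ?n \<Longrightarrow> x' k = x k \<and> y' k = y k"
    "\<And>k. k \<ge> ?n \<Longrightarrow> x' k = y' k" using c by (auto simp: cylinder_iff)
  have t: "(x', y') \<in> tail_arrows S" by (rule tail_arrowsI[OF c'(1,2), of ?n]) (use c'(4) in blast)
  have le: "level (x', y') \<le> ?n" by (rule level_le[OF level(1)[OF xy] c'(4)])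
  have "level (x, y) \<le> level (x', y')"
  proof (rule level_le[OF level(1)[OF t]])
    fix k assume k: "k \<ge> level (x', y')"
    show "x k = y k"
    proof (cases "k < ?n")
      case True
      then show ?thesis using c'(3)[OF True] level(2)[OF t k] by metis
    next
      case False
      then show ?thesis using level(2)[OF xy, of k] by simp
    qed
  qed
  with le show ?thesis by simp
qed

context ah_limit
begin

section \<open>Partial isometries of arrows and conjugation\<close>

text \<open>The matrix unit of the AF-subalgebra with the row of the range path and the column of
  the source path. Conjugation as in \<open>char_act\<close> then carries the diagonal entry at the
  range position to the source position.\<close>

definition partial_iso :: "(nat \<Rightarrow> 'e bedge) \<times> (nat \<Rightarrow> 'e bedge) \<Rightarrow> 'a" where
  "partial_iso g = \<iota> (level g) (matrix_unit S (level g) (vertex (snd g) (level g))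
     (path_pos S (fst g) (level g)) (path_pos S (snd g) (level g)) (\<lambda>_. 1))"

definition char_act :: "(nat \<Rightarrow> 'e bedge) \<times> (nat \<Rightarrow> 'e bedge) \<Rightarrow> ('a \<Rightarrow> complex) \<Rightarrow> 'a \<Rightarrow> complex" where
  "char_act g h = (\<lambda>c\<in>Dlim. h ((adj A (partial_iso g) \<otimes>\<^bsub>A\<^esub> c) \<otimes>\<^bsub>A\<^esub> partial_iso g))"

text \<open>Under connecting maps a matrix unit becomes a sum of matrix units. This condition
  survives and is what conjugation needs: an off-diagonal entry of the conjugate of a diagonal
  element sums products of two entries from one row and different columns.\<close>

definition monomial_rows :: "nat \<Rightarrow> (nat \<Rightarrow> 'x \<Rightarrow> complex mat) \<Rightarrow> bool" where
  "monomial_rows m W \<longleftrightarrow> (\<forall>i\<in>{1..nblocks S m}. \<forall>z\<in>topspace (base S m i).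
     \<forall>a<msize S m i. \<forall>b<msize S m i. \<forall>b'<msize S m i.
       W i z $$ (a, b) \<noteq> 0 \<longrightarrow> W i z $$ (a, b') \<noteq> 0 \<longrightarrow> b = b')"

text \<open>Each connecting map copies the matrix unit along all outgoing edges. Beyond the level of
  the arrow both paths follow the same edge, so the column of \<open>y\<close> keeps a single 1, in
  the row of \<open>x\<close>.\<close>

lemma partial_iso_stage:
  assumes xy: "(x, y) \<in> tail_arrows S" and m: "m \<ge> level (x, y)"
  shows "\<exists>W\<in>carrier (stage_algebra S m). \<iota> m W = partial_iso (x, y) \<and> monomial_rows m W \<and>
    (\<forall>z\<in>topspace (base S m (vertex y m)). \<forall>a<msize S m (vertex y m).
      W (vertex y m) z $$ (a, path_pos S y m) = (if a = path_pos S x m then 1 else 0))"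
  using m
proof (induction m rule: dec_induct)
  case base
  let ?n = "level (x, y)"
  let ?W = "matrix_unit S ?n (vertex y ?n) (path_pos S x ?n) (path_pos S y ?n) (\<lambda>_. 1)"
  have n: "?n \<ge> 1" by (rule level(1)[OF xy])
  note y = tail_arrowsD(2)[OF xy]
  have "?W \<in> carrier (stage_algebra S ?n)" by (rule matrix_unit_closed) simp
  moreover have "monomial_rows ?n ?W"
    unfolding monomial_rows_def by (simp add: matrix_unit_index split: if_splits)
  moreover have "?W (vertex y ?n) z $$ (a, path_pos S y ?n) = (if a = path_pos S x ?n then 1 else 0)"
    if "z \<in> topspace (base S ?n (vertex y ?n))" "a < msize S ?n (vertex y ?n)" for z a
    unfolding matrix_unit_index[OF vertex_in[OF y n] that path_pos_less[OF y n]] by simp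
  ultimately show ?case by (intro bexI[of _ ?W]) (auto simp: partial_iso_def)
next
  case (step m)
  then obtain W where W: "W \<in> carrier (stage_algebra S m)" "\<iota> m W = partial_iso (x, y)" "monomial_rows m W"
    and Wv: "\<And>z a. z \<in> topspace (base S m (vertex y m)) \<Longrightarrow> a < msize S m (vertex y m) \<Longrightarrow>
      W (vertex y m) z $$ (a, path_pos S y m) = (if a = path_pos S x m then 1 else 0)" by blast
  note y = tail_arrowsD(2)[OF xy] and x = tail_arrowsD(1)[OF xy]
  have m: "m \<ge> 1" using level(1)[OF xy] step(1) by linarith
  let ?W = "connecting_map S m W"
  have "monomial_rows (Suc m) ?W"
    unfolding monomial_rows_def
  proof (intro ballI allI impI)
    fix j z p q q' assume j: "j \<in> {1..nblocks S (Suc m)}" and z: "z \<in> topspace (base S (Suc m) j)"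
      and p: "p < msize S (Suc m) j" and q: "q < msize S (Suc m) j" and q': "q' < msize S (Suc m) j"
      and nz: "?W j z $$ (p, q) \<noteq> 0" "?W j z $$ (p, q') \<noteq> 0"
    obtain i e a where ie: "i \<in> {1..nblocks S m}" "e \<in> edges S m i j" "a < msize S m i"
      and pe: "p = pos_offset S m j (i, e) + a" by (rule position_exists[OF m j p])
    obtain i1 e1 b where ie1: "i1 \<in> {1..nblocks S m}" "e1 \<in> edges S m i1 j" "b < msize S m i1"
      and qe: "q = pos_offset S m j (i1, e1) + b" by (rule position_exists[OF m j q])
    obtain i2 e2 b' where ie2: "i2 \<in> {1..nblocks S m}" "e2 \<in> edges S m i2 j" "b' < msize S m i2"
      and qe': "q' = pos_offset S m j (i2, e2) + b'" by (rule position_exists[OF m j q'])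
    have 1: "i = i1" "e = e1" "W i (eigenfun S m i j e z) $$ (a, b) \<noteq> 0"
      using nz(1) unfolding pe qe connecting_map_index[OF m W(1) j z ie ie1] by (auto split: if_splits)
    have 2: "i = i2" "e = e2" "W i (eigenfun S m i j e z) $$ (a, b') \<noteq> 0"
      using nz(2) unfolding pe qe' connecting_map_index[OF m W(1) j z ie ie2] by (auto split: if_splits)
    have "b = b'"
      using W(3) 1(3) 2(3) ie1(3) ie2(3) ie(3) eigenfun_closed[OF m ie(1) j ie(2) z] ie(1)
      unfolding monomial_rows_def 1(1)[symmetric] 2(1)[symmetric] by blast
    then show "q = q'" using qe qe' 1(1,2) 2(1,2) by simp
  qed
  moreover have "?W (vertex y (Suc m)) z $$ (p, path_pos S y (Suc m)) = (if p = path_pos S x (Suc m) then 1 else 0)"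
    if z: "z \<in> topspace (base S (Suc m) (vertex y (Suc m)))" and p: "p < msize S (Suc m) (vertex y (Suc m))" for z p
  proof -
    let ?j = "vertex y (Suc m)"
    obtain e where e: "y m = Edge m (vertex y m) ?j e" "e \<in> edges S m (vertex y m) ?j"
      "vertex y m \<in> {1..nblocks S m}" "?j \<in> {1..nblocks S (Suc m)}"
      "path_pos S y (Suc m) = pos_offset S m ?j (vertex y m, e) + path_pos S y m"
      by (rule path_Suc[OF y m])
    have "x m = y m" by (rule level(2)[OF xy step(1)])
    then have px: "path_pos S x (Suc m) = pos_offset S m ?j (vertex y m, e) + path_pos S x m" using e(1) by simp
    have vx: "vertex x m = vertex y m" by (rule vertex_tail[of x m y, OF \<open>x m = y m\<close>])
    have pxl: "path_pos S x m < msize S m (vertex y m)" using path_pos_less[OF x m] vx by simp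
    obtain i1 e1 a where ie: "i1 \<in> {1..nblocks S m}" "e1 \<in> edges S m i1 ?j" "a < msize S m i1"
      and pe: "p = pos_offset S m ?j (i1, e1) + a" by (rule position_exists[OF m e(4) p])
    have "p = path_pos S x (Suc m) \<longleftrightarrow> i1 = vertex y m \<and> e1 = e \<and> a = path_pos S x m"
      using position_inj[OF m e(4) ie e(3,2) pxl] unfolding pe px by blast
    moreover have "W (vertex y m) (eigenfun S m (vertex y m) ?j e z) $$ (a, path_pos S y m) = (if a = path_pos S x m then 1 else 0)"
      if "i1 = vertex y m"
      by (rule Wv[OF eigenfun_closed[OF m e(3,4,2) z]]) (use ie(3) that in simp)
    ultimately show ?thesis
      unfolding pe e(5) connecting_map_index[OF m W(1) e(4) z ie e(3,2) path_pos_less[OF y m]] by auto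
  qed
  ultimately show ?case
    using connecting_map_closed[OF m W(1)] iota_Suc[OF m W(1)] W(2) by (intro bexI[of _ ?W]) auto
qed

lemma partial_iso_closed: "(x, y) \<in> tail_arrows S \<Longrightarrow> partial_iso (x, y) \<in> carrier A"
  unfolding partial_iso_def by (rule iota_hom(1)[OF level(1)]) (auto intro!: matrix_unit_closed)

text \<open>The entry of the conjugate at \<open>(b, b')\<close> is the sum over \<open>a\<close> of
  the conjugate of \<open>W $$ (a, b)\<close> times \<open>c $$ (a, a)\<close> times
  \<open>W $$ (a, b')\<close>. The row condition kills it for different \<open>b\<close> and
  \<open>b'\<close>; at the position of \<open>y\<close> the explicit column leaves only the term of
  \<open>x\<close>.\<close>

lemma conjugate_stage:
  assumes xy: "(x, y) \<in> tail_arrows S" and m: "m \<ge> level (x, y)" and c: "c \<in> diagonal_part S m"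
  shows "\<exists>c'\<in>diagonal_part S m. (adj A (partial_iso (x, y)) \<otimes>\<^bsub>A\<^esub> \<iota> m c) \<otimes>\<^bsub>A\<^esub> partial_iso (x, y) = \<iota> m c' \<and>
    (\<forall>z\<in>topspace (base S m (vertex y m)). c' (vertex y m) z $$ (path_pos S y m, path_pos S y m) =
       c (vertex y m) z $$ (path_pos S x m, path_pos S x m))"
proof -
  obtain W where W: "W \<in> carrier (stage_algebra S m)" "\<iota> m W = partial_iso (x, y)" "monomial_rows m W"
    and Wv: "\<And>z a. z \<in> topspace (base S m (vertex y m)) \<Longrightarrow> a < msize S m (vertex y m) \<Longrightarrow>
      W (vertex y m) z $$ (a, path_pos S y m) = (if a = path_pos S x m then 1 else 0)"
    using partial_iso_stage[OF xy m] by blast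
  note y = tail_arrowsD(2)[OF xy] and x = tail_arrowsD(1)[OF xy]
  have m1: "m \<ge> 1" using level(1)[OF xy] m by linarith
  let ?A = "stage_algebra S m"
  have cc: "c \<in> carrier ?A" by (rule diagonal_partD(1)[OF c])
  have W': "adj ?A W \<in> carrier ?A" by (rule stage_closed(4)[OF W(1) W(1)])
  have W'c: "adj ?A W \<otimes>\<^bsub>?A\<^esub> c \<in> carrier ?A" by (rule stage_closed(1)[OF W' cc])
  define c' where "c' = (adj ?A W \<otimes>\<^bsub>?A\<^esub> c) \<otimes>\<^bsub>?A\<^esub> W"
  have c'c: "c' \<in> carrier ?A" unfolding c'_def by (rule stage_closed(1)[OF W'c W(1)])
  have e1: "(adj ?A W \<otimes>\<^bsub>?A\<^esub> c) i z $$ (b, a) = cnj (W i z $$ (a, b)) * c i z $$ (a, a)"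
    if i: "i \<in> {1..nblocks S m}" "z \<in> topspace (base S m i)" and ab: "a < msize S m i" "b < msize S m i" for i z a b
  proof -
    have "(adj ?A W \<otimes>\<^bsub>?A\<^esub> c) i z $$ (b, a) = (\<Sum>d<msize S m i. adj ?A W i z $$ (b, d) * c i z $$ (d, a))"
      by (rule stage_ops_index(1)[OF W' cc i ab(2,1)])
    also have "\<dots> = (\<Sum>d\<in>{a}. adj ?A W i z $$ (b, d) * c i z $$ (d, a))"
      by (rule sum.mono_neutral_right) (use ab diagonal_partD(2)[OF c i _ ab(1)] in auto)
    also have "\<dots> = cnj (W i z $$ (a, b)) * c i z $$ (a, a)"
      using stage_ops_index(4)[OF W(1) W(1) i ab(2,1)] by simp
    finally show ?thesis .
  qed
  have e2: "c' i z $$ (b, b') = (\<Sum>a<msize S m i. cnj (W i z $$ (a, b)) * c i z $$ (a, a) * W i z $$ (a, b'))"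
    if i: "i \<in> {1..nblocks S m}" "z \<in> topspace (base S m i)" and ab: "b < msize S m i" "b' < msize S m i" for i z b b'
    unfolding c'_def stage_ops_index(1)[OF W'c W(1) i ab] by (rule sum.cong) (use e1[OF i _ ab(1)] in auto)
  have "c' \<in> diagonal_part S m"
  proof (rule diagonal_partI[OF c'c])
    fix i z b b' assume i: "i \<in> {1..nblocks S m}" "z \<in> topspace (base S m i)"
      and ab: "b < msize S m i" "b' < msize S m i" and ne: "b \<noteq> b'"
    have "W i z $$ (a, b) = 0 \<or> W i z $$ (a, b') = 0" if "a < msize S m i" for a
      using W(3) i ab ne that unfolding monomial_rows_def by blast
    then show "c' i z $$ (b, b') = 0" unfolding e2[OF i ab] by (intro sum.neutral) auto
  qed
  moreover have "(adj A (partial_iso (x, y)) \<otimes>\<^bsub>A\<^esub> \<iota> m c) \<otimes>\<^bsub>A\<^esub> partial_iso (x, y) = \<iota> m c'"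
    unfolding c'_def iota_hom(2)[OF m1 W'c W(1)] iota_hom(2)[OF m1 W' cc] iota_hom(6)[OF m1 W(1)] W(2) ..
  moreover have "c' (vertex y m) z $$ (path_pos S y m, path_pos S y m) = c (vertex y m) z $$ (path_pos S x m, path_pos S x m)"
    if z: "z \<in> topspace (base S m (vertex y m))" for z
  proof -
    have vx: "vertex x m = vertex y m" by (rule vertex_tail[of x m y, OF level(2)[OF xy m]])
    have pxl: "path_pos S x m < msize S m (vertex y m)" using path_pos_less[OF x m1] vx by simp
    have "c' (vertex y m) z $$ (path_pos S y m, path_pos S y m) =
       (\<Sum>a<msize S m (vertex y m). if a = path_pos S x m then c (vertex y m) z $$ (a, a) else 0)"
      unfolding e2[OF vertex_in[OF y m1] z path_pos_less[OF y m1] path_pos_less[OF y m1]]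
      by (rule sum.cong) (use Wv[OF z] in auto)
    then show ?thesis using pxl by simp
  qed
  ultimately show ?thesis by blast
qed

lemma conjugate_Dlim:
  assumes xy: "(x, y) \<in> tail_arrows S" and c: "c \<in> Dlim"
  shows "(adj A (partial_iso (x, y)) \<otimes>\<^bsub>A\<^esub> c) \<otimes>\<^bsub>A\<^esub> partial_iso (x, y) \<in> Dlim"
proof -
  let ?w = "partial_iso (x, y)"
  have w: "?w \<in> carrier A" by (rule partial_iso_closed[OF xy])
  have d: "(adj A ?w \<otimes>\<^bsub>A\<^esub> d) \<otimes>\<^bsub>A\<^esub> ?w \<in> Dlim" if dp: "d \<in> Dpre" for d
  proof -
    obtain n c where n: "n \<ge> level (x, y)" "n \<ge> 1" "c \<in> diagonal_part S n" "d = \<iota> n c" by (rule DpreE[OF dp])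
    then show ?thesis using conjugate_stage[OF xy n(1,3)] stage_Dlim[OF n(2)] by auto
  qed
  obtain s where s: "\<And>k :: nat. s k \<in> Dpre" "(\<lambda>k. nrm A (s k \<ominus>\<^bsub>A\<^esub> c)) \<longlonglongrightarrow> 0" using Dlim_sequence[OF c] by blast
  have cA: "c \<in> carrier A" using c Dlim_sub by blast
  have sA: "s k \<in> carrier A" for k using s(1) Dpre_sub by blast
  have wA: "adj A ?w \<in> carrier A" using w by (rule A.adj_closed)
  have 1: "(\<lambda>k. nrm A ((adj A ?w \<otimes>\<^bsub>A\<^esub> s k) \<ominus>\<^bsub>A\<^esub> (adj A ?w \<otimes>\<^bsub>A\<^esub> c))) \<longlonglongrightarrow> 0"
    by (rule A.limit_mult[OF wA sA wA cA A.limit_const[OF wA] s(2)])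
  have 2: "(\<lambda>k. nrm A (((adj A ?w \<otimes>\<^bsub>A\<^esub> s k) \<otimes>\<^bsub>A\<^esub> ?w) \<ominus>\<^bsub>A\<^esub> ((adj A ?w \<otimes>\<^bsub>A\<^esub> c) \<otimes>\<^bsub>A\<^esub> ?w))) \<longlonglongrightarrow> 0"
    by (rule A.limit_mult[OF _ w _ w 1 A.limit_const[OF w]]) (use wA sA cA in auto)
  show ?thesis by (rule Dlim_limit[OF d[OF s(1)] _ 2]) (use wA cA w in auto)
qed

text \<open>At high stages the action keeps the point of the character and moves only the diagonal
  position, from that of \<open>y\<close> to that of \<open>x\<close>. The algebraic axioms of the
  action are read off from this formula.\<close>

lemma act_stage:
  assumes xy: "(x, y) \<in> tail_arrows S" and h: "h \<in> chars" and hy: "char_path h = y"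
    and m: "m \<ge> level (x, y)" and c: "c \<in> diagonal_part S m"
  shows "char_act (x, y) h (\<iota> m c) = c (vertex y m) (char_point h m) $$ (path_pos S x m, path_pos S x m)"
proof -
  have m1: "m \<ge> 1" using level(1)[OF xy] m by linarith
  obtain c' where c': "c' \<in> diagonal_part S m"
    "(adj A (partial_iso (x, y)) \<otimes>\<^bsub>A\<^esub> \<iota> m c) \<otimes>\<^bsub>A\<^esub> partial_iso (x, y) = \<iota> m c'"
    "\<And>z. z \<in> topspace (base S m (vertex y m)) \<Longrightarrow> c' (vertex y m) z $$ (path_pos S y m, path_pos S y m) =
       c (vertex y m) z $$ (path_pos S x m, path_pos S x m)"
    using conjugate_stage[OF xy m c] by blast
  have "char_act (x, y) h (\<iota> m c) = h (\<iota> m c')"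
    using stage_Dlim[OF m1 c] c'(2) by (simp add: char_act_def)
  also have "\<dots> = c' (vertex y m) (char_point h m) $$ (path_pos S y m, path_pos S y m)"
    using char_eval(2)[OF h m1 c'(1)] hy by simp
  also have "\<dots> = c (vertex y m) (char_point h m) $$ (path_pos S x m, path_pos S x m)"
    by (rule c'(3)) (use char_eval(1)[OF h m1] hy in simp)
  finally show ?thesis .
qed

text \<open>Additivity and homogeneity are formal, but conjugation by a partial isometry is not
  multiplicative on \<open>A\<close>. Multiplicativity is therefore read off on \<open>Dpre\<close>,
  where the new functional is evaluation of a diagonal entry, and extended by continuity.\<close>

lemma act_chars:
  assumes xy: "(x, y) \<in> tail_arrows S" and h: "h \<in> chars" and hy: "char_path h = y"
  shows "char_act (x, y) h \<in> chars"
proof -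
  let ?w = "partial_iso (x, y)" and ?g = "char_act (x, y) h"
  let ?con = "\<lambda>c. (adj A ?w \<otimes>\<^bsub>A\<^esub> c) \<otimes>\<^bsub>A\<^esub> ?w"
  interpret R: ring A by (rule A.ring_axioms)
  have w: "?w \<in> carrier A" by (rule partial_iso_closed[OF xy])
  have wA: "adj A ?w \<in> carrier A" using w by (rule A.adj_closed)
  have g: "?g c = h (?con c)" if "c \<in> Dlim" for c using that by (simp add: char_act_def)
  have x: "x \<in> infinite_paths S" and y: "y \<in> infinite_paths S" using tail_arrowsD[OF xy] .
  have add: "?g (c \<oplus>\<^bsub>A\<^esub> d) = ?g c + ?g d" if c: "c \<in> Dlim" and d: "d \<in> Dlim" for c d
  proof -
    have cA: "c \<in> carrier A" "d \<in> carrier A" using c d Dlim_sub by auto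
    have "?con (c \<oplus>\<^bsub>A\<^esub> d) = ?con c \<oplus>\<^bsub>A\<^esub> ?con d"
      using cA w wA by algebra
    then show ?thesis
      unfolding g[OF c] g[OF d] g[OF Dlim_closed(2)[OF c d]]
      by (simp only: char_hom(1)[OF h conjugate_Dlim[OF xy c] conjugate_Dlim[OF xy d]])
  qed
  have smult: "?g (z \<odot>\<^bsub>A\<^esub> c) = z * ?g c" if c: "c \<in> Dlim" for c z
  proof -
    have cA: "c \<in> carrier A" using c Dlim_sub by auto
    have "?con (z \<odot>\<^bsub>A\<^esub> c) = z \<odot>\<^bsub>A\<^esub> ?con c"
      using A.smult_mult_right[OF wA cA] A.smult_mult_left[OF A.carrier_closed(4)[OF wA cA] w] by simp
    then show ?thesis
      unfolding g[OF c] g[OF Dlim_closed(3)[OF c c]] by (simp only: char_hom(3)[OF h conjugate_Dlim[OF xy c]])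
  qed
  have tends: "(\<lambda>k. ?g (s k)) \<longlonglongrightarrow> ?g c"
    if s: "\<And>k :: nat. s k \<in> Dlim" and c: "c \<in> Dlim" and lim: "(\<lambda>k. nrm A (s k \<ominus>\<^bsub>A\<^esub> c)) \<longlonglongrightarrow> 0" for s c
  proof -
    have cA: "c \<in> carrier A" and sA: "s k \<in> carrier A" for k using c s Dlim_sub by auto
    have 1: "(\<lambda>k. nrm A ((adj A ?w \<otimes>\<^bsub>A\<^esub> s k) \<ominus>\<^bsub>A\<^esub> (adj A ?w \<otimes>\<^bsub>A\<^esub> c))) \<longlonglongrightarrow> 0"
      by (rule A.limit_mult[OF wA sA wA cA A.limit_const[OF wA] lim])
    have 2: "(\<lambda>k. nrm A (?con (s k) \<ominus>\<^bsub>A\<^esub> ?con c)) \<longlonglongrightarrow> 0"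
      by (rule A.limit_mult[OF _ w _ w 1 A.limit_const[OF w]]) (use wA sA cA in auto)
    show ?thesis
      unfolding g[OF s] g[OF c] by (rule char_tendsto[OF h conjugate_Dlim[OF xy s] conjugate_Dlim[OF xy c] 2])
  qed
  have pre: "?g (d \<otimes>\<^bsub>A\<^esub> d') = ?g d * ?g d'" if d: "d \<in> Dpre" "d' \<in> Dpre" for d d'
  proof -
    obtain n c c' where n: "n \<ge> level (x, y)" "n \<ge> 1" "c \<in> diagonal_part S n" "d = \<iota> n c" "c' \<in> diagonal_part S n" "d' = \<iota> n c'"
      by (rule DpreE2[OF d])
    have vx: "vertex x n = vertex y n" by (rule vertex_tail[of x n y, OF level(2)[OF xy n(1)]])
    have pxl: "path_pos S x n < msize S n (vertex y n)" using path_pos_less[OF x n(2)] vx by simp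
    have z: "char_point h n \<in> topspace (base S n (vertex y n))" using char_eval(1)[OF h n(2)] hy by simp
    show ?thesis
      unfolding n(4,6) iota_diagonal(1)[OF n(2,3,5), symmetric] act_stage[OF xy h hy n(1) n(3)]
        act_stage[OF xy h hy n(1) n(5)] act_stage[OF xy h hy n(1) diagonal_closed(1)[OF n(3,5)]]
      by (rule diagonal_mult_index[OF n(3,5) vertex_in[OF y n(2)] z pxl])
  qed
  have mult: "?g (c \<otimes>\<^bsub>A\<^esub> d) = ?g c * ?g d" if c: "c \<in> Dlim" and d: "d \<in> Dlim" for c d
  proof -
    have cA: "c \<in> carrier A" "d \<in> carrier A" using c d Dlim_sub by auto
    obtain s where s: "\<And>k :: nat. s k \<in> Dpre" "(\<lambda>k. nrm A (s k \<ominus>\<^bsub>A\<^esub> c)) \<longlonglongrightarrow> 0" using Dlim_sequence[OF c] by blast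
    obtain t where t: "\<And>k :: nat. t k \<in> Dpre" "(\<lambda>k. nrm A (t k \<ominus>\<^bsub>A\<^esub> d)) \<longlonglongrightarrow> 0" using Dlim_sequence[OF d] by blast
    have sl: "s k \<in> Dlim" "t k \<in> Dlim" for k using s(1) t(1) Dpre_Dlim by auto
    have sA: "s k \<in> carrier A" "t k \<in> carrier A" for k using sl Dlim_sub by auto
    have "(\<lambda>k. ?g (s k \<otimes>\<^bsub>A\<^esub> t k)) \<longlonglongrightarrow> ?g (c \<otimes>\<^bsub>A\<^esub> d)"
      by (rule tends[OF Dlim_closed(1)[OF sl] Dlim_closed(1)[OF c d] A.limit_mult[OF sA cA s(2) t(2)]])
    moreover have "(\<lambda>k. ?g (s k \<otimes>\<^bsub>A\<^esub> t k)) \<longlonglongrightarrow> ?g c * ?g d"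
      unfolding pre[OF s(1) t(1)] by (intro tendsto_mult tends[OF sl(1) c s(2)] tends[OF sl(2) d t(2)])
    ultimately show ?thesis by (rule LIMSEQ_unique)
  qed
  have one: "?g \<one>\<^bsub>A\<^esub> = 1"
  proof -
    let ?n = "level (x, y)"
    have n: "?n \<ge> 1" by (rule level(1)[OF xy])
    have vx: "vertex x ?n = vertex y ?n" by (rule vertex_tail[of x ?n y, OF level(2)[OF xy order_refl]])
    have pxl: "path_pos S x ?n < msize S ?n (vertex y ?n)" using path_pos_less[OF x n] vx by simp
    have z: "char_point h ?n \<in> topspace (base S ?n (vertex y ?n))" using char_eval(1)[OF h n] hy by simp
    show ?thesis
      unfolding iota_hom(4)[OF n, symmetric] act_stage[OF xy h hy order_refl one_diagonal]
        stage_ops_index(5)[OF stage_one_closed stage_one_closed vertex_in[OF y n] z pxl pxl] by simp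
  qed
  have "\<exists>c\<in>Dlim. ?g c \<noteq> 0" by (rule bexI[OF _ one_Dlim]) (simp add: one)
  moreover have "?g \<in> extensional Dlim" by (simp add: char_act_def)
  ultimately show ?thesis
    unfolding chars_iff by (intro conjI ballI allI add mult smult)
qed

lemma act_path:
  assumes xy: "(x, y) \<in> tail_arrows S" and h: "h \<in> chars" and hy: "char_path h = y"
  shows "char_path (char_act (x, y) h) = x"
proof (rule char_path_eqI[OF act_chars[OF assms] tail_arrowsD(1)[OF xy]])
  fix n assume n: "n \<ge> level (x, y)" "n \<ge> 1"
  have x: "x \<in> infinite_paths S" and y: "y \<in> infinite_paths S" using tail_arrowsD[OF xy] .
  have vx: "vertex x n = vertex y n" by (rule vertex_tail[of x n y, OF level(2)[OF xy n(1)]])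
  have pxl: "path_pos S x n < msize S n (vertex y n)" using path_pos_less[OF x n(2)] vx by simp
  have z: "char_point h n \<in> topspace (base S n (vertex y n))" using char_eval(1)[OF h n(2)] hy by simp
  show "char_act (x, y) h (\<iota> n (diag_unit n (vertex x n) (path_pos S x n))) \<noteq> 0"
    unfolding act_stage[OF assms n(1) diag_unit] matrix_unit_index[OF vertex_in[OF y n(2)] z pxl pxl] using vx by simp
qed

text \<open>The new character is evaluated in two ways, by \<open>act_stage\<close> and by
  \<open>char_eval\<close>, on the matrix unit at the position of \<open>x\<close> multiplied by
  \<open>f\<close>.\<close>

lemma act_point:
  assumes xy: "(x, y) \<in> tail_arrows S" and h: "h \<in> chars" and hy: "char_path h = y" and m: "m \<ge> level (x, y)"
    and f: "continuous_map (base S m (vertex y m)) euclidean (f :: 'x \<Rightarrow> complex)"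
  shows "f (char_point (char_act (x, y) h) m) = f (char_point h m)"
proof -
  let ?g = "char_act (x, y) h"
  have m1: "m \<ge> 1" using level(1)[OF xy] m by linarith
  have x: "x \<in> infinite_paths S" and y: "y \<in> infinite_paths S" using tail_arrowsD[OF xy] .
  have vx: "vertex x m = vertex y m" by (rule vertex_tail[of x m y, OF level(2)[OF xy m]])
  have pxl: "path_pos S x m < msize S m (vertex y m)" using path_pos_less[OF x m1] vx by simp
  have z: "char_point h m \<in> topspace (base S m (vertex y m))" using char_eval(1)[OF h m1] hy by simp
  note g = act_chars[OF xy h hy] and gp = act_path[OF xy h hy]
  have z': "char_point ?g m \<in> topspace (base S m (vertex y m))" using char_eval(1)[OF g m1] gp vx by simp
  let ?c = "matrix_unit S m (vertex y m) (path_pos S x m) (path_pos S x m) f"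
  have c: "?c \<in> diagonal_part S m" by (rule matrix_unit_diagonal[OF f])
  have "?g (\<iota> m ?c) = f (char_point h m)"
    unfolding act_stage[OF xy h hy m c] matrix_unit_index[OF vertex_in[OF y m1] z pxl pxl] by simp
  moreover have "?g (\<iota> m ?c) = f (char_point ?g m)"
    unfolding char_eval(2)[OF g m1 c] gp vx matrix_unit_index[OF vertex_in[OF y m1] z' pxl pxl] by simp
  ultimately show ?thesis by simp
qed

section \<open>Continuity and the axioms of the action\<close>

abbreviation spec :: "('a \<Rightarrow> complex) topology" where
  "spec \<equiv> gelfand_spectrum (limit_diagonal S A \<iota>)"

abbreviation char_anchor :: "('a \<Rightarrow> complex) \<Rightarrow> (nat \<Rightarrow> 'e bedge) \<times> (nat \<Rightarrow> 'e bedge)" where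
  "char_anchor h \<equiv> (char_path h, char_path h)"

lemma spec_eq: "spec = subtopology (product_topology (\<lambda>_. euclidean) Dlim) chars"
  by (simp add: gelfand_spectrum_def limit_diagonal_carrier chars_def)

lemma continuous_evaluation: "c \<in> Dlim \<Longrightarrow> continuous_map spec euclidean (\<lambda>h. h c)"
  unfolding spec_eq by (intro continuous_map_from_subtopology continuous_map_product_projection)

lemma continuous_into_spec:
  assumes "\<And>y. y \<in> topspace Y \<Longrightarrow> f y \<in> chars" "\<And>c. c \<in> Dlim \<Longrightarrow> continuous_map Y euclidean (\<lambda>y. f y c)"
  shows "continuous_map Y spec f"
  unfolding spec_eq continuous_map_in_subtopology continuous_map_componentwise
  using assms by (auto simp: chars_iff)

lemma level_refl: "level (x, x) = 1"
  using level_le[of 1 x x] unfolding level_def by (intro Least_equality) auto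

lemma char_path_cylinder:
  assumes h: "h \<in> chars" and g: "g \<in> chars" and n: "n \<ge> 1"
    and ne: "g (\<iota> n (diag_unit n (vertex (char_path h) n) (path_pos S (char_path h) n))) \<noteq> 0"
  shows "k < n \<Longrightarrow> char_path g k = char_path h k" "vertex (char_path g) n = vertex (char_path h) n"
    "path_pos S (char_path g) n = path_pos S (char_path h) n"
proof -
  show v: "vertex (char_path g) n = vertex (char_path h) n" "path_pos S (char_path g) n = path_pos S (char_path h) n"
    using ne unfolding char_diag_unit_path[OF g n] by (simp_all split: if_splits)
  show "k < n \<Longrightarrow> char_path g k = char_path h k"
    by (rule path_pos_inj[OF char_path(1)[OF g] char_path(1)[OF h] n v])
qed

text \<open>Being nonzero on the diagonal unit of \<open>h\<close> at level \<open>n\<close> is an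
  open condition on characters, and it fixes the first \<open>n\<close> edges of the path.\<close>

lemma continuous_char_anchor: "continuous_map spec (unit_space (tail_groupoid S)) char_anchor"
proof -
  have "continuous_map spec (arrows (tail_groupoid S)) char_anchor"
  proof (rule continuous_into_tailI)
    fix h assume "h \<in> topspace spec"
    then have h: "h \<in> chars" by (simp add: topspace_spectrum)
    show "char_anchor h \<in> tail_arrows S" by (rule tail_refl[OF char_path(1)[OF h]])
    fix N :: nat
    let ?n = "max N 1"
    let ?d = "\<iota> ?n (diag_unit ?n (vertex (char_path h) ?n) (path_pos S (char_path h) ?n))"
    have n: "?n \<ge> 1" by simp
    let ?T = "{g \<in> topspace spec. g ?d \<in> - {0}}"
    have "openin spec ?T"
      by (rule openin_continuous_map_preimage[OF continuous_evaluation[OF stage_Dlim[OF n diag_unit]]]) auto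
    moreover have "h \<in> ?T" using h char_diag_unit_path[OF h n] by (simp add: topspace_spectrum)
    moreover have "char_anchor g \<in> cylinder S ?n (char_anchor h)" if "g \<in> ?T" for g
    proof -
      have g: "g \<in> chars" and ne: "g ?d \<noteq> 0" using that by (simp_all add: topspace_spectrum)
      show ?thesis unfolding cylinder_iff using char_path(1)[OF g] char_path_cylinder(1)[OF h g n ne] by simp
    qed
    ultimately show "\<exists>n\<ge>N. \<exists>T. openin spec T \<and> h \<in> T \<and> (\<forall>g\<in>T. char_anchor g \<in> cylinder S n (char_anchor h))"
      by (intro exI[of _ ?n] conjI exI[of _ ?T] ballI) auto
  qed
  then show ?thesis
    unfolding unit_space_def tail_units continuous_map_in_subtopology
    using char_path(1) by (auto simp: topspace_spectrum)
qed

lemma partial_iso_cylinder: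
  assumes xy: "(x, y) \<in> tail_arrows S" and c: "(x', y') \<in> cylinder S (level (x, y)) (x, y)"
  shows "partial_iso (x', y') = partial_iso (x, y)"
proof -
  let ?n = "level (x, y)"
  have n: "?n \<ge> 1" by (rule level(1)[OF xy])
  have c': "y' \<in> infinite_paths S" "\<And>k. k < ?n \<Longrightarrow> x' k = x k" "\<And>k. k < ?n \<Longrightarrow> y' k = y k"
    using c by (auto simp: cylinder_iff)
  have "y' (?n - 1) = y (?n - 1)" by (rule c'(3)) (use n in simp)
  from vertex_prefix[OF c'(1) tail_arrowsD(2)[OF xy] this] n have "vertex y' ?n = vertex y ?n" by simp
  moreover have "path_pos S x' ?n = path_pos S x ?n" "path_pos S y' ?n = path_pos S y ?n"
    using c'(2,3) by (auto intro: path_pos_cong)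
  ultimately show ?thesis by (simp add: partial_iso_def level_cylinder[OF xy c])
qed

abbreviation act_domain :: "(((nat \<Rightarrow> 'e bedge) \<times> (nat \<Rightarrow> 'e bedge)) \<times> ('a \<Rightarrow> complex)) topology" where
  "act_domain \<equiv> subtopology (prod_topology (arrows (tail_groupoid S)) spec)
     {(g, h). src (tail_groupoid S) g = char_anchor h}"

lemma act_domain_iff: "((x, y), h) \<in> topspace act_domain \<longleftrightarrow> (x, y) \<in> tail_arrows S \<and> h \<in> chars \<and> char_path h = y"
  by (auto simp: topspace_tail topspace_spectrum tail_groupoid_simps)

lemma openin_act_domain:
  assumes "openin (arrows (tail_groupoid S)) U" "openin spec V"
  shows "openin act_domain ((U \<times> V) \<inter> topspace act_domain)"
proof -
  have "openin (prod_topology (arrows (tail_groupoid S)) spec) (U \<times> V)"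
    using assms by (simp add: openin_prod_Times_iff)
  moreover from openin_subset[OF this] have "(U \<times> V) \<inter> topspace act_domain =
      (U \<times> V) \<inter> {(g, h). src (tail_groupoid S) g = char_anchor h}"
    unfolding topspace_subtopology by blast
  ultimately show ?thesis by (simp only: openin_subtopology_Int)
qed

text \<open>On the cylinder at the level of an arrow the partial isometry is constant. Locally,
  evaluating the transformed character at \<open>c\<close> is thus evaluating the original one at a
  fixed conjugate of \<open>c\<close>.\<close>

lemma continuous_char_act: "continuous_map act_domain spec (\<lambda>(g, h). char_act g h)"
proof (rule continuous_into_spec)
  fix p assume "p \<in> topspace act_domain"
  moreover obtain x y h where p: "p = ((x, y), h)" by (metis surj_pair)
  ultimately show "(\<lambda>(g, h). char_act g h) p \<in> chars" using act_chars unfolding p act_domain_iff by auto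
next
  fix c assume c: "c \<in> Dlim"
  show "continuous_map act_domain euclidean (\<lambda>p. (\<lambda>(g, h). char_act g h) p c)"
  proof (rule continuous_map_locallyI)
    fix p assume p: "p \<in> topspace act_domain"
    obtain x y h where pe: "p = ((x, y), h)" by (metis surj_pair)
    have xy: "(x, y) \<in> tail_arrows S" and h: "h \<in> chars" using p unfolding pe act_domain_iff by auto
    let ?w = "partial_iso (x, y)" and ?U = "cylinder S (level (x, y)) (x, y)"
    let ?c = "(adj A ?w \<otimes>\<^bsub>A\<^esub> c) \<otimes>\<^bsub>A\<^esub> ?w"
    let ?T = "(?U \<times> topspace spec) \<inter> topspace act_domain"
    have ag: "\<forall>k\<ge>level (x, y). x k = y k" using level(2)[OF xy] by blast
    have "openin act_domain ?T" by (rule openin_act_domain[OF openin_cylinder[OF xy ag] openin_topspace])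
    moreover have "p \<in> ?T" using p cylinder_self[OF xy ag] h by (simp add: pe topspace_spectrum)
    moreover have "continuous_map act_domain euclidean (\<lambda>p. (snd p) ?c)"
      using continuous_map_compose[OF continuous_map_from_subtopology[OF continuous_map_snd]
        continuous_evaluation[OF conjugate_Dlim[OF xy c]]] by (simp add: o_def)
    moreover have "(\<lambda>(g, h). char_act g h) q c = (snd q) ?c" if q: "q \<in> ?T" for q
    proof -
      obtain x' y' g where qe: "q = ((x', y'), g)" by (metis surj_pair)
      have "(x', y') \<in> ?U" using q qe by simp
      from partial_iso_cylinder[OF xy this] show ?thesis using c by (simp add: qe char_act_def)
    qed
    ultimately show "\<exists>T g. openin act_domain T \<and> p \<in> T \<and> continuous_map act_domain euclidean g \<and>
        (\<forall>q\<in>T. (\<lambda>(g, h). char_act g h) q c = g q)" by blast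
  qed
qed

lemma groupoid_action_spec: "groupoid_action (tail_groupoid S) spec char_anchor char_act"
proof (rule groupoid_action.intro[OF etale_tail_groupoid], unfold_locales)
  show "continuous_map spec (unit_space (tail_groupoid S)) char_anchor" by (rule continuous_char_anchor)
  show "continuous_map act_domain spec (\<lambda>(g, h). char_act g h)" by (rule continuous_char_act)
next
  fix h assume "h \<in> topspace spec"
  then have h: "h \<in> chars" by (simp add: topspace_spectrum)
  note r = tail_refl[OF char_path(1)[OF h]]
  show "char_act (char_anchor h) h = h"
  proof (rule char_eqI[OF act_chars[OF r h refl] h])
    fix n c assume n: "n \<ge> (1::nat)" and c: "c \<in> diagonal_part S n"
    show "char_act (char_anchor h) h (\<iota> n c) = h (\<iota> n c)"
      using act_stage[OF r h refl _ c] char_eval(2)[OF h n c] n by (simp add: level_refl)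
  qed
next
  fix g h assume "g \<in> topspace (arrows (tail_groupoid S))" "h \<in> topspace spec" "src (tail_groupoid S) g = char_anchor h"
  moreover obtain x y where g: "g = (x, y)" by (cases g)
  ultimately have "(x, y) \<in> tail_arrows S" "h \<in> chars" "char_path h = y"
    by (simp_all add: topspace_tail topspace_spectrum tail_groupoid_simps)
  from act_path[OF this] show "char_anchor (char_act g h) = rng (tail_groupoid S) g"
    by (simp add: g tail_groupoid_simps)
next
  fix k g h assume "k \<in> topspace (arrows (tail_groupoid S))" "g \<in> topspace (arrows (tail_groupoid S))" "h \<in> topspace spec"
    "src (tail_groupoid S) k = rng (tail_groupoid S) g" "src (tail_groupoid S) g = char_anchor h"
  moreover obtain x y y' z where kg: "k = (x, y)" "g = (y', z)" by (cases k; cases g)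
  ultimately have xy: "(x, y) \<in> tail_arrows S" and yz: "(y, z) \<in> tail_arrows S" and h: "h \<in> chars"
    and hz: "char_path h = z" and y': "y' = y"
    by (simp_all add: topspace_tail topspace_spectrum tail_groupoid_simps)
  note xz = tail_trans[OF xy yz]
  let ?h = "char_act (y, z) h"
  note h' = act_chars[OF yz h hz] and hy = act_path[OF yz h hz]
  have "char_act (x, z) h = char_act (x, y) ?h"
  proof (rule char_eqI[OF act_chars[OF xz h hz] act_chars[OF xy h' hy]])
    fix n c assume n: "n \<ge> max (level (x, z)) (max (level (x, y)) (level (y, z)))" "n \<ge> 1" and c: "c \<in> diagonal_part S n"
    have v: "vertex y n = vertex z n" "vertex x n = vertex z n"
      using level(2)[OF yz, of n] level(2)[OF xz, of n] n by (simp_all add: vertex_def)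
    have p: "path_pos S x n < msize S n (vertex z n)" using path_pos_less[OF tail_arrowsD(1)[OF xy] n(2)] v(2) by simp
    have "continuous_map (base S n (vertex z n)) euclidean (\<lambda>w. c (vertex z n) w $$ (path_pos S x n, path_pos S x n))"
      by (rule stage_carrierD(2)[OF diagonal_partD(1)[OF c] vertex_in[OF tail_arrowsD(2)[OF yz] n(2)] p p])
    \<comment> \<open>Beyond all three levels both sides are the entry of \<open>c\<close> at the
      position of \<open>x\<close>, once at the point of \<open>h\<close> and once at that of the
      intermediate character; a continuous entry takes the same value at both.\<close>
    from act_point[OF yz h hz _ this] n
    show "char_act (x, z) h (\<iota> n c) = char_act (x, y) ?h (\<iota> n c)"
      using act_stage[OF xz h hz _ c] act_stage[OF xy h' hy _ c] v by simp
  qed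
  then show "char_act (gmul (tail_groupoid S) k g) h = char_act k (char_act g h)"
    by (simp add: kg y' tail_groupoid_simps)
qed

end

section \<open>Separation axioms on function types\<close>

lemma open_coordinate: "open W \<Longrightarrow> open ((\<lambda>h. h x) -` W)" for W :: "'b :: topological_space set"
  by (rule open_vimage[OF _ continuous_on_product_coordinates])

text \<open>Stone-Weierstrass in \<open>function_ring_on\<close> concerns subsets of a
  \<open>t2_space\<close> type, and characters have a function type. Separation is inherited from
  the codomain through one coordinate in which two functions differ.\<close>

instance "fun" :: (type, t0_space) t0_space
proof
  fix f g :: "'a \<Rightarrow> 'b"
  assume "f \<noteq> g"
  then obtain x where "f x \<noteq> g x" by blast
  from t0_space_class.t0_space[OF this] obtain U where "open U" "\<not> (f x \<in> U \<longleftrightarrow> g x \<in> U)" by blast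
  then show "\<exists>U. open U \<and> \<not> (f \<in> U \<longleftrightarrow> g \<in> U)"
    by (intro exI[of _ "(\<lambda>h. h x) -` U"]) (simp add: open_coordinate)
qed

instance "fun" :: (type, t1_space) t1_space
proof
  fix f g :: "'a \<Rightarrow> 'b"
  assume "f \<noteq> g"
  then obtain x where "f x \<noteq> g x" by blast
  from t1_space_class.t1_space[OF this] obtain U where "open U" "f x \<in> U" "g x \<notin> U" by blast
  then show "\<exists>U. open U \<and> f \<in> U \<and> g \<notin> U"
    by (intro exI[of _ "(\<lambda>h. h x) -` U"]) (simp add: open_coordinate)
qed

instance "fun" :: (type, t2_space) t2_space
proof
  fix f g :: "'a \<Rightarrow> 'b"
  assume "f \<noteq> g"
  then obtain x where "f x \<noteq> g x" by blast
  from hausdorff[OF this] obtain U V where "open U" "open V" "f x \<in> U" "g x \<in> V" "U \<inter> V = {}" by blast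
  then show "\<exists>U V. open U \<and> open V \<and> f \<in> U \<and> g \<in> V \<and> U \<inter> V = {}"
    by (intro exI[of _ "(\<lambda>h. h x) -` U"] exI[of _ "(\<lambda>h. h x) -` V"]) (auto simp: open_coordinate)
qed

section \<open>Existence of characters\<close>

context ah_limit
begin

text \<open>A contractive functional on the dense part extends to limits by
  \<open>dense_extension\<close>; the homomorphism laws follow by applying them along approximating
  sequences.\<close>

lemma char_extend:
  assumes add: "\<And>d d'. d \<in> Dpre \<Longrightarrow> d' \<in> Dpre \<Longrightarrow> v (d \<oplus>\<^bsub>A\<^esub> d') = v d + (v d' :: complex)"
    and mult: "\<And>d d'. d \<in> Dpre \<Longrightarrow> d' \<in> Dpre \<Longrightarrow> v (d \<otimes>\<^bsub>A\<^esub> d') = v d * v d'"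
    and smult: "\<And>z d. d \<in> Dpre \<Longrightarrow> v (z \<odot>\<^bsub>A\<^esub> d) = z * v d"
    and bound: "\<And>d. d \<in> Dpre \<Longrightarrow> cmod (v d) \<le> nrm A d"
    and one: "v \<one>\<^bsub>A\<^esub> = 1"
  obtains h where "h \<in> chars" "\<And>d. d \<in> Dpre \<Longrightarrow> h d = v d"
proof -
  have DA: "d \<in> carrier A" if "d \<in> Dpre" for d using that Dpre_sub by blast
  have contr: "dist (v d) (v d') \<le> nrm A (d \<ominus>\<^bsub>A\<^esub> d')" if d: "d \<in> Dpre" "d' \<in> Dpre" for d d'
  proof -
    have m: "(-1) \<odot>\<^bsub>A\<^esub> d' \<in> Dpre" by (rule Dpre_closed(3)[OF d(2,2)])
    have "d \<ominus>\<^bsub>A\<^esub> d' = d \<oplus>\<^bsub>A\<^esub> ((-1) \<odot>\<^bsub>A\<^esub> d')" by (simp add: a_minus_def A.smult_simps(5)[OF DA[OF d(2)]])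
    then show ?thesis
      using bound[OF Dpre_closed(2)[OF d(1) m]] add[OF d(1) m] smult[OF d(2), of "-1"] by (simp add: dist_norm)
  qed
  have "\<exists>y\<in>UNIV. \<forall>s. (\<forall>k :: nat. s k \<in> Dpre) \<longrightarrow> (\<lambda>k. nrm A (s k \<ominus>\<^bsub>A\<^esub> x)) \<longlonglongrightarrow> 0 \<longrightarrow> (\<lambda>k. dist (v (s k)) y) \<longlonglongrightarrow> 0"
    if x: "x \<in> Dlim" for x
  proof (rule dense_extension[where ?M1.0 = "carrier A" and ?d1.0 = "\<lambda>x y. nrm A (x \<ominus>\<^bsub>A\<^esub> y)" and u = "\<lambda>d. d" and D = Dpre
      and ?M2.0 = UNIV and ?d2.0 = dist and v = v and x = x])
    fix s :: "nat \<Rightarrow> complex" assume "\<And>e. 0 < e \<Longrightarrow> \<exists>N. \<forall>m\<ge>N. \<forall>n\<ge>N. dist (s m) (s n) < e"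
    then have "Cauchy s" by (rule metric_CauchyI)
    from Cauchy_convergent[OF this] obtain y where "s \<longlonglongrightarrow> y" unfolding convergent_def by blast
    then have "(\<lambda>k. dist (s k) y) \<longlonglongrightarrow> 0" by (rule tendsto_dist_iff[THEN iffD1])
    then show "\<exists>y\<in>UNIV. (\<lambda>k. dist (s k) y) \<longlonglongrightarrow> 0" by blast
  next
    fix e :: real assume "0 < e"
    then show "\<exists>d\<in>Dpre. nrm A (x \<ominus>\<^bsub>A\<^esub> d) < e" using x by (simp add: Dlim_def norm_closure_def)
  next
    show "x \<in> carrier A" using x Dlim_sub by blast
    show "dist (v d) (v d') \<le> nrm A (d \<ominus>\<^bsub>A\<^esub> d')" if "d \<in> Dpre" "d' \<in> Dpre" for d d' by (rule contr[OF that])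
    show "nrm A (p \<ominus>\<^bsub>A\<^esub> q) = nrm A (q \<ominus>\<^bsub>A\<^esub> p)" if "p \<in> carrier A" "q \<in> carrier A" for p q
      by (rule A.nrm_minus_commute[OF that])
    show "nrm A (p \<ominus>\<^bsub>A\<^esub> r) \<le> nrm A (p \<ominus>\<^bsub>A\<^esub> q) + nrm A (q \<ominus>\<^bsub>A\<^esub> r)"
      if "p \<in> carrier A" "q \<in> carrier A" "r \<in> carrier A" for p q r
      by (rule A.nrm_minus_triangle[OF that])
    show "0 \<le> dist p q" "dist p r \<le> dist p q + dist q r" for p q r :: complex
      by (rule zero_le_dist, rule dist_triangle)
    show "d \<in> carrier A" if "d \<in> Dpre" for d by (rule DA[OF that])
  qed simp
  note ex = this
  define f where "f = (\<lambda>x. SOME y. \<forall>s. (\<forall>k :: nat. s k \<in> Dpre) \<longrightarrow> (\<lambda>k. nrm A (s k \<ominus>\<^bsub>A\<^esub> x)) \<longlonglongrightarrow> 0 \<longrightarrow>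
      (\<lambda>k. dist (v (s k)) y) \<longlonglongrightarrow> 0)"
  have f: "(\<lambda>k. v (s k)) \<longlonglongrightarrow> f x"
    if x: "x \<in> Dlim" and s: "\<And>k :: nat. s k \<in> Dpre" "(\<lambda>k. nrm A (s k \<ominus>\<^bsub>A\<^esub> x)) \<longlonglongrightarrow> 0" for x s
  proof -
    have "\<exists>y. \<forall>s. (\<forall>k :: nat. s k \<in> Dpre) \<longrightarrow> (\<lambda>k. nrm A (s k \<ominus>\<^bsub>A\<^esub> x)) \<longlonglongrightarrow> 0 \<longrightarrow> (\<lambda>k. dist (v (s k)) y) \<longlonglongrightarrow> 0"
      using ex[OF x] by (simp only: UNIV_I bex_simps Bex_def simp_thms)
    from someI_ex[OF this] have *: "\<forall>s. (\<forall>k :: nat. s k \<in> Dpre) \<longrightarrow> (\<lambda>k. nrm A (s k \<ominus>\<^bsub>A\<^esub> x)) \<longlonglongrightarrow> 0 \<longrightarrow>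
        (\<lambda>k. dist (v (s k)) (f x)) \<longlonglongrightarrow> 0" unfolding f_def .
    have a: "\<forall>k. s k \<in> Dpre" using s(1) by blast
    show ?thesis by (rule tendsto_dist_iff[THEN iffD2, OF mp[OF mp[OF spec[OF *, of s] a] s(2)]])
  qed
  have fd: "f d = v d" if d: "d \<in> Dpre" for d
  proof -
    have "d \<in> Dlim" using d Dpre_Dlim by blast
    from f[OF this, of "\<lambda>_. d", OF d A.limit_const[OF DA[OF d]]] show ?thesis by (simp add: LIMSEQ_const_iff)
  qed
  have hom: "f (x \<oplus>\<^bsub>A\<^esub> y) = f x + f y" "f (x \<otimes>\<^bsub>A\<^esub> y) = f x * f y" "f (z \<odot>\<^bsub>A\<^esub> x) = z * f x"
    if x: "x \<in> Dlim" and y: "y \<in> Dlim" for x y z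
  proof -
    obtain s where s: "\<And>k :: nat. s k \<in> Dpre" "(\<lambda>k. nrm A (s k \<ominus>\<^bsub>A\<^esub> x)) \<longlonglongrightarrow> 0" using Dlim_sequence[OF x] by blast
    obtain t where t: "\<And>k :: nat. t k \<in> Dpre" "(\<lambda>k. nrm A (t k \<ominus>\<^bsub>A\<^esub> y)) \<longlonglongrightarrow> 0" using Dlim_sequence[OF y] by blast
    have c: "x \<in> carrier A" "y \<in> carrier A" using x y Dlim_sub by auto
    have "(\<lambda>k. v (s k \<oplus>\<^bsub>A\<^esub> t k)) \<longlonglongrightarrow> f (x \<oplus>\<^bsub>A\<^esub> y)"
      by (rule f[OF Dlim_closed(2)[OF x y] Dpre_closed(2)[OF s(1) t(1)] A.limit_add[OF DA[OF s(1)] DA[OF t(1)] c s(2) t(2)]])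
    moreover have "(\<lambda>k. v (s k \<oplus>\<^bsub>A\<^esub> t k)) \<longlonglongrightarrow> f x + f y"
      unfolding add[OF s(1) t(1)] by (intro tendsto_add f[OF x s] f[OF y t])
    ultimately show "f (x \<oplus>\<^bsub>A\<^esub> y) = f x + f y" by (rule LIMSEQ_unique)
    have "(\<lambda>k. v (s k \<otimes>\<^bsub>A\<^esub> t k)) \<longlonglongrightarrow> f (x \<otimes>\<^bsub>A\<^esub> y)"
      by (rule f[OF Dlim_closed(1)[OF x y] Dpre_closed(1)[OF s(1) t(1)] A.limit_mult[OF DA[OF s(1)] DA[OF t(1)] c s(2) t(2)]])
    moreover have "(\<lambda>k. v (s k \<otimes>\<^bsub>A\<^esub> t k)) \<longlonglongrightarrow> f x * f y"
      unfolding mult[OF s(1) t(1)] by (intro tendsto_mult f[OF x s] f[OF y t])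
    ultimately show "f (x \<otimes>\<^bsub>A\<^esub> y) = f x * f y" by (rule LIMSEQ_unique)
    have "(\<lambda>k. v (z \<odot>\<^bsub>A\<^esub> s k)) \<longlonglongrightarrow> f (z \<odot>\<^bsub>A\<^esub> x)"
      by (rule f[OF Dlim_closed(3)[OF x y] Dpre_closed(3)[OF s(1) t(1)] A.limit_smult[OF DA[OF s(1)] c(1) s(2)]])
    moreover have "(\<lambda>k. v (z \<odot>\<^bsub>A\<^esub> s k)) \<longlonglongrightarrow> z * f x"
      unfolding smult[OF s(1)] by (intro tendsto_mult tendsto_const f[OF x s])
    ultimately show "f (z \<odot>\<^bsub>A\<^esub> x) = z * f x" by (rule LIMSEQ_unique)
  qed
  let ?h = "restrict f Dlim"
  have "\<exists>x\<in>Dlim. ?h x \<noteq> 0"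
  proof (rule bexI[OF _ one_Dlim])
    have "\<one>\<^bsub>A\<^esub> \<in> Dpre" using DpreI[OF _ one_diagonal, of 1] iota_hom(4)[of 1] by (metis order_refl)
    then show "?h \<one>\<^bsub>A\<^esub> \<noteq> 0" using one_Dlim fd one by simp
  qed
  then have "?h \<in> chars"
    unfolding chars_iff
  proof (intro conjI ballI allI)
    fix x assume x: "x \<in> Dlim"
    show "?h (z \<odot>\<^bsub>A\<^esub> x) = z * ?h x" for z using hom(3)[OF x x] Dlim_closed(3)[OF x x] x by simp
    fix y assume y: "y \<in> Dlim"
    show "?h (x \<oplus>\<^bsub>A\<^esub> y) = ?h x + ?h y" using hom(1)[OF x y] Dlim_closed(2)[OF x y] x y by simp
    show "?h (x \<otimes>\<^bsub>A\<^esub> y) = ?h x * ?h y" using hom(2)[OF x y] Dlim_closed(1)[OF x y] x y by simp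
  qed simp_all
  moreover have "?h d = v d" if "d \<in> Dpre" for d using that fd Dpre_Dlim by (simp add: subset_iff)
  ultimately show ?thesis by (rule that)
qed

lemma iterated_closed:
  assumes "n \<ge> 1" "c \<in> diagonal_part S n"
  shows "iterated (connecting_map S) n m c \<in> diagonal_part S (n + m)"
proof (induction m)
  case (Suc m)
  then show ?case using connecting_map_diagonal[of "n + m"] assms(1) by simp
qed (use assms in simp)

text \<open>A point of \<open>base S n i\<close> is lifted step by step through the eigenfunctions; evaluation along
  the resulting thread is a character of the limit diagonal.\<close>

lemma character_through:
  assumes n: "n \<ge> 1" and i: "i \<in> {1..nblocks S n}" and x: "x \<in> topspace (base S n i)"
  obtains h where "h \<in> chars" "vertex (char_path h) n = i"
    "\<And>f. continuous_map (base S n i) euclidean f \<Longrightarrow> f (char_point h n) = (f x :: complex)"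
proof -
  \<comment> \<open>States of the recursion are triples of block, point and diagonal index at stage
    \<open>n + k\<close>; \<open>Q\<close> says that the next point maps to the current one under an
    edge and that the index moves along that edge.\<close>
  define P where "P = (\<lambda>k (j, z, b). j \<in> {1..nblocks S (n + k)} \<and> z \<in> topspace (base S (n + k) j) \<and> b < msize S (n + k) j)"
  define Q where "Q = (\<lambda>k (j, z, b) (j', z', b'). \<exists>e\<in>edges S (n + k) j j'. eigenfun S (n + k) j j' e z' = z \<and>
      b' = pos_offset S (n + k) j' (j, e) + b)"
  have step: "\<exists>t'. P (Suc k) t' \<and> Q k t t'" if "P k t" for t k
  proof -
    obtain j z b where t: "t = (j, z, b)" by (metis surj_pair)
    have j: "j \<in> {1..nblocks S (n + k)}" "z \<in> topspace (base S (n + k) j)" "b < msize S (n + k) j"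
      using that by (auto simp: t P_def)
    have nk: "n + k \<ge> 1" using n by simp
    obtain j' e z' where e: "j' \<in> {1..nblocks S (Suc (n + k))}" "e \<in> edges S (n + k) j j'"
      "z' \<in> topspace (base S (Suc (n + k)) j')" "eigenfun S (n + k) j j' e z' = z"
      by (rule eigenfun_jointly_surj[OF nk j(1,2)])
    have "P (Suc k) (j', z', pos_offset S (n + k) j' (j, e) + b)"
      using e position_less[OF nk e(1) j(1) e(2) j(3)] by (simp add: P_def)
    moreover have "Q k t (j', z', pos_offset S (n + k) j' (j, e) + b)"
      using e unfolding Q_def t by auto
    ultimately show ?thesis by blast
  qed
  have "P 0 (i, x, 0)" using i x msize_pos[OF n i] by (simp add: P_def)
  then obtain T where T0: "T 0 = (i, x, 0)" and PT: "\<And>k. P k (T k)" and QT: "\<And>k. Q k (T k) (T (Suc k))"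
    using dependent_nat_choice[of "\<lambda>k t. P k t \<and> (k = 0 \<longrightarrow> t = (i, x, 0))" Q] step
    by (metis nat.distinct(1))
  define J where "J = (\<lambda>k. fst (T k))"
  define Z where "Z = (\<lambda>k. fst (snd (T k)))"
  define B where "B = (\<lambda>k. snd (snd (T k)))"
  have Tk: "T k = (J k, Z k, B k)" for k by (simp add: J_def Z_def B_def)
  have JZB: "J k \<in> {1..nblocks S (n + k)}" "Z k \<in> topspace (base S (n + k) (J k))" "B k < msize S (n + k) (J k)" for k
    using PT[of k] by (auto simp: Tk P_def)
  have nk: "n + k \<ge> 1" for k using n by simp
  define v where "v = (\<lambda>k (c :: nat \<Rightarrow> 'x \<Rightarrow> complex mat). c (J k) (Z k) $$ (B k, B k))"
  have v_Suc: "v (Suc k) (connecting_map S (n + k) c) = v k c" if c: "c \<in> diagonal_part S (n + k)" for k c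
  proof -
    obtain e where e: "e \<in> edges S (n + k) (J k) (J (Suc k))" "eigenfun S (n + k) (J k) (J (Suc k)) e (Z (Suc k)) = Z k"
      "B (Suc k) = pos_offset S (n + k) (J (Suc k)) (J k, e) + B k" using QT[of k] by (auto simp: Tk Q_def)
    have J': "J (Suc k) \<in> {1..nblocks S (Suc (n + k))}" "Z (Suc k) \<in> topspace (base S (Suc (n + k)) (J (Suc k)))"
      using JZB[of "Suc k"] by simp_all
    show ?thesis
      unfolding v_def e(3) connecting_map_index[OF nk diagonal_partD(1)[OF c] J' JZB(1) e(1) JZB(3) JZB(1) e(1) JZB(3)]
      by (simp add: e(2))
  qed
  have v_iter: "v (k + m) (iterated (connecting_map S) (n + k) m c) = v k c" if c: "c \<in> diagonal_part S (n + k)" for k m c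
  proof (induction m)
    case (Suc m)
    have "iterated (connecting_map S) (n + k) m c \<in> diagonal_part S (n + (k + m))"
      using iterated_closed[OF nk c, of m] by (simp add: add.assoc)
    from v_Suc[OF this] Suc show ?case by (simp add: add.assoc)
  qed simp
  \<comment> \<open>The value along the thread is an entry of every later image of \<open>c\<close>,
    hence bounded by the norms at all later stages, and these converge to the norm in the
    limit.\<close>
  have v_bound: "cmod (v k c) \<le> nrm A (\<iota> (n + k) c)" if c: "c \<in> diagonal_part S (n + k)" for k c
  proof (rule LIMSEQ_le_const)
    show "(\<lambda>m. nrm (stage_algebra S (n + k + m)) (iterated (connecting_map S) (n + k) m c)) \<longlonglongrightarrow> nrm A (\<iota> (n + k) c)"
      using limit nk diagonal_partD(1)[OF c] by (simp add: inductive_limit_def)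
    have "cmod (v k c) \<le> nrm (stage_algebra S (n + k + m)) (iterated (connecting_map S) (n + k) m c)" for m
    proof -
      let ?c = "iterated (connecting_map S) (n + k) m c"
      have c': "?c \<in> carrier (stage_algebra S (n + (k + m)))"
        using diagonal_partD(1)[OF iterated_closed[OF nk c, of m]] by (simp add: add.assoc)
      have "cmod (v (k + m) ?c) \<le> matrix_norm (?c (J (k + m)) (Z (k + m)))"
        unfolding v_def by (rule index_le_matrix_norm[OF stage_carrierD(1)[OF c' JZB(1,2)] JZB(3,3)])
      also have "\<dots> \<le> nrm (stage_algebra S (n + (k + m))) ?c"
        by (rule matrix_norm_le_stage_norm[OF nk c' JZB(1,2)])
      finally show ?thesis unfolding v_iter[OF c] by (simp add: add.assoc)
    qed
    then show "\<exists>N. \<forall>m\<ge>N. cmod (v k c) \<le> nrm (stage_algebra S (n + k + m)) (iterated (connecting_map S) (n + k) m c)" by blast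
  qed
  have v_hom: "v k (c \<oplus>\<^bsub>stage_algebra S (n + k)\<^esub> c') = v k c + v k c'"
    "v k (c \<otimes>\<^bsub>stage_algebra S (n + k)\<^esub> c') = v k c * v k c'"
    "v k (w \<odot>\<^bsub>stage_algebra S (n + k)\<^esub> c) = w * v k c"
    "v k \<one>\<^bsub>stage_algebra S (n + k)\<^esub> = 1"
    if c: "c \<in> diagonal_part S (n + k)" "c' \<in> diagonal_part S (n + k)" for k c c' w
    unfolding v_def using stage_ops_index(2,3,5)[OF diagonal_partD(1)[OF c(1)] diagonal_partD(1)[OF c(2)] JZB JZB(3)]
      diagonal_mult_index[OF c JZB] by simp_all
  have rep: "\<exists>k\<ge>N. \<exists>c\<in>diagonal_part S (n + k). d = \<iota> (n + k) c" if "d \<in> Dpre" for d N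
  proof -
    obtain m c where m: "m \<ge> n + N" "m \<ge> 1" "c \<in> diagonal_part S m" "d = \<iota> m c" by (rule DpreE[OF \<open>d \<in> Dpre\<close>])
    then have "m = n + (m - n)" "m - n \<ge> N" by simp_all
    then show ?thesis using m(3,4) by metis
  qed
  have raise: "\<exists>c'\<in>diagonal_part S (n + K). \<iota> (n + K) c' = \<iota> (n + k) c \<and> v K c' = v k c"
    if c: "c \<in> diagonal_part S (n + k)" and K: "K \<ge> k" for k c K
    using K
  proof (induction K rule: dec_induct)
    case base
    then show ?case using c by blast
  next
    case (step K)
    then obtain c' where c': "c' \<in> diagonal_part S (n + K)" "\<iota> (n + K) c' = \<iota> (n + k) c" "v K c' = v k c" by blast
    show ?case
      using connecting_map_diagonal[OF nk c'(1)] iota_Suc[OF nk diagonal_partD(1)[OF c'(1)]] v_Suc[OF c'(1)] c'(2,3)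
      by (intro bexI[of _ "connecting_map S (n + K) c'"]) simp_all
  qed
  \<comment> \<open>The maps \<open>\<iota> n\<close> are not yet known to be injective. The
    difference of two representatives has norm 0 in the limit, so \<open>v_bound\<close> makes its
    value 0; hence the value depends only on the element of \<open>A\<close>.\<close>
  have uniq: "v k c = v k' c'"
    if c: "c \<in> diagonal_part S (n + k)" "c' \<in> diagonal_part S (n + k')" and eq: "\<iota> (n + k) c = \<iota> (n + k') c'" for k k' c c'
  proof -
    let ?K = "max k k'"
    obtain b where b: "b \<in> diagonal_part S (n + ?K)" "\<iota> (n + ?K) b = \<iota> (n + k) c" "v ?K b = v k c"
      using raise[OF c(1), of ?K] by auto
    obtain b' where b': "b' \<in> diagonal_part S (n + ?K)" "\<iota> (n + ?K) b' = \<iota> (n + k') c'" "v ?K b' = v k' c'"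
      using raise[OF c(2), of ?K] by auto
    let ?m = "(-1) \<odot>\<^bsub>stage_algebra S (n + ?K)\<^esub> b'"
    have m: "?m \<in> diagonal_part S (n + ?K)" by (rule diagonal_closed(3)[OF b'(1) b'(1)])
    have A: "\<iota> (n + k) c \<in> carrier A" by (rule iota_hom(1)[OF nk diagonal_partD(1)[OF c(1)]])
    have "\<iota> (n + ?K) (b \<oplus>\<^bsub>stage_algebra S (n + ?K)\<^esub> ?m) = \<iota> (n + k) c \<ominus>\<^bsub>A\<^esub> \<iota> (n + k) c"
      unfolding iota_diagonal(2)[OF nk b(1) m] iota_diagonal(3)[OF nk b'(1) b'(1)] b(2) b'(2) eq[symmetric]
      by (simp add: a_minus_def A.smult_simps(5)[OF A])
    then have "nrm A (\<iota> (n + ?K) (b \<oplus>\<^bsub>stage_algebra S (n + ?K)\<^esub> ?m)) = 0"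
      using A.minus_identities(9)[OF A A A A] A.nrm_zero by simp
    then have "v ?K (b \<oplus>\<^bsub>stage_algebra S (n + ?K)\<^esub> ?m) = 0"
      using v_bound[OF diagonal_closed(2)[OF b(1) m]] by simp
    then show ?thesis using v_hom(1)[OF b(1) m] v_hom(3)[OF b'(1) b'(1), of "-1"] b(3) b'(3) by simp
  qed
  define V where "V = (\<lambda>d. SOME w. \<exists>k. \<exists>c\<in>diagonal_part S (n + k). d = \<iota> (n + k) c \<and> w = v k c)"
  have V: "V (\<iota> (n + k) c) = v k c" if c: "c \<in> diagonal_part S (n + k)" for k c
  proof -
    have "\<exists>w. \<exists>k'. \<exists>c'\<in>diagonal_part S (n + k'). \<iota> (n + k) c = \<iota> (n + k') c' \<and> w = v k' c'" using c by blast
    from someI_ex[OF this] have "\<exists>k'. \<exists>c'\<in>diagonal_part S (n + k'). \<iota> (n + k) c = \<iota> (n + k') c' \<and> V (\<iota> (n + k) c) = v k' c'"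
      unfolding V_def .
    then show ?thesis using uniq[OF c] by metis
  qed
  have rep2: "\<exists>k. \<exists>c\<in>diagonal_part S (n + k). \<exists>c'\<in>diagonal_part S (n + k). d = \<iota> (n + k) c \<and> d' = \<iota> (n + k) c'"
    if d: "d \<in> Dpre" "d' \<in> Dpre" for d d'
  proof -
    obtain k c where k: "c \<in> diagonal_part S (n + k)" "d = \<iota> (n + k) c" using rep[OF d(1), of 0] by blast
    obtain K c' where K: "K \<ge> k" "c' \<in> diagonal_part S (n + K)" "d' = \<iota> (n + K) c'" using rep[OF d(2), of k] by blast
    then show ?thesis using raise[OF k(1) K(1)] k(2) by metis
  qed
  obtain h where h: "h \<in> chars" and hd: "\<And>d. d \<in> Dpre \<Longrightarrow> h d = V d"
  proof (rule char_extend[of V])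
    fix d d' assume d: "d \<in> Dpre" "d' \<in> Dpre"
    obtain k c c' where c: "c \<in> diagonal_part S (n + k)" "c' \<in> diagonal_part S (n + k)"
      and e: "d = \<iota> (n + k) c" "d' = \<iota> (n + k) c'" using rep2[OF d] by blast
    show "V (d \<oplus>\<^bsub>A\<^esub> d') = V d + V d'"
      unfolding e iota_diagonal(2)[OF nk c, symmetric] V[OF c(1)] V[OF c(2)] V[OF diagonal_closed(2)[OF c]] by (rule v_hom(1)[OF c])
    show "V (d \<otimes>\<^bsub>A\<^esub> d') = V d * V d'"
      unfolding e iota_diagonal(1)[OF nk c, symmetric] V[OF c(1)] V[OF c(2)] V[OF diagonal_closed(1)[OF c]] by (rule v_hom(2)[OF c])
  next
    fix w d assume d: "d \<in> Dpre"
    obtain k c where c: "c \<in> diagonal_part S (n + k)" and e: "d = \<iota> (n + k) c" using rep[OF d, of 0] by blast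
    show "V (w \<odot>\<^bsub>A\<^esub> d) = w * V d"
      unfolding e iota_diagonal(3)[OF nk c c, symmetric] V[OF c] V[OF diagonal_closed(3)[OF c c]] by (rule v_hom(3)[OF c c])
    show "cmod (V d) \<le> nrm A d" unfolding e V[OF c] by (rule v_bound[OF c])
  next
    have o: "\<one>\<^bsub>stage_algebra S (n + 0)\<^esub> \<in> diagonal_part S (n + 0)" by (rule one_diagonal)
    show "V \<one>\<^bsub>A\<^esub> = 1"
      unfolding iota_hom(4)[OF nk[of 0], symmetric] V[OF o] by (rule v_hom(4)[OF o o])
  qed blast
  have h0: "h (\<iota> n c) = c i x $$ (0, 0)" if c: "c \<in> diagonal_part S n" for c
    using hd[OF DpreI[OF n c]] V[of c 0] c by (simp add: v_def J_def Z_def B_def T0)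
  have m0: "0 < msize S n i" using msize_pos[OF n i] by simp
  have "h (\<iota> n (diag_unit n i 0)) = 1"
    unfolding h0[OF diag_unit] matrix_unit_index[OF i x m0 m0] by simp
  then have hp: "vertex (char_path h) n = i" "path_pos S (char_path h) n = 0"
    unfolding char_diag_unit_path[OF h n] by (simp_all split: if_splits)
  have hz: "char_point h n \<in> topspace (base S n i)" using char_eval(1)[OF h n] hp by simp
  have "f (char_point h n) = f x" if f: "continuous_map (base S n i) euclidean f" for f :: "'x \<Rightarrow> complex"
  proof -
    have c: "matrix_unit S n i 0 0 f \<in> diagonal_part S n" by (rule matrix_unit_diagonal[OF f])
    have "h (\<iota> n (matrix_unit S n i 0 0 f)) = f x"
      unfolding h0[OF c] matrix_unit_index[OF i x m0 m0] by simp
    then show ?thesis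
      unfolding char_eval(2)[OF h n c] hp matrix_unit_index[OF i hz m0 m0] by simp
  qed
  with h hp(1) show ?thesis by (rule that)
qed

section \<open>Compactness of the spectrum and density\<close>

text \<open>The defining laws are closed conditions on finitely many coordinates each. Being nonzero
  is not closed, and it is replaced by the equivalent equation that the unit is sent to 1.\<close>

lemma closedin_chars: "closedin (product_topology (\<lambda>_. euclidean) Dlim) chars"
proof -
  let ?P = "product_topology (\<lambda>_. euclidean :: complex topology) Dlim"
  define F where "F = {\<lambda>h. h (x \<oplus>\<^bsub>A\<^esub> y) - (h x + h y) | x y. x \<in> Dlim \<and> y \<in> Dlim} \<union>
    {\<lambda>h. h (x \<otimes>\<^bsub>A\<^esub> y) - h x * h y | x y. x \<in> Dlim \<and> y \<in> Dlim} \<union>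
    {\<lambda>h. h (c \<odot>\<^bsub>A\<^esub> x) - c * h x | c x. x \<in> Dlim} \<union> {\<lambda>h :: 'a \<Rightarrow> complex. h \<one>\<^bsub>A\<^esub> - 1}"
  have ev: "continuous_map ?P euclidean (\<lambda>h. h x)" if "x \<in> Dlim" for x
    by (rule continuous_map_product_projection[OF that])
  have con: "continuous_map ?P euclidean (\<lambda>h. c :: complex)" for c by simp
  have cont: "continuous_map ?P euclidean \<phi>" if "\<phi> \<in> F" for \<phi>
    using that unfolding F_def
    by (auto intro!: continuous_map_diff continuous_map_add continuous_map_complex_mult ev con Dlim_closed one_Dlim)
  have "closedin ?P {h \<in> topspace ?P. \<phi> h \<in> {0}}" if "\<phi> \<in> F" for \<phi>
    by (rule closedin_continuous_map_preimage[OF cont[OF that]]) simp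
  moreover have "F \<noteq> {}" by (auto simp: F_def)
  ultimately have "closedin ?P (\<Inter>\<phi>\<in>F. {h \<in> topspace ?P. \<phi> h \<in> {0}})"
    by (intro closedin_Inter) blast+
  also have "(\<Inter>\<phi>\<in>F. {h \<in> topspace ?P. \<phi> h \<in> {0}}) = chars"
  proof (intro Set.set_eqI iffI)
    fix h assume h: "h \<in> (\<Inter>\<phi>\<in>F. {h \<in> topspace ?P. \<phi> h \<in> {0}})"
    have z: "\<phi> h = 0" if "\<phi> \<in> F" for \<phi> using h that by blast
    have "h (x \<oplus>\<^bsub>A\<^esub> y) - (h x + h y) = 0" "h (x \<otimes>\<^bsub>A\<^esub> y) - h x * h y = 0" if "x \<in> Dlim" "y \<in> Dlim" for x y
      by (rule z; use that in \<open>unfold F_def, blast\<close>)+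
    moreover have "h (c \<odot>\<^bsub>A\<^esub> x) - c * h x = 0" if "x \<in> Dlim" for c x
      by (rule z; use that in \<open>unfold F_def, blast\<close>)
    moreover have "h \<one>\<^bsub>A\<^esub> - 1 = 0" by (rule z; unfold F_def, blast)
    moreover have "h \<in> extensional Dlim"
      using h by (auto simp: F_def PiE_def)
    ultimately show "h \<in> chars" unfolding chars_iff using one_Dlim by (auto intro!: bexI[of _ "\<one>\<^bsub>A\<^esub>"])
  next
    fix h assume h: "h \<in> chars"
    then have "h \<in> topspace ?P" by (simp add: chars_iff PiE_def)
    moreover have "\<phi> h = 0" if "\<phi> \<in> F" for \<phi>
      using that char_hom[OF h] char_one[OF h] unfolding F_def by auto
    ultimately show "h \<in> (\<Inter>\<phi>\<in>F. {h \<in> topspace ?P. \<phi> h \<in> {0}})" by blast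
  qed
  finally show ?thesis .
qed

text \<open>The Banach-Alaoglu argument: by \<open>char_bound\<close> characters lie in a product of
  discs, which is compact by Tychonoff.\<close>

lemma compactin_chars: "compactin (product_topology (\<lambda>_. euclidean) Dlim) chars"
proof (rule closed_compactin[OF _ _ closedin_chars])
  show "compactin (product_topology (\<lambda>_. euclidean) Dlim) (\<Pi>\<^sub>E c\<in>Dlim. cball 0 (nrm A c) :: complex set)"
    by (subst compactin_PiE) auto
  show "chars \<subseteq> (\<Pi>\<^sub>E c\<in>Dlim. cball 0 (nrm A c))"
    using char_bound by (auto simp: chars_iff[THEN iffD1] PiE_def Pi_def)
qed

lemma compact_spec: "compact_space spec"
  unfolding spec_eq using compactin_chars by (simp add: compact_space_subtopology)

lemma continuous_on_spec:
  assumes "continuous_map spec euclidean (F :: ('a \<Rightarrow> complex) \<Rightarrow> complex)"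
  shows "continuous_on chars F"
proof -
  have "continuous_map (top_of_set chars) spec (\<lambda>h. h)"
  proof (rule continuous_into_spec)
    fix c
    show "continuous_map (top_of_set chars) euclidean (\<lambda>h. h c)"
      by (simp add: continuous_on_product_coordinates continuous_on_subset[OF _ subset_UNIV])
  qed simp
  from continuous_map_compose[OF this assms] show ?thesis by (simp add: o_def)
qed

text \<open>The function type has the product topology over all of \<open>'a\<close>, the spectrum
  that over \<open>Dlim\<close>. Characters are constantly \<open>undefined\<close> outside
  \<open>Dlim\<close>, so the identity is continuous from the spectrum to the function type and
  carries compactness over.\<close>

lemma compact_chars: "compact chars"
proof -
  have "continuous_map spec (product_topology (\<lambda>_. euclidean) UNIV) (\<lambda>h. h)"
    unfolding continuous_map_componentwise_UNIV
  proof
    fix c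
    show "continuous_map spec euclidean (\<lambda>h. h c)"
    proof (cases "c \<in> Dlim")
      case True
      then show ?thesis by (rule continuous_evaluation)
    next
      case False
      have "continuous_map spec euclidean (\<lambda>h. undefined :: complex)" by simp
      then show ?thesis
        by (rule continuous_map_eq) (use False in \<open>auto simp: topspace_spectrum chars_iff extensional_def\<close>)
    qed
  qed
  then have "continuous_map spec euclidean (\<lambda>h. h)" by (simp add: euclidean_product_topology)
  moreover have "compactin spec chars"
    using compact_spec by (simp add: compact_space_def topspace_spectrum)
  ultimately have "compactin euclidean ((\<lambda>h. h) ` chars)" by (intro image_compactin)
  then show ?thesis by simp
qed

text \<open>The real theorem is applied to the real functions on \<open>chars\<close> that are
  induced by elements of \<open>Dpre\<close>. Real and imaginary parts of \<open>F\<close> are each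
  approximated to within half of \<open>e\<close> and recombined inside \<open>Dpre\<close>.\<close>

lemma stone_weierstrass_spec:
  assumes F: "continuous_map spec euclidean F" and e: "0 < e"
  shows "\<exists>d\<in>Dpre. \<forall>h\<in>chars. cmod (F h - h d) < e"
proof -
  define R where "R = {r. \<exists>d\<in>Dpre. \<forall>h\<in>chars. h d = complex_of_real (r h)}"
  have inlim: "d \<in> Dlim" if "d \<in> Dpre" for d using that Dpre_Dlim by blast
  have one: "\<one>\<^bsub>A\<^esub> \<in> Dpre" using DpreI[OF _ one_diagonal, of 1] iota_hom(4)[of 1] by (metis order_refl)
  interpret R: function_ring_on R chars
  proof
    show "compact chars" by (rule compact_chars)
    show "continuous_on chars r" if rR: "r \<in> R" for r
    proof -
      obtain d where d: "d \<in> Dpre" "\<forall>h\<in>chars. h d = complex_of_real (r h)" using rR unfolding R_def by blast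
      have "continuous_on chars (\<lambda>h. Re (h d))"
        using continuous_on_spec[OF continuous_evaluation[OF inlim[OF d(1)]]] by (rule continuous_on_Re)
      moreover have "Re (h d) = r h" if "h \<in> chars" for h using bspec[OF d(2) that] by simp
      ultimately show ?thesis by (rule continuous_on_eq)
    qed
    show "(\<lambda>h. r h + r' h) \<in> R" "(\<lambda>h. r h * r' h) \<in> R" if rr: "r \<in> R" "r' \<in> R" for r r'
    proof -
      obtain d where d: "d \<in> Dpre" "\<forall>h\<in>chars. h d = complex_of_real (r h)" using rr(1) unfolding R_def by blast
      obtain d' where d': "d' \<in> Dpre" "\<forall>h\<in>chars. h d' = complex_of_real (r' h)" using rr(2) unfolding R_def by blast
      have "\<forall>h\<in>chars. h (d \<oplus>\<^bsub>A\<^esub> d') = complex_of_real (r h + r' h)"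
        "\<forall>h\<in>chars. h (d \<otimes>\<^bsub>A\<^esub> d') = complex_of_real (r h * r' h)"
      proof -
        have "h (d \<oplus>\<^bsub>A\<^esub> d') = complex_of_real (r h + r' h)" "h (d \<otimes>\<^bsub>A\<^esub> d') = complex_of_real (r h * r' h)"
          if h: "h \<in> chars" for h
          using char_hom(1,2)[OF h inlim[OF d(1)] inlim[OF d'(1)]] bspec[OF d(2) h] bspec[OF d'(2) h] by simp_all
        then show "\<forall>h\<in>chars. h (d \<oplus>\<^bsub>A\<^esub> d') = complex_of_real (r h + r' h)"
          "\<forall>h\<in>chars. h (d \<otimes>\<^bsub>A\<^esub> d') = complex_of_real (r h * r' h)" by blast+
      qed
      then show "(\<lambda>h. r h + r' h) \<in> R" "(\<lambda>h. r h * r' h) \<in> R"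
        unfolding R_def using Dpre_closed(1,2)[OF d(1) d'(1)] by blast+
    qed
    show "(\<lambda>_. c) \<in> R" for c
    proof -
      have "\<forall>h\<in>chars. h (complex_of_real c \<odot>\<^bsub>A\<^esub> \<one>\<^bsub>A\<^esub>) = complex_of_real c"
        using char_hom(3)[OF _ one_Dlim, of _ "complex_of_real c"] char_one by (metis mult.right_neutral)
      then show ?thesis unfolding R_def using Dpre_closed(3)[OF one one] by blast
    qed
    show "\<exists>r\<in>R. r h \<noteq> r g" if h: "h \<in> chars" and g: "g \<in> chars" and ne: "h \<noteq> g" for h g
    proof -
      obtain n c where n: "n \<ge> 1" and c: "c \<in> diagonal_part S n" and hg: "h (\<iota> n c) \<noteq> g (\<iota> n c)"
        using char_eqI[OF h g, of 1] ne by blast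
      \<comment> \<open>A character evaluates a diagonal entry, so taking real or imaginary parts of
        all diagonal entries at the stage gives an element on which it takes the real or imaginary
        part of its value.\<close>
      have part: "(\<lambda>h. f (h (\<iota> n c))) \<in> R" if f: "f = Re \<or> f = Im" for f
      proof -
        let ?c = "stage_mat S n (\<lambda>i x a b. if a = b then complex_of_real (f (c i x $$ (a, a))) else 0)"
        have cont: "continuous_map X euclidean (\<lambda>x. complex_of_real (f (k x)))" if "continuous_map X euclidean k" for X and k :: "'x \<Rightarrow> complex"
          using f that unfolding continuous_map_complex_iff by (auto intro!: tendsto_intros)
        have "?c \<in> carrier (stage_algebra S n)"
        proof (rule stage_mat_closed)
          fix i a b assume "i \<in> {1..nblocks S n}" "a < msize S n i" "b < msize S n i"
          then show "continuous_map (base S n i) euclidean (\<lambda>x. if a = b then complex_of_real (f (c i x $$ (a, a))) else 0)"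
            using cont[OF stage_carrierD(2)[OF diagonal_partD(1)[OF c]]] by (cases "a = b") simp_all
        qed
        then have c': "?c \<in> diagonal_part S n" by (rule diagonal_partI) (simp add: stage_mat_index)
        have "k (\<iota> n ?c) = complex_of_real (f (k (\<iota> n c)))" if k: "k \<in> chars" for k
          unfolding char_eval(2)[OF k n c'] char_eval(2)[OF k n c]
            stage_mat_index[OF vertex_in[OF char_path(1)[OF k] n] char_eval(1)[OF k n]
              path_pos_less[OF char_path(1)[OF k] n] path_pos_less[OF char_path(1)[OF k] n]] by simp
        then show ?thesis unfolding R_def using DpreI[OF n c'] by blast
      qed
      have "Re (h (\<iota> n c)) \<noteq> Re (g (\<iota> n c)) \<or> Im (h (\<iota> n c)) \<noteq> Im (g (\<iota> n c))"
        using hg by (simp add: complex_eq_iff)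
      then show ?thesis using part[of Re] part[of Im] by (metis (no_types, lifting))
    qed
  qed
  have cF: "continuous_on chars F" by (rule continuous_on_spec[OF F])
  obtain r where r: "r \<in> R" "\<forall>h\<in>chars. \<bar>Re (F h) - r h\<bar> < e / 2"
    using R.Stone_Weierstrass_basic[OF continuous_on_Re[OF cF], of "e/2"] e by auto
  obtain r' where r': "r' \<in> R" "\<forall>h\<in>chars. \<bar>Im (F h) - r' h\<bar> < e / 2"
    using R.Stone_Weierstrass_basic[OF continuous_on_Im[OF cF], of "e/2"] e by auto
  obtain d where d: "d \<in> Dpre" "\<forall>h\<in>chars. h d = complex_of_real (r h)" using r(1) unfolding R_def by blast
  obtain d' where d': "d' \<in> Dpre" "\<forall>h\<in>chars. h d' = complex_of_real (r' h)" using r'(1) unfolding R_def by blast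
  let ?d = "d \<oplus>\<^bsub>A\<^esub> (\<i> \<odot>\<^bsub>A\<^esub> d')"
  have "cmod (F h - h ?d) < e" if h: "h \<in> chars" for h
  proof -
    have hd: "h ?d = complex_of_real (r h) + \<i> * complex_of_real (r' h)"
      using char_hom(1)[OF h inlim[OF d(1)] inlim[OF Dpre_closed(3)[OF d'(1) d'(1)]]]
        char_hom(3)[OF h inlim[OF d'(1)]] bspec[OF d(2) h] bspec[OF d'(2) h] by simp
    have "cmod (F h - h ?d) \<le> \<bar>Re (F h - h ?d)\<bar> + \<bar>Im (F h - h ?d)\<bar>" by (rule cmod_le)
    also have "\<dots> = \<bar>Re (F h) - r h\<bar> + \<bar>Im (F h) - r' h\<bar>" by (simp add: hd)
    also have "\<dots> < e" using bspec[OF r(2) h] bspec[OF r'(2) h] by linarith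
    finally show ?thesis .
  qed
  then show ?thesis using Dpre_closed(2)[OF d(1) Dpre_closed(3)[OF d'(1) d'(1)]] by blast
qed

end

section \<open>Extending an isometric dense representation\<close>

lemma op_norm_minus_commute:
  assumes T: "T \<in> bounded_operators S" and U: "U \<in> bounded_operators S"
  shows "op_norm S (T \<ominus>\<^bsub>operator_algebra S\<^esub> U) = op_norm S (U \<ominus>\<^bsub>operator_algebra S\<^esub> T)"
proof -
  have le: "op_norm S (T \<ominus>\<^bsub>operator_algebra S\<^esub> U) \<le> op_norm S (U \<ominus>\<^bsub>operator_algebra S\<^esub> T)"
    if T: "T \<in> bounded_operators S" and U: "U \<in> bounded_operators S" for T U
  proof (rule op_norm_minus_leI[OF T U op_norm_minus_nonneg[OF U T]])
    fix \<xi> assume \<xi>: "\<xi> \<in> ell2 S"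
    have "ell2_norm S (\<lambda>g. T \<xi> g - U \<xi> g) = ell2_norm S (\<lambda>g. U \<xi> g - T \<xi> g)"
      using ell2_norm_cmult[of S "-1" "\<lambda>g. U \<xi> g - T \<xi> g"] by simp
    then show "ell2_norm S (\<lambda>g. T \<xi> g - U \<xi> g) \<le> op_norm S (U \<ominus>\<^bsub>operator_algebra S\<^esub> T) * ell2_norm S \<xi>"
      using op_norm_minus_bound[OF U T \<xi>] by simp
  qed
  show ?thesis by (rule antisym[OF le[OF T U] le[OF U T]])
qed

lemma op_norm_minus_triangle:
  assumes T: "T \<in> bounded_operators S" and U: "U \<in> bounded_operators S" and V: "V \<in> bounded_operators S"
  shows "op_norm S (T \<ominus>\<^bsub>operator_algebra S\<^esub> V) \<le>
    op_norm S (T \<ominus>\<^bsub>operator_algebra S\<^esub> U) + op_norm S (U \<ominus>\<^bsub>operator_algebra S\<^esub> V)"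
proof (rule op_norm_minus_leI[OF T V])
  show "0 \<le> op_norm S (T \<ominus>\<^bsub>operator_algebra S\<^esub> U) + op_norm S (U \<ominus>\<^bsub>operator_algebra S\<^esub> V)"
    using op_norm_minus_nonneg[OF T U] op_norm_minus_nonneg[OF U V] by simp
  fix \<xi> assume \<xi>: "\<xi> \<in> ell2 S"
  note b = bounded_operatorsD(2)[OF T \<xi>] bounded_operatorsD(2)[OF U \<xi>] bounded_operatorsD(2)[OF V \<xi>]
  have "ell2_norm S (\<lambda>g. T \<xi> g - V \<xi> g) \<le> ell2_norm S (\<lambda>g. T \<xi> g - U \<xi> g) + ell2_norm S (\<lambda>g. U \<xi> g - V \<xi> g)"
    using ell2_add(2)[OF ell2_diff(1)[OF b(1,2)] ell2_diff(1)[OF b(2,3)]] by simp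
  then show "ell2_norm S (\<lambda>g. T \<xi> g - V \<xi> g) \<le>
      (op_norm S (T \<ominus>\<^bsub>operator_algebra S\<^esub> U) + op_norm S (U \<ominus>\<^bsub>operator_algebra S\<^esub> V)) * ell2_norm S \<xi>"
    using op_norm_minus_bound[OF T U \<xi>] op_norm_minus_bound[OF U V \<xi>] by (simp add: distrib_right)
qed

section \<open>Convergence in operator norm\<close>

definition op_tendsto :: "'g set \<Rightarrow> (nat \<Rightarrow> ('g \<Rightarrow> complex) \<Rightarrow> ('g \<Rightarrow> complex)) \<Rightarrow> (('g \<Rightarrow> complex) \<Rightarrow> ('g \<Rightarrow> complex)) \<Rightarrow> bool" where
  "op_tendsto S T U \<longleftrightarrow> (\<lambda>k. op_norm S (T k \<ominus>\<^bsub>operator_algebra S\<^esub> U)) \<longlonglongrightarrow> 0"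

lemma op_tendsto_vector:
  assumes T: "\<And>k. T k \<in> bounded_operators S" and U: "U \<in> bounded_operators S" and lim: "op_tendsto S T U"
    and \<xi>: "\<xi> \<in> ell2 S"
  shows "(\<lambda>k. ell2_norm S (\<lambda>g. T k \<xi> g - U \<xi> g)) \<longlonglongrightarrow> 0"
proof (rule Lim_null_comparison)
  show "(\<lambda>k. op_norm S (T k \<ominus>\<^bsub>operator_algebra S\<^esub> U) * ell2_norm S \<xi>) \<longlonglongrightarrow> 0"
    using tendsto_mult[OF lim[unfolded op_tendsto_def] tendsto_const[of "ell2_norm S \<xi>"]] by simp
  show "\<forall>\<^sub>F k in sequentially. norm (ell2_norm S (\<lambda>g. T k \<xi> g - U \<xi> g)) \<le> op_norm S (T k \<ominus>\<^bsub>operator_algebra S\<^esub> U) * ell2_norm S \<xi>"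
    using op_norm_minus_bound[OF T U \<xi>] by (intro always_eventually allI) (simp add: ell2_norm_nonneg)
qed

lemma vector_tendsto_coordinate:
  assumes f: "\<And>k. f k \<in> ell2 S" "\<zeta> \<in> ell2 S" and lim: "(\<lambda>k. ell2_norm S (\<lambda>g. f k g - \<zeta> g)) \<longlonglongrightarrow> 0"
  shows "(\<lambda>k :: nat. f k g) \<longlonglongrightarrow> \<zeta> g"
proof (rule LIM_zero_cancel, rule Lim_null_comparison[OF _ lim])
  have "norm (f k g - \<zeta> g) \<le> ell2_norm S (\<lambda>g. f k g - \<zeta> g)" for k
    using cmod_le_ell2_norm[OF ell2_diff(1)[OF f], of k g] .
  then show "\<forall>\<^sub>F k in sequentially. norm (f k g - \<zeta> g) \<le> ell2_norm S (\<lambda>g. f k g - \<zeta> g)" by simp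
qed

lemma op_tendsto_coordinate:
  assumes "\<And>k. T k \<in> bounded_operators S" "U \<in> bounded_operators S" "op_tendsto S T U" "\<xi> \<in> ell2 S"
  shows "(\<lambda>k. T k \<xi> g) \<longlonglongrightarrow> U \<xi> g"
  by (rule vector_tendsto_coordinate[OF bounded_operatorsD(2)[OF assms(1) assms(4)] bounded_operatorsD(2)[OF assms(2,4)]
      op_tendsto_vector[OF assms]])

lemma op_tendsto_unique:
  assumes "\<And>k. T k \<in> bounded_operators S" "U \<in> bounded_operators S" "V \<in> bounded_operators S"
    "op_tendsto S T U" "op_tendsto S T V"
  shows "U = V"
  by (rule operator_eqI[OF assms(2,3)])
    (rule LIMSEQ_unique[OF op_tendsto_coordinate[OF assms(1,2,4)] op_tendsto_coordinate[OF assms(1,3,5)]])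

lemma op_norm_le_minus:
  assumes T: "T \<in> bounded_operators S" and U: "U \<in> bounded_operators S"
  shows "op_norm S T \<le> op_norm S (T \<ominus>\<^bsub>operator_algebra S\<^esub> U) + op_norm S U"
proof (rule op_norm_leI)
  show "0 \<le> op_norm S (T \<ominus>\<^bsub>operator_algebra S\<^esub> U) + op_norm S U"
    using op_norm_minus_nonneg[OF T U] op_norm_nonneg[OF U] by simp
  fix \<xi> assume \<xi>: "\<xi> \<in> ell2 S"
  note b = bounded_operatorsD(2)[OF T \<xi>] bounded_operatorsD(2)[OF U \<xi>]
  have "ell2_norm S (T \<xi>) \<le> ell2_norm S (\<lambda>g. T \<xi> g - U \<xi> g) + ell2_norm S (U \<xi>)"
    using ell2_add(2)[OF ell2_diff(1)[OF b] b(2)] by simp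
  then show "ell2_norm S (T \<xi>) \<le> (op_norm S (T \<ominus>\<^bsub>operator_algebra S\<^esub> U) + op_norm S U) * ell2_norm S \<xi>"
    using op_norm_minus_bound[OF T U \<xi>] op_norm_bound[OF U \<xi>] by (simp add: distrib_right)
qed

text \<open>The change of the inner vector is controlled by the norms of \<open>T k\<close>, which
  are bounded by the norm of \<open>U\<close> plus a null sequence; the remaining change is
  convergence at the fixed vector \<open>U' \<xi>\<close>.\<close>

lemma op_tendsto_compose:
  assumes T: "\<And>k. T k \<in> bounded_operators S" "U \<in> bounded_operators S" "op_tendsto S T U"
    and T': "\<And>k. T' k \<in> bounded_operators S" "U' \<in> bounded_operators S" "op_tendsto S T' U'" and \<xi>: "\<xi> \<in> ell2 S"
  shows "(\<lambda>k. T k (T' k \<xi>) g) \<longlonglongrightarrow> U (U' \<xi>) g"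
proof -
  note b' = bounded_operatorsD(2)[OF T'(1) \<xi>] and bU' = bounded_operatorsD(2)[OF T'(2) \<xi>]
  have "(\<lambda>k. T k (T' k \<xi>) g - T k (U' \<xi>) g) \<longlonglongrightarrow> 0"
  proof (rule Lim_null_comparison)
    show "(\<lambda>k. (op_norm S (T k \<ominus>\<^bsub>operator_algebra S\<^esub> U) + op_norm S U) * ell2_norm S (\<lambda>g. T' k \<xi> g - U' \<xi> g)) \<longlonglongrightarrow> 0"
      using tendsto_mult[OF tendsto_add[OF T(3)[unfolded op_tendsto_def] tendsto_const[of "op_norm S U"]]
        op_tendsto_vector[OF T' \<xi>]] by simp
    have "norm (T k (T' k \<xi>) g - T k (U' \<xi>) g) \<le>
        (op_norm S (T k \<ominus>\<^bsub>operator_algebra S\<^esub> U) + op_norm S U) * ell2_norm S (\<lambda>g. T' k \<xi> g - U' \<xi> g)" for k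
    proof -
      let ?d = "\<lambda>g. T' k \<xi> g - U' \<xi> g"
      have d: "?d \<in> ell2 S" by (rule ell2_diff(1)[OF b' bU'])
      have "T k (\<lambda>g. ?d g + U' \<xi> g) = (\<lambda>g. T k ?d g + T k (U' \<xi>) g)"
        by (rule bounded_operatorsD(3)[OF T(1) d bU'])
      then have "T k (T' k \<xi>) g - T k (U' \<xi>) g = T k ?d g" by simp
      then have "norm (T k (T' k \<xi>) g - T k (U' \<xi>) g) \<le> ell2_norm S (T k ?d)"
        using cmod_le_ell2_norm[OF bounded_operatorsD(2)[OF T(1) d]] by simp
      also have "\<dots> \<le> op_norm S (T k) * ell2_norm S ?d" by (rule op_norm_bound[OF T(1) d])
      also have "\<dots> \<le> (op_norm S (T k \<ominus>\<^bsub>operator_algebra S\<^esub> U) + op_norm S U) * ell2_norm S ?d"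
        by (intro mult_right_mono op_norm_le_minus T ell2_norm_nonneg)
      finally show ?thesis .
    qed
    then show "\<forall>\<^sub>F k in sequentially. norm (T k (T' k \<xi>) g - T k (U' \<xi>) g) \<le>
        (op_norm S (T k \<ominus>\<^bsub>operator_algebra S\<^esub> U) + op_norm S U) * ell2_norm S (\<lambda>g. T' k \<xi> g - U' \<xi> g)"
      by (intro always_eventually allI)
  qed
  from tendsto_add[OF this op_tendsto_coordinate[OF T bU', of g]] show ?thesis by simp
qed

lemma op_tendsto_inner:
  assumes T: "\<And>k. T k \<in> bounded_operators S" "U \<in> bounded_operators S" "op_tendsto S T U"
    and \<xi>: "\<xi> \<in> ell2 S" and \<eta>: "\<eta> \<in> ell2 S"
  shows "(\<lambda>k. ell2_inner S (T k \<xi>) \<eta>) \<longlonglongrightarrow> ell2_inner S (U \<xi>) \<eta>"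
    "(\<lambda>k. ell2_inner S \<eta> (T k \<xi>)) \<longlonglongrightarrow> ell2_inner S \<eta> (U \<xi>)"
proof -
  note b = bounded_operatorsD(2)[OF T(1) \<xi>] and bU = bounded_operatorsD(2)[OF T(2) \<xi>]
  have l: "(\<lambda>k. ell2_norm S (\<lambda>g. T k \<xi> g - U \<xi> g) * ell2_norm S \<eta>) \<longlonglongrightarrow> 0"
    using tendsto_mult[OF op_tendsto_vector[OF T \<xi>] tendsto_const[of "ell2_norm S \<eta>"]] by simp
  show "(\<lambda>k. ell2_inner S (T k \<xi>) \<eta>) \<longlonglongrightarrow> ell2_inner S (U \<xi>) \<eta>"
  proof (rule LIM_zero_cancel, rule Lim_null_comparison[OF _ l], intro always_eventually allI)
    show "norm (ell2_inner S (T k \<xi>) \<eta> - ell2_inner S (U \<xi>) \<eta>) \<le> ell2_norm S (\<lambda>g. T k \<xi> g - U \<xi> g) * ell2_norm S \<eta>" for k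
      using ell2_inner_bound[OF ell2_diff(1)[OF b bU] \<eta>, of k] ell2_inner_diff_left[OF b bU \<eta>, of k] by simp
  qed
  show "(\<lambda>k. ell2_inner S \<eta> (T k \<xi>)) \<longlonglongrightarrow> ell2_inner S \<eta> (U \<xi>)"
  proof (rule LIM_zero_cancel, rule Lim_null_comparison[OF _ l], intro always_eventually allI)
    show "norm (ell2_inner S \<eta> (T k \<xi>) - ell2_inner S \<eta> (U \<xi>)) \<le> ell2_norm S (\<lambda>g. T k \<xi> g - U \<xi> g) * ell2_norm S \<eta>" for k
      using ell2_inner_bound[OF \<eta> ell2_diff(1)[OF b bU], of k] ell2_inner_diff_right[OF \<eta> b bU, of k]
      by (simp add: mult.commute)
  qed
qed

lemma operator_algebra_ops:
  "carrier (operator_algebra S) = bounded_operators S"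
  "T \<otimes>\<^bsub>operator_algebra S\<^esub> U = compose (ell2 S) T U"
  "T \<oplus>\<^bsub>operator_algebra S\<^esub> U = (\<lambda>\<xi>\<in>ell2 S. \<lambda>g. T \<xi> g + U \<xi> g)"
  "c \<odot>\<^bsub>operator_algebra S\<^esub> T = (\<lambda>\<xi>\<in>ell2 S. \<lambda>g. c * T \<xi> g)"
  "\<one>\<^bsub>operator_algebra S\<^esub> = (\<lambda>\<xi>\<in>ell2 S. \<xi>)"
  "adj (operator_algebra S) T = (THE U. U \<in> bounded_operators S \<and>
      (\<forall>\<xi>\<in>ell2 S. \<forall>\<eta>\<in>ell2 S. ell2_inner S (T \<xi>) \<eta> = ell2_inner S \<xi> (U \<eta>)))"
  by (simp_all add: operator_algebra_def)

text \<open>The adjoint is a definite description, so a candidate satisfying the inner product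
  identity determines it once uniqueness is known. Candidates will be supplied by adjoints in the
  dense subalgebra, so a general existence theorem is avoided.\<close>

lemma adj_operator:
  assumes U: "U \<in> bounded_operators S"
    and eq: "\<And>\<xi> \<eta>. \<xi> \<in> ell2 S \<Longrightarrow> \<eta> \<in> ell2 S \<Longrightarrow> ell2_inner S (T \<xi>) \<eta> = ell2_inner S \<xi> (U \<eta>)"
  shows "adj (operator_algebra S) T = U"
  unfolding operator_algebra_ops
proof (rule the_equality)
  show "U \<in> bounded_operators S \<and> (\<forall>\<xi>\<in>ell2 S. \<forall>\<eta>\<in>ell2 S. ell2_inner S (T \<xi>) \<eta> = ell2_inner S \<xi> (U \<eta>))"
    using U eq by blast
  fix V assume "V \<in> bounded_operators S \<and> (\<forall>\<xi>\<in>ell2 S. \<forall>\<eta>\<in>ell2 S. ell2_inner S (T \<xi>) \<eta> = ell2_inner S \<xi> (V \<eta>))"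
  then have V: "V \<in> bounded_operators S" and Veq: "\<And>\<xi> \<eta>. \<xi> \<in> ell2 S \<Longrightarrow> \<eta> \<in> ell2 S \<Longrightarrow> ell2_inner S (T \<xi>) \<eta> = ell2_inner S \<xi> (V \<eta>)"
    by blast+
  show "V = U"
  proof (rule operator_eqI[OF V U])
    fix \<eta> g assume \<eta>: "\<eta> \<in> ell2 S"
    have "V \<eta> = U \<eta>"
      by (rule ell2_ext_inner[OF bounded_operatorsD(2)[OF V \<eta>] bounded_operatorsD(2)[OF U \<eta>]])
        (simp only: Veq[OF _ \<eta>, symmetric] eq[OF _ \<eta>, symmetric])
    then show "V \<eta> g = U \<eta> g" by simp
  qed
qed

text \<open>The dense subalgebra is an index set \<open>D\<close> realised twice, by
  \<open>u\<close> in \<open>A\<close> and by \<open>v\<close> as operators, since one element has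
  representatives at many stages; isometry of differences makes \<open>v\<close> factor through
  \<open>u\<close>. Completeness of the bounded operators gives the extension \<open>F\<close>,
  completeness of \<open>A\<close> shows that its range is closed. The set \<open>W\<close> may
  exceed the image of \<open>D\<close>, provided that image is dense in it.\<close>

lemma (in cstar_algebra) star_isomorphic_dense:
  fixes u :: "'d \<Rightarrow> 'a" and v :: "'d \<Rightarrow> ('g \<Rightarrow> complex) \<Rightarrow> ('g \<Rightarrow> complex)"
  assumes u: "\<And>d. d \<in> D \<Longrightarrow> u d \<in> carrier A" and v: "\<And>d. d \<in> D \<Longrightarrow> v d \<in> bounded_operators S"
    and iso: "\<And>d d'. d \<in> D \<Longrightarrow> d' \<in> D \<Longrightarrow> op_norm S (v d \<ominus>\<^bsub>operator_algebra S\<^esub> v d') = nrm A (u d \<ominus>\<^bsub>A\<^esub> u d')"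
    and mult: "\<And>d d'. d \<in> D \<Longrightarrow> d' \<in> D \<Longrightarrow> \<exists>e\<in>D. u e = u d \<otimes>\<^bsub>A\<^esub> u d' \<and> (\<forall>\<xi>\<in>ell2 S. v e \<xi> = v d (v d' \<xi>))"
    and add: "\<And>d d'. d \<in> D \<Longrightarrow> d' \<in> D \<Longrightarrow> \<exists>e\<in>D. u e = u d \<oplus>\<^bsub>A\<^esub> u d' \<and> (\<forall>\<xi>\<in>ell2 S. v e \<xi> = (\<lambda>g. v d \<xi> g + v d' \<xi> g))"
    and smult: "\<And>d c. d \<in> D \<Longrightarrow> \<exists>e\<in>D. u e = c \<odot>\<^bsub>A\<^esub> u d \<and> (\<forall>\<xi>\<in>ell2 S. v e \<xi> = (\<lambda>g. c * v d \<xi> g))"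
    and adj: "\<And>d. d \<in> D \<Longrightarrow> \<exists>e\<in>D. u e = adj A (u d) \<and>
        (\<forall>\<xi>\<in>ell2 S. \<forall>\<eta>\<in>ell2 S. ell2_inner S (v d \<xi>) \<eta> = ell2_inner S \<xi> (v e \<eta>))"
    and one: "\<exists>e\<in>D. u e = \<one>\<^bsub>A\<^esub> \<and> (\<forall>\<xi>\<in>ell2 S. v e \<xi> = \<xi>)"
    and dense: "norm_closure A (u ` D) = carrier A"
    and W: "v ` D \<subseteq> W" "W \<subseteq> bounded_operators S" "\<And>w e. w \<in> W \<Longrightarrow> 0 < e \<Longrightarrow> \<exists>d\<in>D. op_norm S (w \<ominus>\<^bsub>operator_algebra S\<^esub> v d) < e"
  shows "star_isomorphic A (on_carrier (operator_algebra S) (norm_closure (operator_algebra S) W))"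
proof -
  let ?O = "operator_algebra S"
  have "\<exists>y\<in>bounded_operators S. \<forall>s. (\<forall>k :: nat. s k \<in> D) \<longrightarrow> (\<lambda>k. nrm A (u (s k) \<ominus>\<^bsub>A\<^esub> x)) \<longlonglongrightarrow> 0 \<longrightarrow>
      (\<lambda>k. op_norm S (v (s k) \<ominus>\<^bsub>?O\<^esub> y)) \<longlonglongrightarrow> 0" if x: "x \<in> carrier A" for x
  proof (rule dense_extension[where ?M1.0 = "carrier A" and ?d1.0 = "\<lambda>x y. nrm A (x \<ominus>\<^bsub>A\<^esub> y)" and u = u and D = D
      and ?M2.0 = "bounded_operators S" and ?d2.0 = "\<lambda>T U. op_norm S (T \<ominus>\<^bsub>?O\<^esub> U)" and v = v and x = x])
    show "nrm A (p \<ominus>\<^bsub>A\<^esub> q) = nrm A (q \<ominus>\<^bsub>A\<^esub> p)" if "p \<in> carrier A" "q \<in> carrier A" for p q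
      by (rule nrm_minus_commute[OF that])
    show "0 \<le> op_norm S (T \<ominus>\<^bsub>?O\<^esub> U)" if "T \<in> bounded_operators S" "U \<in> bounded_operators S" for T U
      by (rule op_norm_minus_nonneg[OF that])
    show "nrm A (p \<ominus>\<^bsub>A\<^esub> r) \<le> nrm A (p \<ominus>\<^bsub>A\<^esub> q) + nrm A (q \<ominus>\<^bsub>A\<^esub> r)"
      if "p \<in> carrier A" "q \<in> carrier A" "r \<in> carrier A" for p q r
      by (rule nrm_minus_triangle[OF that])
    show "op_norm S (T \<ominus>\<^bsub>?O\<^esub> V) \<le> op_norm S (T \<ominus>\<^bsub>?O\<^esub> U) + op_norm S (U \<ominus>\<^bsub>?O\<^esub> V)"
      if "T \<in> bounded_operators S" "U \<in> bounded_operators S" "V \<in> bounded_operators S" for T U V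
      by (rule op_norm_minus_triangle[OF that])
    show "\<exists>y\<in>bounded_operators S. (\<lambda>k. op_norm S (s k \<ominus>\<^bsub>?O\<^esub> y)) \<longlonglongrightarrow> 0"
      if "\<And>k :: nat. s k \<in> bounded_operators S" "\<And>e. 0 < e \<Longrightarrow> \<exists>N. \<forall>m\<ge>N. \<forall>n\<ge>N. op_norm S (s m \<ominus>\<^bsub>?O\<^esub> s n) < e" for s
      by (rule bounded_operators_complete[OF that])
    show "op_norm S (v d \<ominus>\<^bsub>?O\<^esub> v d') \<le> nrm A (u d \<ominus>\<^bsub>A\<^esub> u d')" if "d \<in> D" "d' \<in> D" for d d'
      using iso[OF that] by simp
    show "\<exists>d\<in>D. nrm A (x \<ominus>\<^bsub>A\<^esub> u d) < e" if "0 < e" for e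
    proof -
      have "x \<in> norm_closure A (u ` D)" using x dense by simp
      then show ?thesis using that unfolding norm_closure_def by blast
    qed
    show "x \<in> carrier A" by (rule x)
    show "u d \<in> carrier A" if "d \<in> D" for d by (rule u[OF that])
    show "v d \<in> bounded_operators S" if "d \<in> D" for d by (rule v[OF that])
  qed
  note ex = this
  define F where "F = (\<lambda>x. SOME y. y \<in> bounded_operators S \<and> (\<forall>s. (\<forall>k :: nat. s k \<in> D) \<longrightarrow> (\<lambda>k. nrm A (u (s k) \<ominus>\<^bsub>A\<^esub> x)) \<longlonglongrightarrow> 0 \<longrightarrow>
      (\<lambda>k. op_norm S (v (s k) \<ominus>\<^bsub>?O\<^esub> y)) \<longlonglongrightarrow> 0))"
  have F: "F x \<in> bounded_operators S \<and> (\<forall>s. (\<forall>k :: nat. s k \<in> D) \<longrightarrow> (\<lambda>k. nrm A (u (s k) \<ominus>\<^bsub>A\<^esub> x)) \<longlonglongrightarrow> 0 \<longrightarrow>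
      (\<lambda>k. op_norm S (v (s k) \<ominus>\<^bsub>?O\<^esub> F x)) \<longlonglongrightarrow> 0)" if x: "x \<in> carrier A" for x
  proof -
    have "\<exists>y. y \<in> bounded_operators S \<and> (\<forall>s. (\<forall>k :: nat. s k \<in> D) \<longrightarrow> (\<lambda>k. nrm A (u (s k) \<ominus>\<^bsub>A\<^esub> x)) \<longlonglongrightarrow> 0 \<longrightarrow>
      (\<lambda>k. op_norm S (v (s k) \<ominus>\<^bsub>?O\<^esub> y)) \<longlonglongrightarrow> 0)" using ex[OF x] by (simp only: Bex_def)
    from someI_ex[OF this] show ?thesis unfolding F_def .
  qed
  have Fb: "F x \<in> bounded_operators S" if "x \<in> carrier A" for x using F[OF that] by blast
  have FL: "op_tendsto S (\<lambda>k. v (s k)) (F x)"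
    if x: "x \<in> carrier A" and s: "\<And>k :: nat. s k \<in> D" "(\<lambda>k. nrm A (u (s k) \<ominus>\<^bsub>A\<^esub> x)) \<longlonglongrightarrow> 0" for x s
  proof -
    have a: "\<forall>k. s k \<in> D" using s(1) by blast
    show ?thesis unfolding op_tendsto_def by (rule mp[OF mp[OF spec[OF conjunct2[OF F[OF x]], of s] a] s(2)])
  qed
  have uD: "u ` D \<subseteq> carrier A" using u by blast
  have seq: "\<exists>s. (\<forall>k :: nat. s k \<in> D) \<and> (\<lambda>k. nrm A (u (s k) \<ominus>\<^bsub>A\<^esub> x)) \<longlonglongrightarrow> 0" if x: "x \<in> carrier A" for x
  proof -
    have "x \<in> norm_closure A (u ` D)" using x dense by simp
    then obtain t where t: "\<And>k :: nat. t k \<in> u ` D" "(\<lambda>k. nrm A (t k \<ominus>\<^bsub>A\<^esub> x)) \<longlonglongrightarrow> 0"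
      using norm_closure_sequence[OF uD] by blast
    have "\<forall>k. \<exists>d. d \<in> D \<and> u d = t k" using t(1) by (metis imageE)
    then obtain s where "\<forall>k. s k \<in> D \<and> u (s k) = t k" by metis
    then show ?thesis using t(2) by (intro exI[of _ s]) simp
  qed
  \<comment> \<open>One approximating sequence and coordinatewise convergence suffice to identify
    \<open>F x\<close>; the proofs for sums, scalars and products only supply such a
    sequence.\<close>
  have Feq: "F (x) = U" if x: "x \<in> carrier A" and U: "U \<in> bounded_operators S"
    and s: "\<And>k :: nat. s k \<in> D" "(\<lambda>k. nrm A (u (s k) \<ominus>\<^bsub>A\<^esub> x)) \<longlonglongrightarrow> 0"
    and c: "\<And>\<xi> g. \<xi> \<in> ell2 S \<Longrightarrow> (\<lambda>k. v (s k) \<xi> g) \<longlonglongrightarrow> U \<xi> g" for x U s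
    by (rule operator_eqI[OF Fb[OF x] U])
      (rule LIMSEQ_unique[OF op_tendsto_coordinate[OF v[OF s(1)] Fb[OF x] FL[OF x s]] c])
  have F_add: "F (x \<oplus>\<^bsub>A\<^esub> y) = F x \<oplus>\<^bsub>?O\<^esub> F y" if x: "x \<in> carrier A" and y: "y \<in> carrier A" for x y
  proof -
    obtain s where s: "\<And>k :: nat. s k \<in> D" "(\<lambda>k. nrm A (u (s k) \<ominus>\<^bsub>A\<^esub> x)) \<longlonglongrightarrow> 0" using seq[OF x] by blast
    obtain t where t: "\<And>k :: nat. t k \<in> D" "(\<lambda>k. nrm A (u (t k) \<ominus>\<^bsub>A\<^esub> y)) \<longlonglongrightarrow> 0" using seq[OF y] by blast
    have "\<forall>k. \<exists>e. e \<in> D \<and> u e = u (s k) \<oplus>\<^bsub>A\<^esub> u (t k) \<and> (\<forall>\<xi>\<in>ell2 S. v e \<xi> = (\<lambda>g. v (s k) \<xi> g + v (t k) \<xi> g))"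
      using add[OF s(1) t(1)] by (simp only: Bex_def) blast
    then obtain w where w: "\<And>k. w k \<in> D" "\<And>k. u (w k) = u (s k) \<oplus>\<^bsub>A\<^esub> u (t k)"
      "\<And>k \<xi>. \<xi> \<in> ell2 S \<Longrightarrow> v (w k) \<xi> = (\<lambda>g. v (s k) \<xi> g + v (t k) \<xi> g)" by metis
    show ?thesis
    proof (rule Feq)
      show "x \<oplus>\<^bsub>A\<^esub> y \<in> carrier A" using x y by simp
      show "F x \<oplus>\<^bsub>?O\<^esub> F y \<in> bounded_operators S"
        unfolding operator_algebra_ops by (rule operator_add_closed[OF Fb[OF x] Fb[OF y]])
      show "w k \<in> D" for k by (rule w(1))
      show "(\<lambda>k. nrm A (u (w k) \<ominus>\<^bsub>A\<^esub> (x \<oplus>\<^bsub>A\<^esub> y))) \<longlonglongrightarrow> 0"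
        unfolding w(2) by (rule limit_add[OF u[OF s(1)] u[OF t(1)] x y s(2) t(2)])
      show "(\<lambda>k. v (w k) \<xi> g) \<longlonglongrightarrow> (F x \<oplus>\<^bsub>?O\<^esub> F y) \<xi> g" if \<xi>: "\<xi> \<in> ell2 S" for \<xi> g
        using tendsto_add[OF op_tendsto_coordinate[OF v[OF s(1)] Fb[OF x] FL[OF x s] \<xi>]
          op_tendsto_coordinate[OF v[OF t(1)] Fb[OF y] FL[OF y t] \<xi>], of g g] \<xi>
        by (simp add: operator_algebra_ops w(3)[OF \<xi>])
    qed
  qed
  have F_smult: "F (c \<odot>\<^bsub>A\<^esub> x) = c \<odot>\<^bsub>?O\<^esub> F x" if x: "x \<in> carrier A" for x c
  proof -
    obtain s where s: "\<And>k :: nat. s k \<in> D" "(\<lambda>k. nrm A (u (s k) \<ominus>\<^bsub>A\<^esub> x)) \<longlonglongrightarrow> 0" using seq[OF x] by blast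
    have "\<forall>k. \<exists>e. e \<in> D \<and> u e = c \<odot>\<^bsub>A\<^esub> u (s k) \<and> (\<forall>\<xi>\<in>ell2 S. v e \<xi> = (\<lambda>g. c * v (s k) \<xi> g))"
      using smult[OF s(1)] by (simp only: Bex_def) blast
    then obtain w where w: "\<And>k. w k \<in> D" "\<And>k. u (w k) = c \<odot>\<^bsub>A\<^esub> u (s k)"
      "\<And>k \<xi>. \<xi> \<in> ell2 S \<Longrightarrow> v (w k) \<xi> = (\<lambda>g. c * v (s k) \<xi> g)" by metis
    show ?thesis
    proof (rule Feq)
      show "c \<odot>\<^bsub>A\<^esub> x \<in> carrier A" using x by simp
      show "c \<odot>\<^bsub>?O\<^esub> F x \<in> bounded_operators S"
      proof (rule bounded_operatorsI[where K = "cmod c * op_norm S (F x)"])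
        note b = Fb[OF x]
        show "c \<odot>\<^bsub>?O\<^esub> F x \<in> extensional (ell2 S)" by (simp add: operator_algebra_ops)
        fix \<xi> assume \<xi>: "\<xi> \<in> ell2 S"
        show "(c \<odot>\<^bsub>?O\<^esub> F x) \<xi> \<in> ell2 S"
          using ell2_cmult[OF bounded_operatorsD(2)[OF b \<xi>], of c] \<xi> by (simp add: operator_algebra_ops)
        show "(c \<odot>\<^bsub>?O\<^esub> F x) (\<lambda>g. z * \<xi> g) = (\<lambda>g. z * (c \<odot>\<^bsub>?O\<^esub> F x) \<xi> g)" for z
          using ell2_cmult[OF \<xi>, of z] \<xi> by (simp add: operator_algebra_ops bounded_operatorsD(4)[OF b \<xi>] mult.left_commute)
        show "ell2_norm S ((c \<odot>\<^bsub>?O\<^esub> F x) \<xi>) \<le> cmod c * op_norm S (F x) * ell2_norm S \<xi>"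
          using mult_left_mono[OF op_norm_bound[OF b \<xi>], of "cmod c"] \<xi>
          by (simp add: operator_algebra_ops ell2_norm_cmult mult.assoc)
        show "(c \<odot>\<^bsub>?O\<^esub> F x) (\<lambda>g. \<xi> g + \<eta> g) = (\<lambda>g. (c \<odot>\<^bsub>?O\<^esub> F x) \<xi> g + (c \<odot>\<^bsub>?O\<^esub> F x) \<eta> g)" if \<eta>: "\<eta> \<in> ell2 S" for \<eta>
          using ell2_add(1)[OF \<xi> \<eta>] \<xi> \<eta> by (simp add: operator_algebra_ops bounded_operatorsD(3)[OF b \<xi> \<eta>] distrib_left)
      qed
      show "w k \<in> D" for k by (rule w(1))
      show "(\<lambda>k. nrm A (u (w k) \<ominus>\<^bsub>A\<^esub> (c \<odot>\<^bsub>A\<^esub> x))) \<longlonglongrightarrow> 0"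
        unfolding w(2) by (rule limit_smult[OF u[OF s(1)] x s(2)])
      show "(\<lambda>k. v (w k) \<xi> g) \<longlonglongrightarrow> (c \<odot>\<^bsub>?O\<^esub> F x) \<xi> g" if \<xi>: "\<xi> \<in> ell2 S" for \<xi> g
        using tendsto_mult[OF tendsto_const[of c] op_tendsto_coordinate[OF v[OF s(1)] Fb[OF x] FL[OF x s] \<xi>, of g]] \<xi>
        by (simp add: operator_algebra_ops w(3)[OF \<xi>])
    qed
  qed
  have F_mult: "F (x \<otimes>\<^bsub>A\<^esub> y) = F x \<otimes>\<^bsub>?O\<^esub> F y" if x: "x \<in> carrier A" and y: "y \<in> carrier A" for x y
  proof -
    obtain s where s: "\<And>k :: nat. s k \<in> D" "(\<lambda>k. nrm A (u (s k) \<ominus>\<^bsub>A\<^esub> x)) \<longlonglongrightarrow> 0" using seq[OF x] by blast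
    obtain t where t: "\<And>k :: nat. t k \<in> D" "(\<lambda>k. nrm A (u (t k) \<ominus>\<^bsub>A\<^esub> y)) \<longlonglongrightarrow> 0" using seq[OF y] by blast
    have "\<forall>k. \<exists>e. e \<in> D \<and> u e = u (s k) \<otimes>\<^bsub>A\<^esub> u (t k) \<and> (\<forall>\<xi>\<in>ell2 S. v e \<xi> = v (s k) (v (t k) \<xi>))"
      using mult[OF s(1) t(1)] by (simp only: Bex_def) blast
    then obtain w where w: "\<And>k. w k \<in> D" "\<And>k. u (w k) = u (s k) \<otimes>\<^bsub>A\<^esub> u (t k)"
      "\<And>k \<xi>. \<xi> \<in> ell2 S \<Longrightarrow> v (w k) \<xi> = v (s k) (v (t k) \<xi>)" by metis
    note b = Fb[OF x] and b' = Fb[OF y]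
    show ?thesis
    proof (rule Feq)
      show "x \<otimes>\<^bsub>A\<^esub> y \<in> carrier A" using x y by simp
      show "F x \<otimes>\<^bsub>?O\<^esub> F y \<in> bounded_operators S"
      proof (rule bounded_operatorsI[where K = "op_norm S (F x) * op_norm S (F y)"])
        show "F x \<otimes>\<^bsub>?O\<^esub> F y \<in> extensional (ell2 S)" by (simp add: operator_algebra_ops compose_def)
        fix \<xi> assume \<xi>: "\<xi> \<in> ell2 S"
        note c = bounded_operatorsD(2)[OF b' \<xi>]
        show "(F x \<otimes>\<^bsub>?O\<^esub> F y) \<xi> \<in> ell2 S"
          using bounded_operatorsD(2)[OF b c] \<xi> by (simp add: operator_algebra_ops compose_def)
        show "(F x \<otimes>\<^bsub>?O\<^esub> F y) (\<lambda>g. z * \<xi> g) = (\<lambda>g. z * (F x \<otimes>\<^bsub>?O\<^esub> F y) \<xi> g)" for z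
          using ell2_cmult[OF \<xi>, of z] \<xi>
          by (simp add: operator_algebra_ops compose_def bounded_operatorsD(4)[OF b' \<xi>] bounded_operatorsD(4)[OF b c])
        show "ell2_norm S ((F x \<otimes>\<^bsub>?O\<^esub> F y) \<xi>) \<le> op_norm S (F x) * op_norm S (F y) * ell2_norm S \<xi>"
          using order_trans[OF op_norm_bound[OF b c] mult_left_mono[OF op_norm_bound[OF b' \<xi>] op_norm_nonneg[OF b]]] \<xi>
          by (simp add: operator_algebra_ops compose_def mult.assoc)
        show "(F x \<otimes>\<^bsub>?O\<^esub> F y) (\<lambda>g. \<xi> g + \<eta> g) = (\<lambda>g. (F x \<otimes>\<^bsub>?O\<^esub> F y) \<xi> g + (F x \<otimes>\<^bsub>?O\<^esub> F y) \<eta> g)" if \<eta>: "\<eta> \<in> ell2 S" for \<eta>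
          using ell2_add(1)[OF \<xi> \<eta>] \<xi> \<eta> bounded_operatorsD(3)[OF b c bounded_operatorsD(2)[OF b' \<eta>]]
          by (simp add: operator_algebra_ops compose_def bounded_operatorsD(3)[OF b' \<xi> \<eta>])
      qed
      show "w k \<in> D" for k by (rule w(1))
      show "(\<lambda>k. nrm A (u (w k) \<ominus>\<^bsub>A\<^esub> (x \<otimes>\<^bsub>A\<^esub> y))) \<longlonglongrightarrow> 0"
        unfolding w(2) by (rule limit_mult[OF u[OF s(1)] u[OF t(1)] x y s(2) t(2)])
      show "(\<lambda>k. v (w k) \<xi> g) \<longlonglongrightarrow> (F x \<otimes>\<^bsub>?O\<^esub> F y) \<xi> g" if \<xi>: "\<xi> \<in> ell2 S" for \<xi> g
        using op_tendsto_compose[OF v[OF s(1)] b FL[OF x s] v[OF t(1)] b' FL[OF y t] \<xi>, of g] \<xi>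
        by (simp add: operator_algebra_ops compose_def w(3)[OF \<xi>])
    qed
  qed
  have F_adj: "F (adj A x) = adj ?O (F x)" if x: "x \<in> carrier A" for x
  proof -
    obtain s where s: "\<And>k :: nat. s k \<in> D" "(\<lambda>k. nrm A (u (s k) \<ominus>\<^bsub>A\<^esub> x)) \<longlonglongrightarrow> 0" using seq[OF x] by blast
    have "\<forall>k. \<exists>e. e \<in> D \<and> u e = adj A (u (s k)) \<and>
        (\<forall>\<xi>\<in>ell2 S. \<forall>\<eta>\<in>ell2 S. ell2_inner S (v (s k) \<xi>) \<eta> = ell2_inner S \<xi> (v e \<eta>))"
      using adj[OF s(1)] by (simp only: Bex_def) blast
    then obtain w where w: "\<And>k. w k \<in> D" "\<And>k. u (w k) = adj A (u (s k))"
      "\<And>k \<xi> \<eta>. \<xi> \<in> ell2 S \<Longrightarrow> \<eta> \<in> ell2 S \<Longrightarrow> ell2_inner S (v (s k) \<xi>) \<eta> = ell2_inner S \<xi> (v (w k) \<eta>)" by metis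
    have xA: "adj A x \<in> carrier A" using x by simp
    have wl: "(\<lambda>k. nrm A (u (w k) \<ominus>\<^bsub>A\<^esub> adj A x)) \<longlonglongrightarrow> 0"
      unfolding w(2) by (rule limit_adj[OF u[OF s(1)] x s(2)])
    show ?thesis
    proof (rule adj_operator[OF Fb[OF xA], symmetric])
      fix \<xi> \<eta> assume \<xi>: "\<xi> \<in> ell2 S" and \<eta>: "\<eta> \<in> ell2 S"
      show "ell2_inner S (F x \<xi>) \<eta> = ell2_inner S \<xi> (F (adj A x) \<eta>)"
        by (rule LIMSEQ_unique[OF op_tendsto_inner(1)[OF v[OF s(1)] Fb[OF x] FL[OF x s] \<xi> \<eta>]])
          (use op_tendsto_inner(2)[OF v[OF w(1)] Fb[OF xA] FL[OF xA w(1) wl] \<eta> \<xi>] w(3)[OF \<xi> \<eta>] in simp)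
    qed
  qed
  have F_one: "F \<one>\<^bsub>A\<^esub> = \<one>\<^bsub>?O\<^esub>"
  proof -
    obtain e where e: "e \<in> D" "u e = \<one>\<^bsub>A\<^esub>" "\<And>\<xi>. \<xi> \<in> ell2 S \<Longrightarrow> v e \<xi> = \<xi>" using one by blast
    have I: "\<one>\<^bsub>?O\<^esub> = v e"
    proof (rule extensionalityI[of _ "ell2 S"])
      show "v e \<in> extensional (ell2 S)" by (rule bounded_operatorsD(1)[OF v[OF e(1)]])
    qed (simp_all add: operator_algebra_ops e(3))
    have A1: "\<one>\<^bsub>A\<^esub> \<in> carrier A" by simp
    have vD: "v e \<in> bounded_operators S" by (rule v[OF e(1)])
    have l: "(\<lambda>k. nrm A (u e \<ominus>\<^bsub>A\<^esub> \<one>\<^bsub>A\<^esub>)) \<longlonglongrightarrow> 0" unfolding e(2) by (rule limit_const) simp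
    have "op_tendsto S (\<lambda>k. v e) (F \<one>\<^bsub>A\<^esub>)" by (rule FL[OF A1 e(1) l])
    note lim = op_tendsto_coordinate[OF vD Fb[OF A1] this]
    have "F \<one>\<^bsub>A\<^esub> \<xi> g = v e \<xi> g" if "\<xi> \<in> ell2 S" for \<xi> g
      by (rule LIMSEQ_unique[OF lim[OF that] tendsto_const])
    then show ?thesis unfolding I by (intro operator_eqI[OF Fb[OF A1] vD])
  qed
  have vb: "v (s k) \<in> bounded_operators S" if "\<And>k. s k \<in> D" for s and k :: nat by (rule v[OF that])
  have F_inj: "x = y" if x: "x \<in> carrier A" and y: "y \<in> carrier A" and eq: "F x = F y" for x y
  proof -
    obtain s where s: "\<And>k :: nat. s k \<in> D" "(\<lambda>k. nrm A (u (s k) \<ominus>\<^bsub>A\<^esub> x)) \<longlonglongrightarrow> 0" using seq[OF x] by blast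
    obtain t where t: "\<And>k :: nat. t k \<in> D" "(\<lambda>k. nrm A (u (t k) \<ominus>\<^bsub>A\<^esub> y)) \<longlonglongrightarrow> 0" using seq[OF y] by blast
    \<comment> \<open>If the operator limits coincide, isometry forces the two approximating
      sequences in \<open>A\<close> together, so the first one also converges to
      \<open>y\<close>.\<close>
    have "(\<lambda>k. nrm A (u (s k) \<ominus>\<^bsub>A\<^esub> y)) \<longlonglongrightarrow> 0"
    proof (rule Lim_null_comparison)
      show "(\<lambda>k. op_norm S (v (s k) \<ominus>\<^bsub>?O\<^esub> F x) + op_norm S (v (t k) \<ominus>\<^bsub>?O\<^esub> F y) + nrm A (u (t k) \<ominus>\<^bsub>A\<^esub> y)) \<longlonglongrightarrow> 0"
        using tendsto_add[OF tendsto_add[OF FL[OF x s, unfolded op_tendsto_def] FL[OF y t, unfolded op_tendsto_def]] t(2)] by simp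
      have "nrm A (u (s k) \<ominus>\<^bsub>A\<^esub> y) \<le> op_norm S (v (s k) \<ominus>\<^bsub>?O\<^esub> F x) + op_norm S (v (t k) \<ominus>\<^bsub>?O\<^esub> F y) + nrm A (u (t k) \<ominus>\<^bsub>A\<^esub> y)" for k
        using nrm_minus_triangle[OF u[OF s(1)] u[OF t(1)] y, of k k] iso[OF s(1) t(1), of k k]
          op_norm_minus_triangle[OF v[OF s(1)] Fb[OF x] v[OF t(1)], of k k] op_norm_minus_commute[OF Fb[OF y] v[OF t(1)], of k] eq
        by simp
      then show "\<forall>\<^sub>F k in sequentially. norm (nrm A (u (s k) \<ominus>\<^bsub>A\<^esub> y)) \<le>
          op_norm S (v (s k) \<ominus>\<^bsub>?O\<^esub> F x) + op_norm S (v (t k) \<ominus>\<^bsub>?O\<^esub> F y) + nrm A (u (t k) \<ominus>\<^bsub>A\<^esub> y)"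
        using nrm_nonneg[OF carrier_closed(5)[OF u[OF s(1)] y]] by (intro always_eventually allI) simp
    qed
    from limit_unique[OF u[OF s(1)] x y s(2) this] show ?thesis .
  qed
  \<comment> \<open>Half of each error goes into passing from \<open>T\<close> to \<open>W\<close>,
    the other half into passing from \<open>W\<close> to an operator \<open>v d\<close>. The
    resulting sequence is Cauchy in \<open>A\<close> by isometry, and its limit is the
    preimage.\<close>
  have clos: "T \<in> norm_closure ?O W \<longleftrightarrow> T \<in> F ` carrier A" for T
  proof
    assume T: "T \<in> norm_closure ?O W"
    then have Tb: "T \<in> bounded_operators S" by (simp add: norm_closure_def operator_algebra_ops)
    have "\<exists>d. d \<in> D \<and> op_norm S (T \<ominus>\<^bsub>?O\<^esub> v d) < inverse (real (Suc k))" for k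
    proof -
      have e: "0 < inverse (real (Suc k)) / 2" by simp
      obtain w where w: "w \<in> W" "op_norm S (T \<ominus>\<^bsub>?O\<^esub> w) < inverse (real (Suc k)) / 2"
        using T e unfolding norm_closure_def by blast
      obtain d where d: "d \<in> D" "op_norm S (w \<ominus>\<^bsub>?O\<^esub> v d) < inverse (real (Suc k)) / 2" using W(3)[OF w(1) e] by blast
      have "w \<in> bounded_operators S" using w W(2) by blast
      from op_norm_minus_triangle[OF Tb this v[OF d(1)]] w(2) d show ?thesis by (intro exI[of _ d] conjI) linarith+
    qed
    then obtain s where s: "\<And>k. s k \<in> D" "\<And>k. op_norm S (T \<ominus>\<^bsub>?O\<^esub> v (s k)) < inverse (real (Suc k))" by metis
    have lim: "op_tendsto S (\<lambda>k. v (s k)) T"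
      unfolding op_tendsto_def
    proof (rule Lim_null_comparison[OF _ LIMSEQ_inverse_real_of_nat], intro always_eventually allI)
      show "norm (op_norm S (v (s k) \<ominus>\<^bsub>?O\<^esub> T)) \<le> inverse (real (Suc k))" for k
        using s(2)[of k] op_norm_minus_commute[OF Tb v[OF s(1)], of k] op_norm_minus_nonneg[OF v[OF s(1)] Tb, of k] by simp
    qed
    have "\<exists>M. \<forall>m\<ge>M. \<forall>n\<ge>M. nrm A (u (s m) \<ominus>\<^bsub>A\<^esub> u (s n)) < e" if e: "0 < e" for e
    proof -
      have "\<forall>\<^sub>F k in sequentially. op_norm S (v (s k) \<ominus>\<^bsub>?O\<^esub> T) < e / 2"
        using order_tendstoD(2)[OF lim[unfolded op_tendsto_def], of "e / 2"] e by simp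
      then obtain M where M: "\<And>k. k \<ge> M \<Longrightarrow> op_norm S (v (s k) \<ominus>\<^bsub>?O\<^esub> T) < e / 2" by (auto simp: eventually_sequentially)
      have "nrm A (u (s m) \<ominus>\<^bsub>A\<^esub> u (s n)) < e" if "m \<ge> M" "n \<ge> M" for m n
        using op_norm_minus_triangle[OF v[OF s(1)] Tb v[OF s(1)], of m n] op_norm_minus_commute[OF Tb v[OF s(1)], of n]
          M[OF that(1)] M[OF that(2)] iso[OF s(1) s(1), of m n] by simp
      then show ?thesis by blast
    qed
    then obtain x where x: "x \<in> carrier A" "(\<lambda>k. nrm A (u (s k) \<ominus>\<^bsub>A\<^esub> x)) \<longlonglongrightarrow> 0"
      using nrm_complete[of "\<lambda>k. u (s k)", OF u[OF s(1)]] by blast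
    have "T = F x" by (rule op_tendsto_unique[OF v[OF s(1)] Tb Fb[OF x(1)] lim FL[OF x(1) s(1) x(2)]])
    then show "T \<in> F ` carrier A" using x(1) by blast
  next
    assume "T \<in> F ` carrier A"
    then obtain x where x: "x \<in> carrier A" "T = F x" by blast
    obtain s where s: "\<And>k :: nat. s k \<in> D" "(\<lambda>k. nrm A (u (s k) \<ominus>\<^bsub>A\<^esub> x)) \<longlonglongrightarrow> 0" using seq[OF x(1)] by blast
    have "\<exists>y\<in>W. op_norm S (T \<ominus>\<^bsub>?O\<^esub> y) < e" if e: "0 < e" for e
    proof -
      have "\<forall>\<^sub>F k in sequentially. op_norm S (v (s k) \<ominus>\<^bsub>?O\<^esub> F x) < e"
        using order_tendstoD(2)[OF FL[OF x(1) s, unfolded op_tendsto_def], of e] e by simp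
      then obtain k where "op_norm S (v (s k) \<ominus>\<^bsub>?O\<^esub> F x) < e" by (auto simp: eventually_sequentially)
      then show ?thesis
        using W(1) s(1)[of k] op_norm_minus_commute[OF Fb[OF x(1)] v[OF s(1)], of k] x(2) by (intro bexI[of _ "v (s k)"]) auto
    qed
    then show "T \<in> norm_closure ?O W" using Fb[OF x(1)] x(2) by (simp add: norm_closure_def operator_algebra_ops)
  qed
  let ?B = "on_carrier ?O (norm_closure ?O W)"
  have B: "carrier ?B = F ` carrier A" using clos by (auto simp: on_carrier_def)
  have ops: "x \<otimes>\<^bsub>?B\<^esub> y = x \<otimes>\<^bsub>?O\<^esub> y" "x \<oplus>\<^bsub>?B\<^esub> y = x \<oplus>\<^bsub>?O\<^esub> y" "\<one>\<^bsub>?B\<^esub> = \<one>\<^bsub>?O\<^esub>"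
    "c \<odot>\<^bsub>?B\<^esub> x = c \<odot>\<^bsub>?O\<^esub> x" "adj ?B x = adj ?O x" for x y c
    by (simp_all add: on_carrier_def)
  have hom: "F \<in> Ring.ring_hom A ?B"
    by (rule ring_hom_memI) (auto simp: B ops F_mult F_add F_one)
  have "F \<in> star_hom A ?B" using hom by (simp add: star_hom_def ops F_smult F_adj)
  moreover have "F \<in> ring_iso A ?B"
    using hom F_inj by (auto simp: ring_iso_def bij_betw_def inj_on_def B)
  ultimately show ?thesis unfolding star_isomorphic_def by blast
qed

section \<open>Regular representation\<close>

text \<open>The hypotheses on \<open>blk\<close> describe a partition of \<open>S\<close> into
  finite sets. A finite set of coordinates is enlarged to the union of the blocks it meets, and the
  squared estimates are added over the disjoint blocks.\<close>

lemma ell2_block_bound: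
  assumes \<xi>: "\<xi> \<in> ell2 S" and K: "0 \<le> K" and out: "\<And>g. g \<notin> S \<Longrightarrow> \<eta> g = 0"
    and blk: "\<And>g. g \<in> S \<Longrightarrow> finite (blk g)" "\<And>g. g \<in> S \<Longrightarrow> g \<in> blk g" "\<And>g. g \<in> S \<Longrightarrow> blk g \<subseteq> S"
      "\<And>g g'. g \<in> S \<Longrightarrow> g' \<in> blk g \<Longrightarrow> blk g' = blk g"
    and le: "\<And>g. g \<in> S \<Longrightarrow> L2_set (\<lambda>g. cmod (\<eta> g)) (blk g) \<le> K * L2_set (\<lambda>g. cmod (\<xi> g)) (blk g)"
  shows "\<eta> \<in> ell2 S" "ell2_norm S \<eta> \<le> K * ell2_norm S \<xi>"
proof -
  have "L2_set (\<lambda>g. cmod (\<eta> g)) F \<le> K * ell2_norm S \<xi>" if F: "finite F" "F \<subseteq> S" for F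
  proof -
    let ?C = "blk ` F"
    have FS: "g \<in> S" if "g \<in> F" for g using F(2) that by (rule subsetD)
    have fin: "finite ?C" by (rule finite_imageI[OF F(1)])
    have finB: "finite B" if B: "B \<in> ?C" for B using B by (rule imageE) (simp only: blk(1)[OF FS])
    have US: "\<Union>?C \<subseteq> S" by (rule UN_least) (rule blk(3)[OF FS])
    have FU: "F \<subseteq> \<Union>?C" by (rule subsetI) (rule UN_I, assumption, rule blk(2)[OF FS])
    have Ufin: "finite (\<Union>?C)" by (rule finite_Union[OF fin finB])
    have disj: "B \<inter> B' = {}" if BB: "B \<in> ?C" "B' \<in> ?C" "B \<noteq> B'" for B B'
    proof (rule ccontr)
      obtain g where g: "B = blk g" "g \<in> F" using BB(1) by (rule imageE)
      obtain g' where g': "B' = blk g'" "g' \<in> F" using BB(2) by (rule imageE)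
      assume "B \<inter> B' \<noteq> {}"
      then obtain k where k: "k \<in> B" "k \<in> B'" by blast
      have "blk k = B" using k(1) unfolding g(1) by (rule blk(4)[OF FS[OF g(2)]])
      moreover have "blk k = B'" using k(2) unfolding g'(1) by (rule blk(4)[OF FS[OF g'(2)]])
      ultimately show False using BB(3) by (simp only:)
    qed
    have split: "(\<Sum>g\<in>\<Union>?C. \<phi> g) = (\<Sum>B\<in>?C. \<Sum>g\<in>B. \<phi> g)" for \<phi> :: "'a \<Rightarrow> real"
    proof -
      have 1: "\<forall>B\<in>?C. finite B" by (intro ballI finB)
      have 2: "\<forall>B\<in>?C. \<forall>B'\<in>?C. B \<noteq> B' \<longrightarrow> B \<inter> B' = {}" by (intro ballI impI disj)
      show ?thesis using sum.Union_disjoint[OF 1 2] by (simp only: comp_def)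
    qed
    have sq: "(\<Sum>g\<in>B. (cmod (\<eta> g))\<^sup>2) \<le> K\<^sup>2 * (\<Sum>g\<in>B. (cmod (\<xi> g))\<^sup>2)" if B: "B \<in> ?C" for B
    proof -
      obtain g where g': "B = blk g" "g \<in> F" using B by (rule imageE)
      then have g: "g \<in> S" "B = blk g" using FS by simp_all
      have "(L2_set (\<lambda>g. cmod (\<eta> g)) B)\<^sup>2 \<le> (K * L2_set (\<lambda>g. cmod (\<xi> g)) B)\<^sup>2"
        using le[OF g(1)] g(2) by (intro power_mono) (auto simp: L2_set_nonneg)
      then show ?thesis by (simp add: L2_set_def power_mult_distrib sum_nonneg)
    qed
    have "(\<Sum>g\<in>\<Union>?C. (cmod (\<eta> g))\<^sup>2) \<le> K\<^sup>2 * (\<Sum>g\<in>\<Union>?C. (cmod (\<xi> g))\<^sup>2)"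
    proof -
      have "(\<Sum>B\<in>?C. \<Sum>g\<in>B. (cmod (\<eta> g))\<^sup>2) \<le> (\<Sum>B\<in>?C. K\<^sup>2 * (\<Sum>g\<in>B. (cmod (\<xi> g))\<^sup>2))" by (rule sum_mono[OF sq])
      then show ?thesis unfolding split by (simp only: sum_distrib_left)
    qed
    then have "sqrt (\<Sum>g\<in>\<Union>?C. (cmod (\<eta> g))\<^sup>2) \<le> sqrt (K\<^sup>2 * (\<Sum>g\<in>\<Union>?C. (cmod (\<xi> g))\<^sup>2))" by simp
    then have "L2_set (\<lambda>g. cmod (\<eta> g)) (\<Union>?C) \<le> K * L2_set (\<lambda>g. cmod (\<xi> g)) (\<Union>?C)"
      using K by (simp add: L2_set_def real_sqrt_mult)
    moreover have "L2_set (\<lambda>g. cmod (\<eta> g)) F \<le> L2_set (\<lambda>g. cmod (\<eta> g)) (\<Union>?C)"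
      unfolding L2_set_def by (intro real_sqrt_le_mono sum_mono2[OF Ufin FU]) simp
    moreover have "K * L2_set (\<lambda>g. cmod (\<xi> g)) (\<Union>?C) \<le> K * ell2_norm S \<xi>"
      by (rule mult_left_mono[OF L2_set_le_ell2_norm[OF \<xi> Ufin US] K])
    ultimately show ?thesis by linarith
  qed
  from ell2I[OF out this] show "\<eta> \<in> ell2 S" "ell2_norm S \<eta> \<le> K * ell2_norm S \<xi>" by blast+
qed

text \<open>The difference of the two inner products is an unconditional sum of terms that cancel on
  every block. Finite sums over unions of blocks vanish, and such unions contain any given finite
  set, so the total is 0.\<close>

lemma ell2_block_inner:
  assumes \<xi>: "\<xi> \<in> ell2 S" "\<eta> \<in> ell2 S" and \<xi>': "\<xi>' \<in> ell2 S" "\<eta>' \<in> ell2 S"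
    and blk: "\<And>g. g \<in> S \<Longrightarrow> finite (blk g)" "\<And>g. g \<in> S \<Longrightarrow> g \<in> blk g" "\<And>g. g \<in> S \<Longrightarrow> blk g \<subseteq> S"
      "\<And>g g'. g \<in> S \<Longrightarrow> g' \<in> blk g \<Longrightarrow> blk g' = blk g"
    and eq: "\<And>g. g \<in> S \<Longrightarrow> (\<Sum>k\<in>blk g. \<xi> k * cnj (\<eta> k)) = (\<Sum>k\<in>blk g. \<xi>' k * cnj (\<eta>' k))"
  shows "ell2_inner S \<xi> \<eta> = ell2_inner S \<xi>' \<eta>'"
proof -
  let ?f = "\<lambda>g. \<xi> g * cnj (\<eta> g) - \<xi>' g * cnj (\<eta>' g)"
  have s1: "((\<lambda>g. \<xi> g * cnj (\<eta> g)) has_sum ell2_inner S \<xi> \<eta>) S"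
    unfolding ell2_inner_def by (rule has_sum_infsum[OF abs_summable_summable[OF ell2_mult_abs_summable[OF \<xi>]]])
  have s2: "((\<lambda>g. \<xi>' g * cnj (\<eta>' g)) has_sum ell2_inner S \<xi>' \<eta>') S"
    unfolding ell2_inner_def by (rule has_sum_infsum[OF abs_summable_summable[OF ell2_mult_abs_summable[OF \<xi>']]])
  have s2': "((\<lambda>g. - (\<xi>' g * cnj (\<eta>' g))) has_sum - ell2_inner S \<xi>' \<eta>') S"
    using s2 by (simp add: has_sum_uminus)
  define d where "d = ell2_inner S \<xi> \<eta> - ell2_inner S \<xi>' \<eta>'"
  have s: "(?f has_sum d) S"
    using has_sum_add[OF s1 s2'] by (simp add: d_def)
  have "cmod d < e" if e: "0 < e" for e
  proof -
    obtain F where F: "finite F" "F \<subseteq> S" and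
      near: "\<And>F'. finite F' \<Longrightarrow> F \<subseteq> F' \<Longrightarrow> F' \<subseteq> S \<Longrightarrow> dist (sum ?f F') d < e"
      using s e unfolding has_sum_def tendsto_iff eventually_finite_subsets_at_top by meson
    let ?C = "blk ` F"
    have FS: "g \<in> S" if "g \<in> F" for g using F(2) that by (rule subsetD)
    have fin: "finite ?C" by (rule finite_imageI[OF F(1)])
    have finB: "finite B" if B: "B \<in> ?C" for B using B by (rule imageE) (simp only: blk(1)[OF FS])
    have US: "\<Union>?C \<subseteq> S" by (rule UN_least) (rule blk(3)[OF FS])
    have FU: "F \<subseteq> \<Union>?C" by (rule subsetI) (rule UN_I, assumption, rule blk(2)[OF FS])
    have Ufin: "finite (\<Union>?C)" by (rule finite_Union[OF fin finB])
    have disj: "B \<inter> B' = {}" if BB: "B \<in> ?C" "B' \<in> ?C" "B \<noteq> B'" for B B'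
    proof (rule ccontr)
      obtain g where g: "B = blk g" "g \<in> F" using BB(1) by (rule imageE)
      obtain g' where g': "B' = blk g'" "g' \<in> F" using BB(2) by (rule imageE)
      assume "B \<inter> B' \<noteq> {}"
      then obtain k where k: "k \<in> B" "k \<in> B'" by blast
      have "blk k = B" using k(1) unfolding g(1) by (rule blk(4)[OF FS[OF g(2)]])
      moreover have "blk k = B'" using k(2) unfolding g'(1) by (rule blk(4)[OF FS[OF g'(2)]])
      ultimately show False using BB(3) by (simp only:)
    qed
    have "(\<Sum>g\<in>\<Union>?C. ?f g) = (\<Sum>B\<in>?C. \<Sum>g\<in>B. ?f g)"
    proof -
      have 1: "\<forall>B\<in>?C. finite B" by (intro ballI finB)
      have 2: "\<forall>B\<in>?C. \<forall>B'\<in>?C. B \<noteq> B' \<longrightarrow> B \<inter> B' = {}" by (intro ballI impI disj)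
      show ?thesis using sum.Union_disjoint[OF 1 2] by (simp only: comp_def)
    qed
    moreover have "(\<Sum>g\<in>B. ?f g) = 0" if B: "B \<in> ?C" for B
    proof -
      obtain g where "B = blk g" "g \<in> F" using B by (rule imageE)
      then show ?thesis using eq[OF FS[of g]] by (simp add: sum_subtractf)
    qed
    ultimately have "sum ?f (\<Union>?C) = 0" by simp
    moreover have "dist (sum ?f (\<Union>?C)) d < e" by (rule near[OF Ufin FU US])
    ultimately show ?thesis by simp
  qed
  then have "cmod d \<le> 0" by (meson dense_ge less_imp_le not_less order_less_irrefl)
  then show ?thesis by (simp add: d_def)
qed

context ah_limit
begin

section \<open>The transformation groupoid and its finite blocks\<close>

abbreviation trans_groupoid where
  "trans_groupoid \<equiv> transformation_groupoid (tail_groupoid S) spec char_anchor char_act"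

definition act_arrows where "act_arrows = topspace act_domain"

lemma act_arrows_iff: "((x, y), h) \<in> act_arrows \<longleftrightarrow> (x, y) \<in> tail_arrows S \<and> h \<in> chars \<and> char_path h = y"
  unfolding act_arrows_def by (rule act_domain_iff)

lemma trans_groupoid_arrows: "arrows trans_groupoid = act_domain"
  by (simp add: transformation_groupoid_def)

lemma trans_groupoid_simps:
  "topspace (arrows trans_groupoid) = act_arrows"
  "rng trans_groupoid ((x, y), h) = ((x, x), char_act (x, y) h)"
  "gmul trans_groupoid ((x, y), h') ((y', z), h) = ((x, z), h)"
  "ginv trans_groupoid ((x, y), h) = ((y, x), char_act (x, y) h)"
  by (simp add: trans_groupoid_arrows act_arrows_def) (simp_all add: transformation_groupoid_def tail_groupoid_simps)

lemma act_refl: "h \<in> chars \<Longrightarrow> char_path h = x \<Longrightarrow> char_act (x, x) h = h"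
  using groupoid_action.act_unit[OF groupoid_action_spec, of h] topspace_spectrum by simp

lemma act_comp:
  assumes "(z, x) \<in> tail_arrows S" "(x, y) \<in> tail_arrows S" "h \<in> chars" "char_path h = y"
  shows "char_act (z, x) (char_act (x, y) h) = char_act (z, y) h"
  using groupoid_action.act_act[OF groupoid_action_spec, of "(z, x)" "(x, y)" h] assms
  by (simp add: topspace_tail topspace_spectrum tail_groupoid_simps)

definition level_arrows :: "nat \<Rightarrow> (((nat \<Rightarrow> 'e bedge) \<times> (nat \<Rightarrow> 'e bedge)) \<times> ('a \<Rightarrow> complex)) set" where
  "level_arrows n = {g \<in> act_arrows. \<forall>k\<ge>n. fst (fst g) k = snd (fst g) k}"

lemma level_arrows_iff: "((x, y), h) \<in> level_arrows n \<longleftrightarrow> ((x, y), h) \<in> act_arrows \<and> (\<forall>k\<ge>n. x k = y k)"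
  by (simp add: level_arrows_def)

text \<open>Moves within the source fibre of \<open>g\<close>: source path and character stay fixed,
  and the range path gets the prefix with matrix index \<open>b\<close>. For valid \<open>b\<close>
  these arrows are the coordinates of one finite block of the regular representation.\<close>

definition block_shift :: "nat \<Rightarrow> ((nat \<Rightarrow> 'e bedge) \<times> (nat \<Rightarrow> 'e bedge)) \<times> ('a \<Rightarrow> complex) \<Rightarrow> nat \<Rightarrow>
    ((nat \<Rightarrow> 'e bedge) \<times> (nat \<Rightarrow> 'e bedge)) \<times> ('a \<Rightarrow> complex)" where
  "block_shift n g b = ((replace_prefix n (fst (fst g)) b, snd (fst g)), snd g)"

abbreviation block_size :: "nat \<Rightarrow> ((nat \<Rightarrow> 'e bedge) \<times> (nat \<Rightarrow> 'e bedge)) \<times> ('a \<Rightarrow> complex) \<Rightarrow> nat" where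
  "block_size n g \<equiv> msize S n (vertex (fst (fst g)) n)"

text \<open>The value of \<open>f\<close> at the product of the arrow with index \<open>c\<close>
  and the inverse of the arrow with index \<open>b\<close>, that is, the matrix coefficient of
  convolution by \<open>f\<close> on the block of \<open>g\<close>.\<close>

definition block_entry :: "nat \<Rightarrow> (((nat \<Rightarrow> 'e bedge) \<times> (nat \<Rightarrow> 'e bedge)) \<times> ('a \<Rightarrow> complex) \<Rightarrow> complex) \<Rightarrow>
    ((nat \<Rightarrow> 'e bedge) \<times> (nat \<Rightarrow> 'e bedge)) \<times> ('a \<Rightarrow> complex) \<Rightarrow> nat \<Rightarrow> nat \<Rightarrow> complex" where
  "block_entry n f g c b = f ((replace_prefix n (fst (fst g)) c, replace_prefix n (fst (fst g)) b),
     char_act (replace_prefix n (fst (fst g)) b, snd (fst g)) (snd g))"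

lemma replace_prefix_self:
  assumes "x \<in> infinite_paths S" "n \<ge> 1"
  shows "replace_prefix n x (path_pos S x n) = x"
  using replace_prefix_unique(1)[OF assms(1,1,2)] by simp

lemma replace_prefix_twice:
  assumes x: "x \<in> infinite_paths S" "n \<ge> 1" "b < msize S n (vertex x n)" "c < msize S n (vertex x n)"
  shows "replace_prefix n (replace_prefix n x c) b = replace_prefix n x b"
proof -
  note c = replace_prefix[OF x(1,2,4)] and b = replace_prefix[OF x(1,2,3)]
  have "replace_prefix n (replace_prefix n x c) (path_pos S (replace_prefix n x b) n) = replace_prefix n x b"
    by (rule replace_prefix_unique(1)[OF c(1) b(1) x(2)]) (simp add: c(2) b(2))
  then show ?thesis by (simp add: b(3))
qed

lemma replace_prefix_tail:
  assumes "(x, y) \<in> tail_arrows S" "n \<ge> 1" "b < msize S n (vertex x n)"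
  shows "(replace_prefix n x b, x) \<in> tail_arrows S" "(x, replace_prefix n x b) \<in> tail_arrows S"
    "(replace_prefix n x b, y) \<in> tail_arrows S"
proof -
  note r = replace_prefix[OF tail_arrowsD(1)[OF assms(1)] assms(2,3)]
  show a: "(replace_prefix n x b, x) \<in> tail_arrows S"
    by (rule tail_arrowsI[OF r(1) tail_arrowsD(1)[OF assms(1)], of n]) (simp add: r(2))
  show "(x, replace_prefix n x b) \<in> tail_arrows S" by (rule tail_sym[OF a])
  show "(replace_prefix n x b, y) \<in> tail_arrows S" by (rule tail_trans[OF a assms(1)])
qed

lemma block_shift:
  assumes g: "g \<in> act_arrows" and n: "n \<ge> 1" and b: "b < block_size n g"
  shows "block_shift n g b \<in> act_arrows" "block_size n (block_shift n g b) = block_size n g"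
    "c < block_size n g \<Longrightarrow> block_shift n (block_shift n g b) c = block_shift n g c"
    "path_pos S (fst (fst (block_shift n g b))) n = b"
    "vertex (fst (fst (block_shift n g b))) n = vertex (fst (fst g)) n"
proof -
  obtain x y h where gg: "g = ((x, y), h)" by (metis prod.collapse)
  have t: "(x, y) \<in> tail_arrows S" "h \<in> chars" "char_path h = y" using g by (simp_all only: gg act_arrows_iff)
  have b': "b < msize S n (vertex x n)" using b by (simp add: gg)
  note r = replace_prefix[OF tail_arrowsD(1)[OF t(1)] n b']
  show "block_shift n g b \<in> act_arrows"
    unfolding gg block_shift_def fst_conv snd_conv act_arrows_iff using replace_prefix_tail(3)[OF t(1) n b'] t by simp
  show "block_size n (block_shift n g b) = block_size n g"
    "path_pos S (fst (fst (block_shift n g b))) n = b"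
    "vertex (fst (fst (block_shift n g b))) n = vertex (fst (fst g)) n"
    by (simp_all add: gg block_shift_def r)
  show "block_shift n (block_shift n g b) c = block_shift n g c" if "c < block_size n g"
    using that by (simp add: gg block_shift_def replace_prefix_twice[OF tail_arrowsD(1)[OF t(1)] n _ b'])
qed

lemma block_shift_self:
  assumes g: "g \<in> act_arrows" and n: "n \<ge> 1"
  shows "block_shift n g (path_pos S (fst (fst g)) n) = g" "path_pos S (fst (fst g)) n < block_size n g"
proof -
  obtain x y h where gg: "g = ((x, y), h)" by (metis prod.collapse)
  have t: "(x, y) \<in> tail_arrows S" using g by (simp only: gg act_arrows_iff)
  show "block_shift n g (path_pos S (fst (fst g)) n) = g" "path_pos S (fst (fst g)) n < block_size n g"
    using replace_prefix_self[OF tail_arrowsD(1)[OF t] n] path_pos_less[OF tail_arrowsD(1)[OF t] n]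
    by (simp_all add: gg block_shift_def)
qed

definition block :: "nat \<Rightarrow> ((nat \<Rightarrow> 'e bedge) \<times> (nat \<Rightarrow> 'e bedge)) \<times> ('a \<Rightarrow> complex) \<Rightarrow>
    (((nat \<Rightarrow> 'e bedge) \<times> (nat \<Rightarrow> 'e bedge)) \<times> ('a \<Rightarrow> complex)) set" where
  "block n g = block_shift n g ` {..<block_size n g}"

lemma block_shift_inj:
  assumes "g \<in> act_arrows" "n \<ge> 1"
  shows "inj_on (block_shift n g) {..<block_size n g}"
  by (rule inj_on_inverseI[where g = "\<lambda>k. path_pos S (fst (fst k)) n"]) (simp add: block_shift(4)[OF assms])

lemma block:
  assumes g: "g \<in> act_arrows" and n: "n \<ge> 1"
  shows "finite (block n g)" "g \<in> block n g" "block n g \<subseteq> act_arrows" "k \<in> block n g \<Longrightarrow> block n k = block n g"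
proof -
  show "finite (block n g)" by (simp add: block_def)
  show "g \<in> block n g" unfolding block_def
    by (rule image_eqI[where x = "path_pos S (fst (fst g)) n"]) (simp_all add: block_shift_self[OF g n])
  show "block n g \<subseteq> act_arrows" unfolding block_def using block_shift(1)[OF g n] by blast
  assume "k \<in> block n g"
  then obtain b where b: "b < block_size n g" "k = block_shift n g b" by (auto simp: block_def)
  show "block n k = block n g"
    unfolding block_def b(2) block_shift(2)[OF g n b(1)]
    by (rule image_cong[OF refl]) (simp add: block_shift(3)[OF g n b(1)])
qed

lemma sum_block:
  assumes "g \<in> act_arrows" "n \<ge> 1"
  shows "(\<Sum>k\<in>block n g. \<phi> k) = (\<Sum>b<block_size n g. \<phi> (block_shift n g b))"
  unfolding block_def by (simp add: sum.reindex[OF block_shift_inj[OF assms]])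

lemma regular_representation_outside:
  "\<xi> \<in> ell2 act_arrows \<Longrightarrow> g \<notin> act_arrows \<Longrightarrow> regular_representation trans_groupoid f \<xi> g = 0"
  by (simp add: regular_representation_def trans_groupoid_simps)

text \<open>In the convolution at the arrow with index \<open>c\<close> only arrows with that range
  and inside \<open>level_arrows n\<close> contribute. They are exactly the products with inverses
  of the block members, and convolving by the one with index \<open>b\<close> reads \<xi> at the
  block member with index \<open>b\<close>.\<close>

lemma regular_representation_sum:
  assumes n: "n \<ge> 1" and f: "\<And>g. g \<notin> level_arrows n \<Longrightarrow> f g = 0"
    and \<xi>: "\<xi> \<in> ell2 act_arrows" and g: "g \<in> act_arrows" and c: "c < block_size n g"
  shows "regular_representation trans_groupoid f \<xi> (block_shift n g c) =
    (\<Sum>b<block_size n g. block_entry n f g c b * \<xi> (block_shift n g b))"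
proof -
  obtain x y h where gg: "g = ((x, y), h)" by (metis prod.collapse)
  have t: "(x, y) \<in> tail_arrows S" and h: "h \<in> chars" and hy: "char_path h = y" using g by (simp_all only: gg act_arrows_iff)
  have x: "x \<in> infinite_paths S" by (rule tail_arrowsD(1)[OF t])
  let ?m = "msize S n (vertex x n)" and ?r = "replace_prefix n x"
  have c': "c < ?m" using c by (simp add: gg)
  let ?k = "((?r c, y), h)"
  have k: "block_shift n g c = ?k" by (simp add: gg block_shift_def)
  have kG: "?k \<in> act_arrows" using block_shift(1)[OF g n c] by (simp only: k)
  let ?I = "{p \<in> act_arrows. rng trans_groupoid p = rng trans_groupoid ?k}"
  let ?F = "\<lambda>p. f p * \<xi> (gmul trans_groupoid (ginv trans_groupoid p) ?k)"
  let ?q = "\<lambda>b. ((?r c, ?r b), char_act (?r b, y) h)"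
  have rt: "(?r b, y) \<in> tail_arrows S" if "b < ?m" for b using replace_prefix_tail(3)[OF t n that] .
  have ct: "(?r c, ?r b) \<in> tail_arrows S" if "b < ?m" for b
    by (rule tail_trans[OF replace_prefix_tail(1)[OF t n c'] replace_prefix_tail(2)[OF t n that]])
  have qI: "?q b \<in> ?I" if b: "b < ?m" for b
  proof -
    have "?q b \<in> act_arrows"
      unfolding act_arrows_iff using ct[OF b] act_chars[OF rt[OF b] h hy] act_path[OF rt[OF b] h hy] by simp
    then show ?thesis by (simp add: trans_groupoid_simps act_comp[OF ct[OF b] rt[OF b] h hy])
  qed
  have inj: "inj_on ?q {..<?m}"
    by (rule inj_on_inverseI[where g = "\<lambda>p. path_pos S (snd (fst p)) n"]) (simp add: replace_prefix(3)[OF x n])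
  have zero: "?F p = 0" if p: "p \<in> ?I" "p \<notin> ?q ` {..<?m}" for p
  proof -
    obtain x' y' h' where pp: "p = ((x', y'), h')" by (metis prod.collapse)
    have t': "(x', y') \<in> tail_arrows S" and h': "h' \<in> chars" and hy': "char_path h' = y'"
      using p(1) by (simp_all only: pp mem_Collect_eq act_arrows_iff)
    have x': "x' = ?r c" and e: "char_act (x', y') h' = char_act (?r c, y) h"
      using p(1) by (simp_all only: pp trans_groupoid_simps mem_Collect_eq prod.inject) blast
    have "p \<notin> level_arrows n"
    proof
      assume "p \<in> level_arrows n"
      then have ag: "y' k = x k" if "k \<ge> n" for k
        using that by (simp add: pp level_arrows_iff x' replace_prefix(2)[OF x n c'])
      note u = replace_prefix_unique[OF x tail_arrowsD(2)[OF t'] n ag]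
      \<comment> \<open>The source character is recovered from the prescribed range by applying the
        inverse arrow, which shows that \<open>p\<close> is one of the listed arrows.\<close>
      have "h' = char_act (y', y') h'" by (rule act_refl[OF h' hy', symmetric])
      also have "\<dots> = char_act (y', x') (char_act (x', y') h')"
        by (rule act_comp[OF tail_sym[OF t'] t' h' hy', symmetric])
      also have "\<dots> = char_act (y', ?r c) (char_act (?r c, y) h)" by (simp only: e[symmetric]) (simp only: x')
      also have "\<dots> = char_act (y', y) h"
        by (rule act_comp[OF _ rt[OF c'] h hy]) (use tail_sym[OF t'] x' in simp)
      finally have "p = ?q (path_pos S y' n)" by (simp add: pp x' u(1))
      then show False using p(2) u(2) by blast
    qed
    then show ?thesis by (simp add: f)
  qed
  have "regular_representation trans_groupoid f \<xi> ?k = (\<Sum>\<^sub>\<infinity>p\<in>?I. ?F p)"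
    using kG \<xi> by (simp add: regular_representation_def trans_groupoid_simps(1))
  also have "\<dots> = (\<Sum>\<^sub>\<infinity>p\<in>?q ` {..<?m}. ?F p)"
  proof (rule infsum_cong_neutral)
    show "?F p = 0" if "p \<in> ?q ` {..<?m} - ?I" for p using that qI by blast
    show "?F p = 0" if "p \<in> ?I - ?q ` {..<?m}" for p by (rule zero) (use that in blast)+
  qed simp
  also have "\<dots> = (\<Sum>b<?m. ?F (?q b))"
    by (simp add: sum.reindex[OF inj])
  also have "\<dots> = (\<Sum>b<?m. block_entry n f g c b * \<xi> (block_shift n g b))"
    by (simp add: trans_groupoid_simps block_entry_def block_shift_def gg)
  finally show ?thesis by (simp only: k) (simp add: gg)
qed

lemma matrix_norm_crude_le:
  assumes "M \<in> carrier_mat m m"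
  shows "matrix_norm M \<le> (\<Sum>a<m. \<Sum>b<m. cmod (M $$ (a, b)))"
  by (rule matrix_norm_leI[OF assms _ matrix_norm_crude[OF assms]]) (simp add: sum_nonneg)

definition block_matrix where
  "block_matrix n f g = Matrix.mat (block_size n g) (block_size n g) (\<lambda>(c, b). block_entry n f g c b)"

lemma L2_block:
  assumes "g \<in> act_arrows" "n \<ge> 1"
  shows "L2_set \<phi> (block n g) = L2_set (\<lambda>b. \<phi> (block_shift n g b)) {..<block_size n g}"
  unfolding L2_set_def sum_block[OF assms] ..

lemma regular_representation_block:
  assumes n: "n \<ge> 1" and f: "\<And>g. g \<notin> level_arrows n \<Longrightarrow> f g = 0"
    and \<xi>: "\<xi> \<in> ell2 act_arrows" and g: "g \<in> act_arrows"
  shows "L2_set (\<lambda>k. cmod (regular_representation trans_groupoid f \<xi> k)) (block n g) =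
    L2_set (\<lambda>c. cmod (\<Sum>b<block_size n g. block_matrix n f g $$ (c, b) * \<xi> (block_shift n g b))) {..<block_size n g}"
  unfolding L2_block[OF g n]
  by (rule L2_set_cong[OF refl]) (simp add: regular_representation_sum[OF n f \<xi> g] block_matrix_def)

text \<open>For a function living on one level the operator is block diagonal with finite blocks, so
  a uniform bound on the block matrices bounds it. Linearity follows from the finite sum
  formula.\<close>

lemma regular_representation_bounded:
  assumes n: "n \<ge> 1" and f: "\<And>g. g \<notin> level_arrows n \<Longrightarrow> f g = 0" and K: "0 \<le> K"
    and le: "\<And>g. g \<in> act_arrows \<Longrightarrow> matrix_norm (block_matrix n f g) \<le> K"
  shows "regular_representation trans_groupoid f \<in> bounded_operators act_arrows"
    "\<xi> \<in> ell2 act_arrows \<Longrightarrow> ell2_norm act_arrows (regular_representation trans_groupoid f \<xi>) \<le> K * ell2_norm act_arrows \<xi>"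
proof -
  let ?R = "regular_representation trans_groupoid f"
  have b: "?R \<xi> \<in> ell2 act_arrows" "ell2_norm act_arrows (?R \<xi>) \<le> K * ell2_norm act_arrows \<xi>"
    if \<xi>: "\<xi> \<in> ell2 act_arrows" for \<xi>
  proof -
    have l: "L2_set (\<lambda>k. cmod (?R \<xi> k)) (block n g) \<le> K * L2_set (\<lambda>k. cmod (\<xi> k)) (block n g)"
      if g: "g \<in> act_arrows" for g
    proof -
      have "block_matrix n f g \<in> carrier_mat (block_size n g) (block_size n g)" by (simp add: block_matrix_def)
      note mb = matrix_norm_bound[OF this, of "\<lambda>b. \<xi> (block_shift n g b)"]
      have "L2_set (\<lambda>k. cmod (?R \<xi> k)) (block n g) \<le> matrix_norm (block_matrix n f g) * L2_set (\<lambda>k. cmod (\<xi> k)) (block n g)"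
      proof -
        have "L2_set (\<lambda>k. cmod (?R \<xi> k)) (block n g) =
            L2_set (\<lambda>c. cmod (\<Sum>b<block_size n g. block_matrix n f g $$ (c, b) * \<xi> (block_shift n g b))) {..<block_size n g}"
          by (rule regular_representation_block[OF n _ \<xi> g]) (rule f)
        also have "(\<dots> :: real) \<le> matrix_norm (block_matrix n f g) * L2_set (\<lambda>k. cmod (\<xi> k)) (block n g)"
          unfolding L2_block[OF g n] by (rule mb)
        finally show ?thesis .
      qed
      also have "(\<dots> :: real) \<le> K * L2_set (\<lambda>k. cmod (\<xi> k)) (block n g)"
        by (rule mult_right_mono[OF le[OF g] L2_set_nonneg])
      finally show ?thesis .
    qed
    have out: "?R \<xi> g = 0" if "g \<notin> act_arrows" for g by (rule regular_representation_outside[OF \<xi> that])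
    show "?R \<xi> \<in> ell2 act_arrows"
      by (rule ell2_block_bound(1)[where blk = "block n", OF \<xi> K out block(1)[OF _ n] block(2)[OF _ n] block(3)[OF _ n] block(4)[OF _ n] l])
    show "ell2_norm act_arrows (?R \<xi>) \<le> K * ell2_norm act_arrows \<xi>"
      by (rule ell2_block_bound(2)[where blk = "block n", OF \<xi> K out block(1)[OF _ n] block(2)[OF _ n] block(3)[OF _ n] block(4)[OF _ n] l])
  qed
  then show "\<xi> \<in> ell2 act_arrows \<Longrightarrow> ell2_norm act_arrows (?R \<xi>) \<le> K * ell2_norm act_arrows \<xi>" by blast
  have at: "?R \<xi> g = (\<Sum>b<block_size n g. block_entry n f g (path_pos S (fst (fst g)) n) b * \<xi> (block_shift n g b))"
    if "\<xi> \<in> ell2 act_arrows" "g \<in> act_arrows" for \<xi> g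
    using regular_representation_sum[OF n f that block_shift_self(2)[OF that(2) n]]
    by (simp add: block_shift_self(1)[OF that(2) n])
  show "?R \<in> bounded_operators act_arrows"
  proof (rule bounded_operatorsI[where K = K])
    show "?R \<in> extensional (ell2 act_arrows)" by (simp add: regular_representation_def trans_groupoid_simps)
    fix \<xi> assume \<xi>: "\<xi> \<in> ell2 act_arrows"
    show "?R \<xi> \<in> ell2 act_arrows" "ell2_norm act_arrows (?R \<xi>) \<le> K * ell2_norm act_arrows \<xi>" by (rule b[OF \<xi>])+
    show "?R (\<lambda>g. \<xi> g + \<eta> g) = (\<lambda>g. ?R \<xi> g + ?R \<eta> g)" if \<eta>: "\<eta> \<in> ell2 act_arrows" for \<eta>
    proof
      fix g show "?R (\<lambda>g. \<xi> g + \<eta> g) g = ?R \<xi> g + ?R \<eta> g"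
      proof (cases "g \<in> act_arrows")
        case True
        show ?thesis by (simp add: at[OF \<xi> True] at[OF \<eta> True] at[OF ell2_add(1)[OF \<xi> \<eta>] True] distrib_left sum.distrib)
      next
        case False
        show ?thesis
          by (simp add: regular_representation_outside[OF _ False] \<xi> \<eta> ell2_add(1)[OF \<xi> \<eta>])
      qed
    qed
    show "?R (\<lambda>g. z * \<xi> g) = (\<lambda>g. z * ?R \<xi> g)" for z
    proof
      fix g show "?R (\<lambda>g. z * \<xi> g) g = z * ?R \<xi> g"
      proof (cases "g \<in> act_arrows")
        case True
        show ?thesis by (simp add: at[OF \<xi> True] at[OF ell2_cmult[OF \<xi>] True] sum_distrib_left mult.left_commute)
      next
        case False
        show ?thesis by (simp add: regular_representation_outside[OF _ False] \<xi> ell2_cmult[OF \<xi>])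
      qed
    qed
  qed
qed

end

section \<open>Kernels of stage elements\<close>

context ah_limit
begin

definition kern :: "nat \<Rightarrow> (nat \<Rightarrow> 'x \<Rightarrow> complex mat) \<Rightarrow>
    ((nat \<Rightarrow> 'e bedge) \<times> (nat \<Rightarrow> 'e bedge)) \<times> ('a \<Rightarrow> complex) \<Rightarrow> complex" where
  "kern n a = (\<lambda>((x, y), h). if ((x, y), h) \<in> level_arrows n
     then a (vertex y n) (char_point h n) $$ (path_pos S x n, path_pos S y n) else 0)"

lemma kern_apply: "((x, y), h) \<in> level_arrows n \<Longrightarrow>
    kern n a ((x, y), h) = a (vertex y n) (char_point h n) $$ (path_pos S x n, path_pos S y n)"
  by (simp add: kern_def)

lemma kern_outside: "g \<notin> level_arrows n \<Longrightarrow> kern n a g = 0"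
  by (cases g) (auto simp: kern_def)

text \<open>A single point that serves all rows and columns of the block of \<open>g\<close>,
  although the arrows entering the block matrix have different source characters.\<close>

definition range_point :: "nat \<Rightarrow> ((nat \<Rightarrow> 'e bedge) \<times> (nat \<Rightarrow> 'e bedge)) \<times> ('a \<Rightarrow> complex) \<Rightarrow> 'x" where
  "range_point n g = char_point (char_act (fst g) (snd g)) n"

lemma range_point_in:
  assumes g: "g \<in> act_arrows" and n: "n \<ge> 1"
  shows "vertex (fst (fst g)) n \<in> {1..nblocks S n}"
    "range_point n g \<in> topspace (base S n (vertex (fst (fst g)) n))"
proof -
  obtain x y h where gg: "g = ((x, y), h)" by (metis prod.collapse)
  have t: "(x, y) \<in> tail_arrows S" and h: "h \<in> chars" and hy: "char_path h = y" using g by (simp_all only: gg act_arrows_iff)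
  show "vertex (fst (fst g)) n \<in> {1..nblocks S n}" using vertex_in[OF tail_arrowsD(1)[OF t] n] by (simp add: gg)
  show "range_point n g \<in> topspace (base S n (vertex (fst (fst g)) n))"
    using char_eval(1)[OF act_chars[OF t h hy] n] by (simp add: range_point_def gg act_path[OF t h hy])
qed

text \<open>The source character in each entry arises from the range character of \<open>g\<close>
  by an arrow of level at most \<open>n\<close>. By \<open>act_point\<close> the continuous matrix
  entry takes the same value at both points.\<close>

lemma block_entry_kern:
  assumes n: "n \<ge> 1" and a: "a \<in> carrier (stage_algebra S n)" and g: "g \<in> act_arrows"
    and b: "b < block_size n g" and c: "c < block_size n g"
  shows "block_entry n (kern n a) g c b = a (vertex (fst (fst g)) n) (range_point n g) $$ (c, b)"
proof -
  obtain x y h where gg: "g = ((x, y), h)" by (metis prod.collapse)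
  have t: "(x, y) \<in> tail_arrows S" and h: "h \<in> chars" and hy: "char_path h = y" using g by (simp_all only: gg act_arrows_iff)
  let ?m = "msize S n (vertex x n)" and ?r = "replace_prefix n x" and ?V = "vertex x n"
  have b': "b < ?m" and c': "c < ?m" using b c by (simp_all add: gg)
  note x = tail_arrowsD(1)[OF t]
  note rb = replace_prefix[OF x n b'] and rc = replace_prefix[OF x n c']
  note tb = replace_prefix_tail[OF t n b'] and tc = replace_prefix_tail[OF t n c']
  let ?h = "char_act (?r b, y) h" and ?h' = "char_act (x, y) h"
  have mem: "((?r c, ?r b), ?h) \<in> level_arrows n"
    unfolding level_arrows_iff act_arrows_iff
    using tail_trans[OF tc(1) tb(2)] act_chars[OF tb(3) h hy] act_path[OF tb(3) h hy] rb(2) rc(2) by simp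
  have h': "?h' \<in> chars" "char_path ?h' = x" by (rule act_chars[OF t h hy], rule act_path[OF t h hy])
  have "?h = char_act (?r b, x) ?h'" by (rule act_comp[OF tb(1) t h hy, symmetric])
  moreover have "a ?V (char_point (char_act (?r b, x) ?h') n) $$ (c, b) = a ?V (char_point ?h' n) $$ (c, b)"
  proof (rule act_point[OF tb(1) h' _ , of n "\<lambda>z. a ?V z $$ (c, b)"])
    show "level (?r b, x) \<le> n" by (rule level_le[OF n]) (rule rb(2))
    show "continuous_map (base S n (vertex x n)) euclidean (\<lambda>z. a ?V z $$ (c, b))"
      by (rule stage_carrierD(2)[OF a vertex_in[OF x n] c' b'])
  qed
  ultimately show ?thesis
    using kern_apply[OF mem, of a] by (simp add: block_entry_def gg range_point_def rb(3,4) rc(3))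
qed

abbreviation rep :: "nat \<Rightarrow> (nat \<Rightarrow> 'x \<Rightarrow> complex mat) \<Rightarrow> _" where
  "rep n a \<equiv> regular_representation trans_groupoid (kern n a)"

lemma rep_apply:
  assumes n: "n \<ge> 1" and a: "a \<in> carrier (stage_algebra S n)"
    and \<xi>: "\<xi> \<in> ell2 act_arrows" and g: "g \<in> act_arrows" and c: "c < block_size n g"
  shows "rep n a \<xi> (block_shift n g c) =
    (\<Sum>b<block_size n g. a (vertex (fst (fst g)) n) (range_point n g) $$ (c, b) * \<xi> (block_shift n g b))"
proof -
  have "rep n a \<xi> (block_shift n g c) = (\<Sum>b<block_size n g. block_entry n (kern n a) g c b * \<xi> (block_shift n g b))"
    by (rule regular_representation_sum[OF n _ \<xi> g c]) (rule kern_outside)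
  also have "\<dots> = (\<Sum>b<block_size n g. a (vertex (fst (fst g)) n) (range_point n g) $$ (c, b) * \<xi> (block_shift n g b))"
    by (rule sum.cong[OF refl]) (simp add: block_entry_kern[OF n a g _ c])
  finally show ?thesis .
qed

lemma rep_apply_at:
  assumes n: "n \<ge> 1" and a: "a \<in> carrier (stage_algebra S n)"
    and \<xi>: "\<xi> \<in> ell2 act_arrows" and g: "g \<in> act_arrows"
  shows "rep n a \<xi> g =
    (\<Sum>b<block_size n g. a (vertex (fst (fst g)) n) (range_point n g) $$ (path_pos S (fst (fst g)) n, b) * \<xi> (block_shift n g b))"
  using rep_apply[OF n a \<xi> g block_shift_self(2)[OF g n]] by (simp add: block_shift_self(1)[OF g n])

lemma block_matrix_kern:
  assumes n: "n \<ge> 1" and a: "a \<in> carrier (stage_algebra S n)" and g: "g \<in> act_arrows"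
  shows "block_matrix n (kern n a) g = a (vertex (fst (fst g)) n) (range_point n g)"
  using stage_carrierD(1)[OF a range_point_in[OF g n]]
  by (intro eq_matI) (auto simp: block_matrix_def block_entry_kern[OF n a g])

lemma rep_bounded:
  assumes n: "n \<ge> 1" and a: "a \<in> carrier (stage_algebra S n)"
  shows "rep n a \<in> bounded_operators act_arrows" "op_norm act_arrows (rep n a) \<le> nrm (stage_algebra S n) a"
proof -
  note 0 = stage_norm_nonneg[OF n a]
  have le: "matrix_norm (block_matrix n (kern n a) g) \<le> nrm (stage_algebra S n) a" if g: "g \<in> act_arrows" for g
    unfolding block_matrix_kern[OF n a g] by (rule matrix_norm_le_stage_norm[OF n a range_point_in[OF g n]])
  show "rep n a \<in> bounded_operators act_arrows"
    by (rule regular_representation_bounded(1)[OF n kern_outside 0 le])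
  show "op_norm act_arrows (rep n a) \<le> nrm (stage_algebra S n) a"
    by (rule op_norm_leI[OF 0]) (rule regular_representation_bounded(2)[OF n kern_outside 0 le])
qed

text \<open>For the lower bound, a point \<open>z\<close> is represented by a character through
  \<open>character_through\<close>; on the block of the corresponding unit arrow the operator is the
  matrix at \<open>z\<close>, and vectors supported on that block realise its norm.\<close>

lemma rep_norm:
  assumes n: "n \<ge> 1" and a: "a \<in> carrier (stage_algebra S n)"
  shows "op_norm act_arrows (rep n a) = nrm (stage_algebra S n) a"
proof (rule antisym[OF rep_bounded(2)[OF n a]])
  note b = rep_bounded(1)[OF n a]
  show "nrm (stage_algebra S n) a \<le> op_norm act_arrows (rep n a)"
  proof (rule stage_norm_leI[OF op_norm_nonneg[OF b]])
    fix i z assume i: "i \<in> {1..nblocks S n}" and z: "z \<in> topspace (base S n i)"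
    obtain h where h: "h \<in> chars" "vertex (char_path h) n = i"
      and ev: "\<And>f :: 'x \<Rightarrow> complex. continuous_map (base S n i) euclidean f \<Longrightarrow> f (char_point h n) = f z"
      by (rule character_through[OF n i z]) blast
    define x where "x = char_path h"
    let ?g = "((x, x), h)"
    have g: "?g \<in> act_arrows" unfolding act_arrows_iff x_def using tail_refl[OF char_path(1)[OF h(1)]] h(1) by simp
    have vx: "vertex x n = i" by (simp add: x_def h(2))
    have rp: "range_point n ?g = char_point h n"
      by (simp add: range_point_def act_refl[OF h(1) x_def[symmetric]])
    have az: "a i z \<in> carrier_mat (msize S n i) (msize S n i)" by (rule stage_carrierD(1)[OF a i z])
    have eq: "a i (char_point h n) $$ (c, b) = a i z $$ (c, b)" if "c < msize S n i" "b < msize S n i" for c b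
      by (rule ev[OF stage_carrierD(2)[OF a i that]])
    let ?m = "msize S n i"
    show "matrix_norm (a i z) \<le> op_norm act_arrows (rep n a)"
    proof (rule matrix_norm_leI[OF az op_norm_nonneg[OF b]])
      fix v :: "nat \<Rightarrow> complex"
      \<comment> \<open>The given vector transported to the block of the unit arrow and extended by
        0.\<close>
      define \<xi> where "\<xi> = (\<lambda>k. if k \<in> block n ?g then v (path_pos S (fst (fst k)) n) else 0)"
      have \<xi>s: "\<xi> (block_shift n ?g c) = v c" if "c < ?m" for c
        using that block_shift(4)[OF g n, of c] by (auto simp: \<xi>_def block_def vx)
      have out: "k \<notin> block n ?g \<Longrightarrow> \<xi> k = 0" for k by (simp add: \<xi>_def)
      have \<xi>: "\<xi> \<in> ell2 act_arrows" "ell2_norm act_arrows \<xi> = L2_set (\<lambda>k. cmod (\<xi> k)) (block n ?g)"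
        by (rule ell2_finite_support[OF block(1)[OF g n] block(3)[OF g n] out], assumption)+
      have \<xi>n: "ell2_norm act_arrows \<xi> = L2_set (\<lambda>c. cmod (v c)) {..<?m}"
        unfolding \<xi>(2) unfolding L2_block[OF g n] by (rule L2_set_cong) (simp_all add: vx \<xi>s)
      have r: "rep n a \<xi> (block_shift n ?g c) = (\<Sum>b<?m. a i z $$ (c, b) * v b)" if c: "c < ?m" for c
        using rep_apply[OF n a \<xi>(1) g] c by (simp add: vx rp eq \<xi>s)
      have "L2_set (\<lambda>c. cmod (\<Sum>b<?m. a i z $$ (c, b) * v b)) {..<?m} = L2_set (\<lambda>k. cmod (rep n a \<xi> k)) (block n ?g)"
        unfolding L2_block[OF g n] by (rule L2_set_cong) (simp_all add: vx r)
      also have "(\<dots> :: real) \<le> ell2_norm act_arrows (rep n a \<xi>)"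
        by (rule L2_set_le_ell2_norm[OF bounded_operatorsD(2)[OF b \<xi>(1)] block(1)[OF g n] block(3)[OF g n]])
      also have "(\<dots> :: real) \<le> op_norm act_arrows (rep n a) * ell2_norm act_arrows \<xi>" by (rule op_norm_bound[OF b \<xi>(1)])
      finally show "L2_set (\<lambda>c. cmod (\<Sum>b<?m. a i z $$ (c, b) * v b)) {..<?m} \<le>
          op_norm act_arrows (rep n a) * L2_set (\<lambda>b. cmod (v b)) {..<?m}" unfolding \<xi>n .
    qed
  qed
qed

lemma rep_eqI:
  assumes "\<xi> \<in> ell2 act_arrows" "n \<ge> 1" "a \<in> carrier (stage_algebra S n)"
    and "\<And>g. g \<notin> act_arrows \<Longrightarrow> \<eta> g = 0" "\<And>g. g \<in> act_arrows \<Longrightarrow> rep n a \<xi> g = \<eta> g"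
  shows "rep n a \<xi> = \<eta>"
proof
  show "rep n a \<xi> g = \<eta> g" for g
    by (cases "g \<in> act_arrows") (simp_all add: assms regular_representation_outside)
qed

lemma rep_mult:
  assumes n: "n \<ge> 1" and a: "a \<in> carrier (stage_algebra S n)" and b: "b \<in> carrier (stage_algebra S n)"
    and \<xi>: "\<xi> \<in> ell2 act_arrows"
  shows "rep n (a \<otimes>\<^bsub>stage_algebra S n\<^esub> b) \<xi> = rep n a (rep n b \<xi>)"
proof (rule rep_eqI[OF \<xi> n stage_closed(1)[OF a b]])
  note \<eta> = bounded_operatorsD(2)[OF rep_bounded(1)[OF n b] \<xi>]
  show "rep n a (rep n b \<xi>) g = 0" if "g \<notin> act_arrows" for g by (rule regular_representation_outside[OF \<eta> that])
  fix g assume g: "g \<in> act_arrows"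
  let ?m = "block_size n g" and ?V = "vertex (fst (fst g)) n" and ?p = "path_pos S (fst (fst g)) n" and ?z = "range_point n g"
  note p = block_shift_self(2)[OF g n]
  have "rep n a (rep n b \<xi>) g = (\<Sum>d<?m. a ?V ?z $$ (?p, d) * (\<Sum>e<?m. b ?V ?z $$ (d, e) * \<xi> (block_shift n g e)))"
    unfolding rep_apply_at[OF n a \<eta> g] by (rule sum.cong[OF refl]) (simp add: rep_apply[OF n b \<xi> g])
  also have "\<dots> = (\<Sum>d<?m. \<Sum>e<?m. a ?V ?z $$ (?p, d) * b ?V ?z $$ (d, e) * \<xi> (block_shift n g e))"
    by (simp only: sum_distrib_left mult.assoc)
  also have "\<dots> = (\<Sum>e<?m. \<Sum>d<?m. a ?V ?z $$ (?p, d) * b ?V ?z $$ (d, e) * \<xi> (block_shift n g e))"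
    by (rule sum.swap)
  also have "\<dots> = (\<Sum>e<?m. (a \<otimes>\<^bsub>stage_algebra S n\<^esub> b) ?V ?z $$ (?p, e) * \<xi> (block_shift n g e))"
    by (rule sum.cong[OF refl]) (simp add: stage_ops_index(1)[OF a b range_point_in[OF g n] p] sum_distrib_right)
  also have "\<dots> = rep n (a \<otimes>\<^bsub>stage_algebra S n\<^esub> b) \<xi> g"
    by (rule rep_apply_at[OF n stage_closed(1)[OF a b] \<xi> g, symmetric])
  finally show "rep n (a \<otimes>\<^bsub>stage_algebra S n\<^esub> b) \<xi> g = rep n a (rep n b \<xi>) g" by (rule sym)
qed

lemma rep_add:
  assumes n: "n \<ge> 1" and a: "a \<in> carrier (stage_algebra S n)" and b: "b \<in> carrier (stage_algebra S n)"
    and \<xi>: "\<xi> \<in> ell2 act_arrows"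
  shows "rep n (a \<oplus>\<^bsub>stage_algebra S n\<^esub> b) \<xi> = (\<lambda>g. rep n a \<xi> g + rep n b \<xi> g)"
proof (rule rep_eqI[OF \<xi> n stage_closed(2)[OF a b]])
  show "rep n a \<xi> g + rep n b \<xi> g = 0" if "g \<notin> act_arrows" for g
    by (simp add: regular_representation_outside[OF \<xi> that])
  fix g assume g: "g \<in> act_arrows"
  show "rep n (a \<oplus>\<^bsub>stage_algebra S n\<^esub> b) \<xi> g = rep n a \<xi> g + rep n b \<xi> g"
    unfolding rep_apply_at[OF n a \<xi> g] rep_apply_at[OF n b \<xi> g] rep_apply_at[OF n stage_closed(2)[OF a b] \<xi> g] sum.distrib[symmetric]
    by (rule sum.cong[OF refl]) (simp add: stage_ops_index(2)[OF a b range_point_in[OF g n] block_shift_self(2)[OF g n]] distrib_right)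
qed

lemma rep_smult:
  assumes n: "n \<ge> 1" and a: "a \<in> carrier (stage_algebra S n)" and \<xi>: "\<xi> \<in> ell2 act_arrows"
  shows "rep n (z \<odot>\<^bsub>stage_algebra S n\<^esub> a) \<xi> = (\<lambda>g. z * rep n a \<xi> g)"
proof (rule rep_eqI[OF \<xi> n stage_closed(3)[OF a a]])
  show "z * rep n a \<xi> g = 0" if "g \<notin> act_arrows" for g
    by (simp add: regular_representation_outside[OF \<xi> that])
  fix g assume g: "g \<in> act_arrows"
  show "rep n (z \<odot>\<^bsub>stage_algebra S n\<^esub> a) \<xi> g = z * rep n a \<xi> g"
    unfolding rep_apply_at[OF n a \<xi> g] rep_apply_at[OF n stage_closed(3)[OF a a] \<xi> g] sum_distrib_left
    by (rule sum.cong[OF refl]) (simp add: stage_ops_index(3)[OF a a range_point_in[OF g n] block_shift_self(2)[OF g n]])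
qed

lemma rep_one:
  assumes n: "n \<ge> 1" and \<xi>: "\<xi> \<in> ell2 act_arrows"
  shows "rep n \<one>\<^bsub>stage_algebra S n\<^esub> \<xi> = \<xi>"
proof (rule rep_eqI[OF \<xi> n stage_one_closed])
  show "\<xi> g = 0" if "g \<notin> act_arrows" for g by (rule ell2_outside[OF \<xi> that])
  fix g assume g: "g \<in> act_arrows"
  note p = block_shift_self[OF g n]
  have "rep n \<one>\<^bsub>stage_algebra S n\<^esub> \<xi> g = (\<Sum>b<block_size n g. if path_pos S (fst (fst g)) n = b then \<xi> (block_shift n g b) else 0)"
    unfolding rep_apply_at[OF n stage_one_closed \<xi> g]
    by (rule sum.cong[OF refl]) (simp add: stage_ops_index(5)[OF stage_one_closed stage_one_closed range_point_in[OF g n] p(2)])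
  also have "\<dots> = \<xi> g" using p by simp
  finally show "rep n \<one>\<^bsub>stage_algebra S n\<^esub> \<xi> g = \<xi> g" .
qed

text \<open>By \<open>ell2_block_inner\<close> it suffices to compare on each block, where both
  sides are the same double sum for a matrix and its conjugate transpose.\<close>

lemma rep_adj:
  assumes n: "n \<ge> 1" and a: "a \<in> carrier (stage_algebra S n)" and \<xi>: "\<xi> \<in> ell2 act_arrows" and \<eta>: "\<eta> \<in> ell2 act_arrows"
  shows "ell2_inner act_arrows (rep n a \<xi>) \<eta> = ell2_inner act_arrows \<xi> (rep n (adj (stage_algebra S n) a) \<eta>)"
proof (rule ell2_block_inner[where blk = "block n"])
  note a' = stage_closed(4)[OF a a]
  show "rep n a \<xi> \<in> ell2 act_arrows" by (rule bounded_operatorsD(2)[OF rep_bounded(1)[OF n a] \<xi>])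
  show "rep n (adj (stage_algebra S n) a) \<eta> \<in> ell2 act_arrows" by (rule bounded_operatorsD(2)[OF rep_bounded(1)[OF n a'] \<eta>])
  fix g assume g: "g \<in> act_arrows"
  show "finite (block n g)" "g \<in> block n g" "block n g \<subseteq> act_arrows" by (rule block[OF g n])+
  show "block n k = block n g" if "k \<in> block n g" for k by (rule block(4)[OF g n that])
  let ?m = "block_size n g" and ?M = "a (vertex (fst (fst g)) n) (range_point n g)" and ?s = "block_shift n g"
  note z = range_point_in[OF g n]
  have "(\<Sum>k\<in>block n g. rep n a \<xi> k * cnj (\<eta> k)) = (\<Sum>c<?m. \<Sum>b<?m. ?M $$ (c, b) * \<xi> (?s b) * cnj (\<eta> (?s c)))"
    unfolding sum_block[OF g n] by (rule sum.cong[OF refl]) (simp add: rep_apply[OF n a \<xi> g] sum_distrib_right)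
  also have "\<dots> = (\<Sum>b<?m. \<Sum>c<?m. ?M $$ (c, b) * \<xi> (?s b) * cnj (\<eta> (?s c)))" by (rule sum.swap)
  also have "\<dots> = (\<Sum>k\<in>block n g. \<xi> k * cnj (rep n (adj (stage_algebra S n) a) \<eta> k))"
    unfolding sum_block[OF g n]
    by (rule sum.cong[OF refl]) (simp add: rep_apply[OF n a' \<eta> g] stage_ops_index(4)[OF a a z] sum_distrib_left ac_simps)
  finally show "(\<Sum>k\<in>block n g. rep n a \<xi> k * cnj (\<eta> k)) = (\<Sum>k\<in>block n g. \<xi> k * cnj (rep n (adj (stage_algebra S n) a) \<eta> k))" .
qed (rule \<xi> \<eta>)+

text \<open>The same element of the limit diagonal, the unit at the path position multiplied by
  \<open>f\<close>, is evaluated at stage \<open>n\<close> and, after the connecting map, at the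
  next stage.\<close>

lemma char_point_Suc:
  assumes h: "h \<in> chars" and n: "n \<ge> 1" and f: "continuous_map (base S n (vertex (char_path h) n)) euclidean (f :: 'x \<Rightarrow> complex)"
    and e: "char_path h n = Edge n i j e"
  shows "f (eigenfun S n i j e (char_point h (Suc n))) = f (char_point h n)"
proof -
  let ?x = "char_path h"
  note x = char_path(1)[OF h]
  obtain e' where e': "?x n = Edge n (vertex ?x n) (vertex ?x (Suc n)) e'"
    "e' \<in> edges S n (vertex ?x n) (vertex ?x (Suc n))"
    "vertex ?x n \<in> {1..nblocks S n}" "vertex ?x (Suc n) \<in> {1..nblocks S (Suc n)}"
    "path_pos S ?x (Suc n) = pos_offset S n (vertex ?x (Suc n)) (vertex ?x n, e') + path_pos S ?x n"
    by (rule path_Suc[OF x n])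
  have ij: "i = vertex ?x n" "j = vertex ?x (Suc n)" "e = e'" using e e'(1) by simp_all
  let ?p = "path_pos S ?x n"
  note p = path_pos_less[OF x n]
  let ?c = "matrix_unit S n (vertex ?x n) ?p ?p f"
  have c: "?c \<in> diagonal_part S n" by (rule matrix_unit_diagonal[OF f])
  note cc = diagonal_partD(1)[OF c]
  note q = char_eval(1)[OF h n]
  have Sn: "Suc n \<ge> 1" by simp
  note q' = char_eval(1)[OF h Sn]
  have "f (char_point h n) = h (\<iota> n ?c)"
    unfolding char_eval(2)[OF h n c] using matrix_unit_index[OF e'(3) q p p] by simp
  also have "\<dots> = h (\<iota> (Suc n) (connecting_map S n ?c))" by (simp only: iota_Suc[OF n cc])
  also have "\<dots> = ?c (vertex ?x n) (eigenfun S n (vertex ?x n) (vertex ?x (Suc n)) e' (char_point h (Suc n))) $$ (?p, ?p)"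
    unfolding char_eval(2)[OF h Sn connecting_map_diagonal[OF n c]] e'(5)
    using connecting_map_index[OF n cc e'(4) q' e'(3) e'(2) p e'(3) e'(2) p] by simp
  also have "\<dots> = f (eigenfun S n i j e (char_point h (Suc n)))"
    unfolding ij using matrix_unit_index[OF e'(3) eigenfun_closed[OF n e'(3,4,2) q'] p p] by simp
  finally show ?thesis by (rule sym)
qed

section \<open>Independence of the stage\<close>

text \<open>At an arrow of level \<open>Suc n\<close> the entry of the image vanishes unless both
  paths use the same edge at position \<open>n\<close>, which is exactly membership in level
  \<open>n\<close>. If they do, the entry is that of \<open>a\<close> composed with the
  eigenfunction of this edge, and \<open>char_point_Suc\<close> removes the eigenfunction.\<close>

lemma kern_connecting_map:
  assumes n: "n \<ge> 1" and a: "a \<in> carrier (stage_algebra S n)"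
  shows "kern (Suc n) (connecting_map S n a) = kern n a"
proof
  fix g :: "((nat \<Rightarrow> 'e bedge) \<times> (nat \<Rightarrow> 'e bedge)) \<times> ('a \<Rightarrow> complex)"
  obtain x y h where gg: "g = ((x, y), h)" by (metis prod.collapse)
  show "kern (Suc n) (connecting_map S n a) g = kern n a g"
  proof (cases "g \<in> level_arrows (Suc n)")
    case False
    then have "g \<notin> level_arrows n" unfolding gg level_arrows_iff by (auto dest: Suc_leD)
    with False show ?thesis by (simp add: kern_outside)
  next
    case True
    then have G: "g \<in> act_arrows" and tl: "\<And>k. k \<ge> Suc n \<Longrightarrow> x k = y k" by (simp_all add: gg level_arrows_iff)
    have t: "(x, y) \<in> tail_arrows S" and h: "h \<in> chars" and hy: "char_path h = y" using G by (simp_all only: gg act_arrows_iff)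
    note x = tail_arrowsD(1)[OF t] and y = tail_arrowsD(2)[OF t]
    have V: "vertex x (Suc n) = vertex y (Suc n)" by (rule vertex_tail[OF tl]) simp
    obtain e where e: "x n = Edge n (vertex x n) (vertex x (Suc n)) e" "e \<in> edges S n (vertex x n) (vertex x (Suc n))"
      "vertex x n \<in> {1..nblocks S n}" "vertex x (Suc n) \<in> {1..nblocks S (Suc n)}"
      "path_pos S x (Suc n) = pos_offset S n (vertex x (Suc n)) (vertex x n, e) + path_pos S x n"
      by (rule path_Suc[OF x n])
    obtain d where d: "y n = Edge n (vertex y n) (vertex y (Suc n)) d" "d \<in> edges S n (vertex y n) (vertex y (Suc n))"
      "vertex y n \<in> {1..nblocks S n}" "vertex y (Suc n) \<in> {1..nblocks S (Suc n)}"
      "path_pos S y (Suc n) = pos_offset S n (vertex y (Suc n)) (vertex y n, d) + path_pos S y n"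
      by (rule path_Suc[OF y n])
    have Sn: "Suc n \<ge> 1" by simp
    have q: "char_point h (Suc n) \<in> topspace (base S (Suc n) (vertex y (Suc n)))"
      using char_eval(1)[OF h Sn] by (simp only: hy)
    note px = path_pos_less[OF x n] and py = path_pos_less[OF y n]
    have L: "kern (Suc n) (connecting_map S n a) g =
        (if vertex x n = vertex y n \<and> e = d then a (vertex x n) (eigenfun S n (vertex x n) (vertex y (Suc n)) e (char_point h (Suc n)))
           $$ (path_pos S x n, path_pos S y n) else 0)"
      unfolding gg kern_apply[OF True[unfolded gg]] e(5) d(5)
      using connecting_map_index[OF n a d(4) q e(3) e(2)[unfolded V] px d(3) d(2) py] by (simp only: V)
    show ?thesis
    proof (cases "x n = y n")
      case False
      \<comment> \<open>Both edges end at the same vertex, so they can only differ in their source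
        or in their label.\<close>
      then have "\<not> (vertex x n = vertex y n \<and> e = d)" using e(1) d(1) V by auto
      moreover have "g \<notin> level_arrows n" using False unfolding gg level_arrows_iff by auto
      ultimately show ?thesis unfolding L by (simp only: if_False) (rule kern_outside[symmetric])
    next
      case eq: True
      have v: "vertex x n = vertex y n" "e = d" using eq e(1) d(1) by simp_all
      have "x k = y k" if "k \<ge> n" for k using that eq tl[of k] by (cases "k = n") auto
      then have gn: "((x, y), h) \<in> level_arrows n" using G by (simp add: gg level_arrows_iff)
      have px': "path_pos S x n < msize S n (vertex y n)" using px by (simp only: v)
      have "a (vertex y n) (eigenfun S n (vertex y n) (vertex y (Suc n)) d (char_point h (Suc n))) $$ (path_pos S x n, path_pos S y n)
          = a (vertex y n) (char_point h n) $$ (path_pos S x n, path_pos S y n)"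
        by (rule char_point_Suc[OF h n, of "\<lambda>z. a (vertex y n) z $$ (path_pos S x n, path_pos S y n)"])
          (use stage_carrierD(2)[OF a d(3) px' py] d(1) in \<open>simp_all add: hy\<close>)
      then show ?thesis unfolding L unfolding gg kern_apply[OF gn] by (simp add: v)
    qed
  qed
qed

lemma kern_lift:
  assumes "n \<ge> 1" "n \<le> m" "a \<in> carrier (stage_algebra S n)"
  shows "\<exists>b\<in>carrier (stage_algebra S m). \<iota> m b = \<iota> n a \<and> kern m b = kern n a"
  using assms(2)
proof (induction m rule: dec_induct)
  case base
  then show ?case using assms(3) by blast
next
  case (step m)
  then obtain b where b: "b \<in> carrier (stage_algebra S m)" "\<iota> m b = \<iota> n a" "kern m b = kern n a" by blast
  have m: "m \<ge> 1" using assms(1) step(1) by simp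
  show ?case
    using connecting_map_closed[OF m b(1)] iota_Suc[OF m b(1)] kern_connecting_map[OF m b(1)] b(2,3)
    by (intro bexI[of _ "connecting_map S m b"]) auto
qed

text \<open>The operator depends only on the kernel and has the norm of the stage element at every
  stage. Hence connecting maps preserve norms, and the sequence defining the norm in the limit is
  constant.\<close>

lemma iota_norm:
  assumes n: "n \<ge> 1" and a: "a \<in> carrier (stage_algebra S n)"
  shows "nrm A (\<iota> n a) = nrm (stage_algebra S n) a"
proof -
  have it: "iterated (connecting_map S) n m a \<in> carrier (stage_algebra S (n + m)) \<and>
      nrm (stage_algebra S (n + m)) (iterated (connecting_map S) n m a) = nrm (stage_algebra S n) a" for m
  proof (induction m)
    case 0
    then show ?case using a by simp
  next
    case (Suc m)
    have nm: "n + m \<ge> 1" using n by simp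
    note c = Suc.IH[THEN conjunct1]
    have "nrm (stage_algebra S (Suc (n + m))) (connecting_map S (n + m) (iterated (connecting_map S) n m a)) =
        nrm (stage_algebra S (n + m)) (iterated (connecting_map S) n m a)"
      using rep_norm[OF nm c] rep_norm[OF _ connecting_map_closed[OF nm c]] by (simp add: kern_connecting_map[OF nm c])
    then show ?case using connecting_map_closed[OF nm c] Suc.IH by simp
  qed
  have "(\<lambda>m. nrm (stage_algebra S (n + m)) (iterated (connecting_map S) n m a)) \<longlonglongrightarrow> nrm A (\<iota> n a)"
    using limit n a by (simp add: inductive_limit_def)
  then have "(\<lambda>m :: nat. nrm (stage_algebra S n) a) \<longlonglongrightarrow> nrm A (\<iota> n a)" by (simp only: it[THEN conjunct2])
  then show ?thesis by (rule LIMSEQ_unique[OF _ tendsto_const])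
qed

text \<open>Both elements are moved to a common stage, which changes neither their kernels nor their
  images in \<open>A\<close>; there the difference is a single stage element.\<close>

lemma rep_minus_norm:
  assumes n: "n \<ge> 1" "a \<in> carrier (stage_algebra S n)" and n': "n' \<ge> 1" "a' \<in> carrier (stage_algebra S n')"
  shows "op_norm act_arrows (rep n a \<ominus>\<^bsub>operator_algebra act_arrows\<^esub> rep n' a') = nrm A (\<iota> n a \<ominus>\<^bsub>A\<^esub> \<iota> n' a')"
proof -
  define m where "m = max n n'"
  have m: "m \<ge> 1" "n \<le> m" "n' \<le> m" using n by (auto simp: m_def)
  obtain b where b: "b \<in> carrier (stage_algebra S m)" "\<iota> m b = \<iota> n a" "kern m b = kern n a" using kern_lift[OF n(1) m(2) n(2)] by blast
  obtain b' where b': "b' \<in> carrier (stage_algebra S m)" "\<iota> m b' = \<iota> n' a'" "kern m b' = kern n' a'" using kern_lift[OF n'(1) m(3) n'(2)] by blast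
  let ?c = "b \<oplus>\<^bsub>stage_algebra S m\<^esub> ((-1) \<odot>\<^bsub>stage_algebra S m\<^esub> b')"
  note mb' = stage_closed(3)[OF b'(1) b'(1)]
  have c: "?c \<in> carrier (stage_algebra S m)" by (rule stage_closed(2)[OF b(1) mb'])
  note rb = rep_bounded(1)[OF m(1) b(1)] and rb' = rep_bounded(1)[OF m(1) b'(1)]
  have "rep m b \<ominus>\<^bsub>operator_algebra act_arrows\<^esub> rep m b' = rep m ?c"
  proof (rule operator_eqI[of _ act_arrows])
    show "rep m b \<ominus>\<^bsub>operator_algebra act_arrows\<^esub> rep m b' \<in> bounded_operators act_arrows"
      unfolding operator_minus[OF rb rb'] by (rule operator_diff_closed[OF rb rb'])
    show "rep m ?c \<in> bounded_operators act_arrows" by (rule rep_bounded(1)[OF m(1) c])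
    show "(rep m b \<ominus>\<^bsub>operator_algebra act_arrows\<^esub> rep m b') \<xi> g = rep m ?c \<xi> g" if \<xi>: "\<xi> \<in> ell2 act_arrows" for \<xi> g
      unfolding operator_minus[OF rb rb'] rep_add[OF m(1) b(1) mb' \<xi>] rep_smult[OF m(1) b'(1) \<xi>] using \<xi> by simp
  qed
  moreover have "\<iota> m ?c = \<iota> n a \<ominus>\<^bsub>A\<^esub> \<iota> n' a'"
    using iota_hom(3)[OF m(1) b(1) mb'] iota_hom(5)[OF m(1) b'(1), of "-1"] b(2) b'(2)
      A.smult_simps(5)[OF iota_hom(1)[OF n']] by (simp add: a_minus_def)
  ultimately show ?thesis
    using rep_norm[OF m(1) c] iota_norm[OF m(1) c] by (simp add: b(3) b'(3))
qed

end

section \<open>Kernels and compactly supported functions\<close>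

context ah_limit
begin

lemma openin_level_arrows: "openin act_domain (level_arrows n)"
proof (subst openin_subopen, intro ballI)
  fix g assume g: "g \<in> level_arrows n"
  obtain x y h where gg: "g = ((x, y), h)" by (metis prod.collapse)
  have G: "((x, y), h) \<in> act_arrows" and tl: "\<forall>k\<ge>n. x k = y k" using g by (simp_all add: gg level_arrows_iff)
  have t: "(x, y) \<in> tail_arrows S" and h: "h \<in> chars" using G by (simp_all add: act_arrows_iff)
  let ?V = "(cylinder S n (x, y) \<times> topspace spec) \<inter> topspace act_domain"
  have "openin act_domain ?V" by (rule openin_act_domain[OF openin_cylinder[OF t tl] openin_topspace])
  moreover have "g \<in> ?V"
    unfolding gg by (intro IntI SigmaI cylinder_self[OF t tl] G[unfolded act_arrows_def]) (simp add: topspace_spectrum h)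
  moreover have "?V \<subseteq> level_arrows n"
    by (auto simp: level_arrows_def act_arrows_def cylinder_def)
  ultimately show "\<exists>V. openin act_domain V \<and> g \<in> V \<and> V \<subseteq> level_arrows n" by blast
qed

text \<open>A disagreement at some \<open>k\<close> beyond \<open>n\<close> persists on any cylinder
  whose prefixes include position \<open>k\<close>.\<close>

lemma closedin_level_arrows: "closedin act_domain (level_arrows n)"
  unfolding closedin_def
proof
  show "level_arrows n \<subseteq> topspace act_domain" by (auto simp: level_arrows_def act_arrows_def)
  show "openin act_domain (topspace act_domain - level_arrows n)"
  proof (subst openin_subopen, intro ballI)
    fix g assume g: "g \<in> topspace act_domain - level_arrows n"
    obtain x y h where gg: "g = ((x, y), h)" by (metis prod.collapse)
    have G: "((x, y), h) \<in> act_arrows" and nl: "((x, y), h) \<notin> level_arrows n" using g by (simp_all only: gg act_arrows_def Diff_iff simp_thms)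
    have t: "(x, y) \<in> tail_arrows S" and h: "h \<in> chars" using G by (simp_all add: act_arrows_iff)
    obtain k where k: "k \<ge> n" "x k \<noteq> y k" using nl G by (auto simp: level_arrows_iff)
    obtain m where m: "m \<ge> Suc k" "\<forall>k\<ge>m. x k = y k" by (rule agree_beyond[OF t])
    let ?V = "(cylinder S m (x, y) \<times> topspace spec) \<inter> topspace act_domain"
    have "openin act_domain ?V" by (rule openin_act_domain[OF openin_cylinder[OF t m(2)] openin_topspace])
    moreover have "g \<in> ?V"
      unfolding gg by (intro IntI SigmaI cylinder_self[OF t m(2)] G[unfolded act_arrows_def]) (simp add: topspace_spectrum h)
    moreover have "k' \<notin> level_arrows n" if k': "k' \<in> ?V" for k'
    proof -
      obtain x' y' h' where kk: "k' = ((x', y'), h')" by (metis prod.collapse)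
      have "(x', y') \<in> cylinder S m (x, y)" using k' by (simp add: kk)
      then have "x' k = x k" "y' k = y k" using m(1) by (simp_all add: cylinder_iff)
      then show ?thesis using k by (auto simp: kk level_arrows_iff)
    qed
    ultimately show "\<exists>V. openin act_domain V \<and> g \<in> V \<and> V \<subseteq> topspace act_domain - level_arrows n" by blast
  qed
qed

section \<open>Sectors of the spectrum and compactness of levels\<close>

definition sector :: "nat \<Rightarrow> nat \<Rightarrow> nat \<Rightarrow> ('a \<Rightarrow> complex) set" where
  "sector n i b = {h \<in> chars. vertex (char_path h) n = i \<and> path_pos S (char_path h) n = b}"

text \<open>The diagonal unit of \<open>(i, b)\<close> takes only the values 0 and 1 on characters,
  so the sector is both the preimage of an open set and of a closed one.\<close>

lemma sector_clopen:
  assumes n: "n \<ge> 1"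
  shows "openin spec (sector n i b)" "closedin spec (sector n i b)"
proof -
  let ?d = "\<iota> n (diag_unit n i b)"
  have c: "continuous_map spec euclidean (\<lambda>h. h ?d)" by (rule continuous_evaluation[OF stage_Dlim[OF n diag_unit]])
  have 1: "sector n i b = {h \<in> topspace spec. h ?d \<in> - {0}}"
    by (auto simp: sector_def topspace_spectrum char_diag_unit_path[OF _ n] split: if_splits)
  have 2: "sector n i b = {h \<in> topspace spec. h ?d \<in> {1}}"
    by (auto simp: sector_def topspace_spectrum char_diag_unit_path[OF _ n] split: if_splits)
  show "openin spec (sector n i b)" unfolding 1 by (rule openin_continuous_map_preimage[OF c]) auto
  show "closedin spec (sector n i b)" unfolding 2 by (rule closedin_continuous_map_preimage[OF c]) auto
qed

text \<open>A local section of the source map over a sector: the arrow with source character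
  \<open>h\<close> whose range path has matrix index \<open>a\<close> at level
  \<open>n\<close>.\<close>

definition sector_arrow :: "nat \<Rightarrow> nat \<Rightarrow> ('a \<Rightarrow> complex) \<Rightarrow> ((nat \<Rightarrow> 'e bedge) \<times> (nat \<Rightarrow> 'e bedge)) \<times> ('a \<Rightarrow> complex)" where
  "sector_arrow n a h = ((replace_prefix n (char_path h) a, char_path h), h)"

lemma sector_arrow:
  assumes n: "n \<ge> 1" and a: "a < msize S n i" and h: "h \<in> sector n i b"
  shows "sector_arrow n a h \<in> level_arrows n"
proof -
  have hc: "h \<in> chars" "vertex (char_path h) n = i" using h by (simp_all add: sector_def)
  have a': "a < msize S n (vertex (char_path h) n)" using a hc(2) by simp
  note x = char_path(1)[OF hc(1)]
  show ?thesis
    unfolding sector_arrow_def level_arrows_iff act_arrows_iff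
    using replace_prefix_tail(1)[OF tail_refl[OF x] n a'] replace_prefix(2)[OF x n a'] hc(1) by simp
qed

lemma level_arrows_sector:
  assumes n: "n \<ge> 1" and g: "((x, y), h) \<in> level_arrows n"
  shows "h \<in> sector n (vertex y n) (path_pos S y n)" "((x, y), h) = sector_arrow n (path_pos S x n) h"
    "vertex y n \<in> {1..nblocks S n}" "path_pos S x n < msize S n (vertex y n)" "path_pos S y n < msize S n (vertex y n)"
proof -
  have t: "(x, y) \<in> tail_arrows S" and h: "h \<in> chars" "char_path h = y" and tl: "\<And>k. k \<ge> n \<Longrightarrow> x k = y k"
    using g by (simp_all add: level_arrows_iff act_arrows_iff)
  note y = tail_arrowsD(2)[OF t]
  note u = replace_prefix_unique[OF y tail_arrowsD(1)[OF t] n tl]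
  show "h \<in> sector n (vertex y n) (path_pos S y n)" using h by (simp add: sector_def)
  show "((x, y), h) = sector_arrow n (path_pos S x n) h" by (simp add: sector_arrow_def h(2) u(1))
  show "path_pos S x n < msize S n (vertex y n)" by (rule u(2))
  show "vertex y n \<in> {1..nblocks S n}" by (rule vertex_in[OF y n])
  show "path_pos S y n < msize S n (vertex y n)" by (rule path_pos_less[OF y n])
qed

lemma continuous_sector_arrow:
  assumes n: "n \<ge> 1" and a: "a < msize S n i"
  shows "continuous_map (subtopology spec (sector n i b)) act_domain (sector_arrow n a)"
proof -
  let ?X = "subtopology spec (sector n i b)"
  have top: "topspace ?X = sector n i b" by (auto simp: topspace_spectrum sector_def)
  have path: "continuous_map ?X (arrows (tail_groupoid S)) (\<lambda>h. (replace_prefix n (char_path h) a, char_path h))"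
  proof (rule continuous_into_tailI)
    fix h assume "h \<in> topspace ?X"
    then have h: "h \<in> sector n i b" by (simp only: top)
    then have hc: "h \<in> chars" "vertex (char_path h) n = i" by (simp_all add: sector_def)
    have la: "sector_arrow n a h \<in> level_arrows n" by (rule sector_arrow[OF n a h])
    then show "(replace_prefix n (char_path h) a, char_path h) \<in> tail_arrows S"
      by (simp add: sector_arrow_def level_arrows_iff act_arrows_iff)
    fix N
    \<comment> \<open>Taking \<open>m\<close> at least \<open>n\<close> puts the replaced prefix
      inside the compared part, so beyond \<open>m\<close> both paths of the arrow agree.\<close>
    define m where "m = max n N"
    have m: "m \<ge> N" "m \<ge> n" "m \<ge> 1" using n by (auto simp: m_def)
    let ?T = "sector m (vertex (char_path h) m) (path_pos S (char_path h) m) \<inter> sector n i b"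
    have T: "openin ?X ?T" by (rule openin_subtopology_Int[OF sector_clopen(1)[OF m(3)]])
    have hT: "h \<in> ?T" using h hc by (simp add: sector_def)
    have "(replace_prefix n (char_path k) a, char_path k) \<in> cylinder S m (replace_prefix n (char_path h) a, char_path h)"
      if k: "k \<in> ?T" for k
    proof -
      have kc: "k \<in> chars" "vertex (char_path k) n = i" "vertex (char_path k) m = vertex (char_path h) m"
        "path_pos S (char_path k) m = path_pos S (char_path h) m" using k by (simp_all add: sector_def)
      note x = char_path(1)[OF hc(1)] and y = char_path(1)[OF kc(1)]
      have ax: "a < msize S n (vertex (char_path h) n)" and ay: "a < msize S n (vertex (char_path k) n)"
        using a hc(2) kc(2) by simp_all
      note rx = replace_prefix[OF x n ax] and ry = replace_prefix[OF y n ay]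
      have e: "char_path k j = char_path h j" if "j < m" for j
        by (rule path_pos_inj[OF y x m(3) kc(3,4) that])
      have "replace_prefix n (char_path k) a j = replace_prefix n (char_path h) a j" if "j < m" for j
      proof (cases "j < n")
        case True
        show ?thesis
          by (rule path_pos_inj[OF ry(1) rx(1) n _ _ True]) (simp_all add: rx ry hc(2) kc(2))
      next
        case False
        then show ?thesis using e[OF that] by (simp add: rx(2) ry(2))
      qed
      moreover have "replace_prefix n (char_path k) a j = char_path k j" if "j \<ge> m" for j
        by (rule ry(2)) (use that m(2) in simp)
      ultimately show ?thesis using e ry(1) y by (simp add: cylinder_iff)
    qed
    then show "\<exists>m\<ge>N. \<exists>T. openin ?X T \<and> h \<in> T \<and> (\<forall>k\<in>T. (replace_prefix n (char_path k) a, char_path k) \<in>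
        cylinder S m (replace_prefix n (char_path h) a, char_path h))"
      using T hT m(1) by blast
  qed
  have "continuous_map ?X (prod_topology (arrows (tail_groupoid S)) spec) (sector_arrow n a)"
    unfolding sector_arrow_def by (intro continuous_map_pairedI path continuous_map_from_subtopology continuous_map_id[unfolded id_def])
  moreover have "sector_arrow n a h \<in> topspace act_domain" if "h \<in> topspace ?X" for h
    using sector_arrow[OF n a, of h b] that unfolding top by (simp add: level_arrows_def act_arrows_def)
  ultimately show ?thesis by (auto simp: continuous_map_in_subtopology image_subset_iff)
qed

definition level_index :: "nat \<Rightarrow> (nat \<times> nat \<times> nat) set" where
  "level_index n = (SIGMA i:{1..nblocks S n}. {..<msize S n i} \<times> {..<msize S n i})"

lemma finite_level_index: "finite (level_index n)"
  by (auto simp: level_index_def)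

text \<open>The level is a finite union, over block, row and column, of images of compact sectors
  under the continuous sections \<open>sector_arrow\<close>.\<close>

lemma compact_level_arrows:
  assumes n: "n \<ge> 1"
  shows "compactin act_domain (level_arrows n)"
proof -
  have "compactin act_domain (case t of (i, a, b) \<Rightarrow> sector_arrow n a ` sector n i b)" if "t \<in> level_index n" for t
  proof -
    obtain i a b where t: "t = (i, a, b)" by (metis prod.collapse)
    have a: "a < msize S n i" using that by (simp add: t level_index_def)
    have "compactin spec (sector n i b)"
      by (rule closedin_compact_space[OF compact_spec sector_clopen(2)[OF n]])
    then have "compactin (subtopology spec (sector n i b)) (sector n i b)" by (simp add: compactin_subtopology)
    from image_compactin[OF this continuous_sector_arrow[OF n a]] show ?thesis by (simp add: t)
  qed
  then have "compactin act_domain (\<Union>t\<in>level_index n. case t of (i, a, b) \<Rightarrow> sector_arrow n a ` sector n i b)"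
    by (intro compactin_Union finite_imageI finite_level_index) auto
  moreover have "(\<Union>t\<in>level_index n. case t of (i, a, b) \<Rightarrow> sector_arrow n a ` sector n i b) = level_arrows n"
  proof (intro Set.set_eqI iffI)
    fix g assume "g \<in> (\<Union>t\<in>level_index n. case t of (i, a, b) \<Rightarrow> sector_arrow n a ` sector n i b)"
    then show "g \<in> level_arrows n" by (auto simp: level_index_def intro: sector_arrow[OF n])
  next
    fix g assume g: "g \<in> level_arrows n"
    obtain x y h where gg: "g = ((x, y), h)" by (metis prod.collapse)
    note s = level_arrows_sector[OF n g[unfolded gg]]
    show "g \<in> (\<Union>t\<in>level_index n. case t of (i, a, b) \<Rightarrow> sector_arrow n a ` sector n i b)"
      by (rule UN_I[where a = "(vertex y n, path_pos S x n, path_pos S y n)"])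
        (use s in \<open>auto simp: level_index_def gg\<close>)
  qed
  ultimately show ?thesis by simp
qed

text \<open>Off the level the kernel vanishes on an open set. Near an arrow of the level it is
  evaluation of the source character at one fixed diagonal element: the relevant off-diagonal entry
  of \<open>a\<close>, moved to the diagonal position of the source path.\<close>

lemma continuous_kern:
  assumes n: "n \<ge> 1" and a: "a \<in> carrier (stage_algebra S n)"
  shows "continuous_map act_domain euclidean (kern n a)"
proof (rule continuous_map_locallyI)
  fix g assume g: "g \<in> topspace act_domain"
  obtain x y h where gg: "g = ((x, y), h)" by (metis prod.collapse)
  show "\<exists>T \<phi>. openin act_domain T \<and> g \<in> T \<and> continuous_map act_domain euclidean \<phi> \<and> (\<forall>k\<in>T. kern n a k = \<phi> k)"
  proof (cases "g \<in> level_arrows n")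
    case False
    have "openin act_domain (topspace act_domain - level_arrows n)" using closedin_level_arrows by (simp add: closedin_def)
    then show ?thesis using False g by (intro exI[of _ "topspace act_domain - level_arrows n"] exI[of _ "\<lambda>_. 0"]) (simp add: kern_outside)
  next
    case True
    have G: "((x, y), h) \<in> act_arrows" and tl: "\<forall>k\<ge>n. x k = y k" using True by (simp_all add: gg level_arrows_iff)
    have t: "(x, y) \<in> tail_arrows S" and h: "h \<in> chars" using G by (simp_all add: act_arrows_iff)
    note s = level_arrows_sector[OF n True[unfolded gg]]
    let ?V = "vertex y n" and ?p = "path_pos S x n" and ?q = "path_pos S y n"
    define c where "c = matrix_unit S n ?V ?q ?q (\<lambda>z. a ?V z $$ (?p, ?q))"
    have c: "c \<in> diagonal_part S n"
      unfolding c_def by (rule matrix_unit_diagonal) (rule stage_carrierD(2)[OF a s(3,4,5)])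
    let ?T = "(cylinder S n (x, y) \<times> topspace spec) \<inter> topspace act_domain"
    have "openin act_domain ?T" by (rule openin_act_domain[OF openin_cylinder[OF t tl] openin_topspace])
    moreover have "g \<in> ?T"
      unfolding gg by (intro IntI SigmaI cylinder_self[OF t tl] G[unfolded act_arrows_def]) (simp add: topspace_spectrum h)
    moreover have "continuous_map act_domain euclidean (\<lambda>k. snd k (\<iota> n c))"
      using continuous_map_compose[OF continuous_map_from_subtopology[OF continuous_map_snd] continuous_evaluation[OF stage_Dlim[OF n c]]]
      by (simp add: o_def)
    moreover have "kern n a k = snd k (\<iota> n c)" if k: "k \<in> ?T" for k
    proof -
      obtain x' y' h' where kk: "k = ((x', y'), h')" by (metis prod.collapse)
      have cy: "(x', y') \<in> cylinder S n (x, y)" and kG: "((x', y'), h') \<in> act_arrows"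
        using k by (simp_all add: kk act_arrows_def)
      have h': "h' \<in> chars" "char_path h' = y'" using kG by (simp_all add: act_arrows_iff)
      have kl: "((x', y'), h') \<in> level_arrows n" using kG cy by (simp add: level_arrows_iff cylinder_iff)
      have p: "path_pos S x' n = ?p" "path_pos S y' n = ?q" using cy by (auto simp: cylinder_iff intro: path_pos_cong)
      obtain n' where n': "n = Suc n'" using n by (cases n) auto
      have V: "vertex y' n = ?V" unfolding n'
        by (rule vertex_prefix) (use cy tail_arrowsD(2)[OF t] in \<open>simp_all add: cylinder_iff n'\<close>)
      note ev = char_eval[OF h'(1) n]
      have pt: "char_point h' n \<in> topspace (base S n ?V)" using ev(1) by (simp add: h'(2) V)
      have "snd k (\<iota> n c) = c ?V (char_point h' n) $$ (?q, ?q)" using ev(2)[OF c] by (simp add: kk h'(2) V p)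
      also have "\<dots> = a ?V (char_point h' n) $$ (?p, ?q)"
        unfolding c_def using matrix_unit_index[OF s(3) pt s(5,5)] by simp
      also have "\<dots> = kern n a k" unfolding kk kern_apply[OF kl] by (simp add: V p)
      finally show ?thesis by (rule sym)
    qed
    ultimately show ?thesis by blast
  qed
qed

text \<open>The support stays inside the level, which is closed and compact.\<close>

lemma kern_compactly_supported:
  assumes n: "n \<ge> 1" and a: "a \<in> carrier (stage_algebra S n)"
  shows "kern n a \<in> compactly_supported trans_groupoid"
  unfolding compactly_supported_def trans_groupoid_arrows mem_Collect_eq
proof (intro conjI allI impI)
  show "continuous_map act_domain euclidean (kern n a)" by (rule continuous_kern[OF n a])
  show "kern n a g = 0" if "g \<notin> topspace act_domain" for g
    by (rule kern_outside) (use that closedin_subset[OF closedin_level_arrows] in blast)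
  have "act_domain closure_of {g \<in> topspace act_domain. kern n a g \<noteq> 0} \<subseteq> level_arrows n"
    by (rule closure_of_minimal[OF _ closedin_level_arrows]) (use kern_outside in blast)
  then show "compactin act_domain (act_domain closure_of {g \<in> topspace act_domain. kern n a g \<noteq> 0})"
    by (rule closed_compactin[OF compact_level_arrows[OF n] _ closedin_closure_of])
qed

text \<open>The levels form an increasing open cover of all arrows, so the compact support already
  lies in one of them.\<close>

lemma compactly_supported_level:
  assumes f: "f \<in> compactly_supported trans_groupoid"
  obtains N where "N \<ge> 1" "\<And>g. g \<notin> level_arrows N \<Longrightarrow> f g = 0"
proof -
  have out: "\<And>g. g \<notin> topspace act_domain \<Longrightarrow> f g = 0"
    and comp: "compactin act_domain (act_domain closure_of {g \<in> topspace act_domain. f g \<noteq> 0})"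
    using f by (simp_all only: compactly_supported_def trans_groupoid_arrows mem_Collect_eq) blast+
  let ?K = "act_domain closure_of {g \<in> topspace act_domain. f g \<noteq> 0}"
  have cover: "?K \<subseteq> \<Union>(range level_arrows)"
  proof
    fix g assume gK: "g \<in> ?K"
    have g: "g \<in> act_arrows" unfolding act_arrows_def by (rule subsetD[OF closure_of_subset_topspace gK])
    obtain x y h where gg: "g = ((x, y), h)" by (metis prod.collapse)
    have t: "(x, y) \<in> tail_arrows S" using g by (simp add: gg act_arrows_iff)
    obtain m where "m \<ge> 0" "\<forall>k\<ge>m. x k = y k" by (rule agree_beyond[OF t])
    then have "g \<in> level_arrows m" using g by (simp add: gg level_arrows_iff)
    then show "g \<in> \<Union>(range level_arrows)" by blast
  qed
  obtain F where F: "finite F" "F \<subseteq> range level_arrows" "?K \<subseteq> \<Union>F"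
    using compactinD[OF comp _ cover] openin_level_arrows by blast
  obtain I where I: "finite I" "F = level_arrows ` I" using finite_subset_image[OF F(1,2)] by blast
  \<comment> \<open>The inserted 0 gives \<open>Max\<close> a nonempty set, and the successor makes
    \<open>N\<close> a valid stage.\<close>
  define N where "N = Suc (Max (insert 0 I))"
  have mono: "level_arrows i \<subseteq> level_arrows N" if "i \<in> I" for i
  proof -
    have "i \<le> N" using that I(1) by (simp add: N_def le_SucI)
    then show ?thesis by (auto simp: level_arrows_def)
  qed
  show thesis
  proof (rule that[of N])
    show "N \<ge> 1" by (simp add: N_def)
    fix g assume g: "g \<notin> level_arrows N"
    show "f g = 0"
    proof (rule ccontr)
      assume nz: "f g \<noteq> 0"
      then have "g \<in> {g \<in> topspace act_domain. f g \<noteq> 0}" using out by blast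
      moreover have "{g \<in> topspace act_domain. f g \<noteq> 0} \<subseteq> ?K" by (rule closure_of_subset) blast
      ultimately have "g \<in> \<Union>F" using F(3) by blast
      then show False using mono g I(2) by blast
    qed
  qed
qed

text \<open>Right multiplication by a diagonal element scales columns, and the column of an arrow is
  the position of its source path. On kernels this is multiplication by the value of the source
  character.\<close>

lemma kern_times:
  assumes n: "n \<ge> 1" and a: "a \<in> carrier (stage_algebra S n)" and d: "d \<in> Dpre"
  shows "\<exists>m\<ge>1. \<exists>w\<in>carrier (stage_algebra S m). kern m w = (\<lambda>g. kern n a g * snd g d)"
proof -
  obtain m c where m: "m \<ge> n" "m \<ge> 1" and c: "c \<in> diagonal_part S m" and dc: "d = \<iota> m c" by (rule DpreE[OF d])
  obtain b where b: "b \<in> carrier (stage_algebra S m)" "kern m b = kern n a" using kern_lift[OF n m(1) a] by blast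
  note cc = diagonal_partD(1)[OF c]
  let ?w = "b \<otimes>\<^bsub>stage_algebra S m\<^esub> c"
  have "kern m ?w g = kern n a g * snd g d" for g
  proof (cases "g \<in> level_arrows m")
    case False
    then show ?thesis by (simp add: kern_outside b(2)[symmetric])
  next
    case True
    obtain x y h where gg: "g = ((x, y), h)" by (metis prod.collapse)
    note l = True[unfolded gg]
    note s = level_arrows_sector[OF m(2) l]
    have h: "h \<in> chars" "char_path h = y" using l by (simp_all add: level_arrows_iff act_arrows_iff)
    let ?V = "vertex y m" and ?z = "char_point h m" and ?p = "path_pos S x m" and ?q = "path_pos S y m"
    have z: "?z \<in> topspace (base S m ?V)" using char_eval(1)[OF h(1) m(2)] by (simp add: h(2))
    have "kern m ?w g = (\<Sum>k<msize S m ?V. b ?V ?z $$ (?p, k) * c ?V ?z $$ (k, ?q))"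
      unfolding gg kern_apply[OF l] by (rule stage_ops_index(1)[OF b(1) cc s(3) z s(4,5)])
    also have "\<dots> = (\<Sum>k<msize S m ?V. if k = ?q then b ?V ?z $$ (?p, ?q) * c ?V ?z $$ (?q, ?q) else 0)"
      by (rule sum.cong[OF refl]) (auto simp: diagonal_partD(2)[OF c s(3) z _ s(5)])
    also have "\<dots> = b ?V ?z $$ (?p, ?q) * c ?V ?z $$ (?q, ?q)" using s(5) by simp
    also have "c ?V ?z $$ (?q, ?q) = h d" unfolding dc using char_eval(2)[OF h(1) m(2) c] by (simp add: h(2))
    finally show ?thesis unfolding b(2)[symmetric] unfolding gg kern_apply[OF l] by simp
  qed
  then show ?thesis using m(2) stage_closed(1)[OF b(1) cc] by blast
qed

lemma kern_plus:
  assumes n: "n \<ge> 1" "a \<in> carrier (stage_algebra S n)" and n': "n' \<ge> 1" "a' \<in> carrier (stage_algebra S n')"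
  shows "\<exists>m\<ge>1. \<exists>w\<in>carrier (stage_algebra S m). kern m w = (\<lambda>g. kern n a g + kern n' a' g)"
proof -
  define m where "m = max n n'"
  have m: "m \<ge> 1" "n \<le> m" "n' \<le> m" using n by (auto simp: m_def)
  obtain b where b: "b \<in> carrier (stage_algebra S m)" "kern m b = kern n a" using kern_lift[OF n(1) m(2) n(2)] by blast
  obtain b' where b': "b' \<in> carrier (stage_algebra S m)" "kern m b' = kern n' a'" using kern_lift[OF n'(1) m(3) n'(2)] by blast
  let ?w = "b \<oplus>\<^bsub>stage_algebra S m\<^esub> b'"
  have "kern m ?w g = kern m b g + kern m b' g" for g
  proof (cases "g \<in> level_arrows m")
    case False
    then show ?thesis by (simp add: kern_outside)
  next
    case True
    obtain x y h where gg: "g = ((x, y), h)" by (metis prod.collapse)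
    note l = True[unfolded gg]
    note s = level_arrows_sector[OF m(1) l]
    have h: "h \<in> chars" "char_path h = y" using l by (simp_all add: level_arrows_iff act_arrows_iff)
    have z: "char_point h m \<in> topspace (base S m (vertex y m))" using char_eval(1)[OF h(1) m(1)] by (simp add: h(2))
    show ?thesis
      unfolding gg kern_apply[OF l] by (rule stage_ops_index(2)[OF b(1) b'(1) s(3) z s(4,5)])
  qed
  then show ?thesis using m(1) stage_closed(2)[OF b(1) b'(1)] unfolding b(2) b'(2) by blast
qed

lemma kern_sum:
  assumes "finite X" "\<And>t. t \<in> X \<Longrightarrow> \<exists>m\<ge>1. \<exists>w\<in>carrier (stage_algebra S m). kern m w = \<phi> t"
  shows "\<exists>m\<ge>1. \<exists>w\<in>carrier (stage_algebra S m). kern m w = (\<lambda>g. \<Sum>t\<in>X. \<phi> t g)"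
  using assms
proof (induction X)
  case empty
  let ?w = "0 \<odot>\<^bsub>stage_algebra S 1\<^esub> \<one>\<^bsub>stage_algebra S 1\<^esub>"
  have c: "?w \<in> carrier (stage_algebra S 1)" by (rule stage_closed(3)[OF stage_one_closed stage_one_closed])
  have n: "(1 :: nat) \<ge> 1" by simp
  have "kern 1 ?w g = 0" for g
  proof (cases "g \<in> level_arrows 1")
    case False
    then show ?thesis by (rule kern_outside)
  next
    case True
    obtain x y h where gg: "g = ((x, y), h)" by (metis prod.collapse)
    note l = True[unfolded gg]
    note s = level_arrows_sector[OF n l]
    have h: "h \<in> chars" "char_path h = y" using l by (simp_all add: level_arrows_iff act_arrows_iff)
    have z: "char_point h 1 \<in> topspace (base S 1 (vertex y 1))" using char_eval(1)[OF h(1) n] by (simp add: h(2))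
    show ?thesis
      unfolding gg kern_apply[OF l] stage_ops_index(3)[OF stage_one_closed stage_one_closed s(3) z s(4,5)] by simp
  qed
  then have "kern 1 ?w = (\<lambda>g. \<Sum>t\<in>{}. \<phi> t g)" by auto
  then show ?case using c n by blast
next
  case (insert t X)
  obtain m w where m: "m \<ge> 1" "w \<in> carrier (stage_algebra S m)" "kern m w = \<phi> t" using insert.prems by blast
  have "\<exists>m\<ge>1. \<exists>w\<in>carrier (stage_algebra S m). kern m w = (\<lambda>g. \<Sum>t\<in>X. \<phi> t g)"
    by (rule insert.IH) (rule insert.prems, simp)
  then obtain m' w' where m': "m' \<ge> 1" "w' \<in> carrier (stage_algebra S m')" "kern m' w' = (\<lambda>g. \<Sum>t\<in>X. \<phi> t g)" by blast
  show ?case using kern_plus[OF m(1,2) m'(1,2)] by (simp add: m(3) m'(3) insert.hyps)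
qed

end

section \<open>Density of the kernels\<close>

context ah_limit
begin

text \<open>Both functions vanish off one common level, so all convolution sums are finite and split
  termwise.\<close>

lemma regular_representation_add:
  assumes n: "n \<ge> 1" and f: "\<And>g. g \<notin> level_arrows n \<Longrightarrow> f g = 0" and f': "\<And>g. g \<notin> level_arrows n \<Longrightarrow> f' g = 0"
    and \<xi>: "\<xi> \<in> ell2 act_arrows"
  shows "regular_representation trans_groupoid (\<lambda>g. f g + f' g) \<xi> =
    (\<lambda>g. regular_representation trans_groupoid f \<xi> g + regular_representation trans_groupoid f' \<xi> g)"
proof
  fix g
  have ff: "f g + f' g = 0" if "g \<notin> level_arrows n" for g using f[OF that] f'[OF that] by simp
  show "regular_representation trans_groupoid (\<lambda>g. f g + f' g) \<xi> g =
    regular_representation trans_groupoid f \<xi> g + regular_representation trans_groupoid f' \<xi> g"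
  proof (cases "g \<in> act_arrows")
    case False
    show ?thesis by (simp add: regular_representation_outside[OF \<xi> False])
  next
    case True
    note p = block_shift_self[OF True n]
    let ?R = "\<lambda>F. (\<Sum>b<block_size n g. block_entry n F g (path_pos S (fst (fst g)) n) b * \<xi> (block_shift n g b))"
    have 1: "regular_representation trans_groupoid f \<xi> g = ?R f"
      using regular_representation_sum[where f = f, OF n _ \<xi> True p(2)] f by (simp only: p(1)) simp
    have 2: "regular_representation trans_groupoid f' \<xi> g = ?R f'"
      using regular_representation_sum[where f = f', OF n _ \<xi> True p(2)] f' by (simp only: p(1)) simp
    have 3: "regular_representation trans_groupoid (\<lambda>g. f g + f' g) \<xi> g = ?R (\<lambda>g. f g + f' g)"
      using regular_representation_sum[where f = "\<lambda>g. f g + f' g", OF n _ \<xi> True p(2)] ff by (simp only: p(1)) simp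
    have "?R (\<lambda>g. f g + f' g) = ?R f + ?R f'"
      by (simp add: block_entry_def distrib_right sum.distrib)
    then show ?thesis unfolding 1 2 3 .
  qed
qed

text \<open>A block matrix of size \<open>m\<close> has \<open>m * m\<close> entries of modulus at
  most \<open>e\<close>. The sum of the squared block sizes dominates this number for every block at
  stage \<open>n\<close>, giving a constant independent of the arrow.\<close>

lemma regular_representation_small:
  assumes n: "n \<ge> 1" and f: "\<And>g. g \<notin> level_arrows n \<Longrightarrow> f g = 0" and e: "\<And>g. cmod (f g) \<le> e"
  shows "regular_representation trans_groupoid f \<in> bounded_operators act_arrows"
    "\<xi> \<in> ell2 act_arrows \<Longrightarrow> ell2_norm act_arrows (regular_representation trans_groupoid f \<xi>) \<le>
       ((\<Sum>i\<in>{1..nblocks S n}. (real (msize S n i))\<^sup>2) * e) * ell2_norm act_arrows \<xi>"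
proof -
  let ?M = "\<Sum>i\<in>{1..nblocks S n}. (real (msize S n i))\<^sup>2"
  have e0: "0 \<le> e" using order_trans[OF norm_ge_zero e] .
  have K: "0 \<le> ?M * e" using e0 by (intro mult_nonneg_nonneg sum_nonneg) auto
  have le: "matrix_norm (block_matrix n f g) \<le> ?M * e" if g: "g \<in> act_arrows" for g
  proof -
    let ?m = "block_size n g"
    have "matrix_norm (block_matrix n f g) \<le> (\<Sum>a<?m. \<Sum>b<?m. cmod (block_matrix n f g $$ (a, b)))"
      by (rule matrix_norm_crude_le) (simp add: block_matrix_def)
    also have "(\<dots> :: real) \<le> (\<Sum>a<?m. \<Sum>b<?m. e)"
      by (intro sum_mono) (simp add: block_matrix_def block_entry_def e)
    also have "(\<dots> :: real) = (real ?m)\<^sup>2 * e" by (simp add: power2_eq_square)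
    also have "(\<dots> :: real) \<le> ?M * e"
      by (rule mult_right_mono[OF member_le_sum[OF range_point_in(1)[OF g n]] e0]) auto
    finally show ?thesis .
  qed
  show "regular_representation trans_groupoid f \<in> bounded_operators act_arrows"
    by (rule regular_representation_bounded(1)[OF n f K le])
  show "\<xi> \<in> ell2 act_arrows \<Longrightarrow> ell2_norm act_arrows (regular_representation trans_groupoid f \<xi>) \<le> ?M * e * ell2_norm act_arrows \<xi>"
    by (rule regular_representation_bounded(2)[OF n f K le])
qed

text \<open>Pulled back along the section and extended by 0 off the clopen sector, \<open>f\<close>
  becomes a continuous function on the spectrum, to which Stone-Weierstrass applies.\<close>

lemma sector_function_approx:
  assumes n: "n \<ge> 1" and a: "a < msize S n i" and f: "continuous_map act_domain euclidean (f :: _ \<Rightarrow> complex)" and e: "0 < e"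
  shows "\<exists>d\<in>Dpre. \<forall>h\<in>sector n i b. cmod (f (sector_arrow n a h) - h d) < e"
proof -
  let ?U = "sector n i b"
  define F where "F = (\<lambda>h. if h \<in> ?U then f (sector_arrow n a h) else 0)"
  have "continuous_map spec euclidean F"
  proof (rule pasting_lemma[where I = UNIV and T = "\<lambda>k :: bool. if k then ?U else topspace spec - ?U"
        and f = "\<lambda>k h. if k then f (sector_arrow n a h) else 0"])
    show "openin spec (if k then ?U else topspace spec - ?U)" for k
      using sector_clopen[OF n, of i b] by (simp add: closedin_def)
    show "continuous_map (subtopology spec (if k then ?U else topspace spec - ?U)) euclidean (\<lambda>h. if k then f (sector_arrow n a h) else 0)" for k
      using continuous_map_compose[OF continuous_sector_arrow[OF n a, of b] f] by (cases k) (simp_all add: o_def)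
    show "\<exists>k. k \<in> UNIV \<and> x \<in> (if k then ?U else topspace spec - ?U) \<and> F x = (if k then f (sector_arrow n a x) else 0)"
      if "x \<in> topspace spec" for x
      using that by (intro exI[of _ "x \<in> ?U"]) (simp add: F_def)
    show "(if k then f (sector_arrow n a x) else 0) = (if k' then f (sector_arrow n a x) else 0)"
      if "k \<in> UNIV" "k' \<in> UNIV" "x \<in> topspace spec \<inter> (if k then ?U else topspace spec - ?U) \<inter> (if k' then ?U else topspace spec - ?U)" for k k' x
      using that by (auto split: if_splits)
  qed
  from stone_weierstrass_spec[OF this e] obtain d where d: "d \<in> Dpre" "\<forall>h\<in>chars. cmod (F h - h d) < e" by blast
  have "cmod (f (sector_arrow n a h) - h d) < e" if "h \<in> ?U" for h
    using bspec[OF d(2), of h] that by (simp add: F_def sector_def)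
  with d(1) show ?thesis by blast
qed

text \<open>On each piece of the level, given by block, row and column, \<open>f\<close> is a
  function of the source character. The approximant is the sum over the pieces of the kernel of a
  matrix unit times an approximating element of \<open>Dpre\<close>; at every arrow of the level
  exactly one matrix unit kernel is nonzero. Confinement to level \<open>N\<close> is kept, since
  the later norm bound uses the block sizes of that level.\<close>

lemma kern_approx:
  assumes f: "continuous_map act_domain euclidean f" and N: "N \<ge> 1" "\<And>g. g \<notin> level_arrows N \<Longrightarrow> f g = 0" and e: "0 < e"
  shows "\<exists>m\<ge>1. \<exists>w\<in>carrier (stage_algebra S m). (\<forall>g. g \<notin> level_arrows N \<longrightarrow> kern m w g = 0) \<and>
    (\<forall>g. cmod (f g - kern m w g) \<le> e)"
proof -
  have "\<forall>t\<in>level_index N. \<exists>d\<in>Dpre. \<forall>i a b. t = (i, a, b) \<longrightarrow> (\<forall>h\<in>sector N i b. cmod (f (sector_arrow N a h) - h d) < e)"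
  proof
    fix t assume t: "t \<in> level_index N"
    obtain i a b where tt: "t = (i, a, b)" by (metis prod.collapse)
    have "a < msize S N i" using t by (simp add: tt level_index_def)
    from sector_function_approx[OF N(1) this f e, of b]
    show "\<exists>d\<in>Dpre. \<forall>i a b. t = (i, a, b) \<longrightarrow> (\<forall>h\<in>sector N i b. cmod (f (sector_arrow N a h) - h d) < e)" by (simp add: tt)
  qed
  then obtain d where d: "\<And>t. t \<in> level_index N \<Longrightarrow> d t \<in> Dpre"
    and near: "\<And>i a b h. (i, a, b) \<in> level_index N \<Longrightarrow> h \<in> sector N i b \<Longrightarrow> cmod (f (sector_arrow N a h) - h (d (i, a, b))) < e"
    by metis
  define E where "E = (\<lambda>(i, a, b). matrix_unit S N i a b (\<lambda>_. 1))"
  have E: "E t \<in> carrier (stage_algebra S N)" for t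
    unfolding E_def by (cases t) (simp add: matrix_unit_closed)
  have "\<exists>m\<ge>1. \<exists>w\<in>carrier (stage_algebra S m). kern m w = (\<lambda>g. \<Sum>t\<in>level_index N. kern N (E t) g * snd g (d t))"
    by (rule kern_sum[OF finite_level_index]) (rule kern_times[OF N(1) E d])
  then obtain m w where mw: "m \<ge> 1" "w \<in> carrier (stage_algebra S m)"
    "kern m w = (\<lambda>g. \<Sum>t\<in>level_index N. kern N (E t) g * snd g (d t))" by blast
  have out: "kern m w g = 0" if "g \<notin> level_arrows N" for g
    unfolding mw(3) by (simp add: kern_outside[OF that])
  have "cmod (f g - kern m w g) \<le> e" for g
  proof (cases "g \<in> level_arrows N")
    case False
    then show ?thesis using e by (simp add: out N(2))
  next
    case True
    obtain x y h where gg: "g = ((x, y), h)" by (metis prod.collapse)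
    note l = True[unfolded gg]
    note s = level_arrows_sector[OF N(1) l]
    have h: "h \<in> chars" "char_path h = y" using l by (simp_all add: level_arrows_iff act_arrows_iff)
    have z: "char_point h N \<in> topspace (base S N (vertex y N))" using char_eval(1)[OF h(1) N(1)] by (simp add: h(2))
    let ?t = "(vertex y N, path_pos S x N, path_pos S y N)"
    have t: "?t \<in> level_index N" using s(3-5) by (simp add: level_index_def)
    have ent: "kern N (E t) g = (if t = ?t then 1 else 0)" for t
      unfolding gg kern_apply[OF l] by (cases t) (auto simp: E_def matrix_unit_index[OF s(3) z s(4,5)])
    have "kern m w g = (\<Sum>t\<in>level_index N. if t = ?t then h (d t) else 0)"
      unfolding mw(3) ent by (rule sum.cong[OF refl]) (simp add: gg)
    then have "kern m w g = h (d ?t)" using t finite_level_index by simp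
    moreover have "f g = f (sector_arrow N (path_pos S x N) h)" unfolding gg using s(2) by simp
    ultimately show ?thesis using near[OF t s(1)] by simp
  qed
  then show ?thesis using mw(1,2) out by blast
qed

text \<open>Uniform approximation within a fixed level is norm approximation, because the constant
  of \<open>regular_representation_small\<close> depends on that level only. Boundedness for general
  \<open>f\<close> also comes from the approximation, as a small operator plus a represented stage
  element.\<close>

lemma rep_dense:
  assumes f: "f \<in> compactly_supported trans_groupoid"
  shows "regular_representation trans_groupoid f \<in> bounded_operators act_arrows"
    "0 < e \<Longrightarrow> \<exists>m\<ge>1. \<exists>w\<in>carrier (stage_algebra S m).
       op_norm act_arrows (regular_representation trans_groupoid f \<ominus>\<^bsub>operator_algebra act_arrows\<^esub> rep m w) < e"
proof -
  let ?R = "regular_representation trans_groupoid"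
  obtain N where N: "N \<ge> 1" "\<And>g. g \<notin> level_arrows N \<Longrightarrow> f g = 0" using compactly_supported_level[OF f] by blast
  have c: "continuous_map act_domain euclidean f" using f unfolding compactly_supported_def trans_groupoid_arrows by blast
  define M where "M = (\<Sum>i\<in>{1..nblocks S N}. (real (msize S N i))\<^sup>2)"
  have M: "0 \<le> M" unfolding M_def by (rule sum_nonneg) simp
  have main: "?R f \<in> bounded_operators act_arrows \<and> (\<exists>m\<ge>1. \<exists>w\<in>carrier (stage_algebra S m).
       op_norm act_arrows (?R f \<ominus>\<^bsub>operator_algebra act_arrows\<^esub> rep m w) < e)" if e: "0 < e" for e
  proof -
    \<comment> \<open>Chosen so that \<open>M * \<delta>\<close> is strictly below \<open>e\<close>;
      the summand 1 covers \<open>M = 0\<close>.\<close>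
    define \<delta> where "\<delta> = e / (M + 1)"
    have \<delta>: "0 < \<delta>" using e M by (simp add: \<delta>_def)
    have small: "M * \<delta> < e" using e M by (simp add: \<delta>_def field_simps)
    obtain m w where mw: "m \<ge> 1" "w \<in> carrier (stage_algebra S m)" "\<And>g. g \<notin> level_arrows N \<Longrightarrow> kern m w g = 0"
      "\<And>g. cmod (f g - kern m w g) \<le> \<delta>" using kern_approx[OF c N \<delta>] by blast
    let ?d = "\<lambda>g. f g - kern m w g"
    have out: "?d g = 0" if "g \<notin> level_arrows N" for g using mw(3)[OF that] N(2)[OF that] by simp
    have db: "?R ?d \<in> bounded_operators act_arrows"
      by (rule regular_representation_small(1)[OF N(1) out mw(4)])
    have dn: "ell2_norm act_arrows (?R ?d \<xi>) \<le> M * \<delta> * ell2_norm act_arrows \<xi>" if "\<xi> \<in> ell2 act_arrows" for \<xi>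
      unfolding M_def by (rule regular_representation_small(2)[OF N(1) out mw(4) that])
    note wb = rep_bounded(1)[OF mw(1,2)]
    have split: "?R f \<xi> = (\<lambda>g. ?R ?d \<xi> g + rep m w \<xi> g)" if \<xi>: "\<xi> \<in> ell2 act_arrows" for \<xi>
    proof -
      have "?R (\<lambda>g. ?d g + kern m w g) \<xi> = (\<lambda>g. ?R ?d \<xi> g + rep m w \<xi> g)"
        by (rule regular_representation_add[OF N(1) out mw(3) \<xi>])
      then show ?thesis by simp
    qed
    have "?R f = (\<lambda>\<xi>\<in>ell2 act_arrows. \<lambda>g. ?R ?d \<xi> g + rep m w \<xi> g)"
      by (rule extensionalityI[of _ "ell2 act_arrows"]) (simp_all add: split, simp add: regular_representation_def trans_groupoid_simps)
    then have fb: "?R f \<in> bounded_operators act_arrows" using operator_add_closed[OF db wb] by simp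
    have "op_norm act_arrows (?R f \<ominus>\<^bsub>operator_algebra act_arrows\<^esub> rep m w) \<le> M * \<delta>"
      by (rule op_norm_minus_leI[OF fb wb]) (use M \<delta> dn in \<open>simp_all add: split\<close>)
    then show ?thesis using fb mw(1,2) small by (intro conjI exI[of _ m] bexI[of _ w]) auto
  qed
  show "?R f \<in> bounded_operators act_arrows" using main[of 1] by simp
  show "0 < e \<Longrightarrow> \<exists>m\<ge>1. \<exists>w\<in>carrier (stage_algebra S m).
       op_norm act_arrows (?R f \<ominus>\<^bsub>operator_algebra act_arrows\<^esub> rep m w) < e" using main by blast
qed

text \<open>The index set consists of a stage together with an element of it. Sums and products of
  two indices are formed at the larger stage, after lifting both with
  \<open>kern_lift\<close>.\<close>

lemma reduced_cstar_algebra_isomorphic: "star_isomorphic A (reduced_cstar_algebra trans_groupoid)"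
  unfolding reduced_cstar_algebra_def trans_groupoid_simps(1)
proof (rule A.star_isomorphic_dense[where D = "{(n, a). n \<ge> 1 \<and> a \<in> carrier (stage_algebra S n)}"
      and u = "\<lambda>(n, a). \<iota> n a" and v = "\<lambda>(n, a). rep n a"])
  let ?D = "{(n, a). n \<ge> 1 \<and> a \<in> carrier (stage_algebra S n)}"
    and ?u = "\<lambda>(n, a). \<iota> n a" and ?v = "\<lambda>(n, a). rep n a"
  fix d assume d: "d \<in> ?D"
  obtain n a where na: "d = (n, a)" "n \<ge> 1" "a \<in> carrier (stage_algebra S n)" using d by auto
  show "?u d \<in> carrier A" using iota_hom(1)[OF na(2,3)] by (simp add: na(1))
  show "?v d \<in> bounded_operators act_arrows" using rep_bounded(1)[OF na(2,3)] by (simp add: na(1))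
  show "\<exists>e\<in>?D. ?u e = c \<odot>\<^bsub>A\<^esub> ?u d \<and> (\<forall>\<xi>\<in>ell2 act_arrows. ?v e \<xi> = (\<lambda>g. c * ?v d \<xi> g))" for c
    by (rule bexI[of _ "(n, c \<odot>\<^bsub>stage_algebra S n\<^esub> a)"])
      (simp_all add: na(1) iota_hom(5)[OF na(2,3)] rep_smult[OF na(2,3)] stage_closed(3)[OF na(3,3)] na(2)[simplified])
  show "\<exists>e\<in>?D. ?u e = adj A (?u d) \<and> (\<forall>\<xi>\<in>ell2 act_arrows. \<forall>\<eta>\<in>ell2 act_arrows.
      ell2_inner act_arrows (?v d \<xi>) \<eta> = ell2_inner act_arrows \<xi> (?v e \<eta>))"
    by (rule bexI[of _ "(n, adj (stage_algebra S n) a)"])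
      (simp_all add: na(1) iota_hom(6)[OF na(2,3)] rep_adj[OF na(2,3)] stage_closed(4)[OF na(3,3)] na(2)[simplified])
  fix d' assume d': "d' \<in> ?D"
  obtain n' a' where na': "d' = (n', a')" "n' \<ge> 1" "a' \<in> carrier (stage_algebra S n')" using d' by auto
  show "op_norm act_arrows (?v d \<ominus>\<^bsub>operator_algebra act_arrows\<^esub> ?v d') = nrm A (?u d \<ominus>\<^bsub>A\<^esub> ?u d')"
    using rep_minus_norm[OF na(2,3) na'(2,3)] by (simp add: na(1) na'(1))
  define m where "m = max n n'"
  have m: "m \<ge> 1" "n \<le> m" "n' \<le> m" using na(2) by (auto simp: m_def)
  obtain b where b: "b \<in> carrier (stage_algebra S m)" "\<iota> m b = \<iota> n a" "kern m b = kern n a" using kern_lift[OF na(2) m(2) na(3)] by blast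
  obtain b' where b': "b' \<in> carrier (stage_algebra S m)" "\<iota> m b' = \<iota> n' a'" "kern m b' = kern n' a'" using kern_lift[OF na'(2) m(3) na'(3)] by blast
  show "\<exists>e\<in>?D. ?u e = ?u d \<otimes>\<^bsub>A\<^esub> ?u d' \<and> (\<forall>\<xi>\<in>ell2 act_arrows. ?v e \<xi> = ?v d (?v d' \<xi>))"
    by (rule bexI[of _ "(m, b \<otimes>\<^bsub>stage_algebra S m\<^esub> b')"])
      (simp_all add: na(1) na'(1) iota_hom(2)[OF m(1) b(1) b'(1)] rep_mult[OF m(1) b(1) b'(1)] stage_closed(1)[OF b(1) b'(1)] m(1)[simplified] b(2,3) b'(2,3))
  show "\<exists>e\<in>?D. ?u e = ?u d \<oplus>\<^bsub>A\<^esub> ?u d' \<and> (\<forall>\<xi>\<in>ell2 act_arrows. ?v e \<xi> = (\<lambda>g. ?v d \<xi> g + ?v d' \<xi> g))"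
    by (rule bexI[of _ "(m, b \<oplus>\<^bsub>stage_algebra S m\<^esub> b')"])
      (simp_all add: na(1) na'(1) iota_hom(3)[OF m(1) b(1) b'(1)] rep_add[OF m(1) b(1) b'(1)] stage_closed(2)[OF b(1) b'(1)] m(1)[simplified] b(2,3) b'(2,3))
next
  let ?D = "{(n, a). n \<ge> 1 \<and> a \<in> carrier (stage_algebra S n)}"
    and ?u = "\<lambda>(n, a). \<iota> n a" and ?v = "\<lambda>(n, a). rep n a"
  show "\<exists>e\<in>?D. ?u e = \<one>\<^bsub>A\<^esub> \<and> (\<forall>\<xi>\<in>ell2 act_arrows. ?v e \<xi> = \<xi>)"
    by (rule bexI[of _ "(1, \<one>\<^bsub>stage_algebra S 1\<^esub>)"]) (simp_all add: iota_hom(4) rep_one stage_one_closed)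
  have "?u ` ?D = (\<Union>n\<in>{1..}. \<iota> n ` carrier (stage_algebra S n))" by force
  then show "norm_closure A (?u ` ?D) = carrier A" using dense_union by simp
  show "?v ` ?D \<subseteq> regular_representation trans_groupoid ` compactly_supported trans_groupoid"
    using kern_compactly_supported by auto
  show "regular_representation trans_groupoid ` compactly_supported trans_groupoid \<subseteq> bounded_operators act_arrows"
    using rep_dense(1) by blast
  show "\<exists>d\<in>?D. op_norm act_arrows (w \<ominus>\<^bsub>operator_algebra act_arrows\<^esub> ?v d) < e"
    if w: "w \<in> regular_representation trans_groupoid ` compactly_supported trans_groupoid" and e: "0 < e" for w e
  proof -
    obtain f where f: "f \<in> compactly_supported trans_groupoid" "w = regular_representation trans_groupoid f" using w by blast
    obtain m a where "m \<ge> 1" "a \<in> carrier (stage_algebra S m)"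
      "op_norm act_arrows (w \<ominus>\<^bsub>operator_algebra act_arrows\<^esub> rep m a) < e"
      using rep_dense(2)[OF f(1) e] f(2) by blast
    then show ?thesis by (intro bexI[of _ "(m, a)"]) auto
  qed
qed

end

theorem theoremA:
  fixes S :: "('x, 'e) ah_system"
    and A :: "'a cstar"
    and \<iota> :: "nat \<Rightarrow> (nat \<Rightarrow> 'x \<Rightarrow> complex mat) \<Rightarrow> 'a"
  assumes "diagonal_AH_system S"
    and "inductive_limit (stage_algebra S) (connecting_map S) A \<iota>"
  shows "\<exists>anchor act.
    groupoid_action (tail_groupoid S) (gelfand_spectrum (limit_diagonal S A \<iota>)) anchor act \<and>
    star_isomorphic A
      (reduced_cstar_algebra
        (transformation_groupoid (tail_groupoid S) (gelfand_spectrum (limit_diagonal S A \<iota>))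
          anchor act))"
proof -
  interpret ah_limit S A \<iota>
    using assms by (intro ah_limit.intro ah_limit_axioms.intro)
  show ?thesis using groupoid_action_spec reduced_cstar_algebra_isomorphic by blast
qed

end
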